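(* Let $A$ be a local domain which contains an algebraically closed field $\mathbf k$ such that $A/m_A\cong\mathbf k$. Let $K$ be the quotient field of $A$ and let $V_0$ be a valuation of $K$ which dominates $A$ and such that the residue field of the valuation ring of $V_0$ is $\mathbf k$. Suppose that $f(z)\in A[z]$ is unitary and irreducible (in $K[z]$), that there is a unique extension of $V_0$ to a valuation $\omega$ of $K[z]/(f(z))$, and that the characteristic $p$ of $\mathbf k$ does not divide $\deg_z f$. Let $W$ be the pseudo valuation of $K[z]$ associated to $\omega$ (so $I(W)_\infty=(f(z))$ in $K[z]$). Then there exist a positive integer $k$ and a realization of the algorithm (with respect to $W$) consisting of approximants $V_1,\dots,V_k$ to $f$ over $V_0$ such that $W=V_k$. Moreover $$\deg_z f=[G_\omega:G_{V_0}]=[G_{V_k}:G_{V_0}].$$ Further, in the expressions $\phi_{i+1}=\phi_i^{n_i}-c_i\phi_1^{j_1(i)}\cdots\phi_{i-1}^{j_{i-1}(i)}$ of the key polynomials of this realization one has $c_i\in A$ for all $1\le i\le k-1$, and $$\mathrm{gr}_\omega(A[z]/(f(z)))\cong \mathrm{gr}_{V_0}(A)[\overline\phi_1,\dots,\overline\phi_{k-1}]/I$$ where $\overline\phi_1,\dots,\overline\phi_{k-1}$ are variables and $$I=(\overline\phi_1^{n_1}-\overline c_1,\ \overline\phi_2^{n_2}-\overline c_2\overline\phi_1^{j_1(2)},\ \dots,\ \overline\phi_{k-1}^{n_{k-1}}-\overline c_{k-1}\overline\phi_1^{j_1(k-1)}\overline\phi_2^{j_2(k-1)}\cdots\overline\phi_{k-2}^{j_{k-2}(k-1)}),$$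 and this is a finitely generated and presented $\mathrm{gr}_{V_0}(A)$-module. Here $\overline c_i$ is the initial form of $c_i$ in $\mathrm{gr}_{V_0}(A)$.
   Context: Conventions. "Unitary" means monic. A local ring is a commutative ring with a unique maximal ideal (not necessarily Noetherian); the maximal ideal of $A$ is $m_A$. For a valuation $V$, $R_V$, $m_V$, $G_V$ denote valuation ring, maximal ideal, value group; $V$ dominates $A$ if $A\subset R_V$ and $m_V\cap A=m_A$. A pseudo valuation on a domain $B$ is a map $V:B\to G_V\cup\{\infty\}$, $G_V$ a totally ordered abelian group, such that $I(V)_\infty=\{g\in B: V(g)=\infty\}$ is a prime ideal and $V$ induces a valuation with value group $G_V$ on the quotient field of $B/I(V)_\infty$. For a domain $B$ and a (pseudo) valuation $V$ on it, $\mathrm{gr}_V(B)=\bigoplus_{\gamma\in G_V}\mathcal P_\gamma(B)/\mathcal P_\gamma^+(B)$, where $\mathcal P_\gamma(B)=\{g:V(g)\ge\gamma\}$, $\mathcal P^+_\gamma(B)=\{g:V(g)>\gamma\}$; the initial form of $g$ is its class in degree $V(g)$. A valuation $\omega$ of $K[z]/(f(z))$ is identified with the pseudo valuation $W$ of $K[z]$, $W(g)=\omega(g \bmod f)$. Equivalence. For a (pseudo) valuation $V$ of $K[z]$: $g\sim h$ in $V$ if $V(g-h)>\min\{V(g),V(h)\}$ or $V(g)=V(h)=\infty$; $h\mid g$ in $V$ if $g\sim ah$ in $V$ for some $a\in K[z]$; $g$ is equivalence irreducible in $V$ if $g\mid ab$ in $V$ implies $g\mid a$ or $g\mid b$ in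 $V$. Inductive valuations. Put $\phi_1=z$ and $V_1=[V_0;V_1(\phi_1)=\mu_1]$, i.e. $V_1(\sum a_iz^i)=\min_i(V_0(a_i)+i\mu_1)$. For $k\ge2$, $\phi_k\in K[z]$ is a key polynomial over $V_{k-1}$ with key value $\mu_k$ if: (1) $\phi_k$ is equivalence irreducible in $V_{k-1}$; (2) if $\phi_k\mid g$ in $V_{k-1}$ then $\deg_z\phi_k\le\deg_z g$; (3) $\phi_k$ is monic of positive degree; (4) $\mu_k>V_{k-1}(\phi_k)$; (5) $\deg_z\phi_k\ge\deg_z\phi_{k-1}$; (6) $\phi_k\sim\phi_{k-1}$ in $V_{k-1}$ is false. Then $V_k=[V_{k-1};V_k(\phi_k)=\mu_k]$ is defined by $V_k(g)=\min_i(V_{k-1}(g_i)+i\mu_k)$ where $g=\sum_i g_i\phi_k^i$ with $\deg_z g_i<\deg_z\phi_k$. Key values lie in an ordered abelian group containing the previous value group; $\mu_k=\infty$ is allowed only for the last stage (then $V_k$ is a pseudo valuation). It is known that $\deg_z\phi_{i}$ divides $\deg_z\phi_{i+1}$ and that each $g\in K[z]$ has a unique expansion $g=\sum_j a_j\phi_1^{m_{1,j}}\cdots\phi_k^{m_{k,j}}$, $a_j\in K$, $0\le m_{i,j}<\deg_z\phi_{i+1}/\deg_z\phi_i$ for $i<k$; $g$ is homogeneous in $V_k$ if all terms have the same $V_k$-value. Approximants. Writing $f=\sum f_j\phi_k^j$ with $\deg_z f_j<\deg_z\phi_k$, $\mathrm{proj}(V_k)=\alpha-\beta$, where $\alpha$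 and $\beta$ are the largest and smallest exponents $j$ with $V_k(f)=V_k(f_j\phi_k^j)$ (zero has value $\infty$). $V_k$ is a $k$-th approximant to $f$ over $V_0$ if it is obtained by stages $V_1=[V_0;V_1(\phi_1)=\mu_1]$ with $\phi_1=z$, and, for $2\le i\le k$, $V_i=[V_{i-1};V_i(\phi_i)=\mu_i]$ with $\phi_i$ a key polynomial over $V_{i-1}$ with key value $\mu_i$ which is homogeneous in $V_{i-1}$, and $\mathrm{proj}(V_k)>0$. A sequence of approximants $V_1,V_2,\dots$ is one with $V_i=[V_{i-1};V_i(\phi_i)=\mu_i]$ an $i$-th approximant for each $i$. Realization of the algorithm (with respect to $W$): a sequence of approximants $V_1,V_2,\dots$ to $f$ over $V_0$ with $V_i=[V_{i-1};V_i(\phi_i)=W(\phi_i)]$ for all $i$, $\phi_1=z$, and for $i\ge2$ $$\phi_i=\phi_{i-1}^{n_{i-1}}-c_{i-1}\phi_1^{j_1(i-1)}\cdots\phi_{i-2}^{j_{i-2}(i-1)},$$ with $c_{i-1}\in R_{V_0}$, $n_{i-1}=[G_{V_{i-1}}:G_{V_{i-2}}]$, $0\le j_l(m)<n_l$ for all $l,m$. *)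

theory Defs
  imports
    "HOL-Algebra.Algebraic_Closure_Type"
    "HOL-Algebra.Module"
    "HOL-Library.Extended"
begin

text \<open>
  The field \<open>K\<close> is a type of class \<^class>\<open>field\<close> and \<open>K[z]\<close> is the type of polynomials over it; as
  rings in the sense of HOL-Algebra both are \<^const>\<open>ring_of_type_algebra\<close>, and a subring with
  carrier \<open>S\<close> is \<open>ring_of_type_algebra\<lparr>carrier := S\<rparr>\<close>.  All values lie in one ambient ordered abelian
  group, a type \<open>'g\<close> of class \<^class>\<open>linordered_ab_group_add\<close>; the value groups of the individual
  valuations are subgroups of it.
\<close>

text \<open>The type \<open>'g extended\<close> also has a least element, which is never a value.\<close>

definition valuation_on :: "('b, 'm) ring_scheme \<Rightarrow> ('b \<Rightarrow> 'g::linordered_ab_group_add extended) \<Rightarrow> bool" where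
  "valuation_on R v \<longleftrightarrow>
     (\<forall>x\<in>carrier R. v x \<noteq> -\<infinity> \<and> (v x = \<infinity> \<longleftrightarrow> x = \<zero>\<^bsub>R\<^esub>)) \<and>
     (\<forall>x\<in>carrier R. \<forall>y\<in>carrier R. v (x \<otimes>\<^bsub>R\<^esub> y) = v x + v y) \<and>
     (\<forall>x\<in>carrier R. \<forall>y\<in>carrier R. min (v x) (v y) \<le> v (x \<oplus>\<^bsub>R\<^esub> y))"

definition val_ring :: "('b, 'm) ring_scheme \<Rightarrow> ('b \<Rightarrow> 'g::linordered_ab_group_add extended) \<Rightarrow> 'b set" where
  "val_ring R v = {x \<in> carrier R. 0 \<le> v x}"

definition val_ideal :: "('b, 'm) ring_scheme \<Rightarrow> ('b \<Rightarrow> 'g::linordered_ab_group_add extended) \<Rightarrow> 'b set" where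
  "val_ideal R v = {x \<in> carrier R. 0 < v x}"

text \<open>
  For a (pseudo) valuation on a domain, the value group is that of the induced valuation on the
  quotient field of the domain modulo the prime of elements of infinite value; its elements are
  the values of fractions.
\<close>

definition value_group :: "('b, 'm) ring_scheme \<Rightarrow> ('b \<Rightarrow> 'g::linordered_ab_group_add extended) \<Rightarrow> 'g set" where
  "value_group R v = {a - b | a b. \<exists>x\<in>carrier R. \<exists>y\<in>carrier R. v x = Fin a \<and> v y = Fin b}"

text \<open>As usual for \<^const>\<open>card\<close>, an infinite index is rendered as \<open>0\<close>.\<close>

definition group_index :: "'g::ab_group_add set \<Rightarrow> 'g set \<Rightarrow> nat" where
  "group_index G H = card ((\<lambda>a. (+) a ` H) ` G)"

definition local_ring :: "('b, 'm) ring_scheme \<Rightarrow> bool" where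
  "local_ring R \<longleftrightarrow> cring R \<and> (\<exists>!M. maximalideal M R)"

definition max_ideal :: "('b, 'm) ring_scheme \<Rightarrow> 'b set" where
  "max_ideal R = (THE M. maximalideal M R)"

definition dominates :: "('a::field \<Rightarrow> 'g::linordered_ab_group_add extended) \<Rightarrow> 'a set \<Rightarrow> bool" where
  "dominates V A \<longleftrightarrow>
     A \<subseteq> val_ring ring_of_type_algebra V \<and>
     val_ideal ring_of_type_algebra V \<inter> A = max_ideal (ring_of_type_algebra\<lparr>carrier := A\<rparr>)"

definition polys_over :: "'a::field set \<Rightarrow> 'a poly set" where
  "polys_over A = {p. \<forall>i. Polynomial.coeff p i \<in> A}"

definition residue_ring :: "'a::field set \<Rightarrow> 'a poly \<Rightarrow> 'a poly set ring" where
  "residue_ring A f =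
     (ring_of_type_algebra\<lparr>carrier := polys_over A\<rparr>)
       Quot (PIdl\<^bsub>ring_of_type_algebra\<lparr>carrier := polys_over A\<rparr>\<^esub> f)"

definition residue_class :: "'a::field set \<Rightarrow> 'a poly \<Rightarrow> 'a poly \<Rightarrow> 'a poly set" where
  "residue_class A f g =
     (PIdl\<^bsub>ring_of_type_algebra\<lparr>carrier := polys_over A\<rparr>\<^esub> f)
       +>\<^bsub>ring_of_type_algebra\<lparr>carrier := polys_over A\<rparr>\<^esub> g"

text \<open>
  The natural map from \<open>A[z]/(f)\<close> to \<open>K[z]/(f)\<close> sends a coset \<open>C\<close> of \<open>f A[z]\<close> to \<open>C + f K[z]\<close>.
\<close>

definition residue_ring_map :: "'a::field poly \<Rightarrow> 'a poly set \<Rightarrow> 'a poly set" where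
  "residue_ring_map f C = C <+>\<^bsub>ring_of_type_algebra\<^esub> (PIdl\<^bsub>ring_of_type_algebra\<^esub> f)"

definition valuation_ring_of :: "('b, 'm) ring_scheme \<Rightarrow> 'b set \<Rightarrow> bool" where
  "valuation_ring_of L S \<longleftrightarrow>
     subring S L \<and> (\<forall>x\<in>carrier L - {\<zero>\<^bsub>L\<^esub>}. x \<in> S \<or> inv\<^bsub>L\<^esub> x \<in> S)"

lemma valuation_ring_of_val_ring:
  assumes "field L" "valuation_on L v"
  shows "valuation_ring_of L (val_ring L v)"
proof -
  interpret field L
    by fact
  have fin: "\<exists>a. v x = Fin a" if "x \<in> carrier L" "x \<noteq> \<zero>\<^bsub>L\<^esub>" for x
    using assms(2) that unfolding valuation_on_def by (cases "v x") auto
  have mul: "v (x \<otimes>\<^bsub>L\<^esub> y) = v x + v y" if "x \<in> carrier L" "y \<in> carrier L" for x y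
    using assms(2) that unfolding valuation_on_def by blast
  have one: "v \<one>\<^bsub>L\<^esub> = 0"
    using mul[of "\<one>\<^bsub>L\<^esub>" "\<one>\<^bsub>L\<^esub>"] fin[of "\<one>\<^bsub>L\<^esub>"] by (auto simp: zero_extended_def)
  have "v (\<ominus>\<^bsub>L\<^esub> \<one>\<^bsub>L\<^esub>) + v (\<ominus>\<^bsub>L\<^esub> \<one>\<^bsub>L\<^esub>) = 0"
    using mul[of "\<ominus>\<^bsub>L\<^esub> \<one>\<^bsub>L\<^esub>" "\<ominus>\<^bsub>L\<^esub> \<one>\<^bsub>L\<^esub>"] one by (simp add: l_minus r_minus)
  moreover obtain a where "v (\<ominus>\<^bsub>L\<^esub> \<one>\<^bsub>L\<^esub>) = Fin a"
    using fin[of "\<ominus>\<^bsub>L\<^esub> \<one>\<^bsub>L\<^esub>"] by (metis a_inv_closed minus_minus minus_zero one_closed zero_not_one)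
  ultimately have neg_one: "v (\<ominus>\<^bsub>L\<^esub> \<one>\<^bsub>L\<^esub>) = 0"
    by (simp add: zero_extended_def)
  have neg: "v (\<ominus>\<^bsub>L\<^esub> x) = v x" if "x \<in> carrier L" for x
    using mul[of "\<ominus>\<^bsub>L\<^esub> \<one>\<^bsub>L\<^esub>" x] that neg_one by (simp add: l_minus)
  have "subring (val_ring L v) L"
  proof (rule subringI)
    fix x y assume xy: "x \<in> val_ring L v" "y \<in> val_ring L v"
    then show "x \<otimes>\<^bsub>L\<^esub> y \<in> val_ring L v"
      using mul[of x y] add_mono[of 0 "v x" 0 "v y"] by (simp add: val_ring_def)
    show "x \<oplus>\<^bsub>L\<^esub> y \<in> val_ring L v"
      using xy assms(2) unfolding valuation_on_def val_ring_def
      by (force intro: order_trans[of 0 "min (v x) (v y)"])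
  qed (auto simp: val_ring_def one neg)
  moreover have "inv\<^bsub>L\<^esub> x \<in> val_ring L v"
    if "x \<in> carrier L - {\<zero>\<^bsub>L\<^esub>}" "x \<notin> val_ring L v" for x
  proof -
    have x: "x \<in> carrier L" "inv\<^bsub>L\<^esub> x \<in> carrier L" "x \<otimes>\<^bsub>L\<^esub> inv\<^bsub>L\<^esub> x = \<one>\<^bsub>L\<^esub>"
      using that(1) field_Units by auto
    then have "x \<noteq> \<zero>\<^bsub>L\<^esub>" "inv\<^bsub>L\<^esub> x \<noteq> \<zero>\<^bsub>L\<^esub>"
      by auto
    then obtain a b where "v x = Fin a" "v (inv\<^bsub>L\<^esub> x) = Fin b"
      using fin x by blast
    moreover from this have "a + b = 0"
      using mul[of x "inv\<^bsub>L\<^esub> x"] one x by (simp add: zero_extended_def)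
    ultimately have "v x = Fin a" "v (inv\<^bsub>L\<^esub> x) = Fin b" "a = - b"
      by (auto simp: eq_neg_iff_add_eq_0)
    then show ?thesis
      using that(2) x by (auto simp: val_ring_def zero_extended_def)
  qed
  ultimately show ?thesis
    unfolding valuation_ring_of_def by blast
qed

text \<open>
  Uniqueness of an extension is meant up to equivalence of valuations, with values in arbitrary
  ordered abelian groups.  As HOL cannot quantify over the type of values inside a formula, the
  competing valuations are represented by their valuation rings, that is by the valuation rings of
  \<open>K[z]/(f)\<close> that lie over the valuation ring of \<open>V\<^sub>0\<close>.
\<close>

definition extends_valuation ::
  "('a::field \<Rightarrow> 'g::linordered_ab_group_add extended) \<Rightarrow> 'a poly \<Rightarrow> ('a poly set \<Rightarrow> 'g extended) \<Rightarrow> bool" where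
  "extends_valuation V0 f \<omega> \<longleftrightarrow>
     valuation_on (residue_ring UNIV f) \<omega> \<and> (\<forall>a. \<omega> (residue_class UNIV f [:a:]) = V0 a)"

definition unique_extension ::
  "('a::field \<Rightarrow> 'g::linordered_ab_group_add extended) \<Rightarrow> 'a poly \<Rightarrow> ('a poly set \<Rightarrow> 'g extended) \<Rightarrow> bool" where
  "unique_extension V0 f \<omega> \<longleftrightarrow>
     extends_valuation V0 f \<omega> \<and>
     (\<forall>S. valuation_ring_of (residue_ring UNIV f) S \<and>
          {a. residue_class UNIV f [:a:] \<in> S} = val_ring ring_of_type_algebra V0
          \<longrightarrow> S = val_ring (residue_ring UNIV f) \<omega>)"

definition equiv_in :: "('a::field poly \<Rightarrow> 'g::linordered_ab_group_add extended) \<Rightarrow> 'a poly \<Rightarrow> 'a poly \<Rightarrow> bool" where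
  "equiv_in V g h \<longleftrightarrow> min (V g) (V h) < V (g - h) \<or> (V g = \<infinity> \<and> V h = \<infinity>)"

definition equiv_dvd :: "('a::field poly \<Rightarrow> 'g::linordered_ab_group_add extended) \<Rightarrow> 'a poly \<Rightarrow> 'a poly \<Rightarrow> bool" where
  "equiv_dvd V h g \<longleftrightarrow> (\<exists>a. equiv_in V g (a * h))"

definition equiv_irreducible :: "('a::field poly \<Rightarrow> 'g::linordered_ab_group_add extended) \<Rightarrow> 'a poly \<Rightarrow> bool" where
  "equiv_irreducible V g \<longleftrightarrow>
     (\<forall>a b. equiv_dvd V g (a * b) \<longrightarrow> equiv_dvd V g a \<or> equiv_dvd V g b)"

text \<open>
  \<open>\<phi>'\<close> is the preceding key polynomial.  In the minimality condition the polynomial \<open>g\<close> has to be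
  nonzero: every polynomial equivalence-divides \<open>0\<close>, whose degree is \<open>0\<close> here.
\<close>

definition key_polynomial ::
  "('a::field poly \<Rightarrow> 'g::linordered_ab_group_add extended) \<Rightarrow> 'a poly \<Rightarrow> 'a poly \<Rightarrow> 'g extended \<Rightarrow> bool" where
  "key_polynomial V \<phi>' \<phi> \<mu> \<longleftrightarrow>
     equiv_irreducible V \<phi> \<and>
     (\<forall>g. g \<noteq> 0 \<and> equiv_dvd V \<phi> g \<longrightarrow> Polynomial.degree \<phi> \<le> Polynomial.degree g) \<and>
     Polynomial.lead_coeff \<phi> = 1 \<and> 0 < Polynomial.degree \<phi> \<and>
     V \<phi> < \<mu> \<and>
     Polynomial.degree \<phi>' \<le> Polynomial.degree \<phi> \<and>
     \<not> equiv_in V \<phi> \<phi>'"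

text \<open>
  \<open>adic_coeff \<phi> g i\<close> is the coefficient \<open>g\<^sub>i\<close> in the expansion \<open>g = \<Sum>\<^sub>i g\<^sub>i \<phi>\<^sup>i\<close> with
  \<open>deg g\<^sub>i < deg \<phi>\<close>; see the two lemmas below.
\<close>

definition adic_coeff :: "'a::field poly \<Rightarrow> 'a poly \<Rightarrow> nat \<Rightarrow> 'a poly" where
  "adic_coeff \<phi> g i = (g div \<phi> ^ i) mod \<phi>"

lemma degree_adic_coeff:
  assumes "0 < Polynomial.degree \<phi>"
  shows "Polynomial.degree (adic_coeff \<phi> g i) < Polynomial.degree \<phi>"
  unfolding adic_coeff_def using assms
  by (metis degree_0 degree_mod_less less_nat_zero_code)

lemma adic_expansion:
  assumes "0 < Polynomial.degree \<phi>"
  shows "g = (\<Sum>i\<le>Polynomial.degree g div Polynomial.degree \<phi>. adic_coeff \<phi> g i * \<phi> ^ i)"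
proof -
  have nz: "\<phi> \<noteq> 0"
    using assms by auto
  have part: "g = (\<Sum>i<n. adic_coeff \<phi> g i * \<phi> ^ i) + (g div \<phi> ^ n) * \<phi> ^ n" for n
  proof (induction n)
    case 0
    then show ?case by simp
  next
    case (Suc n)
    have "g div \<phi> ^ n = (g div \<phi> ^ n div \<phi>) * \<phi> + adic_coeff \<phi> g n"
      unfolding adic_coeff_def by simp
    also have "g div \<phi> ^ n div \<phi> = g div \<phi> ^ Suc n"
      by (metis poly_div_mult_right power_Suc2)
    finally have "(g div \<phi> ^ n) * \<phi> ^ n
        = (g div \<phi> ^ Suc n) * \<phi> ^ Suc n + adic_coeff \<phi> g n * \<phi> ^ n"
      by (metis distrib_right mult.assoc power_Suc)
    with Suc show ?case
      by (simp add: algebra_simps)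
  qed
  let ?N = "Polynomial.degree g div Polynomial.degree \<phi>"
  have "Polynomial.degree g < Polynomial.degree (\<phi> ^ Suc ?N)"
    using assms nz dividend_less_div_times[of "Polynomial.degree \<phi>" "Polynomial.degree g"]
    by (simp del: power_Suc add: degree_power_eq)
  then have "g div \<phi> ^ Suc ?N = 0"
    by (simp add: div_poly_less)
  with part[of "Suc ?N"] show ?thesis
    by (simp add: lessThan_Suc_atMost)
qed

text \<open>The multiple \<open>i\<mu>\<close> is written \<open>\<Sum>_<i. \<mu>\<close>; in particular it is \<open>0\<close> for \<open>i = 0\<close> even if \<open>\<mu> = \<infinity>\<close>.\<close>

definition first_stage ::
  "('a::field \<Rightarrow> 'g::linordered_ab_group_add extended) \<Rightarrow> 'g extended \<Rightarrow> 'a poly \<Rightarrow> 'g extended" where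
  "first_stage V0 \<mu> g =
     (MIN i\<in>{..Polynomial.degree g}. V0 (Polynomial.coeff g i) + (\<Sum>_<i. \<mu>))"

definition augmentation ::
  "('a::field poly \<Rightarrow> 'g::linordered_ab_group_add extended) \<Rightarrow> 'a poly \<Rightarrow> 'g extended \<Rightarrow> 'a poly \<Rightarrow> 'g extended" where
  "augmentation V \<phi> \<mu> g =
     (MIN i\<in>{..Polynomial.degree g div Polynomial.degree \<phi>}. V (adic_coeff \<phi> g i) + (\<Sum>_<i. \<mu>))"

text \<open>
  The set \<open>M\<close> consists of the exponents \<open>(m\<^sub>1, \<dots>, m\<^sub>k)\<close> of the terms with nonzero coefficient in
  the unique expansion of \<open>g\<close> in the key polynomials.
\<close>

definition homogeneous_in ::
  "('a::field poly \<Rightarrow> 'g::linordered_ab_group_add extended) \<Rightarrow> (nat \<Rightarrow> 'a poly) \<Rightarrow> nat \<Rightarrow> 'a poly \<Rightarrow> bool" where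
  "homogeneous_in V \<phi> k g \<longleftrightarrow>
     (\<exists>M a \<gamma>. finite M \<and>
        (\<forall>m\<in>M. (\<forall>l. l \<notin> {1..k} \<longrightarrow> m l = 0) \<and>
               (\<forall>l\<in>{1..<k}. m l < Polynomial.degree (\<phi> (l + 1)) div Polynomial.degree (\<phi> l)) \<and>
               a m \<noteq> 0) \<and>
        g = (\<Sum>m\<in>M. Polynomial.smult (a m) (\<Prod>l=1..k. \<phi> l ^ m l)) \<and>
        (\<forall>m\<in>M. V (Polynomial.smult (a m) (\<Prod>l=1..k. \<phi> l ^ m l)) = \<gamma>))"

text \<open>
  Exponents range over those of the expansion, \<open>0, \<dots>, deg f div deg \<phi>\<close>, including the ones with
  zero coefficient; the latter matter exactly if \<open>V f = \<infinity>\<close>.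
\<close>

definition proj ::
  "('a::field poly \<Rightarrow> 'g::linordered_ab_group_add extended) \<Rightarrow> 'a poly \<Rightarrow> 'a poly \<Rightarrow> nat" where
  "proj V \<phi> f =
     (let J = {j. j \<le> Polynomial.degree f div Polynomial.degree \<phi> \<and> V f = V (adic_coeff \<phi> f j * \<phi> ^ j)}
      in Max J - Min J)"

text \<open>Sequences \<open>\<phi>\<close>, \<open>\<mu>\<close>, \<open>V\<close> are indexed from \<open>1\<close>; their values at other indices are irrelevant.\<close>

definition approximant ::
  "('a::field \<Rightarrow> 'g::linordered_ab_group_add extended) \<Rightarrow> 'a poly \<Rightarrow> (nat \<Rightarrow> 'a poly) \<Rightarrow> (nat \<Rightarrow> 'g extended) \<Rightarrow>
   (nat \<Rightarrow> 'a poly \<Rightarrow> 'g extended) \<Rightarrow> nat \<Rightarrow> bool" where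
  "approximant V0 f \<phi> \<mu> V k \<longleftrightarrow>
     1 \<le> k \<and>
     (\<forall>i\<in>{1..k}. \<mu> i \<noteq> -\<infinity>) \<and> (\<forall>i\<in>{1..<k}. \<mu> i \<noteq> \<infinity>) \<and>
     \<phi> 1 = [:0, 1:] \<and> V 1 = first_stage V0 (\<mu> 1) \<and>
     (\<forall>i\<in>{2..k}. key_polynomial (V (i - 1)) (\<phi> (i - 1)) (\<phi> i) (\<mu> i) \<and>
                 homogeneous_in (V (i - 1)) \<phi> (i - 1) (\<phi> i) \<and>
                 V i = augmentation (V (i - 1)) (\<phi> i) (\<mu> i)) \<and>
     0 < proj (V k) (\<phi> k) f"

definition stage_group ::
  "('a::field \<Rightarrow> 'g::linordered_ab_group_add extended) \<Rightarrow> (nat \<Rightarrow> 'a poly \<Rightarrow> 'g extended) \<Rightarrow> nat \<Rightarrow> 'g set" where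
  "stage_group V0 V i =
     (if i = 0 then value_group ring_of_type_algebra V0 else value_group ring_of_type_algebra (V i))"

definition realization ::
  "('a::field \<Rightarrow> 'g::linordered_ab_group_add extended) \<Rightarrow> ('a poly \<Rightarrow> 'g extended) \<Rightarrow> 'a poly \<Rightarrow> nat \<Rightarrow>
   (nat \<Rightarrow> 'a poly) \<Rightarrow> (nat \<Rightarrow> 'a poly \<Rightarrow> 'g extended) \<Rightarrow> (nat \<Rightarrow> nat) \<Rightarrow> (nat \<Rightarrow> 'a) \<Rightarrow> (nat \<Rightarrow> nat \<Rightarrow> nat) \<Rightarrow> bool" where
  "realization V0 W f k \<phi> V n c j \<longleftrightarrow>
     (\<forall>i\<in>{1..k}. approximant V0 f \<phi> (\<lambda>l. W (\<phi> l)) V i) \<and>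
     (\<forall>i\<in>{2..k}.
        \<phi> i = \<phi> (i - 1) ^ n (i - 1)
              - Polynomial.smult (c (i - 1)) (\<Prod>l=1..i - 2. \<phi> l ^ j l (i - 1)) \<and>
        c (i - 1) \<in> val_ring ring_of_type_algebra V0 \<and>
        n (i - 1) = group_index (stage_group V0 V (i - 1)) (stage_group V0 V (i - 2)) \<and>
        (\<forall>l\<in>{1..i - 2}. j l (i - 1) < n l))"

definition val_ge :: "('b, 'm) ring_scheme \<Rightarrow> ('b \<Rightarrow> 'g::linordered_ab_group_add extended) \<Rightarrow> 'g \<Rightarrow> 'b set" where
  "val_ge B v \<gamma> = {x \<in> carrier B. Fin \<gamma> \<le> v x}"

definition val_gt :: "('b, 'm) ring_scheme \<Rightarrow> ('b \<Rightarrow> 'g::linordered_ab_group_add extended) \<Rightarrow> 'g \<Rightarrow> 'b set" where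
  "val_gt B v \<gamma> = {x \<in> carrier B. Fin \<gamma> < v x}"

definition gr_component ::
  "('b, 'm) ring_scheme \<Rightarrow> ('b \<Rightarrow> 'g::linordered_ab_group_add extended) \<Rightarrow> 'g \<Rightarrow> 'b set monoid" where
  "gr_component B v \<gamma> = (B\<lparr>carrier := val_ge B v \<gamma>\<rparr>) A_Mod (val_gt B v \<gamma>)"

text \<open>
  Elements are families of cosets with finite support.  Degrees range over the whole ambient group:
  the components in degrees outside the value group are zero.  The zero of the component of degree
  \<open>\<gamma>\<close> is the coset \<open>val_gt B v \<gamma>\<close>.
\<close>

definition gr_ring ::
  "('b, 'm) ring_scheme \<Rightarrow> ('b \<Rightarrow> 'g::linordered_ab_group_add extended) \<Rightarrow> ('g \<Rightarrow> 'b set) ring" where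
  "gr_ring B v =
     \<lparr>carrier = {x. (\<forall>\<gamma>. x \<gamma> \<in> carrier (gr_component B v \<gamma>)) \<and> finite {\<gamma>. x \<gamma> \<noteq> val_gt B v \<gamma>}},
      monoid.mult = (\<lambda>x y \<gamma>. \<Otimes>\<^bsub>gr_component B v \<gamma>\<^esub>\<alpha>\<in>{\<alpha>. x \<alpha> \<noteq> val_gt B v \<alpha>}.
                (\<Union>a\<in>x \<alpha>. \<Union>b\<in>y (\<gamma> - \<alpha>). val_gt B v \<gamma> +>\<^bsub>B\<^esub> (a \<otimes>\<^bsub>B\<^esub> b))),
      one = (\<lambda>\<gamma>. if \<gamma> = 0 then val_gt B v 0 +>\<^bsub>B\<^esub> \<one>\<^bsub>B\<^esub> else val_gt B v \<gamma>),
      ring.zero = val_gt B v,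
      add = (\<lambda>x y \<gamma>. x \<gamma> <+>\<^bsub>B\<^esub> y \<gamma>)\<rparr>"

definition initial_form ::
  "('b, 'm) ring_scheme \<Rightarrow> ('b \<Rightarrow> 'g::linordered_ab_group_add extended) \<Rightarrow> 'b \<Rightarrow> 'g \<Rightarrow> 'b set" where
  "initial_form B v g = (\<lambda>\<gamma>. if v g = Fin \<gamma> then val_gt B v \<gamma> +>\<^bsub>B\<^esub> g else val_gt B v \<gamma>)"

text \<open>
  The homomorphism from the graded ring of a domain to that of \<open>(C, w)\<close> induced by a
  homomorphism \<open>h\<close> of domains that preserves values.
\<close>

definition gr_map ::
  "('c, 'n) ring_scheme \<Rightarrow> ('c \<Rightarrow> 'g::linordered_ab_group_add extended) \<Rightarrow> ('b \<Rightarrow> 'c) \<Rightarrow> ('g \<Rightarrow> 'b set) \<Rightarrow> 'g \<Rightarrow> 'c set" where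
  "gr_map C w h x = (\<lambda>\<gamma>. val_gt C w \<gamma> <+>\<^bsub>C\<^esub> h ` x \<gamma>)"

text \<open>
  The ring on the polynomials of \<^theory>\<open>HOL-Algebra.Indexed_Polynomials\<close> with variables indexed by \<open>I\<close>:
  a polynomial maps monomials, i.e. multisets of indices, to coefficients.
\<close>

definition mpoly_ring :: "('r, 'm) ring_scheme \<Rightarrow> 'i set \<Rightarrow> ('i multiset \<Rightarrow> 'r) ring" where
  "mpoly_ring R I =
     \<lparr>carrier = ring.indexed_pset R I (carrier R),
      monoid.mult = (\<lambda>P Q m. \<Oplus>\<^bsub>R\<^esub>a\<in>{a. a \<subseteq># m}. P a \<otimes>\<^bsub>R\<^esub> Q (m - a)),
      one = ring.indexed_const R \<one>\<^bsub>R\<^esub>,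
      ring.zero = ring.indexed_const R \<zero>\<^bsub>R\<^esub>,
      add = ring.indexed_padd R\<rparr>"

definition restrict_scalars :: "('r \<Rightarrow> 's) \<Rightarrow> ('s, 'm) ring_scheme \<Rightarrow> ('r, 's) module" where
  "restrict_scalars \<psi> S =
     \<lparr>carrier = carrier S, monoid.mult = monoid.mult S, one = one S, ring.zero = ring.zero S, add = add S,
      module.smult = (\<lambda>a x. \<psi> a \<otimes>\<^bsub>S\<^esub> x)\<rparr>"

definition module_generators ::
  "('r, 'm) ring_scheme \<Rightarrow> ('r, 'x, 'n) module_scheme \<Rightarrow> nat \<Rightarrow> (nat \<Rightarrow> 'x) \<Rightarrow> bool" where
  "module_generators R M n e \<longleftrightarrow>
     e \<in> {..<n} \<rightarrow> carrier M \<and>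
     (\<forall>x\<in>carrier M. \<exists>a\<in>{..<n} \<rightarrow> carrier R. x = (\<Oplus>\<^bsub>M\<^esub>i\<in>{..<n}. a i \<odot>\<^bsub>M\<^esub> e i))"

definition finitely_generated_module ::
  "('r, 'm) ring_scheme \<Rightarrow> ('r, 'x, 'n) module_scheme \<Rightarrow> bool" where
  "finitely_generated_module R M \<longleftrightarrow> module R M \<and> (\<exists>n e. module_generators R M n e)"

definition module_relations ::
  "('r, 'm) ring_scheme \<Rightarrow> ('r, 'x, 'n) module_scheme \<Rightarrow> nat \<Rightarrow> (nat \<Rightarrow> 'x) \<Rightarrow> (nat \<Rightarrow> 'r) set" where
  "module_relations R M n e =
     {a \<in> {..<n} \<rightarrow> carrier R. (\<Oplus>\<^bsub>M\<^esub>i\<in>{..<n}. a i \<odot>\<^bsub>M\<^esub> e i) = \<zero>\<^bsub>M\<^esub>}"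

definition finitely_presented_module ::
  "('r, 'm) ring_scheme \<Rightarrow> ('r, 'x, 'n) module_scheme \<Rightarrow> bool" where
  "finitely_presented_module R M \<longleftrightarrow>
     module R M \<and>
     (\<exists>n e. module_generators R M n e \<and>
        (\<exists>(q :: nat) r. (\<forall>t<q. r t \<in> module_relations R M n e) \<and>
           (\<forall>a\<in>module_relations R M n e. \<exists>b\<in>{..<q} \<rightarrow> carrier R.
              \<forall>i<n. a i = (\<Oplus>\<^bsub>R\<^esub>t\<in>{..<q}. b t \<otimes>\<^bsub>R\<^esub> r t i))))"

definition presentation_ideal ::
  "('r, 'm) ring_scheme \<Rightarrow> nat \<Rightarrow> (nat \<Rightarrow> nat) \<Rightarrow> (nat \<Rightarrow> 'r) \<Rightarrow> (nat \<Rightarrow> nat \<Rightarrow> nat) \<Rightarrow> (nat multiset \<Rightarrow> 'r) set" where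
  "presentation_ideal R k n c j =
     (let P = mpoly_ring R {1..<k}; x = ring.indexed_var R
      in Idl\<^bsub>P\<^esub> {x i [^]\<^bsub>P\<^esub> n i
                  \<ominus>\<^bsub>P\<^esub> ring.indexed_const R (c i) \<otimes>\<^bsub>P\<^esub> (\<Otimes>\<^bsub>P\<^esub>l\<in>{1..<i}. x l [^]\<^bsub>P\<^esub> j l i)
                 | i. i \<in> {1..<k}})"

end

theory Submission
  imports Defs "HOL-Library.Poly_Mapping" "HOL-Number_Theory.Cong"
begin

text \<open>
  For a key polynomial \<open>\<phi>\<close> the augmentation of \<open>W\<close> at \<open>\<phi>\<close> with key value \<open>W(\<phi>)\<close> is a valuation
  below \<open>W\<close> that agrees with \<open>W\<close> in degrees less than \<open>deg \<phi>\<close>, and these augmentations are the stages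
  of the algorithm.  By a Chevalley type argument, uniqueness of \<open>\<omega>\<close> makes every element of
  its valuation ring integral over that of \<open>V\<^sub>0\<close>.  Hence the residue field does not grow, and
  \<open>deg \<phi>\<close> divides \<open>deg f\<close> for every key polynomial \<open>\<phi>\<close>.

  If \<open>W(\<phi>) < \<infinity>\<close> and \<open>n\<close> is the order of \<open>W(\<phi>)\<close> modulo the preceding value group, put
  \<open>e = deg f / (n deg \<phi>)\<close>.  It is a unit of \<open>A\<close>, so \<open>f\<close> has an approximate \<open>e\<close>-th root \<open>g\<close> over
  \<open>A\<close>.  The term of least value in the expansion of \<open>\<phi>\<^sup>n - g\<close> in the key polynomials is
  the one to be subtracted from \<open>\<phi>\<^sup>n\<close> to get the next key polynomial, with coefficient in \<open>A\<close>.  Either the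
  degree increases, or \<open>g\<close> stays the same and \<open>\<phi> - g\<close> loses a term; so the process
  stops, and it can only stop at \<open>\<phi> = f\<close>.

  The monomials in the key polynomials before the last one then have values in distinct classes
  modulo the value group of \<open>V\<^sub>0\<close>.  Their initial forms are a basis of the graded ring as a module, and
  the relations between consecutive key polynomials rewrite every monomial into basis elements.
\<close>

text \<open>The delicate point is that the coefficients lie in \<open>A\<close> and not merely in K.
  Solving for the monomial that cancels the initial form of \<phi>^n gives a coefficient in K only;
  it is therefore read off from \<phi>^n - g, which has coefficients in \<open>A\<close> since g
  does. For this W(g) > n W(\<phi>) is needed. The construction of approximate roots can be started
  at any key polynomial of the right degree and then respects the filtration by the augmentation
  there; as the root is unique, its value is at least that of every such key polynomial.

  Divisibility of degrees comes from integrality as follows. If a constant a has the value of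
  \<phi>^N, an integral equation for \<phi>^N / a makes f a factor of a polynomial in \<phi> whose
  term of highest degree also has least value. The highest exponent of a term of least value is
  additive on products, so f inherits this property, and its degree is that exponent times deg
  \<phi>.\<close>

hide_const (open) Polynomials.degree

section \<open>Pseudo valuations\<close>

text \<open>Defined in every commutative monoid, so that one notation serves group elements and
  possibly infinite values; as in the augmentations, the multiple by 0 is 0 even for
  \<infinity>.\<close>

definition nsc :: "nat \<Rightarrow> 'b::comm_monoid_add \<Rightarrow> 'b" (infixr \<open>\<bullet>\<close> 75) where
  "i \<bullet> x = (\<Sum>_<i. x)"

lemma nsc_0 [simp]: "0 \<bullet> x = 0"
  and nsc_Suc: "Suc i \<bullet> x = x + i \<bullet> x"
  and nsc_1 [simp]: "Suc 0 \<bullet> x = x"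
  by (simp_all add: nsc_def add.commute)

lemma nsc_add: "(i + j) \<bullet> x = i \<bullet> x + j \<bullet> x"
  by (induction i) (simp_all add: nsc_Suc add.assoc)

lemma nsc_add_right: "i \<bullet> (x + y) = i \<bullet> x + i \<bullet> y"
  by (simp add: nsc_def sum.distrib)

lemma nsc_mult: "(i * j) \<bullet> x = i \<bullet> j \<bullet> x"
  by (induction i) (simp_all add: nsc_Suc nsc_add)

lemma nsc_minus: "i \<bullet> (- x) = - (i \<bullet> (x :: 'b::ab_group_add))"
  by (simp add: nsc_def sum_negf)

lemma nsc_Fin: "i \<bullet> Fin x = Fin (i \<bullet> (x::'b::comm_monoid_add))"
  by (induction i) (simp_all add: nsc_Suc zero_extended_def)

lemma nsc_inf: "0 < i \<Longrightarrow> i \<bullet> (\<infinity> :: 'b::comm_monoid_add extended) = \<infinity>"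
  by (induction i) (auto simp: nsc_Suc plus_case zero_extended_def split: extended.splits)

lemma extended_add_cancel:
  fixes x y :: "'b::linordered_ab_group_add extended"
  assumes "z \<noteq> \<infinity>" "z \<noteq> -\<infinity>"
  shows "x + z = y + z \<longleftrightarrow> x = y" "x + z \<le> y + z \<longleftrightarrow> x \<le> y" "x + z < y + z \<longleftrightarrow> x < y"
    "z + x = z + y \<longleftrightarrow> x = y" "z + x \<le> z + y \<longleftrightarrow> x \<le> y" "z + x < z + y \<longleftrightarrow> x < y"
  using assms by (cases x; cases y; cases z; simp)+

lemma extended_add_eq_inf:
  fixes x y :: "'b::linordered_ab_group_add extended"
  shows "x \<noteq> -\<infinity> \<Longrightarrow> y \<noteq> -\<infinity> \<Longrightarrow> x + y = \<infinity> \<longleftrightarrow> x = \<infinity> \<or> y = \<infinity>"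
    "x \<noteq> -\<infinity> \<Longrightarrow> y \<noteq> -\<infinity> \<Longrightarrow> x + y \<noteq> -\<infinity>"
  by (cases x; cases y; simp)+

lemma extended_add_inf [simp]: "\<infinity> + (x :: 'b::linordered_ab_group_add extended) = \<infinity>" "x + \<infinity> = \<infinity>"
  by (cases x; simp)+

lemma extended_zero_neq [simp]:
  "(0 :: 'b::zero extended) \<noteq> \<infinity>" "(0 :: 'b::zero extended) \<noteq> -\<infinity>"
  "\<infinity> \<noteq> (0 :: 'b::zero extended)" "-\<infinity> \<noteq> (0 :: 'b::zero extended)"
  by (simp_all add: zero_extended_def)

lemma less_inf_iff: "(x :: 'b::linorder extended) < \<infinity> \<longleftrightarrow> x \<noteq> \<infinity>"
  by (cases x) auto

lemma valuation_on_type_algebra: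
  "valuation_on (ring_of_type_algebra :: 'r::comm_ring_1 ring) v \<longleftrightarrow>
     (\<forall>x. v x \<noteq> -\<infinity> \<and> (v x = \<infinity> \<longleftrightarrow> x = 0)) \<and>
     (\<forall>x y. v (x * y) = v x + v y) \<and> (\<forall>x y. min (v x) (v y) \<le> v (x + y))"
  by (simp add: valuation_on_def ring_of_type_algebra_def)

text \<open>That the elements of infinite value form a prime ideal follows from the axioms: it is an
  ideal by \<open>zero\<close>, \<open>mult\<close> and \<open>add_ge\<close>, prime by
  \<open>mult\<close> since values are never -\<infinity>, and proper by
  \<open>one_finite\<close>.\<close>

locale pseudo_valuation =
  fixes W :: "'r::comm_ring_1 \<Rightarrow> 'g::linordered_ab_group_add extended"
  assumes not_Minf [simp]: "W x \<noteq> -\<infinity>"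
    and mult: "W (x * y) = W x + W y"
    and add_ge: "min (W x) (W y) \<le> W (x + y)"
    and zero [simp]: "W 0 = \<infinity>"
    and one_finite: "W 1 \<noteq> \<infinity>"
begin

lemma one [simp]: "W 1 = 0"
  using mult[of 1 1] one_finite by (cases "W 1") (auto simp: zero_extended_def)

lemma minus [simp]: "W (- x) = W x"
proof -
  have "W (-1) + W (-1) = 0"
    using mult[of "-1" "-1"] by simp
  then have "W (-1) = 0"
    by (cases "W (-1)") (auto simp: zero_extended_def double_zero)
  then show ?thesis
    using mult[of "-1" x] by simp
qed

lemma minus_commute: "W (x - y) = W (y - x)"
  using minus[of "x - y"] by simp

lemma power: "W (x ^ n) = n \<bullet> W x"
  by (induction n) (simp_all add: nsc_Suc mult)

lemma diff_ge: "min (W x) (W y) \<le> W (x - y)"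
  using add_ge[of x "- y"] by simp

lemma add_geI: "\<gamma> \<le> W x \<Longrightarrow> \<gamma> \<le> W y \<Longrightarrow> \<gamma> \<le> W (x + y)"
  using add_ge[of x y] by (meson min.boundedI order_trans)

lemma diff_geI: "\<gamma> \<le> W x \<Longrightarrow> \<gamma> \<le> W y \<Longrightarrow> \<gamma> \<le> W (x - y)"
  using diff_ge[of x y] by (meson min.boundedI order_trans)

lemma add_gtI: "\<gamma> < W x \<Longrightarrow> \<gamma> < W y \<Longrightarrow> \<gamma> < W (x + y)"
  using add_ge[of x y] by (meson min_less_iff_conj order_less_le_trans)

lemma diff_gtI: "\<gamma> < W x \<Longrightarrow> \<gamma> < W y \<Longrightarrow> \<gamma> < W (x - y)"
  using diff_ge[of x y] by (meson min_less_iff_conj order_less_le_trans)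

lemma add_eq:
  assumes "W x < W y"
  shows "W (x + y) = W x" "W (y + x) = W x"
proof -
  have "W x \<le> W (x + y)"
    using assms by (intro add_geI) auto
  moreover have "W (x + y) \<le> W x"
    using diff_gtI[of "W x" "x + y" y] assms by force
  ultimately show "W (x + y) = W x" "W (y + x) = W x"
    by (simp_all add: add.commute)
qed

lemma diff_eq:
  assumes "W x < W y"
  shows "W (x - y) = W x" "W (y - x) = W x"
  using add_eq[of x "- y"] assms minus_commute[of x y] by simp_all

lemma sum_geI: "(\<And>i. i \<in> S \<Longrightarrow> \<gamma> \<le> W (x i)) \<Longrightarrow> \<gamma> \<le> W (\<Sum>i\<in>S. x i)"
  by (induction S rule: infinite_finite_induct) (simp_all add: add_geI)

lemma sum_gtI: "\<gamma> \<noteq> \<infinity> \<Longrightarrow> (\<And>i. i \<in> S \<Longrightarrow> \<gamma> < W (x i)) \<Longrightarrow> \<gamma> < W (\<Sum>i\<in>S. x i)"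
  by (induction S rule: infinite_finite_induct) (simp_all add: add_gtI less_inf_iff)

lemma sum_eq:
  assumes "finite S" "i \<in> S" "\<And>j. j \<in> S - {i} \<Longrightarrow> W (x i) < W (x j)"
  shows "W (\<Sum>i\<in>S. x i) = W (x i)"
proof (cases "W (x i) = \<infinity>")
  case True
  then have "S - {i} = {}"
    using assms(3) by (metis equals0I less_extended_simps(4))
  with assms(2) have "S = {i}"
    by blast
  then show ?thesis by simp
next
  case False
  have "W (x i) < W (\<Sum>j\<in>S - {i}. x j)"
    by (rule sum_gtI[OF False assms(3)])
  then show ?thesis
    using sum.remove[OF assms(1,2), of x] add_eq(1) by metis
qed

lemma sum_distinct:
  assumes "finite S" "S \<noteq> {}" "inj_on (\<lambda>i. W (x i)) S"
  obtains i where "i \<in> S" "\<And>j. j \<in> S \<Longrightarrow> W (x i) \<le> W (x j)" "\<And>j. j \<in> S - {i} \<Longrightarrow> W (x i) < W (x j)"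
    "W (\<Sum>i\<in>S. x i) = W (x i)"
proof -
  have "Min ((\<lambda>i. W (x i)) ` S) \<in> (\<lambda>i. W (x i)) ` S"
    using assms by (intro Min_in) auto
  then obtain i where i: "i \<in> S" "W (x i) = Min ((\<lambda>i. W (x i)) ` S)"
    by auto
  have le: "W (x i) \<le> W (x j)" if "j \<in> S" for j
    using i assms(1) that by simp
  have lt: "W (x i) < W (x j)" if "j \<in> S - {i}" for j
    using le[of j] that assms(3) i(1) by (auto simp: order_less_le inj_on_def)
  show thesis
    using that[OF i(1) le lt] sum_eq[of S i x] assms(1) i(1) lt by blast
qed

text \<open>The term of least finite value cannot cancel, so it gives the value of the sum. Infinite
  values may repeat, because expansions contain zero coefficients.\<close>

lemma sum_ge_distinct:
  assumes "finite S" "\<And>i j. i \<in> S \<Longrightarrow> j \<in> S \<Longrightarrow> i \<noteq> j \<Longrightarrow> W (x i) \<noteq> \<infinity> \<Longrightarrow> W (x i) \<noteq> W (x j)"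
    and "i \<in> S"
  shows "W (\<Sum>i\<in>S. x i) \<le> W (x i)"
proof (cases "W (x i) = \<infinity>")
  case False
  define T where "T = {i\<in>S. W (x i) \<noteq> \<infinity>}"
  have T: "finite T" "T \<noteq> {}" "inj_on (\<lambda>i. W (x i)) T"
    using assms False by (auto simp: T_def inj_on_def)
  obtain i0 where i0: "i0 \<in> T" "\<And>j. j \<in> T \<Longrightarrow> W (x i0) \<le> W (x j)"
      "\<And>j. j \<in> T - {i0} \<Longrightarrow> W (x i0) < W (x j)" "W (\<Sum>i\<in>T. x i) = W (x i0)"
    by (rule sum_distinct[OF T], rule that, assumption+)
  have "W (x i0) \<noteq> \<infinity>"
    using i0(1) by (simp add: T_def)
  then have "W (x i0) < W (\<Sum>i\<in>S - T. x i)"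
    by (rule sum_gtI) (use \<open>W (x i0) \<noteq> \<infinity>\<close> in \<open>simp add: T_def less_inf_iff\<close>)
  then have "W (\<Sum>i\<in>T. x i) < W (\<Sum>i\<in>S - T. x i)"
    using i0(4) by simp
  then have "W (\<Sum>i\<in>S. x i) = W (\<Sum>i\<in>T. x i)"
    using sum.subset_diff[of T S x] add_eq(2) assms(1) by (simp add: T_def)
  moreover have "i \<in> T"
    using False assms(3) by (simp add: T_def)
  ultimately show ?thesis
    using i0(2,4) by simp
qed simp

end

lemma pseudo_valuation_of_valuation:
  assumes "valuation_on (ring_of_type_algebra :: 'r::comm_ring_1 ring) v"
  shows "pseudo_valuation v"
  using assms unfolding valuation_on_type_algebra by unfold_locales auto

section \<open>Expansions in powers of a polynomial\<close>

lemma adic_coeff_add: "adic_coeff \<phi> (p + q) i = adic_coeff \<phi> p i + adic_coeff \<phi> q i"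
  by (simp add: adic_coeff_def poly_div_add_left poly_mod_add_left)

lemma adic_coeff_0 [simp]: "adic_coeff \<phi> 0 i = 0"
  by (simp add: adic_coeff_def)

lemma adic_coeff_sum: "adic_coeff \<phi> (\<Sum>a\<in>S. p a) i = (\<Sum>a\<in>S. adic_coeff \<phi> (p a) i)"
  by (induction S rule: infinite_finite_induct) (simp_all add: adic_coeff_add)

lemma adic_coeff_mult_power:
  assumes "\<phi> \<noteq> 0"
  shows "adic_coeff \<phi> (p * \<phi> ^ k) i = (if i < k then 0 else adic_coeff \<phi> p (i - k))"
proof (cases "i < k")
  case True
  then have "\<phi> ^ k = \<phi> ^ (k - i - 1) * \<phi> * \<phi> ^ i"
    by (metis True Suc_diff_Suc add.commute diff_Suc_eq_diff_pred le_add_diff_inverse2 less_imp_le_nat minus_nat.diff_0 power_Suc2 power_add diff_Suc_1)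
  then have "p * \<phi> ^ k = (p * \<phi> ^ (k - i - 1) * \<phi>) * \<phi> ^ i"
    by (simp only: mult.assoc)
  then have "p * \<phi> ^ k div \<phi> ^ i = p * \<phi> ^ (k - i - 1) * \<phi>"
    using assms by (metis nonzero_mult_div_cancel_right power_eq_0_iff)
  then show ?thesis
    using True by (simp add: adic_coeff_def)
next
  case False
  then have "\<phi> ^ i = \<phi> ^ (i - k) * \<phi> ^ k"
    by (simp add: power_add[symmetric])
  then have "p * \<phi> ^ k div \<phi> ^ i = p div \<phi> ^ (i - k)"
    using assms by simp
  then show ?thesis
    using False by (simp add: adic_coeff_def)
qed

lemma adic_coeff_div_power: "adic_coeff \<phi> (p div \<phi> ^ k) i = adic_coeff \<phi> p (i + k)"
  unfolding adic_coeff_def by (subst add.commute) (simp only: power_add poly_div_mult_right)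

lemma adic_coeff_small:
  assumes "degree p < degree \<phi>"
  shows "adic_coeff \<phi> p i = (if i = 0 then p else 0)"
proof (cases "i = 0")
  case False
  have "\<phi> \<noteq> 0" "degree \<phi> \<le> i * degree \<phi>"
    using assms False by auto
  then have "degree p < degree (\<phi> ^ i)"
    using order_less_le_trans[OF assms] by (metis degree_power_eq)
  then show ?thesis
    using False by (simp add: adic_coeff_def div_poly_less)
qed (use assms in \<open>simp add: adic_coeff_def mod_poly_less\<close>)

lemma adic_coeff_beyond:
  assumes "degree p < i * degree \<phi>"
  shows "adic_coeff \<phi> p i = 0"
proof -
  have "\<phi> \<noteq> 0"
    using assms by auto
  then show ?thesis
    using assms by (simp add: adic_coeff_def div_poly_less degree_power_eq)
qed

lemma degree_adic_term:
  fixes a \<phi> :: "'a::idom poly"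
  assumes "a \<noteq> 0" "\<phi> \<noteq> 0"
  shows "degree (a * \<phi> ^ i) = degree a + i * degree \<phi>"
  using assms by (subst Polynomial.degree_mult_eq) (simp_all add: degree_power_eq)

lemma adic_expansion_le:
  assumes "0 < degree \<phi>" "degree p div degree \<phi> \<le> N"
  shows "p = (\<Sum>i\<le>N. adic_coeff \<phi> p i * \<phi> ^ i)"
proof -
  have "(\<Sum>i\<le>N. adic_coeff \<phi> p i * \<phi> ^ i)
      = (\<Sum>i\<le>degree p div degree \<phi>. adic_coeff \<phi> p i * \<phi> ^ i)"
  proof (rule sum.mono_neutral_right)
    show "\<forall>i\<in>{..N} - {..degree p div degree \<phi>}. adic_coeff \<phi> p i * \<phi> ^ i = 0"
    proof
      fix i assume "i \<in> {..N} - {..degree p div degree \<phi>}"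
      then have "degree p div degree \<phi> < i"
        by auto
      then have "adic_coeff \<phi> p i = 0"
        using assms(1) by (intro adic_coeff_beyond) (simp add: div_less_iff_less_mult)
      then show "adic_coeff \<phi> p i * \<phi> ^ i = 0"
        by (simp only: mult_zero_left)
    qed
    show "{..degree p div degree \<phi>} \<subseteq> {..N}"
      using assms(2) by simp
  qed simp
  with adic_expansion[OF assms(1), of p] show ?thesis
    by (rule trans[OF _ sym])
qed

section \<open>Augmentation at a key polynomial\<close>

locale poly_pseudo_valuation = pseudo_valuation W
  for W :: "'a::field poly \<Rightarrow> 'g::linordered_ab_group_add extended"
begin

text \<open>Key polynomials in terms of W alone: reducing a product of two polynomials of smaller
  degree modulo \<phi> keeps the value in the remainder, while the carry into the next power of
  \<phi> strictly gains. This is what makes the augmentation multiplicative. As no earlier stage is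
  mentioned, the notion covers z at the beginning and f at the end of the algorithm alike.\<close>

definition key :: "'a poly \<Rightarrow> bool" where
  "key \<phi> \<longleftrightarrow> Polynomial.lead_coeff \<phi> = 1 \<and> 0 < degree \<phi> \<and>
     (\<forall>p. degree p < degree \<phi> \<longrightarrow> p \<noteq> 0 \<longrightarrow> W p \<noteq> \<infinity>) \<and>
     (\<forall>a b. degree a < degree \<phi> \<longrightarrow> a \<noteq> 0 \<longrightarrow>
            degree b < degree \<phi> \<longrightarrow> b \<noteq> 0 \<longrightarrow>
        W ((a * b) mod \<phi>) = W a + W b \<and> W a + W b < W ((a * b) div \<phi>) + W \<phi>)"

text \<open>The augmentation is taken over W instead of the preceding stage. Augmenting evaluates
  its base only in degrees below deg \<phi>, where the two agree for the key polynomials of a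
  chain.\<close>

definition U :: "'a poly \<Rightarrow> 'a poly \<Rightarrow> 'g extended" where
  "U \<phi> = augmentation W \<phi> (W \<phi>)"

definition adic_term :: "'a poly \<Rightarrow> 'a poly \<Rightarrow> nat \<Rightarrow> 'a poly" where
  "adic_term \<phi> p i = adic_coeff \<phi> p i * \<phi> ^ i"

text \<open>The exponent s is the largest at which the minimum is attained, the right end of a face
  of the Newton polygon; like a degree, it is additive on products.\<close>

definition leads :: "'a poly \<Rightarrow> 'a poly \<Rightarrow> nat \<Rightarrow> bool" where
  "leads \<phi> p s \<longleftrightarrow> W (adic_term \<phi> p s) = U \<phi> p \<and> (\<forall>t>s. U \<phi> p < W (adic_term \<phi> p t))"

lemma adic_term_add: "adic_term \<phi> (p + q) i = adic_term \<phi> p i + adic_term \<phi> q i"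
  by (simp add: adic_term_def adic_coeff_add algebra_simps)

lemma adic_term_sum: "adic_term \<phi> (\<Sum>a\<in>S. p a) i = (\<Sum>a\<in>S. adic_term \<phi> (p a) i)"
  by (simp add: adic_term_def adic_coeff_sum sum_distrib_right)

lemma adic_term_0 [simp]: "adic_term \<phi> 0 i = 0"
  by (simp add: adic_term_def)

lemma adic_term_beyond:
  assumes "0 < degree \<phi>" "degree p div degree \<phi> < i"
  shows "adic_term \<phi> p i = 0"
  using assms by (simp add: adic_term_def adic_coeff_beyond div_less_iff_less_mult)

lemma U_eq_Min: "U \<phi> p = (MIN i\<in>{..degree p div degree \<phi>}. W (adic_term \<phi> p i))"
  by (simp add: U_def augmentation_def adic_term_def mult power nsc_def)

text \<open>Terms beyond the degree bound vanish and have value \<infinity>, so the minimum may run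
  over all exponents. This makes polynomials of different degrees comparable term by term.\<close>

lemma U_ge_iff:
  assumes "0 < degree \<phi>"
  shows "x \<le> U \<phi> p \<longleftrightarrow> (\<forall>i. x \<le> W (adic_term \<phi> p i))"
proof
  assume "x \<le> U \<phi> p"
  then have le: "x \<le> W (adic_term \<phi> p i)" if "i \<le> degree p div degree \<phi>" for i
    using that by (simp add: U_eq_Min)
  show "\<forall>i. x \<le> W (adic_term \<phi> p i)"
  proof
    show "x \<le> W (adic_term \<phi> p i)" for i
      using le[of i] adic_term_beyond[OF assms, of p i]
      by (cases "i \<le> degree p div degree \<phi>") auto
  qed
qed (simp add: U_eq_Min)

lemma U_le_term: "0 < degree \<phi> \<Longrightarrow> U \<phi> p \<le> W (adic_term \<phi> p i)"
  using U_ge_iff by blast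

lemma U_attained:
  obtains i where "i \<le> degree p div degree \<phi>" "U \<phi> p = W (adic_term \<phi> p i)"
proof -
  have "U \<phi> p \<in> (\<lambda>i. W (adic_term \<phi> p i)) ` {..degree p div degree \<phi>}"
    unfolding U_eq_Min by (intro Min_in) auto
  then show thesis
    using that by auto
qed

lemma U_not_Minf [simp]: "U \<phi> p \<noteq> -\<infinity>"
  by (metis U_attained not_Minf)

lemma U_le_W:
  assumes "0 < degree \<phi>"
  shows "U \<phi> p \<le> W p"
proof -
  have "U \<phi> p \<le> W (\<Sum>i\<le>degree p div degree \<phi>. adic_term \<phi> p i)"
    by (intro sum_geI U_le_term assms)
  then show ?thesis
    unfolding adic_term_def using adic_expansion[OF assms, of p] by simp
qed

lemma U_add_ge:
  assumes "0 < degree \<phi>"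
  shows "min (U \<phi> p) (U \<phi> q) \<le> U \<phi> (p + q)"
  unfolding U_ge_iff[OF assms] adic_term_add
  by (meson U_le_term[OF assms] add_ge min.mono order_trans)

lemma U_small:
  assumes "degree p < degree \<phi>"
  shows "U \<phi> p = W p"
  using assms by (simp add: U_eq_Min div_less adic_term_def adic_coeff_small)

lemma degree_keyD: "key \<phi> \<Longrightarrow> 0 < degree \<phi>"
  and lead_coeff_keyD: "key \<phi> \<Longrightarrow> Polynomial.lead_coeff \<phi> = 1"
  and key_nonzero: "key \<phi> \<Longrightarrow> \<phi> \<noteq> 0"
  and key_finite: "key \<phi> \<Longrightarrow> degree p < degree \<phi> \<Longrightarrow> p \<noteq> 0 \<Longrightarrow> W p \<noteq> \<infinity>"
  by (auto simp: key_def)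

lemma key_mod:
  assumes "key \<phi>" "degree a < degree \<phi>" "degree b < degree \<phi>"
    "a \<noteq> 0" "b \<noteq> 0"
  shows "W ((a * b) mod \<phi>) = W a + W b" "W a + W b < W ((a * b) div \<phi>) + W \<phi>"
  using assms by (auto simp: key_def)

lemma adic_term_finite:
  assumes "key \<phi>" "W \<phi> \<noteq> \<infinity>" "adic_coeff \<phi> p i \<noteq> 0"
  shows "W (adic_term \<phi> p i) \<noteq> \<infinity>"
proof -
  have "W (adic_coeff \<phi> p i) \<noteq> \<infinity>"
    using assms key_finite degree_adic_coeff degree_keyD by blast
  moreover have "W \<phi> = Fin \<mu> \<Longrightarrow> i \<bullet> W \<phi> \<noteq> \<infinity>" for \<mu>
    by (simp add: nsc_Fin)
  ultimately show ?thesis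
    using assms(2) not_Minf[of \<phi>]
    by (cases "W \<phi>") (auto simp: adic_term_def mult power nsc_Fin extended_add_eq_inf)
qed

lemma U_finite:
  assumes "key \<phi>" "W \<phi> \<noteq> \<infinity>" "p \<noteq> 0"
  shows "U \<phi> p \<noteq> \<infinity>"
proof
  assume inf: "U \<phi> p = \<infinity>"
  have "adic_coeff \<phi> p i = 0" for i
    using adic_term_finite[OF assms(1,2), of p i] U_le_term[OF degree_keyD[OF assms(1)], of p i] inf by auto
  then show False
    using adic_expansion[OF degree_keyD[OF assms(1)], of p] assms(3) by simp
qed

lemma leads_exists:
  assumes "key \<phi>" "W \<phi> \<noteq> \<infinity>" "p \<noteq> 0"
  obtains s where "leads \<phi> p s"
proof -
  define S where "S = {s. s \<le> degree p div degree \<phi> \<and> W (adic_term \<phi> p s) = U \<phi> p}"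
  obtain i where "i \<le> degree p div degree \<phi>" "U \<phi> p = W (adic_term \<phi> p i)"
    by (rule U_attained)
  then have "i \<in> S"
    by (simp add: S_def)
  have "finite S"
    by (simp add: S_def)
  then have max: "Max S \<in> S" "\<And>t. t \<in> S \<Longrightarrow> t \<le> Max S"
    using \<open>i \<in> S\<close> by (auto intro: Max_in)
  have "U \<phi> p < W (adic_term \<phi> p t)" if "Max S < t" for t
  proof (cases "t \<le> degree p div degree \<phi>")
    case True
    have "t \<notin> S"
      using max(2)[of t] that by auto
    then have "W (adic_term \<phi> p t) \<noteq> U \<phi> p"
      using True by (simp add: S_def)
    then show ?thesis
      using U_le_term[OF degree_keyD[OF assms(1)], of p t] by simp
  next
    case False
    then show ?thesis
      using adic_term_beyond[OF degree_keyD[OF assms(1)], of p t] U_finite[OF assms] by (simp add: less_inf_iff)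
  qed
  moreover have "W (adic_term \<phi> p (Max S)) = U \<phi> p"
    using max(1) unfolding S_def by blast
  ultimately show thesis
    using that[of "Max S"] by (simp add: leads_def)
qed

lemma leads_le_degree:
  assumes "key \<phi>" "W \<phi> \<noteq> \<infinity>" "p \<noteq> 0" "leads \<phi> p s"
  shows "s * degree \<phi> \<le> degree p"
proof (rule ccontr)
  assume "\<not> ?thesis"
  then have "adic_term \<phi> p s = 0"
    by (simp add: adic_term_def adic_coeff_beyond)
  then show False
    using assms U_finite[OF assms(1-3)] by (simp add: leads_def)
qed

lemma leads_unique: "leads \<phi> p s \<Longrightarrow> leads \<phi> p t \<Longrightarrow> s = t"
  by (metis leads_def linorder_neqE_nat order_less_irrefl)

text \<open>The term at \<open>s + t\<close> of the product comes from the two leading terms up to terms of larger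
  value: reducing a product of coefficients modulo \<open>\<phi>\<close> carries over into the next exponent only
  with a strict gain in value.\<close>

lemma leads_mult:
  assumes key: "key \<phi>" "W \<phi> \<noteq> \<infinity>" and nz: "p \<noteq> 0" "q \<noteq> 0" and lead: "leads \<phi> p s" "leads \<phi> q t"
  shows "U \<phi> (p * q) = U \<phi> p + U \<phi> q" "leads \<phi> (p * q) (s + t)"
proof -
  note dpos = degree_keyD[OF key(1)]
  define \<gamma> where "\<gamma> = U \<phi> p + U \<phi> q"
  have fin: "U \<phi> p \<noteq> \<infinity>" "U \<phi> q \<noteq> \<infinity>" "\<gamma> \<noteq> \<infinity>"
    using U_finite[OF key] nz by (auto simp: \<gamma>_def extended_add_eq_inf)
  define x where "x = (\<lambda>(i, j). adic_coeff \<phi> p i * adic_coeff \<phi> q j * \<phi> ^ (i + j))"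
  let ?a = "adic_coeff \<phi> p" and ?b = "adic_coeff \<phi> q" and ?T = "adic_term \<phi>"
  have deg: "degree (?a i) < degree \<phi>" "degree (?b i) < degree \<phi>" for i
    using degree_adic_coeff[OF dpos] by auto
  \<comment> \<open>A product of two coefficients has degree below 2 deg \<phi>, hence only the
    digits 0 and 1.\<close>
  have tm: "?T (x (i, j)) r = (if r = i + j then ((?a i * ?b j) mod \<phi>) * \<phi> ^ (i + j)
      else if r = Suc (i + j) then ((?a i * ?b j) div \<phi>) * \<phi> ^ Suc (i + j) else 0)" for i j r
  proof -
    have "degree (?a i * ?b j) < 2 * degree \<phi>"
      using degree_mult_le[of "?a i" "?b j"] deg(1)[of i] deg(2)[of j] by linarith
    moreover have "adic_coeff \<phi> (?a i * ?b j) k = 0" if "2 \<le> k" for k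
      using calculation mult_le_mono1[OF that, of "degree \<phi>"]
      by (intro adic_coeff_beyond) linarith
    moreover have "(?a i * ?b j) div \<phi> mod \<phi> = (?a i * ?b j) div \<phi>"
    proof -
      have "degree (\<phi> * \<phi>) = 2 * degree \<phi>"
        using key_nonzero[OF key(1)] by (simp add: Polynomial.degree_mult_eq)
      then have "?a i * ?b j div \<phi> div \<phi> = 0"
        using \<open>degree (?a i * ?b j) < _\<close>
        by (simp only: poly_div_mult_right[symmetric] div_poly_less)
      then show ?thesis
        by (metis add.left_neutral div_mult_mod_eq mult_zero_left)
    qed
    ultimately have "adic_coeff \<phi> (?a i * ?b j) k = (if k = 0 then (?a i * ?b j) mod \<phi>
        else if k = 1 then (?a i * ?b j) div \<phi> else 0)" for k
      by (auto simp: adic_coeff_def)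
    from this[of "r - (i + j)"] show ?thesis
      using key_nonzero[OF key(1)]
      by (cases r "i + j" rule: linorder_cases)
        (auto simp: adic_term_def x_def adic_coeff_mult_power)
  qed
  have val: "W (?T (x (i, j)) (i + j)) = W (?T p i) + W (?T q j)"
    "W (?T p i) + W (?T q j) < W (?T (x (i, j)) (Suc (i + j)))" if "?a i \<noteq> 0" "?b j \<noteq> 0" for i j
  proof -
    obtain \<mu> where \<mu>: "W \<phi> = Fin \<mu>"
      using key(2) not_Minf[of \<phi>] by (cases "W \<phi>") auto
    note m = key_mod[OF key(1) deg(1)[of i] deg(2)[of j] that]
    show "W (?T (x (i, j)) (i + j)) = W (?T p i) + W (?T q j)"
      unfolding tm using m(1) by (simp add: mult power nsc_add adic_term_def ac_simps)
    have "W (?a i) + W (?b j) + (i + j) \<bullet> W \<phi> < W ((?a i * ?b j) div \<phi>) + W \<phi> + (i + j) \<bullet> W \<phi>"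
      using m(2) by (simp add: extended_add_cancel \<mu> nsc_Fin)
    then show "W (?T p i) + W (?T q j) < W (?T (x (i, j)) (Suc (i + j)))"
      unfolding tm by (simp add: mult power nsc_add adic_term_def ac_simps nsc_Suc)
  qed
  have ge: "\<gamma> \<le> W (?T p i) + W (?T q j)" for i j
    unfolding \<gamma>_def by (intro add_mono U_le_term dpos)
  have all: "\<gamma> \<le> W (?T (x (i, j)) r)" for i j r
  proof (cases "?a i = 0 \<or> ?b j = 0")
    case False
    then show ?thesis
      using val[of i j] ge[of i j] tm[of i j r]
      by (cases "r = i + j"; cases "r = Suc (i + j)") (auto intro: order_trans)
  qed (auto simp: x_def)
  have gt: "\<gamma> < W (?T (x (i, j)) r)" if "s + t \<le> r" "(i, j) \<noteq> (s, t) \<or> r \<noteq> s + t" for i j r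
  proof (cases "?a i = 0 \<or> ?b j = 0")
    case False
    consider "r = i + j" | "r = Suc (i + j)" | "r \<noteq> i + j" "r \<noteq> Suc (i + j)"
      by blast
    then show ?thesis
    proof cases
      case 1
      \<comment> \<open>From i + j \<ge> s + t and (i, j) \<noteq> (s, t); beyond s and t the terms
        lie strictly above the minimum by \<open>leads\<close>.\<close>
      then have "s < i \<or> t < j"
        using that by auto
      then have "\<gamma> < W (?T p i) + W (?T q j)"
      proof
        assume "s < i"
        then have "U \<phi> p < W (?T p i)"
          using lead(1) by (auto simp: leads_def)
        then have "\<gamma> < W (?T p i) + U \<phi> q"
          using fin by (simp add: \<gamma>_def extended_add_cancel)
        also have "\<dots> \<le> W (?T p i) + W (?T q j)"
          by (intro add_mono U_le_term dpos order_refl)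
        finally show ?thesis .
      next
        assume "t < j"
        then have "U \<phi> q < W (?T q j)"
          using lead(2) by (auto simp: leads_def)
        then have "\<gamma> < U \<phi> p + W (?T q j)"
          using fin by (simp add: \<gamma>_def extended_add_cancel)
        also have "\<dots> \<le> W (?T p i) + W (?T q j)"
          by (intro add_mono U_le_term dpos order_refl)
        finally show ?thesis .
      qed
      then show ?thesis
        using val(1)[of i j] False 1 by simp
    next
      case 2
      then show ?thesis
        using val(2)[of i j] False ge[of i j] by (auto intro: order_le_less_trans)
    next
      case 3
      then show ?thesis
        using tm[of i j r] fin by (simp add: less_inf_iff)
    qed
  qed (use fin in \<open>auto simp: x_def less_inf_iff\<close>)
  have st: "?a s \<noteq> 0" "?b t \<noteq> 0"
    using lead fin by (auto simp: leads_def adic_term_def)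
  have eq: "W (?T (x (s, t)) (s + t)) = \<gamma>"
    using val(1)[OF st] lead by (simp add: leads_def \<gamma>_def)
  let ?I = "{..degree p div degree \<phi>} \<times> {..degree q div degree \<phi>}"
  have "p * q = (\<Sum>i\<le>degree p div degree \<phi>. ?a i * \<phi> ^ i)
      * (\<Sum>j\<le>degree q div degree \<phi>. ?b j * \<phi> ^ j)"
    using adic_expansion[OF dpos] by metis
  also have "\<dots> = (\<Sum>ij\<in>?I. x ij)"
    by (simp add: sum_product sum.cartesian_product x_def power_add case_prod_beta ac_simps)
  finally have pq: "p * q = (\<Sum>ij\<in>?I. x ij)" .
  have stI: "(s, t) \<in> ?I"
    using st adic_coeff_beyond[of p s \<phi>] adic_coeff_beyond[of q t \<phi>] dpos
    by (auto simp: less_eq_div_iff_mult_less_eq intro!: leI)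
  have all': "\<gamma> \<le> W (?T (p * q) r)" for r
    unfolding pq adic_term_sum using all by (intro sum_geI) auto
  have gt': "\<gamma> < W (?T (p * q) r)" if "s + t < r" for r
    unfolding pq adic_term_sum using gt that fin(3) by (intro sum_gtI) (auto simp del: less_extended_simps)
  have eq': "W (?T (p * q) (s + t)) = \<gamma>"
    unfolding pq adic_term_sum eq[symmetric]
  proof (rule sum_eq[OF _ stI])
    fix ij assume "ij \<in> ?I - {(s, t)}"
    then show "W (?T (x (s, t)) (s + t)) < W (?T (x ij) (s + t))"
      using gt[of "s + t" "fst ij" "snd ij"] by (simp add: eq prod_eq_iff)
  qed simp
  show U: "U \<phi> (p * q) = U \<phi> p + U \<phi> q"
    using all' eq' U_ge_iff[OF dpos, of \<gamma> "p * q"] U_le_term[OF dpos, of "p * q" "s + t"]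
    by (simp add: \<gamma>_def antisym)
  show "leads \<phi> (p * q) (s + t)"
    using gt' eq' U by (simp add: leads_def \<gamma>_def)
qed

lemma valuation_U:
  assumes "key \<phi>" "W \<phi> \<noteq> \<infinity>"
  shows "valuation_on (ring_of_type_algebra :: 'a poly ring) (U \<phi>)"
  unfolding valuation_on_type_algebra
proof (intro conjI allI)
  fix p q
  show "U \<phi> p = \<infinity> \<longleftrightarrow> p = 0"
    using U_finite[OF assms] by (cases "p = 0") (auto simp: U_eq_Min)
  show "U \<phi> (p * q) = U \<phi> p + U \<phi> q"
  proof (cases "p = 0 \<or> q = 0")
    case False
    then obtain s t where "leads \<phi> p s" "leads \<phi> q t"
      using leads_exists[OF assms] by metis
    then show ?thesis
      using leads_mult(1)[OF assms] False by blast
  qed (auto simp: U_eq_Min)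
  show "min (U \<phi> p) (U \<phi> q) \<le> U \<phi> (p + q)"
    by (rule U_add_ge) (use assms degree_keyD in auto)
qed simp

end

section \<open>Key polynomials\<close>

lemma degree_diff_less_of_lead_coeff_eq:
  fixes p q :: "'a::comm_ring_1 poly"
  assumes "degree p = degree q" "Polynomial.lead_coeff p = Polynomial.lead_coeff q"
    and "0 < degree p"
  shows "degree (p - q) < degree p"
proof -
  have "degree (p - q) \<le> degree p"
    using assms(1) by (intro degree_diff_le) auto
  moreover have "degree (p - q) \<noteq> degree p"
  proof
    assume eq: "degree (p - q) = degree p"
    have "Polynomial.lead_coeff (p - q) = 0"
      unfolding eq using assms(1,2) by simp
    then have "p - q = 0"
      by (simp only: leading_coeff_0_iff)
    then show False
      using eq assms(3) by simp
  qed
  ultimately show ?thesis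
    by simp
qed

lemma smult_sum_right: "Polynomial.smult a (\<Sum>i\<in>S. p i) = (\<Sum>i\<in>S. Polynomial.smult a (p i))"
  by (induction S rule: infinite_finite_induct) (simp_all add: smult_add_right)

text \<open>Bezout: an element of least degree in the ideal (f, p) divides both generators, so it is
  a unit, since f is irreducible and does not divide p.\<close>

lemma inverse_mod_irreducible:
  fixes f p :: "'a::field poly"
  assumes "Factorial_Ring.irreducible f" "\<not> f dvd p"
  obtains q where "f dvd p * q - 1"
proof -
  define S where "S = {g. g \<noteq> 0 \<and> (\<exists>a b. g = a * f + b * p)}"
  have "p = 0 * f + 1 * p"
    by simp
  then have "p \<in> S"
    using assms(2) unfolding S_def by blast
  then obtain g where g: "g \<in> S" "\<And>h. h \<in> S \<Longrightarrow> degree g \<le> degree h"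
    using ex_has_least_nat[of "\<lambda>g. g \<in> S" p degree] by blast
  then obtain a b where ab: "g = a * f + b * p"
    unfolding S_def by blast
  have dvd: "g dvd u * f + v * p" for u v
  proof (rule ccontr)
    assume "\<not> g dvd u * f + v * p"
    then have nz: "(u * f + v * p) mod g \<noteq> 0"
      by (simp add: dvd_eq_mod_eq_0)
    define k where "k = (u * f + v * p) div g"
    have "(u * f + v * p) mod g = (u * f + v * p) - k * g"
      by (simp add: k_def minus_div_mult_eq_mod)
    also have "\<dots> = (u - k * a) * f + (v - k * b) * p"
      by (simp add: ab algebra_simps)
    finally have "(u * f + v * p) mod g \<in> S"
      using nz unfolding S_def by blast
    moreover have "g \<noteq> 0"
      using g(1) by (simp add: S_def)
    ultimately show False
      using g(2) degree_mod_less[of g "u * f + v * p"] nz by (meson leD)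
  qed
  have "g dvd f" "g dvd p"
    using dvd[of 1 0] dvd[of 0 1] by auto
  then obtain k where k: "f = g * k"
    by blast
  have "g dvd 1"
  proof (rule ccontr)
    assume "\<not> g dvd 1"
    then have "k dvd 1"
      using assms(1) k by (auto dest: Factorial_Ring.irreducibleD)
    then have "f dvd g"
      using k by (metis dvd_refl mult_dvd_mono mult.right_neutral)
    then show False
      using \<open>g dvd p\<close> assms(2) dvd_trans by blast
  qed
  then obtain u where "1 = g * u"
    by blast
  then have "p * (b * u) - 1 = f * (- (a * u))"
    by (simp add: ab algebra_simps)
  then show thesis
    using that by (metis dvd_triv_left)
qed

lemma pcompose_eq_sum:
  fixes p q :: "'a::comm_semiring_1 poly"
  shows "pcompose p q = (\<Sum>i\<le>degree p. Polynomial.smult (Polynomial.coeff p i) (q ^ i))"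
proof -
  have "degree (map_poly (\<lambda>x. [:x:]) p) = degree p"
    by (rule degree_map_poly) simp
  then show ?thesis
    by (simp add: pcompose_altdef poly_altdef coeff_map_poly)
qed

lemma (in pseudo_valuation) eq_of_diff_gt:
  assumes "min (W x) (W y) < W (x - y)"
  shows "W x = W y"
proof (cases "W x" "W y" rule: linorder_cases)
  case less
  then show ?thesis
    using assms diff_eq(1)[OF less] by (simp add: min_absorb1)
next
  case greater
  then show ?thesis
    using assms diff_eq(2)[OF greater] by (simp add: min_absorb2)
qed

context poly_pseudo_valuation
begin

text \<open>Here \<phi> is monic of the least degree in which some value grows from V to W.
  Remainders modulo \<phi> keep their value and nonzero multiples of \<phi> strictly gain. Hence
  V(g) < W(g) means that g mod \<phi> has larger value than g under V, so that g is equivalent to a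
  multiple of \<phi>.\<close>

lemma key_of_less:
  assumes V: "valuation_on (ring_of_type_algebra :: 'a poly ring) V" and le: "\<And>p. V p \<le> W p"
    and eq: "\<And>p. degree p < degree \<phi> \<Longrightarrow> V p = W p"
    and \<phi>: "Polynomial.lead_coeff \<phi> = 1" "0 < degree \<phi>" "V \<phi> < W \<phi>"
  shows "key \<phi>" (is ?key) and "g \<noteq> 0 \<Longrightarrow> equiv_dvd V \<phi> g \<longleftrightarrow> V g < W g"
proof -
  interpret V: pseudo_valuation V
    using V by (rule pseudo_valuation_of_valuation)
  have Vfin: "p \<noteq> 0 \<Longrightarrow> V p \<noteq> \<infinity>" for p
    using V unfolding valuation_on_type_algebra by blast
  have lt: "V (q * \<phi>) < W (q * \<phi>)" if "q \<noteq> 0" for q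
  proof -
    have "V q + V \<phi> < V q + W \<phi>"
      using \<phi>(3) Vfin[OF that] by (simp add: extended_add_cancel)
    also have "\<dots> \<le> W q + W \<phi>"
      using le by (intro add_mono order_refl)
    finally show ?thesis
      by (simp add: mult V.mult)
  qed
  have small: "V (p mod \<phi>) = W (p mod \<phi>)" for p
    using eq[of "p mod \<phi>"] degree_mod_less[of \<phi> p] \<phi>(2) by (cases "p mod \<phi> = 0") fastforce+
  \<comment> \<open>If the value of \<open>g\<close> under \<open>V\<close> came from \<open>g mod \<phi>\<close>, then so would the one under \<open>W\<close>.\<close>
  have mod_gt: "V g < V (g mod \<phi>)" if "V g < W g" for g
  proof (rule ccontr)
    assume "\<not> V g < V (g mod \<phi>)"
    moreover have "V g \<noteq> \<infinity>"
      using that by auto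
    ultimately have r: "V (g mod \<phi>) \<le> V g" "g mod \<phi> \<noteq> 0"
      by (auto simp: less_inf_iff not_less)
    have "V (g mod \<phi>) \<le> V (g - g mod \<phi>)"
      using r(1) by (intro V.diff_geI) auto
    then have q: "V (g mod \<phi>) \<le> V (g div \<phi> * \<phi>)"
      by (simp add: minus_mod_eq_div_mult)
    have "W (g mod \<phi>) < W (g div \<phi> * \<phi>)"
    proof (cases "g div \<phi> = 0")
      case True
      then show ?thesis
        using r(2) Vfin[OF r(2)] by (simp add: small[symmetric] less_inf_iff)
    next
      case False
      then show ?thesis
        using lt[OF False] q by (simp add: small[symmetric])
    qed
    then have "W g = W (g mod \<phi>)"
      using add_eq(2)[of "g mod \<phi>" "g div \<phi> * \<phi>"] by (simp add: mult.commute)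
    then show False
      using that r small by simp
  qed
  show "equiv_dvd V \<phi> g \<longleftrightarrow> V g < W g" if "g \<noteq> 0" for g
  proof
    assume "equiv_dvd V \<phi> g"
    then obtain a where a: "equiv_in V g (a * \<phi>)"
      unfolding equiv_dvd_def by blast
    then have a': "min (V g) (V (a * \<phi>)) < V (g - a * \<phi>)"
      using Vfin[OF that] by (auto simp: equiv_in_def)
    have Veq: "V g = V (a * \<phi>)"
      using a' by (rule V.eq_of_diff_gt)
    then have "a \<noteq> 0"
      using Vfin[OF that] by auto
    then have "V g < W (a * \<phi>)"
      using lt Veq by metis
    moreover have "V g < W (g - a * \<phi>)"
      using a' Veq le[of "g - a * \<phi>"] by simp
    ultimately show "V g < W g"
      using add_gtI[of "V g" "g - a * \<phi>" "a * \<phi>"] by simp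
  next
    assume "V g < W g"
    then have "V g < V (g mod \<phi>)"
      by (rule mod_gt)
    then have "V g < V (g - (g div \<phi>) * \<phi>)"
      by (simp add: minus_div_mult_eq_mod)
    then show "equiv_dvd V \<phi> g"
      unfolding equiv_dvd_def equiv_in_def by (metis min_less_iff_disj)
  qed
  show ?key
    unfolding key_def
  proof (intro conjI allI impI)
    fix p :: "'a poly"
    assume "degree p < degree \<phi>" "p \<noteq> 0"
    then show "W p \<noteq> \<infinity>"
      using eq Vfin by metis
  next
    fix a b :: "'a poly"
    assume ab: "degree a < degree \<phi>" "a \<noteq> 0" "degree b < degree \<phi>" "b \<noteq> 0"
    then have VW: "V (a * b) = W (a * b)"
      using eq by (simp add: mult V.mult)
    define q where "q = (a * b) div \<phi>"
    have ab_eq: "a * b = q * \<phi> + (a * b) mod \<phi>"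
      by (simp add: q_def)
    have fin: "V (a * b) \<noteq> \<infinity>"
      using ab Vfin by simp
    \<comment> \<open>If the values of a b and of its remainder differed, the multiple q \<phi>
      would have the smaller of the two under V and a strictly larger one under W. As V and W agree
      on a b and on the remainder, this contradicts the ultrametric inequality for W.\<close>
    have r: "V ((a * b) mod \<phi>) = V (a * b)"
    proof (cases "V ((a * b) mod \<phi>)" "V (a * b)" rule: linorder_cases)
      case less
      then have *: "V (q * \<phi>) = V ((a * b) mod \<phi>)"
        using V.diff_eq(2)[OF less] by (simp add: q_def minus_mod_eq_div_mult)
      then have "q \<noteq> 0"
        using less by auto
      then have "W ((a * b) mod \<phi>) < W (q * \<phi>)"
        using lt[of q] * small[of "a * b"] by simp
      then have "W (a * b) = W ((a * b) mod \<phi>)"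
        using add_eq(2) ab_eq by metis
      then show ?thesis
        using less VW small[of "a * b"] by simp
    next
      case greater
      then have *: "V (q * \<phi>) = V (a * b)"
        using V.diff_eq(1)[OF greater] by (simp add: q_def minus_mod_eq_div_mult)
      then have "q \<noteq> 0"
        using fin by auto
      then have "W (a * b) < W (q * \<phi>)"
        using lt[of q] * VW by simp
      moreover have "W (a * b) < W ((a * b) mod \<phi>)"
        using greater VW small[of "a * b"] by simp
      ultimately have "W (a * b) < W (a * b)"
        using add_gtI ab_eq by metis
      then show ?thesis by simp
    qed
    show "W ((a * b) mod \<phi>) = W a + W b"
      using r VW small[of "a * b"] by (simp add: mult)
    show "W a + W b < W ((a * b) div \<phi>) + W \<phi>"
    proof (cases "q = 0")
      case True
      then show ?thesis
        using fin VW by (simp add: q_def mult less_inf_iff)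
    next
      case False
      have "V (a * b) \<le> V (q * \<phi>)"
        using V.diff_geI[of "V (a * b)" "a * b" "(a * b) mod \<phi>"] r
        by (simp add: q_def minus_mod_eq_div_mult)
      then show ?thesis
        using lt[OF False] VW by (simp add: q_def mult)
    qed
  qed (use \<phi> in auto)
qed

text \<open>Since divisibility by \<phi> is detected by V(g) < W(g), equivalence irreducibility says
  that a product gains value only if a factor does, and minimality of the degree says that nothing
  of smaller degree gains. Equivalence to \<phi>' is impossible because \<phi> gains and \<phi>'
  does not.\<close>

lemma key_polynomial_of_less:
  assumes V: "valuation_on (ring_of_type_algebra :: 'a poly ring) V" and le: "\<And>p. V p \<le> W p"
    and eq: "\<And>p. degree p < degree \<phi> \<Longrightarrow> V p = W p"
    and \<phi>: "Polynomial.lead_coeff \<phi> = 1" "0 < degree \<phi>" "V \<phi> < W \<phi>"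
    and \<phi>': "V \<phi>' = W \<phi>'" "\<phi>' \<noteq> 0" "degree \<phi>' \<le> degree \<phi>"
  shows "key_polynomial V \<phi>' \<phi> (W \<phi>)"
proof -
  interpret V: pseudo_valuation V
    using V by (rule pseudo_valuation_of_valuation)
  have Vfin: "p \<noteq> 0 \<Longrightarrow> V p \<noteq> \<infinity>" for p
    using V unfolding valuation_on_type_algebra by blast
  have dvd: "equiv_dvd V \<phi> g \<longleftrightarrow> V g < W g" if "g \<noteq> 0" for g
    using key_of_less(2)[of V \<phi> g] V le eq \<phi> that by blast
  have zero: "equiv_dvd V \<phi> 0"
    unfolding equiv_dvd_def equiv_in_def by (rule exI[of _ 0]) simp
  have "equiv_irreducible V \<phi>"
    unfolding equiv_irreducible_def
  proof (intro allI impI)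
    fix a b assume ab: "equiv_dvd V \<phi> (a * b)"
    show "equiv_dvd V \<phi> a \<or> equiv_dvd V \<phi> b"
    proof (cases "a = 0 \<or> b = 0")
      case False
      then have "V a + V b < W a + W b"
        using ab dvd[of "a * b"] by (simp add: mult V.mult)
      then have "V a \<noteq> W a \<or> V b \<noteq> W b"
        by auto
      then show ?thesis
        using dvd[of a] dvd[of b] False le[of a] le[of b] by (auto simp: order_less_le)
    qed (use zero in auto)
  qed
  moreover have "degree \<phi> \<le> degree g" if "g \<noteq> 0" "equiv_dvd V \<phi> g" for g
    using dvd[OF that(1)] that(2) eq[of g] by (metis leI order_less_irrefl)
  moreover have "\<not> equiv_in V \<phi> \<phi>'"
  proof
    assume "equiv_in V \<phi> \<phi>'"
    then have a: "min (V \<phi>) (V \<phi>') < V (\<phi> - \<phi>')"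
      using Vfin[OF \<phi>'(2)] by (auto simp: equiv_in_def)
    have "V \<phi> = V \<phi>'"
      using a by (rule V.eq_of_diff_gt)
    then have "W \<phi>' < W \<phi>" "W \<phi>' < W (\<phi> - \<phi>')"
      using a \<phi>(3) \<phi>'(1) le[of "\<phi> - \<phi>'"] by auto
    then have "W \<phi>' < W (\<phi> - (\<phi> - \<phi>'))"
      by (rule diff_gtI)
    then show False by simp
  qed
  ultimately show ?thesis
    unfolding key_polynomial_def using \<phi> \<phi>' by blast
qed

lemma U_key:
  assumes "key \<phi>"
  shows "U \<phi> \<phi> = W \<phi>"
proof (rule antisym)
  note pos = degree_keyD[OF assms] key_nonzero[OF assms]
  have "adic_coeff \<phi> \<phi> i = (if i = 1 then 1 else 0)" for i
    using adic_coeff_mult_power[OF pos(2), of 1 1 i] adic_coeff_small[of 1 \<phi> "i - 1"] pos by auto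
  then have "adic_term \<phi> \<phi> i = (if i = 1 then \<phi> else 0)" for i
    by (simp add: adic_term_def)
  then show "W \<phi> \<le> U \<phi> \<phi>"
    by (simp add: U_ge_iff[OF pos(1)])
qed (use U_le_W degree_keyD assms in auto)

end

text \<open>\<open>integral\<close> is what remains of the uniqueness of the extension, and
  \<open>residue\<close> of the condition on the residue field. With these two, the chain of key
  polynomials is constructed from W alone, without returning to \<omega>.\<close>

locale unique_extension_poly = poly_pseudo_valuation W
  for W :: "'a::field poly \<Rightarrow> 'g::linordered_ab_group_add extended" +
  fixes V0 :: "'a \<Rightarrow> 'g extended" and f :: "'a poly"
  assumes V0: "valuation_on (ring_of_type_algebra :: 'a ring) V0"
    and W_const [simp]: "W [:a:] = V0 a"
    and W_inf_iff: "W p = \<infinity> \<longleftrightarrow> f dvd p"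
    and monic_f: "Polynomial.lead_coeff f = 1"
    and irreducible_f: "Factorial_Ring.irreducible f"
    and integral: "0 \<le> W p \<Longrightarrow> \<exists>\<chi>. Polynomial.lead_coeff \<chi> = 1 \<and> 0 < degree \<chi> \<and>
      (\<forall>i. 0 \<le> V0 (Polynomial.coeff \<chi> i)) \<and> f dvd pcompose \<chi> p"
    and residue: "W p = 0 \<Longrightarrow> \<exists>a. a \<noteq> 0 \<and> V0 a = 0 \<and> 0 < W (p - [:a:])"
begin

sublocale V0: pseudo_valuation V0
  using V0 by (rule pseudo_valuation_of_valuation)

lemma V0_inf_iff: "V0 a = \<infinity> \<longleftrightarrow> a = 0"
  using V0 unfolding valuation_on_type_algebra by blast

lemma W_smult: "W (Polynomial.smult a p) = V0 a + W p"
  using mult[of "[:a:]" p] by simp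

lemma V0_divide:
  assumes "V0 a = Fin x" "V0 b = Fin y"
  shows "V0 (a / b) = Fin (x - y)"
proof -
  have "b \<noteq> 0"
    using assms(2) by auto
  then have "V0 (a / b) + Fin y = Fin x"
    using V0.mult[of "a / b" b] assms by simp
  then show ?thesis
    by (cases "V0 (a / b)") (auto simp: eq_diff_eq)
qed

lemma degree_f_pos: "0 < degree f"
  using irreducible_f unfolding irreducible_def by (metis gr0I is_unit_iff_degree)

lemma W_finite_small:
  assumes "degree p < degree f" "p \<noteq> 0"
  shows "W p \<noteq> \<infinity>"
  using assms dvd_imp_degree_le[of f p] by (auto simp: W_inf_iff)

section \<open>Integral equations and divisibility of degrees\<close>

lemma inverse_mod_f:
  assumes "W p = Fin \<gamma>"
  obtains q where "W (p * q - 1) = \<infinity>" "W q = Fin (- \<gamma>)"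
proof -
  have "\<not> f dvd p"
    using assms W_inf_iff[of p] by auto
  then obtain b where "f dvd p * b - 1"
    using inverse_mod_irreducible[OF irreducible_f] by blast
  then have inf: "W (p * b - 1) = \<infinity>"
    by (simp add: W_inf_iff)
  then have "W (p * b) = 0"
    using add_eq(1)[of 1 "p * b - 1"] by (simp add: zero_extended_def)
  then have "W b = Fin (- \<gamma>)"
    using assms by (cases "W b") (auto simp: mult zero_extended_def eq_neg_iff_add_eq_0 add.commute)
  then show thesis
    using that inf by blast
qed

text \<open>In an integral equation for p two different terms must share a finite value, for
  otherwise the sum could not have value \<infinity>; comparing them exhibits a multiple of the
  value of p as a difference of values of \<open>V0\<close>. Integrality is available for
  nonnegative values, so an element of negative value is first inverted modulo f.\<close>

lemma nsc_value_in_V0: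
  assumes "W p = Fin \<gamma>"
  obtains N a where "0 < N" "V0 a = Fin (N \<bullet> \<gamma>)"
proof -
  have nonneg: "\<exists>N a. 0 < N \<and> V0 a = Fin (N \<bullet> \<delta>)" if q: "W q = Fin \<delta>" "0 \<le> \<delta>" for q \<delta>
  proof -
    obtain \<chi> where \<chi>: "Polynomial.lead_coeff \<chi> = 1" "f dvd pcompose \<chi> q"
      using integral[of q] q by (auto simp: zero_extended_def)
    define x where "x i = Polynomial.smult (Polynomial.coeff \<chi> i) (q ^ i)" for i
    have x: "W (x i) = V0 (Polynomial.coeff \<chi> i) + Fin (i \<bullet> \<delta>)" for i
      by (simp add: x_def W_smult power q nsc_Fin)
    have inf: "W (\<Sum>i\<le>degree \<chi>. x i) = \<infinity>"
      using \<chi>(2) by (simp add: W_inf_iff pcompose_eq_sum x_def)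
    have top: "W (x (degree \<chi>)) \<noteq> \<infinity>"
      using \<chi>(1) by (simp add: x zero_extended_def)
    have "\<not> (\<forall>i\<in>{..degree \<chi>}. \<forall>j\<in>{..degree \<chi>}. i \<noteq> j \<longrightarrow> W (x i) \<noteq> \<infinity> \<longrightarrow> W (x i) \<noteq> W (x j))"
      using sum_ge_distinct[of "{..degree \<chi>}" x "degree \<chi>"] inf top by auto
    then obtain i j where "i \<noteq> j" "W (x i) \<noteq> \<infinity>" "W (x i) = W (x j)"
      by blast
    then obtain i j where ij: "i < j" "W (x i) \<noteq> \<infinity>" "W (x i) = W (x j)"
      by (metis linorder_neqE_nat)
    then obtain u v where uv: "V0 (Polynomial.coeff \<chi> i) = Fin u" "V0 (Polynomial.coeff \<chi> j) = Fin v"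
      using V0.not_Minf[of "Polynomial.coeff \<chi> i"] V0.not_Minf[of "Polynomial.coeff \<chi> j"]
      by (cases "V0 (Polynomial.coeff \<chi> i)"; cases "V0 (Polynomial.coeff \<chi> j)") (auto simp: x)
    have "u + i \<bullet> \<delta> = v + j \<bullet> \<delta>"
      using ij uv by (simp add: x)
    moreover have "j \<bullet> \<delta> = (j - i) \<bullet> \<delta> + i \<bullet> \<delta>"
      using ij(1) nsc_add[of "j - i" i \<delta>] by simp
    ultimately have "u - v = (j - i) \<bullet> \<delta>"
      by (simp add: algebra_simps)
    then show ?thesis
      using V0_divide[OF uv] ij(1) by (intro exI[of _ "j - i"] exI[of _ "Polynomial.coeff \<chi> i / Polynomial.coeff \<chi> j"]) simp
  qed
  show thesis
  proof (cases "0 \<le> \<gamma>")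
    case True
    then show ?thesis
      using nonneg[OF assms] that by blast
  next
    case False
    obtain q where q: "W q = Fin (- \<gamma>)"
      using inverse_mod_f[OF assms] by blast
    obtain N a where Na: "0 < N" "V0 a = Fin (N \<bullet> (- \<gamma>))"
      using nonneg[OF q] False by (metis linorder_le_cases neg_0_le_iff_le)
    have "V0 (1 / a) = Fin (N \<bullet> \<gamma>)"
      using V0_divide[OF _ Na(2), of 1 0] by (simp add: zero_extended_def nsc_minus)
    then show ?thesis
      using that Na(1) by blast
  qed
qed

text \<open>Some constant a has the value of p^N. The integral equation of p^N / a, multiplied by
  a^D, becomes a monic equation for p^N in which no term has smaller value than the top one.\<close>

lemma monic_relation:
  assumes "W p = Fin \<gamma>"
  obtains N D r where "0 < N" "0 < D" "r D = 1" "\<And>i. i \<le> D \<Longrightarrow> ((D - i) * N) \<bullet> Fin \<gamma> \<le> V0 (r i)"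
    "f dvd (\<Sum>i\<le>D. Polynomial.smult (r i) (p ^ (N * i)))"
proof -
  obtain N a where Na: "0 < N" "V0 a = Fin (N \<bullet> \<gamma>)"
    using nsc_value_in_V0[OF assms] by blast
  have "a \<noteq> 0"
    using Na(2) by auto
  define x where "x = Polynomial.smult (1 / a) (p ^ N)"
  have "V0 (1 / a) = Fin (- (N \<bullet> \<gamma>))"
    using V0_divide[OF _ Na(2), of 1 0] by (simp add: zero_extended_def)
  then have "W x = 0"
    by (simp add: x_def W_smult power assms nsc_Fin zero_extended_def)
  then obtain \<chi> where \<chi>: "Polynomial.lead_coeff \<chi> = 1" "0 < degree \<chi>"
      "\<And>i. 0 \<le> V0 (Polynomial.coeff \<chi> i)" "f dvd pcompose \<chi> x"
    using integral[of x] by auto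
  define D where "D = degree \<chi>"
  define r where "r i = Polynomial.coeff \<chi> i * a ^ (D - i)" for i
  have "Polynomial.smult (a ^ D) (pcompose \<chi> x) = (\<Sum>i\<le>D. Polynomial.smult (r i) (p ^ (N * i)))"
    unfolding pcompose_eq_sum D_def[symmetric] smult_sum_right
  proof (rule sum.cong)
    fix i assume "i \<in> {..D}"
    then have "a ^ D = a ^ (D - i) * a ^ i"
      by (simp add: power_add[symmetric])
    then show "Polynomial.smult (a ^ D) (Polynomial.smult (Polynomial.coeff \<chi> i) (x ^ i)) = Polynomial.smult (r i) (p ^ (N * i))"
      using \<open>a \<noteq> 0\<close> by (simp add: x_def r_def smult_power power_mult[symmetric] field_simps)
  qed simp
  then have "f dvd (\<Sum>i\<le>D. Polynomial.smult (r i) (p ^ (N * i)))"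
    using \<chi>(4) by (metis dvd_smult)
  moreover have "((D - i) * N) \<bullet> Fin \<gamma> \<le> V0 (r i)" for i
  proof -
    have "0 + ((D - i) * N) \<bullet> Fin \<gamma> \<le> V0 (Polynomial.coeff \<chi> i) + ((D - i) * N) \<bullet> Fin \<gamma>"
      using \<chi>(3) by (intro add_mono order_refl)
    also have "((D - i) * N) \<bullet> Fin \<gamma> = V0 (a ^ (D - i))"
      by (simp add: V0.power Na(2) nsc_mult nsc_Fin)
    finally show ?thesis
      by (simp add: r_def V0.mult V0.power Na(2) nsc_mult nsc_Fin)
  qed
  ultimately show thesis
    using that[of N D r] Na(1) \<chi>(1,2) by (simp add: D_def r_def)
qed

text \<open>The multiple Y of f is a polynomial in \<phi> whose top term has least value, so its
  \<open>leads\<close> exponent times deg \<phi> reaches deg Y. Both the exponents and the degrees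
  add up over Y = f q, and for each factor the exponent times deg \<phi> is at most the degree; so
  equality holds for each factor.\<close>

lemma degree_key_dvd_degree_f:
  assumes "key \<phi>" "W \<phi> \<noteq> \<infinity>"
  obtains e where "degree f = e * degree \<phi>" "leads \<phi> f e"
proof -
  note pos = degree_keyD[OF assms(1)] key_nonzero[OF assms(1)]
  obtain \<mu> where \<mu>: "W \<phi> = Fin \<mu>"
    using assms(2) not_Minf[of \<phi>] by (cases "W \<phi>") auto
  obtain N D r where r: "0 < N" "0 < D" "r D = 1" "\<And>i. i \<le> D \<Longrightarrow> ((D - i) * N) \<bullet> Fin \<mu> \<le> V0 (r i)"
      "f dvd (\<Sum>i\<le>D. Polynomial.smult (r i) (\<phi> ^ (N * i)))"
    using monic_relation[OF \<mu>] by blast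
  define x where "x i = Polynomial.smult (r i) (\<phi> ^ (N * i))" for i
  define Y where "Y = (\<Sum>i\<le>D. x i)"
  have x_val: "(D * N) \<bullet> W \<phi> \<le> W (x i)" if "i \<le> D" for i
  proof -
    have "D * N = (D - i) * N + N * i"
      using that by (metis add_mult_distrib le_add_diff_inverse2 mult.commute)
    then have "(D * N) \<bullet> W \<phi> = ((D - i) * N) \<bullet> Fin \<mu> + (N * i) \<bullet> W \<phi>"
      by (metis \<mu> nsc_add)
    also have "\<dots> \<le> W (x i)"
      unfolding x_def W_smult power by (intro add_mono r that order_refl)
    finally show ?thesis .
  qed
  \<comment> \<open>The coefficients are constants and deg \<phi> is positive, so Y is already
    written as a \<phi>-adic expansion.\<close>
  have adic_x: "adic_term \<phi> (x i) s = (if s = N * i then x i else 0)" for i s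
  proof -
    have "x i = [:r i:] * \<phi> ^ (N * i)"
      by (simp add: x_def)
    then show ?thesis
      using adic_coeff_mult_power[OF pos(2), of "[:r i:]" "N * i" s]
        adic_coeff_small[of "[:r i:]" \<phi> "s - N * i"] pos(1)
      by (auto simp: adic_term_def)
  qed
  have term_Y: "adic_term \<phi> Y s = (\<Sum>i\<le>D. if s = N * i then x i else 0)" for s
    by (simp add: Y_def adic_term_sum adic_x)
  have ge: "(D * N) \<bullet> W \<phi> \<le> W (adic_term \<phi> Y s)" for s
    unfolding term_Y using x_val by (intro sum_geI) auto
  have "adic_term \<phi> Y (D * N) = (\<Sum>i\<le>D. if i = D then x i else 0)"
    unfolding term_Y using r(1) by (intro sum.cong) auto
  then have "adic_term \<phi> Y (D * N) = \<phi> ^ (N * D)"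
    by (simp add: x_def r(3))
  then have top: "W (adic_term \<phi> Y (D * N)) = (D * N) \<bullet> W \<phi>"
    by (simp add: power mult.commute)
  have fin: "(D * N) \<bullet> W \<phi> \<noteq> \<infinity>"
    by (simp add: \<mu> nsc_Fin)
  have "adic_term \<phi> Y t = 0" if "D * N < t" for t
    unfolding term_Y using that by (intro sum.neutral) (auto simp: mult.commute[of N])
  then have lead_Y: "leads \<phi> Y (D * N)"
    using ge top fin U_ge_iff[OF pos(1), of "(D * N) \<bullet> W \<phi>" Y] U_le_term[OF pos(1), of Y "D * N"]
    by (auto simp: leads_def less_inf_iff intro: antisym)
  have "Y \<noteq> 0"
    using top fin by auto
  obtain q where q: "Y = f * q"
    using r(5) by (auto simp: Y_def x_def)
  then have nz: "f \<noteq> 0" "q \<noteq> 0"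
    using \<open>Y \<noteq> 0\<close> by auto
  obtain s t where st: "leads \<phi> f s" "leads \<phi> q t"
    using leads_exists[OF assms] nz by metis
  have "s + t = D * N"
    using leads_mult(2)[OF assms nz st] lead_Y leads_unique q by metis
  moreover have "degree Y \<le> (D * N) * degree \<phi>"
    unfolding Y_def
  proof (rule degree_sum_le)
    fix i assume "i \<in> {..D}"
    then show "degree (x i) \<le> D * N * degree \<phi>"
      unfolding x_def by (intro order_trans[OF degree_smult_le] order_trans[OF degree_power_le]) (auto simp: ac_simps)
  qed simp
  ultimately have "degree f + degree q \<le> s * degree \<phi> + t * degree \<phi>"
    using nz by (simp add: q Polynomial.degree_mult_eq flip: distrib_right)
  moreover have "s * degree \<phi> \<le> degree f" "t * degree \<phi> \<le> degree q"
    using leads_le_degree[OF assms] nz st by auto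
  ultimately have "degree f = s * degree \<phi>"
    by linarith
  then show thesis
    using that st(1) by blast
qed

end

section \<open>Ramification and approximate roots\<close>

lemma degree_lead_coeff_power_monic:
  fixes p :: "'a::idom poly"
  assumes "Polynomial.lead_coeff p = 1"
  shows "Polynomial.lead_coeff (p ^ n) = 1" "degree (p ^ n) = n * degree p"
proof -
  show "Polynomial.lead_coeff (p ^ n) = 1"
    using assms by (simp only: lead_coeff_power power_one)
  have "p \<noteq> 0"
    using assms by auto
  then show "degree (p ^ n) = n * degree p"
    by (rule degree_power_eq)
qed

lemma monic_add_lower:
  fixes p q :: "'a::comm_ring_1 poly"
  assumes "Polynomial.lead_coeff p = 1" "degree q < degree p"
  shows "Polynomial.lead_coeff (p + q) = 1" "degree (p + q) = degree p"
    "Polynomial.lead_coeff (p - q) = 1" "degree (p - q) = degree p"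
  using assms degree_add_eq_left[of q p] degree_add_eq_left[of "- q" p] lead_coeff_add_le[of q p]
    lead_coeff_add_le[of "- q" p] by (simp_all add: coeff_eq_0)

context unique_extension_poly
begin

text \<open>If m is the degree of a key polynomial, this is a group. For the degree of a member of a
  chain it turns out to be the value group of the stage before that member.\<close>

definition Gam :: "nat \<Rightarrow> 'g set" where
  "Gam m = {\<gamma>. \<exists>p. degree p < m \<and> W p = Fin \<gamma>}"

lemma Gam_V0: "0 < m \<Longrightarrow> V0 a = Fin \<gamma> \<Longrightarrow> \<gamma> \<in> Gam m"
  unfolding Gam_def by (auto intro: exI[of _ "[:a:]"])

lemma Gam_1: "\<gamma> \<in> Gam 1 \<longleftrightarrow> (\<exists>a. V0 a = Fin \<gamma>)"
  using Gam_V0[of 1] by (auto simp: Gam_def elim!: degree_eq_zeroE)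

lemma Gam_0: "0 < m \<Longrightarrow> 0 \<in> Gam m"
  by (rule Gam_V0[of m 1]) (simp_all add: zero_extended_def)

context
  fixes \<phi>
  assumes key: "key \<phi>"
begin

lemma Gam_add: "\<gamma> \<in> Gam (degree \<phi>) \<Longrightarrow> \<delta> \<in> Gam (degree \<phi>) \<Longrightarrow> \<gamma> + \<delta> \<in> Gam (degree \<phi>)"
proof -
  assume "\<gamma> \<in> Gam (degree \<phi>)" "\<delta> \<in> Gam (degree \<phi>)"
  then obtain p q where pq: "degree p < degree \<phi>" "degree q < degree \<phi>"
      "W p = Fin \<gamma>" "W q = Fin \<delta>"
    by (auto simp: Gam_def)
  moreover from this have "p \<noteq> 0" "q \<noteq> 0"
    by auto
  ultimately have val: "W ((p * q) mod \<phi>) = Fin (\<gamma> + \<delta>)"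
    using key_mod(1)[OF key] by simp
  then have "(p * q) mod \<phi> \<noteq> 0"
    by auto
  then have "degree ((p * q) mod \<phi>) < degree \<phi>"
    using degree_mod_less[of \<phi> "p * q"] key_nonzero[OF key] by auto
  then show ?thesis
    using val by (auto simp: Gam_def)
qed

lemma Gam_nsc: "\<gamma> \<in> Gam (degree \<phi>) \<Longrightarrow> i \<bullet> \<gamma> \<in> Gam (degree \<phi>)"
  by (induction i) (simp_all add: nsc_Suc Gam_add Gam_0 degree_keyD[OF key])

text \<open>A positive multiple N \<gamma> is the value of a constant, which can be inverted; then
  -\<gamma> = (N - 1) \<gamma> - N \<gamma>.\<close>

lemma Gam_uminus: "\<gamma> \<in> Gam (degree \<phi>) \<Longrightarrow> - \<gamma> \<in> Gam (degree \<phi>)"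
proof -
  assume \<gamma>: "\<gamma> \<in> Gam (degree \<phi>)"
  then obtain p where "W p = Fin \<gamma>"
    by (auto simp: Gam_def)
  then obtain N a where N: "0 < N" "V0 a = Fin (N \<bullet> \<gamma>)"
    using nsc_value_in_V0 by blast
  have "V0 (1 / a) = Fin (- (N \<bullet> \<gamma>))"
    using V0_divide[OF _ N(2), of 1 0] by (simp add: zero_extended_def)
  then have "- (N \<bullet> \<gamma>) \<in> Gam (degree \<phi>)"
    by (rule Gam_V0[OF degree_keyD[OF key]])
  moreover have "- \<gamma> = (N - 1) \<bullet> \<gamma> + - (N \<bullet> \<gamma>)"
    using N(1) nsc_Suc[of "N - 1" \<gamma>] by simp
  ultimately show ?thesis
    using Gam_add Gam_nsc[OF \<gamma>] by metis
qed

lemma Gam_diff: "\<gamma> \<in> Gam (degree \<phi>) \<Longrightarrow> \<delta> \<in> Gam (degree \<phi>) \<Longrightarrow> \<gamma> - \<delta> \<in> Gam (degree \<phi>)"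
  using Gam_add[of \<gamma> "- \<delta>"] Gam_uminus[of \<delta>] by simp

end

definition ord :: "'a poly \<Rightarrow> nat" where
  "ord \<phi> = (LEAST n. 0 < n \<and> (\<exists>\<gamma>\<in>Gam (degree \<phi>). n \<bullet> W \<phi> = Fin \<gamma>))"

context
  fixes \<phi> \<mu>
  assumes key: "key \<phi>" and \<mu>: "W \<phi> = Fin \<mu>"
begin

lemma ord_exists: "\<exists>n. 0 < n \<and> (\<exists>\<gamma>\<in>Gam (degree \<phi>). n \<bullet> W \<phi> = Fin \<gamma>)"
  using nsc_value_in_V0[OF \<mu>] Gam_V0[OF degree_keyD[OF key]] \<mu> by (metis nsc_Fin)

lemma ord_pos: "0 < ord \<phi>"
  and ord_in_Gam: "ord \<phi> \<bullet> \<mu> \<in> Gam (degree \<phi>)"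
  using LeastI_ex[OF ord_exists] by (auto simp: ord_def \<mu> nsc_Fin)

lemma ord_least: "0 < n \<Longrightarrow> n \<bullet> \<mu> \<in> Gam (degree \<phi>) \<Longrightarrow> ord \<phi> \<le> n"
  unfolding ord_def by (rule Least_le) (simp add: \<mu> nsc_Fin)

lemma distinct_residues_Gam:
  assumes "\<alpha> \<in> Gam (degree \<phi>)" "\<beta> \<in> Gam (degree \<phi>)" "i < ord \<phi>" "j < ord \<phi>"
    and eq: "\<alpha> + i \<bullet> \<mu> = \<beta> + j \<bullet> \<mu>"
  shows "i = j"
proof -
  have False if "\<alpha> \<in> Gam (degree \<phi>)" "\<beta> \<in> Gam (degree \<phi>)" "i < j" "j < ord \<phi>" "\<alpha> + i \<bullet> \<mu> = \<beta> + j \<bullet> \<mu>"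
    for \<alpha> \<beta> i j
  proof -
    have "j \<bullet> \<mu> = (j - i) \<bullet> \<mu> + i \<bullet> \<mu>"
      using that(3) nsc_add[of "j - i" i \<mu>] by simp
    then have "(j - i) \<bullet> \<mu> = \<alpha> - \<beta>"
      using that(5) by (simp add: algebra_simps)
    then have "ord \<phi> \<le> j - i"
      using ord_least[of "j - i"] Gam_diff[OF key that(1,2)] that(3) by simp
    then show False
      using that(4) by simp
  qed
  from this[of \<alpha> \<beta> i j] this[of \<beta> \<alpha> j i] show ?thesis
    using assms by (metis linorder_neqE_nat)
qed

lemma adic_term_value:
  assumes "W (adic_term \<phi> p i) \<noteq> \<infinity>"
  obtains \<alpha> where "\<alpha> \<in> Gam (degree \<phi>)" "W (adic_term \<phi> p i) = Fin (\<alpha> + i \<bullet> \<mu>)"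
proof -
  obtain \<alpha> where \<alpha>: "W (adic_coeff \<phi> p i) = Fin \<alpha>"
    using assms not_Minf[of "adic_coeff \<phi> p i"]
    by (cases "W (adic_coeff \<phi> p i)") (auto simp: adic_term_def mult)
  then have "\<alpha> \<in> Gam (degree \<phi>)"
    using degree_adic_coeff[OF degree_keyD[OF key], of p i] by (auto simp: Gam_def)
  then show thesis
    using that \<alpha> by (simp add: adic_term_def mult power \<mu> nsc_Fin)
qed

text \<open>Exponents below \<open>ord\<close> put the values of the terms into different cosets of
  \<open>Gam (degree \<phi>)\<close>, so nothing cancels. Thus a polynomial on which W exceeds the
  augmentation has at least the degree of the next key polynomial.\<close>

lemma U_eq_W:
  assumes "degree p < ord \<phi> * degree \<phi>"
  shows "U \<phi> p = W p"
proof (rule antisym)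
  note pos = degree_keyD[OF key]
  show "U \<phi> p \<le> W p"
    by (rule U_le_W[OF pos])
  let ?N = "degree p div degree \<phi>"
  have N: "?N < ord \<phi>"
    using assms pos by (simp add: div_less_iff_less_mult)
  have "W p \<le> W (adic_term \<phi> p i)" for i
  proof (cases "i \<le> ?N")
    case True
    have "W (\<Sum>i\<le>?N. adic_term \<phi> p i) \<le> W (adic_term \<phi> p i)"
    proof (rule sum_ge_distinct)
      fix i j assume ij: "i \<in> {..?N}" "j \<in> {..?N}" "i \<noteq> j" "W (adic_term \<phi> p i) \<noteq> \<infinity>"
      show "W (adic_term \<phi> p i) \<noteq> W (adic_term \<phi> p j)"
      proof
        assume eq: "W (adic_term \<phi> p i) = W (adic_term \<phi> p j)"
        obtain \<alpha> \<beta> where "\<alpha> \<in> Gam (degree \<phi>)" "\<beta> \<in> Gam (degree \<phi>)" "\<alpha> + i \<bullet> \<mu> = \<beta> + j \<bullet> \<mu>"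
          using adic_term_value[of p i] adic_term_value[of p j] ij(4) eq by (metis extended.inject)
        then show False
          using distinct_residues_Gam[of \<alpha> \<beta> i j] ij N by auto
      qed
    qed (use True in auto)
    then show ?thesis
      using adic_expansion[OF pos, of p] by (simp add: adic_term_def)
  next
    case False
    then show ?thesis
      using adic_term_beyond[OF pos, of p i] by simp
  qed
  then show "W p \<le> U \<phi> p"
    by (simp add: U_ge_iff[OF pos])
qed

text \<open>W is infinite at f while the augmentation is finite there, which \<open>U_eq_W\<close>
  excludes in small degree.\<close>

lemma ord_degree_le: "ord \<phi> * degree \<phi> \<le> degree f"
proof (rule ccontr)
  assume "\<not> ?thesis"
  then have "U \<phi> f = W f"
    by (intro U_eq_W) simp
  also have "W f = \<infinity>"
    by (simp add: W_inf_iff)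
  finally show False
    using U_finite[OF key, of f] \<mu> degree_f_pos by (cases "f = 0") auto
qed

context
  fixes b
  assumes b: "degree b < degree \<phi>" "ord \<phi> \<bullet> W \<phi> < W (\<phi> ^ ord \<phi> - b)"
begin

lemma next_key_degree:
  "Polynomial.lead_coeff (\<phi> ^ ord \<phi> - b) = 1"
  "degree (\<phi> ^ ord \<phi> - b) = ord \<phi> * degree \<phi>"
proof -
  note m = degree_lead_coeff_power_monic[OF lead_coeff_keyD[OF key], of "ord \<phi>"]
  have "degree b < degree (\<phi> ^ ord \<phi>)"
    using b(1) ord_pos m(2) by (metis less_le_trans mult_le_mono1 nat_mult_1 One_nat_def Suc_leI)
  from monic_add_lower[OF m(1) this] m(2)
  show "Polynomial.lead_coeff (\<phi> ^ ord \<phi> - b) = 1"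
    "degree (\<phi> ^ ord \<phi> - b) = ord \<phi> * degree \<phi>"
    by auto
qed

lemma U_next_key: "U \<phi> (\<phi> ^ ord \<phi> - b) < W (\<phi> ^ ord \<phi> - b)"
proof -
  note pos = degree_keyD[OF key] key_nonzero[OF key]
  have "adic_coeff \<phi> (\<phi> ^ ord \<phi>) (ord \<phi>) = 1"
    using adic_coeff_mult_power[OF pos(2), of 1 "ord \<phi>" "ord \<phi>"] adic_coeff_small[of 1 \<phi> 0] pos by simp
  moreover have "adic_coeff \<phi> (- b) (ord \<phi>) = 0"
    using adic_coeff_small[of "- b" \<phi> "ord \<phi>"] b(1) ord_pos by simp
  ultimately have "adic_term \<phi> (\<phi> ^ ord \<phi> + - b) (ord \<phi>) = \<phi> ^ ord \<phi>"
    by (simp only: adic_term_def adic_coeff_add) simp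
  then have "U \<phi> (\<phi> ^ ord \<phi> - b) \<le> ord \<phi> \<bullet> W \<phi>"
    using U_le_term[OF pos(1), of "\<phi> ^ ord \<phi> + - b" "ord \<phi>"] by (simp add: power)
  then show ?thesis
    using b(2) by (rule order_le_less_trans)
qed

text \<open>Below the degree of the new polynomial the augmentation agrees with W by
  \<open>U_eq_W\<close>, and at the polynomial itself the value grows; so the criterion for a pair
  of valuations applies.\<close>

lemma next_key: "key (\<phi> ^ ord \<phi> - b)"
  and next_key_polynomial: "key_polynomial (U \<phi>) \<phi> (\<phi> ^ ord \<phi> - b) (W (\<phi> ^ ord \<phi> - b))"
proof -
  let ?h = "\<phi> ^ ord \<phi> - b"
  have val: "valuation_on (ring_of_type_algebra :: 'a poly ring) (U \<phi>)"
    using key \<mu> by (intro valuation_U) auto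
  have le: "U \<phi> p \<le> W p" for p
    by (rule U_le_W[OF degree_keyD[OF key]])
  have eq: "U \<phi> p = W p" if "degree p < degree ?h" for p
    using that U_eq_W by (simp add: next_key_degree)
  have pos: "0 < degree ?h" "degree \<phi> \<le> degree ?h"
    using ord_pos degree_keyD[OF key] by (simp_all add: next_key_degree)
  show "key ?h"
    by (rule key_of_less(1)[where V = "U \<phi>"])
      (use val le eq pos U_next_key next_key_degree in auto)
  show "key_polynomial (U \<phi>) \<phi> ?h (W ?h)"
    by (rule key_polynomial_of_less)
      (use val le eq pos U_next_key next_key_degree U_key[OF key] key_nonzero[OF key] in auto)
qed

end

text \<open>The quotient of \<phi>^n by an element b of the same value has value 0, hence the
  residue of a constant, by which b is scaled. Its coefficients are in K, not necessarily in
  \<open>A\<close>: this key polynomial is only a means to bound the degrees and the values of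
  approximate roots.\<close>

lemma next_key_exists:
  obtains b where "degree b < degree \<phi>" "W b = ord \<phi> \<bullet> W \<phi>" "ord \<phi> \<bullet> W \<phi> < W (\<phi> ^ ord \<phi> - b)"
proof -
  let ?\<gamma> = "ord \<phi> \<bullet> \<mu>"
  obtain b where b: "degree b < degree \<phi>" "W b = Fin ?\<gamma>"
    using ord_in_Gam by (auto simp: Gam_def)
  obtain q where q: "W (b * q - 1) = \<infinity>" "W q = Fin (- ?\<gamma>)"
    using inverse_mod_f[OF b(2)] by blast
  have val: "W (\<phi> ^ ord \<phi>) = Fin ?\<gamma>"
    by (simp add: power \<mu> nsc_Fin)
  then have "W (\<phi> ^ ord \<phi> * q) = 0"
    using q(2) by (simp add: mult zero_extended_def)
  then obtain a where a: "a \<noteq> 0" "V0 a = 0" "0 < W (\<phi> ^ ord \<phi> * q - [:a:])"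
    using residue by blast
  have "W b < W b + W (\<phi> ^ ord \<phi> * q - [:a:])"
    using a(3) extended_add_cancel(6)[of "W b" 0] b(2) by simp
  then have "W b < W (b * (\<phi> ^ ord \<phi> * q - [:a:]))"
    by (simp add: mult)
  moreover have "W b < W (\<phi> ^ ord \<phi> * (b * q - 1))"
    using q(1) b(2) by (simp add: mult)
  ultimately have "W b < W (b * (\<phi> ^ ord \<phi> * q - [:a:]) - \<phi> ^ ord \<phi> * (b * q - 1))"
    by (rule diff_gtI)
  also have "b * (\<phi> ^ ord \<phi> * q - [:a:]) - \<phi> ^ ord \<phi> * (b * q - 1) = \<phi> ^ ord \<phi> - Polynomial.smult a b"
    by (simp add: algebra_simps)
  finally show thesis
    using that[of "Polynomial.smult a b"] b a \<mu> by (simp add: W_smult nsc_Fin)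
qed

text \<open>This is the degree of a next key polynomial over K. If that has finite value, its degree
  divides deg f; otherwise it is a multiple of f, and \<open>ord_degree_le\<close> gives equality of
  the degrees.\<close>

lemma ord_degree_dvd: "ord \<phi> * degree \<phi> dvd degree f"
proof -
  obtain b where b: "degree b < degree \<phi>" "ord \<phi> \<bullet> W \<phi> < W (\<phi> ^ ord \<phi> - b)"
    using next_key_exists by blast
  let ?h = "\<phi> ^ ord \<phi> - b"
  show ?thesis
  proof (cases "W ?h = \<infinity>")
    case True
    then have "f dvd ?h"
      by (simp add: W_inf_iff)
    moreover have "?h \<noteq> 0"
      using next_key_degree(1)[OF b] by auto
    ultimately have "degree f \<le> ord \<phi> * degree \<phi>"
      using dvd_imp_degree_le[of f ?h] next_key_degree(2)[OF b] by simp
    then show ?thesis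
      using ord_degree_le by simp
  next
    case False
    then show ?thesis
      using degree_key_dvd_degree_f[OF next_key[OF b] False] next_key_degree(2)[OF b] by (metis dvd_triv_right)
  qed
qed

end

end

section \<open>Approximate roots\<close>

lemma binomial_second_order:
  fixes g x :: "'a::idom poly"
  assumes "degree x \<le> degree g"
  obtains k where "(g + x) ^ Suc e = g ^ Suc e + of_nat (Suc e) * g ^ e * x + x * x * k"
    "degree k \<le> (e - 1) * degree g" "e = 0 \<Longrightarrow> k = 0"
proof -
  \<comment> \<open>For e = 0 the truncated e - 1 is 0, and the degree bound would still allow a
    nonzero constant; hence the separate clause.\<close>
  have "\<exists>k. (g + x) ^ Suc e = g ^ Suc e + of_nat (Suc e) * g ^ e * x + x * x * k \<and>
    degree k \<le> (e - 1) * degree g \<and> (e = 0 \<longrightarrow> k = 0)"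
  proof (induction e)
    case (Suc e)
    then obtain k where k: "(g + x) ^ Suc e = g ^ Suc e + of_nat (Suc e) * g ^ e * x + x * x * k"
      "degree k \<le> (e - 1) * degree g" "e = 0 \<longrightarrow> k = 0"
      by blast
    let ?k = "of_nat (Suc e) * g ^ e + (g + x) * k"
    have "(g + x) ^ Suc (Suc e) = g ^ Suc (Suc e) + of_nat (Suc (Suc e)) * g ^ Suc e * x + x * x * ?k"
      by (subst power_Suc, subst k(1)) (simp add: algebra_simps)
    moreover have "degree ((g + x) * k) \<le> e * degree g"
    proof (cases "e = 0")
      case False
      have "degree ((g + x) * k) \<le> degree (g + x) + degree k"
        by (rule degree_mult_le)
      also have "\<dots> \<le> degree g + (e - 1) * degree g"
        using assms k(2) by (intro add_mono degree_add_le) auto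
      finally show ?thesis
        using False by (cases e) auto
    qed (use k in simp)
    moreover have "degree (of_nat (Suc e) * g ^ e) \<le> e * degree g"
      using degree_mult_le[of "of_nat (Suc e)" "g ^ e"] degree_power_le[of g e]
      by (simp only: degree_of_nat) (simp add: mult.commute)
    ultimately show ?case
      by (intro exI[of _ ?k]) (auto intro: degree_add_le)
  qed simp
  then show thesis
    using that by blast
qed

text \<open>
  The degree of \<open>F - g ^ e\<close> is lowered by dividing it by \<open>\<phi> ^ (e - 1)\<close> and adding the quotient,
  divided by \<open>e\<close>, to \<open>g\<close>.  The filtration \<open>T\<close> records what is preserved on the way.
\<close>

lemma approximate_root_exists:
  fixes F \<phi> :: "'a::field poly" and T :: "nat \<Rightarrow> 'a poly set"
  assumes \<phi>: "Polynomial.lead_coeff \<phi> = 1" "0 < degree \<phi>" "\<phi> \<in> T 1"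
    and F: "Polynomial.lead_coeff F = 1" "degree F = e * degree \<phi>" "F \<in> T e"
    and e: "0 < e" "(of_nat e :: 'a) \<noteq> 0"
    and T_one: "1 \<in> T 0"
    and T_add: "\<And>x y l. x \<in> T l \<Longrightarrow> y \<in> T l \<Longrightarrow> x + y \<in> T l"
    and T_diff: "\<And>x y l. x \<in> T l \<Longrightarrow> y \<in> T l \<Longrightarrow> x - y \<in> T l"
    and T_mult: "\<And>x y k l. x \<in> T k \<Longrightarrow> y \<in> T l \<Longrightarrow> x * y \<in> T (k + l)"
    and T_smult: "\<And>x l. x \<in> T l \<Longrightarrow> Polynomial.smult (1 / of_nat e) x \<in> T l"
    and T_div: "\<And>x. x \<in> T e \<Longrightarrow> x div \<phi> ^ (e - 1) \<in> T 1"
  shows "\<exists>g. g \<in> T 1 \<and> Polynomial.lead_coeff g = 1 \<and> degree g = degree \<phi> \<and>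
    (F = g ^ e \<or> degree (F - g ^ e) < (e - 1) * degree \<phi>)"
proof (rule ccontr)
  assume contr: "\<not> ?thesis"
  define m where "m = degree \<phi>"
  define S where "S = {g. g \<in> T 1 \<and> Polynomial.lead_coeff g = 1 \<and> degree g = m}"
  obtain e' where e': "e = Suc e'"
    using e(1) by (cases e) auto
  have "\<phi> \<in> S"
    using \<phi> by (simp add: S_def m_def)
  \<comment> \<open>A candidate with F - g^e of least degree; below it is improved.\<close>
  then obtain g where g: "g \<in> S" "\<And>h. h \<in> S \<Longrightarrow> degree (F - g ^ e) \<le> degree (F - h ^ e)"
    using ex_has_least_nat[of "\<lambda>g. g \<in> S" \<phi> "\<lambda>g. degree (F - g ^ e)"] by blast
  then have gS: "g \<in> T 1" "Polynomial.lead_coeff g = 1" "degree g = m"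
    by (auto simp: S_def)
  note gpow = degree_lead_coeff_power_monic[OF gS(2)]
  define R where "R = F - g ^ e"
  have "g ^ l \<in> T l" for l
    using T_one T_mult[OF gS(1)] by (induction l) auto
  then have RT: "R \<in> T e"
    using F(3) T_diff by (simp add: R_def)
  have not_root: "\<not> (F = h ^ e \<or> degree (F - h ^ e) < (e - 1) * m)" if "h \<in> S" for h
    using contr that unfolding S_def m_def by blast
  then have R: "R \<noteq> 0" "e' * m \<le> degree R"
    using not_root[OF g(1)] by (auto simp: R_def e')
  have "degree (F - g ^ e) < degree F"
    using F gpow \<phi>(2) e(1) gS(3) by (intro degree_diff_less_of_lead_coeff_eq) (simp_all add: m_def)
  then have Rless: "degree R < e * m"
    using F(2) by (simp add: R_def m_def)
  define Q where "Q = R div \<phi> ^ e'"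
  have \<phi>_nz: "\<phi> \<noteq> 0"
    using \<phi>(1) by auto
  note ppow = degree_lead_coeff_power_monic[OF \<phi>(1), of e']
  have Rmod: "R = Q * \<phi> ^ e' + R mod \<phi> ^ e'"
    unfolding Q_def by (rule div_mult_mod_eq[symmetric])
  have QT: "Q \<in> T 1"
    using T_div[OF RT] by (simp add: Q_def e')
  have "Q \<noteq> 0"
  proof
    assume "Q = 0"
    then have "R = R mod \<phi> ^ e'"
      using Rmod by simp
    then have "degree R < degree (\<phi> ^ e')"
      using degree_mod_less'[of "\<phi> ^ e'" R] \<phi>_nz R(1) by simp
    then show False
      using R(2) ppow(2) by (simp add: m_def)
  qed
  have deg_mod: "R mod \<phi> ^ e' = 0 \<or> degree (R mod \<phi> ^ e') < degree (Q * \<phi> ^ e')"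
    using degree_mod_less[of "\<phi> ^ e'" R] \<phi>_nz degree_adic_term[OF \<open>Q \<noteq> 0\<close> \<phi>_nz, of e'] ppow(2)
    by auto
  then have Qdeg: "degree R = degree Q + e' * m" "Polynomial.lead_coeff R = Polynomial.lead_coeff Q"
  proof -
    have "degree R = degree (Q * \<phi> ^ e')"
      "Polynomial.lead_coeff R = Polynomial.lead_coeff (Q * \<phi> ^ e')"
      using deg_mod Rmod degree_add_eq_left[of "R mod \<phi> ^ e'" "Q * \<phi> ^ e'"]
        lead_coeff_add_le[of "R mod \<phi> ^ e'" "Q * \<phi> ^ e'"] by (metis add.commute add_0_right)+
    then show "degree R = degree Q + e' * m"
      using degree_adic_term[OF \<open>Q \<noteq> 0\<close> \<phi>_nz, of e'] by (simp add: m_def)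
    have "Polynomial.lead_coeff (Q * \<phi> ^ e') = Polynomial.lead_coeff Q"
      by (simp only: lead_coeff_mult ppow(1) mult_1_right)
    with \<open>Polynomial.lead_coeff R = _\<close> show "Polynomial.lead_coeff R = Polynomial.lead_coeff Q"
      by (rule trans)
  qed
  have Qless: "degree Q < m"
    using Rless Qdeg(1) by (simp add: e')
  \<comment> \<open>The factor 1/e turns the linear term e g^(e-1) x of the expansion into g^(e-1)
    Q, which has the leading term of R.\<close>
  define x where "x = Polynomial.smult (1 / of_nat e) Q"
  have x: "degree x = degree Q"
    using e by (simp add: x_def)
  define h where "h = g + x"
  have hS: "h \<in> S"
    using monic_add_lower[OF gS(2), of x] gS T_add[OF gS(1) T_smult[OF QT]] x Qless
    by (simp add: S_def h_def x_def)
  obtain k where k: "(g + x) ^ Suc e' = g ^ Suc e' + of_nat (Suc e') * g ^ e' * x + x * x * k"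
    "degree k \<le> (e' - 1) * degree g" "e' = 0 \<Longrightarrow> k = 0"
    using binomial_second_order[of x g e'] x Qless gS(3) by (metis less_imp_le)
  have "of_nat (Suc e') * g ^ e' * x = g ^ e' * Q"
    using e(2) by (simp add: x_def e' of_nat_poly field_simps)
  then have F_h: "F - h ^ e = (R - g ^ e' * Q) - x * x * k"
    using k(1) by (simp add: h_def R_def e' algebra_simps)
  \<comment> \<open>For e' > 0 the degree is at most 2 deg Q + (e' - 1) m, which is below deg Q + e'
    m = deg R because deg Q < m.\<close>
  have deg_xxk: "x * x * k = 0 \<or> degree (x * x * k) < degree R"
  proof (cases "e' = 0")
    case False
    have "degree (x * x * k) \<le> degree x + degree x + degree k"
      using degree_mult_le[of "x * x" k] degree_mult_le[of x x] by linarith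
    also have "\<dots> < degree R"
      using k(2) Qdeg(1) Qless False by (cases e') (auto simp: x gS(3))
    finally show ?thesis ..
  qed (use k in auto)
  have "g ^ e' \<noteq> 0"
    using gS(2) by auto
  then have "degree (g ^ e' * Q) = degree R"
    using Qdeg(1) gpow(2)[of e'] gS(3) \<open>Q \<noteq> 0\<close> by (simp add: Polynomial.degree_mult_eq)
  moreover have "Polynomial.lead_coeff (g ^ e' * Q) = Polynomial.lead_coeff R"
    by (simp only: lead_coeff_mult gpow(1) Qdeg(2) mult_1_left)
  ultimately have gQ: "degree R = degree (g ^ e' * Q)" "Polynomial.lead_coeff R = Polynomial.lead_coeff (g ^ e' * Q)"
    by auto
  show False
  \<comment> \<open>A constant R leaves no room for a smaller degree. It forces e = 1, and then the
    improved candidate is an exact root.\<close>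
  proof (cases "degree R = 0")
    case True
    then have "e' = 0"
      using R(2) \<phi>(2) by (simp add: m_def)
    moreover from this have "R = Q"
      by (simp add: Q_def)
    ultimately have "F = h ^ e"
      using F_h k(3) by simp
    then show False
      using not_root[OF hS] by simp
  next
    case False
    have "degree (R - g ^ e' * Q) < degree R"
      using False by (intro degree_diff_less_of_lead_coeff_eq gQ) simp
    then have "degree (F - h ^ e) < degree R"
      unfolding F_h using deg_xxk by (metis degree_diff_less diff_zero)
    then show False
      using g(2)[OF hS] by (simp add: R_def)
  qed
qed

text \<open>The difference h^e - g^e is h - g times a polynomial of degree exactly (e - 1) m, the
  leading coefficient of which is e. So two different roots would differ in their powers by too high
  a degree.\<close>

lemma approximate_root_unique:
  fixes F g h :: "'a::field poly"
  assumes g: "Polynomial.lead_coeff g = 1" "degree g = m"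
      "F = g ^ e \<or> degree (F - g ^ e) < (e - 1) * m"
    and h: "Polynomial.lead_coeff h = 1" "degree h = m"
      "F = h ^ e \<or> degree (F - h ^ e) < (e - 1) * m"
    and e: "0 < e" "(of_nat e :: 'a) \<noteq> 0" and m: "0 < m"
  shows "g = h"
proof (rule ccontr)
  assume "g \<noteq> h"
  obtain e' where e': "e = Suc e'"
    using e(1) by (cases e) auto
  define x where "x = h - g"
  have "x \<noteq> 0"
    using \<open>g \<noteq> h\<close> by (simp add: x_def)
  have xless: "degree x < m"
    using degree_diff_less_of_lead_coeff_eq[of h g] g h m by (simp add: x_def)
  obtain k where k: "(g + x) ^ Suc e' = g ^ Suc e' + of_nat (Suc e') * g ^ e' * x + x * x * k"
    "degree k \<le> (e' - 1) * degree g" "e' = 0 \<Longrightarrow> k = 0"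
    using binomial_second_order[of x g e'] xless g(2) by (metis less_imp_le)
  note gpow = degree_lead_coeff_power_monic[OF g(1), of e']
  define y where "y = of_nat (Suc e') * g ^ e'"
  have y: "degree y = e' * m" "y \<noteq> 0"
    using e(2) gpow g by (auto simp: y_def e' of_nat_poly simp del: of_nat_Suc)
  have "x * k = 0 \<or> degree (x * k) < e' * m"
  proof (cases "e' = 0")
    case False
    then show ?thesis
      using degree_mult_le[of x k] k(2) xless g(2) by (cases e') auto
  qed (use k in auto)
  then have deg: "degree (y + x * k) = e' * m" "y + x * k \<noteq> 0"
    using y degree_add_eq_left[of "x * k" y] by (auto simp: add_eq_0_iff)
  have diff: "(F - g ^ e) - (F - h ^ e) = x * (y + x * k)"
    using k(1) by (simp add: e' x_def y_def algebra_simps)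
  have ge: "e' * m \<le> degree (x * (y + x * k))"
    using deg \<open>x \<noteq> 0\<close> by (simp add: Polynomial.degree_mult_eq)
  have ne: "x * (y + x * k) \<noteq> 0"
    using deg(2) \<open>x \<noteq> 0\<close> by simp
  show False
  proof (cases "F = g ^ e \<and> F = h ^ e")
    case True
    then have "x * (y + x * k) = 0"
      using diff by (metis diff_self)
    then show False
      using ne by contradiction
  next
    case False
    have pos: "0 < e' * m"
      using False g(3) h(3) by (auto simp add: e' simp del: nat_0_less_mult_iff power_Suc)
    then have "degree (F - g ^ e) < e' * m" "degree (F - h ^ e) < e' * m"
      using g(3) h(3) by (auto simp add: e' simp del: nat_0_less_mult_iff power_Suc)
    then have "degree (x * (y + x * k)) < e' * m"
      unfolding diff[symmetric] by (rule degree_diff_less)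
    then show False
      using ge by simp
  qed
qed

section \<open>Expansions in powers of key polynomials\<close>

text \<open>Exponents vanish outside {1..<k}, so that each monomial belongs to exactly one function.
  The polynomials involved are those before the k-th.\<close>

definition expon :: "(nat \<Rightarrow> nat) \<Rightarrow> nat \<Rightarrow> (nat \<Rightarrow> nat) set" where
  "expon n k = {J. (\<forall>l\<in>{1..<k}. J l < n l) \<and> (\<forall>l. l \<notin> {1..<k} \<longrightarrow> J l = 0)}"

definition kmon :: "(nat \<Rightarrow> 'b::comm_monoid_mult) \<Rightarrow> nat \<Rightarrow> (nat \<Rightarrow> nat) \<Rightarrow> 'b" where
  "kmon \<phi> k J = (\<Prod>l\<in>{1..<k}. \<phi> l ^ J l)"

lemma expon_1: "expon n (Suc 0) = {\<lambda>_. 0}"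
  by (auto simp: expon_def)

lemma bij_betw_expon:
  assumes "1 \<le> k"
  shows "bij_betw (\<lambda>(i, J). J(k := i)) ({..<n k} \<times> expon n k) (expon n (Suc k))"
proof (rule bij_betwI[where g = "\<lambda>J. (J k, J(k := 0))"])
  show "(\<lambda>(i, J). J(k := i)) \<in> {..<n k} \<times> expon n k \<rightarrow> expon n (Suc k)"
    using assms by (auto simp: expon_def)
  show "(\<lambda>J. (J k, J(k := 0))) \<in> expon n (Suc k) \<rightarrow> {..<n k} \<times> expon n k"
    using assms by (auto simp: expon_def)
  show "(\<lambda>J. (J k, J(k := 0))) ((\<lambda>(i, J). J(k := i)) x) = x" if "x \<in> {..<n k} \<times> expon n k" for x
    using that by (auto simp: expon_def fun_upd_idem_iff split: prod.splits)
qed auto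

lemma sum_expon:
  assumes "1 \<le> k"
  shows "(\<Sum>J\<in>expon n (Suc k). F J) = (\<Sum>i<n k. \<Sum>J\<in>expon n k. F (J(k := i)))"
  using sum.reindex_bij_betw[OF bij_betw_expon[OF assms, of n], of F]
  by (simp add: sum.cartesian_product case_prod_beta)

lemma finite_expon [simp]: "1 \<le> k \<Longrightarrow> finite (expon n k)"
proof (induction k rule: nat_induct_at_least)
  case (Suc k)
  then show ?case
    using bij_betw_finite[OF bij_betw_expon[of k n]] by simp
qed (simp add: expon_1)

lemma card_expon: "1 \<le> k \<Longrightarrow> card (expon n k) = (\<Prod>l\<in>{1..<k}. n l)"
proof (induction k rule: nat_induct_at_least)
  case (Suc k)
  then show ?case
    using bij_betw_same_card[OF bij_betw_expon[of k n]] by (simp add: card_cartesian_product mult.commute)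
qed (simp add: expon_1)

lemma kmon_1 [simp]: "kmon \<phi> (Suc 0) J = 1"
  by (simp add: kmon_def)

lemma kmon_Suc: "1 \<le> k \<Longrightarrow> kmon \<phi> (Suc k) J = kmon \<phi> k J * \<phi> k ^ J k"
  by (simp add: kmon_def)

lemma kmon_cong: "(\<And>l. l \<in> {1..<k} \<Longrightarrow> \<phi> l = \<phi>' l \<and> J l = J' l) \<Longrightarrow> kmon \<phi> k J = kmon \<phi>' k J'"
  by (simp add: kmon_def)

lemma expon_cong: "(\<And>l. l \<in> {1..<k} \<Longrightarrow> n l = n' l) \<Longrightarrow> expon n k = expon n' k"
  by (auto simp: expon_def)

lemma expon_upd: "1 \<le> k \<Longrightarrow> J \<in> expon n (Suc k) \<Longrightarrow> J(k := 0) \<in> expon n k"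
  by (auto simp: expon_def)

text \<open>The degrees are the place values of a mixed radix system with digits
  \<open>J l < n l\<close>; a number with k - 1 digits stays below the next place value.\<close>

lemma degree_kmon_less:
  fixes \<phi> :: "nat \<Rightarrow> 'a::idom poly"
  assumes "1 \<le> k" "\<And>l. l \<in> {1..<k} \<Longrightarrow> degree (\<phi> l) = (\<Prod>i\<in>{1..<l}. n i)"
    and "J \<in> expon n k"
  shows "degree (kmon \<phi> k J) < (\<Prod>i\<in>{1..<k}. n i)"
  using assms
proof (induction k arbitrary: J rule: nat_induct_at_least)
  case (Suc k)
  let ?M = "\<Prod>i\<in>{1..<k}. n i"
  have "J(k := 0) \<in> expon n k" "kmon \<phi> k (J(k := 0)) = kmon \<phi> k J"
    using Suc.prems Suc.hyps by (auto simp: expon_upd intro: kmon_cong)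
  then have less: "degree (kmon \<phi> k J) < ?M"
    by (metis Suc.IH[of "J(k := 0)"] Suc.prems(1) atLeastLessThanSuc insertCI Suc.hyps)
  have "J k < n k" "degree (\<phi> k) = ?M"
    using Suc.prems Suc.hyps by (auto simp: expon_def)
  then have "degree (\<phi> k ^ J k) \<le> J k * ?M"
    using degree_power_le[of "\<phi> k" "J k"] by (simp add: mult.commute)
  also have "\<dots> \<le> (n k - 1) * ?M"
    using \<open>J k < n k\<close> by (intro mult_le_mono1) simp
  finally have "degree (\<phi> k ^ J k) \<le> (n k - 1) * ?M" .
  then have "degree (kmon \<phi> (Suc k) J) < ?M + (n k - 1) * ?M"
    using less degree_mult_le[of "kmon \<phi> k J" "\<phi> k ^ J k"] Suc.hyps by (simp add: kmon_Suc)
  also have "\<dots> = (\<Prod>i\<in>{1..<Suc k}. n i)"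
    using \<open>J k < n k\<close> Suc.hyps by (cases "n k") (auto simp: mult.commute)
  finally show ?case .
qed simp

text \<open>Serves twice: for the ring \<open>A\<close>, where coefficients have to be controlled,
  and for all of K, where only values matter.\<close>

locale subring_type =
  fixes A :: "'a::field set"
  assumes A_1: "1 \<in> A"
    and A_diff: "a \<in> A \<Longrightarrow> b \<in> A \<Longrightarrow> a - b \<in> A"
    and A_mult: "a \<in> A \<Longrightarrow> b \<in> A \<Longrightarrow> a * b \<in> A"
begin

lemma A_0: "0 \<in> A"
  using A_diff[OF A_1 A_1] by simp

lemma A_uminus: "a \<in> A \<Longrightarrow> - a \<in> A"
  using A_diff[OF A_0, of a] by simp

lemma A_add: "a \<in> A \<Longrightarrow> b \<in> A \<Longrightarrow> a + b \<in> A"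
  using A_diff[of a "- b"] A_uminus[of b] by simp

lemma A_sum: "(\<And>i. i \<in> S \<Longrightarrow> a i \<in> A) \<Longrightarrow> (\<Sum>i\<in>S. a i) \<in> A"
  by (induction S rule: infinite_finite_induct) (auto simp: A_0 A_add)

lemma polys_over_0: "0 \<in> polys_over A"
  and polys_over_1: "1 \<in> polys_over A"
  by (auto simp: polys_over_def A_0 A_1)

lemma polys_over_const: "a \<in> A \<Longrightarrow> [:a:] \<in> polys_over A"
  by (auto simp: polys_over_def A_0 coeff_pCons split: nat.split)

lemma polys_over_monom: "a \<in> A \<Longrightarrow> Polynomial.monom a i \<in> polys_over A"
  by (auto simp: polys_over_def A_0)

lemma polys_over_add: "p \<in> polys_over A \<Longrightarrow> q \<in> polys_over A \<Longrightarrow> p + q \<in> polys_over A"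
  and polys_over_diff: "p \<in> polys_over A \<Longrightarrow> q \<in> polys_over A \<Longrightarrow> p - q \<in> polys_over A"
  and polys_over_smult: "a \<in> A \<Longrightarrow> p \<in> polys_over A \<Longrightarrow> Polynomial.smult a p \<in> polys_over A"
  and polys_over_mult: "p \<in> polys_over A \<Longrightarrow> q \<in> polys_over A \<Longrightarrow> p * q \<in> polys_over A"
  by (auto simp: polys_over_def coeff_mult A_add A_diff A_mult A_uminus intro: A_sum)

lemma polys_over_power: "p \<in> polys_over A \<Longrightarrow> p ^ i \<in> polys_over A"
  by (induction i) (auto simp: polys_over_1 polys_over_mult)

lemma polys_over_prod: "(\<And>i. i \<in> S \<Longrightarrow> p i \<in> polys_over A) \<Longrightarrow> (\<Prod>i\<in>S. p i) \<in> polys_over A"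
  by (induction S rule: infinite_finite_induct) (auto simp: polys_over_1 polys_over_mult)

lemma polys_over_kmon: "(\<And>l. l \<in> {1..<k} \<Longrightarrow> \<phi> l \<in> polys_over A) \<Longrightarrow> kmon \<phi> k J \<in> polys_over A"
  unfolding kmon_def by (intro polys_over_prod polys_over_power)

lemma polys_over_div_mod:
  assumes "Polynomial.lead_coeff q = 1" "q \<in> polys_over A" "p \<in> polys_over A"
  shows "p div q \<in> polys_over A" "p mod q \<in> polys_over A"
proof -
  have "p div q \<in> polys_over A \<and> p mod q \<in> polys_over A"
    using assms(3)
  proof (induction "degree p" arbitrary: p rule: less_induct)
    case less
    consider "degree p < degree q" | "degree q = 0"
      | "0 < degree q" "degree q \<le> degree p"
      by linarith
    then show ?case
    proof cases
      case 1
      then show ?thesis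
        using less.prems by (simp add: div_poly_less mod_poly_less polys_over_0)
    next
      case 2
      then have "q = 1"
        using assms(1) by (metis degree_eq_zeroE coeff_pCons_0 one_pCons)
      then show ?thesis
        using less.prems by (simp add: polys_over_0)
    next
      case 3
      define s where "s = Polynomial.monom (Polynomial.lead_coeff p) (degree p - degree q)"
      define p' where "p' = p - s * q"
      have q: "q \<noteq> 0" and p: "p \<noteq> 0"
        using 3 by auto
      have s: "s \<in> polys_over A" "s \<noteq> 0" "degree s = degree p - degree q"
        using less.prems p by (auto simp: s_def polys_over_def A_0 degree_monom_eq)
      have "degree (s * q) = degree p"
        using s 3 q by (simp add: Polynomial.degree_mult_eq)
      moreover have "Polynomial.lead_coeff (s * q) = Polynomial.lead_coeff p"
        unfolding lead_coeff_mult assms(1) using p by (simp add: s_def degree_monom_eq)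
      ultimately have "degree p' < degree p"
        unfolding p'_def using 3 by (intro degree_diff_less_of_lead_coeff_eq) auto
      moreover have "p' \<in> polys_over A"
        unfolding p'_def by (intro polys_over_diff polys_over_mult less.prems s assms)
      ultimately have IH: "p' div q \<in> polys_over A" "p' mod q \<in> polys_over A"
        using less.hyps by blast+
      have "p = s * q + p'"
        by (simp add: p'_def)
      then have "p div q = s + p' div q" "p mod q = p' mod q"
        using q by (simp_all add: poly_div_add_left poly_mod_add_left)
      then show ?thesis
        using IH s by (simp add: polys_over_add)
    qed
  qed
  then show "p div q \<in> polys_over A" "p mod q \<in> polys_over A"
    by auto
qed

lemma adic_coeff_polys_over:
  assumes "Polynomial.lead_coeff q = 1" "q \<in> polys_over A" "p \<in> polys_over A"
  shows "adic_coeff q p i \<in> polys_over A"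
  unfolding adic_coeff_def
  by (intro polys_over_div_mod polys_over_power degree_lead_coeff_power_monic assms)

text \<open>Expand in powers of the last polynomial and then each coefficient by induction. All
  divisions are by monic polynomials over \<open>A\<close>, so the coefficients never leave
  \<open>A\<close>.\<close>

lemma kmon_expansion:
  assumes "1 \<le> k" "\<And>l. l \<in> {1..<k} \<Longrightarrow> degree (\<phi> l) = (\<Prod>i\<in>{1..<l}. n i)"
    and "\<And>l. l \<in> {1..<k} \<Longrightarrow> 0 < n l"
    and "\<And>l. l \<in> {1..<k} \<Longrightarrow> Polynomial.lead_coeff (\<phi> l) = 1 \<and> \<phi> l \<in> polys_over A"
    and "p \<in> polys_over A" "degree p < (\<Prod>i\<in>{1..<k}. n i)"
  shows "\<exists>b. (\<forall>J. b J \<in> A) \<and> p = (\<Sum>J\<in>expon n k. Polynomial.smult (b J) (kmon \<phi> k J))"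
  using assms
proof (induction k arbitrary: p rule: nat_induct_at_least)
  case base
  then obtain a where a: "p = [:a:]"
    by (auto elim!: degree_eq_zeroE)
  have "a \<in> A"
    using base(4) a unfolding polys_over_def by (metis (mono_tags) coeff_pCons_0 mem_Collect_eq)
  then show ?case
    using a by (intro exI[of _ "\<lambda>_. a"]) (simp add: expon_1)
next
  case (Suc k)
  let ?M = "\<Prod>i\<in>{1..<k}. n i"
  have M: "degree (\<phi> k) = ?M" "0 < ?M" and \<phi>: "Polynomial.lead_coeff (\<phi> k) = 1" "\<phi> k \<in> polys_over A"
    using Suc.prems Suc.hyps by (auto intro!: prod_pos)
  have "\<exists>b. (\<forall>J. b J \<in> A) \<and> adic_coeff (\<phi> k) p i = (\<Sum>J\<in>expon n k. Polynomial.smult (b J) (kmon \<phi> k J))" for i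
    using Suc.prems Suc.hyps M degree_adic_coeff[of "\<phi> k" p i]
    by (intro Suc.IH adic_coeff_polys_over \<phi> Suc.prems) auto
  then obtain b where b: "\<And>i J. b i J \<in> A"
      "\<And>i. adic_coeff (\<phi> k) p i = (\<Sum>J\<in>expon n k. Polynomial.smult (b i J) (kmon \<phi> k J))"
    by metis
  have deg: "degree p div degree (\<phi> k) < n k"
    using Suc.prems(5) Suc.hyps M by (simp add: div_less_iff_less_mult mult.commute)
  then have "p = (\<Sum>i\<le>n k - 1. adic_coeff (\<phi> k) p i * \<phi> k ^ i)"
    using M by (intro adic_expansion_le) auto
  also have "{..n k - 1} = {..<n k}"
    using deg by auto
  finally have "p = (\<Sum>i<n k. \<Sum>J\<in>expon n k. Polynomial.smult (b i J) (kmon \<phi> k J * \<phi> k ^ i))"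
    by (simp add: b(2) sum_distrib_right)
  also have "\<dots> = (\<Sum>i<n k. \<Sum>J\<in>expon n k. Polynomial.smult (b ((J(k := i)) k) ((J(k := i))(k := 0))) (kmon \<phi> (Suc k) (J(k := i))))"
  proof (intro sum.cong refl)
    fix i J assume "J \<in> expon n k"
    then have "J(k := 0) = J"
      by (auto simp: expon_def)
    moreover have "kmon \<phi> k (J(k := i)) = kmon \<phi> k J"
      by (rule kmon_cong) auto
    ultimately show "Polynomial.smult (b i J) (kmon \<phi> k J * \<phi> k ^ i)
        = Polynomial.smult (b ((J(k := i)) k) ((J(k := i))(k := 0))) (kmon \<phi> (Suc k) (J(k := i)))"
      using Suc.hyps by (simp add: kmon_Suc)
  qed
  also have "\<dots> = (\<Sum>J\<in>expon n (Suc k). Polynomial.smult (b (J k) (J(k := 0))) (kmon \<phi> (Suc k) J))"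
    using Suc.hyps by (subst sum_expon) auto
  finally show ?case
    using b(1) by (intro exI[of _ "\<lambda>J. b (J k) (J(k := 0))"]) simp
qed

end

text \<open>The assumptions on \<open>of_nat\<close> express that \<open>A\<close> contains a field
  on which \<open>V0\<close> is trivial, and that the characteristic does not divide deg f. They
  make every factor e of deg f a unit of value 0.\<close>

locale unique_extension_over = unique_extension_poly W V0 f + subring_type A
  for W :: "'a::field poly \<Rightarrow> 'g::linordered_ab_group_add extended" and V0 f A +
  assumes f_over: "f \<in> polys_over A"
    and A_inverse_of_nat: "of_nat i \<noteq> (0::'a) \<Longrightarrow> 1 / of_nat i \<in> A"
    and V0_of_nat: "of_nat i \<noteq> (0::'a) \<Longrightarrow> V0 (of_nat i) = 0"
    and degree_f_nonzero: "of_nat (degree f) \<noteq> (0::'a)"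
begin

text \<open>The approximate e-th root of f: the degree of f - g^e lies below deg f - deg g. Equality
  f = g^e is listed separately because the zero polynomial has degree 0, which is not below the
  bound if e = 1.\<close>

definition is_root :: "nat \<Rightarrow> 'a poly \<Rightarrow> bool" where
  "is_root e g \<longleftrightarrow> Polynomial.lead_coeff g = 1 \<and> degree f = e * degree g \<and>
     (f = g ^ e \<or> degree (f - g ^ e) < (e - 1) * degree g)"

lemma is_root_exists:
  assumes "degree f = e * m"
  obtains g where "is_root e g" "degree g = m" "g \<in> polys_over A"
proof -
  have e: "0 < e" "of_nat e \<noteq> (0::'a)"
    using assms degree_f_nonzero degree_f_pos by (auto intro: gr0I)
  have m: "0 < m"
    using assms degree_f_pos by (auto intro: gr0I)
  \<comment> \<open>The construction starts at z^m; the filtration is constant and records only that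
    coefficients stay in \<open>A\<close>.\<close>
  have "\<exists>g. g \<in> polys_over A \<and> Polynomial.lead_coeff g = 1 \<and> degree g = degree (Polynomial.monom (1::'a) m) \<and>
    (f = g ^ e \<or> degree (f - g ^ e) < (e - 1) * degree (Polynomial.monom (1::'a) m))"
    by (rule approximate_root_exists[where T = "\<lambda>_. polys_over A"])
      (use assms m e A_inverse_of_nat f_over monic_f in \<open>auto simp: degree_monom_eq A_1 polys_over_monom polys_over_1
        polys_over_add polys_over_diff polys_over_mult polys_over_smult
        intro!: polys_over_div_mod(1) polys_over_power polys_over_monom degree_lead_coeff_power_monic(1)\<close>)
  then show thesis
    using that assms by (auto simp: is_root_def degree_monom_eq)
qed

lemma is_root_unique:
  assumes "is_root e g" "is_root e h"
  shows "g = h"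
proof -
  have pos: "0 < e" "of_nat e \<noteq> (0::'a)" "0 < degree g"
    using assms(1) degree_f_nonzero degree_f_pos by (auto simp: is_root_def intro!: gr0I)
  have "e * degree h = e * degree g"
    using assms unfolding is_root_def by metis
  then have deg: "degree h = degree g"
    using pos(1) by simp
  have h: "f = h ^ e \<or> degree (f - h ^ e) < (e - 1) * degree g"
    using assms(2) unfolding is_root_def deg by blast
  show ?thesis
    by (rule approximate_root_unique[OF _ refl _ _ deg h pos])
      (use assms in \<open>unfold is_root_def, blast+\<close>)
qed

text \<open>The construction of the root is run again, starting at h, with the filtration by
  \<open>l \<bullet> W h \<le> U h x\<close>. It contains f at level e since
  \<open>leads h f e\<close> and the coefficient of h^e in f is 1. The outcome has value at least
  W(h) and is g by uniqueness, although g itself was constructed without reference to h.\<close>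

lemma is_root_value:
  assumes key: "key h" and g: "is_root e g" "degree g = degree h"
  shows "W h \<le> W g"
proof (cases "W h = \<infinity>")
  case True
  have "h \<noteq> 0"
    using key_nonzero[OF key] .
  then have "degree f \<le> degree g"
    using True dvd_imp_degree_le[of f h] g(2) by (simp add: W_inf_iff)
  then have "e * degree g \<le> 1 * degree g"
    using g(1) by (simp add: is_root_def)
  moreover have "0 < e" "0 < degree g"
    using g(1) degree_f_pos by (auto simp: is_root_def intro!: gr0I)
  ultimately have "e = 1"
    by simp
  then have "f = g"
    using g(1) by (simp add: is_root_def)
  then show ?thesis
    using W_inf_iff[of g] by simp
next
  case False
  note pos = degree_keyD[OF key]
  have val: "valuation_on (ring_of_type_algebra :: 'a poly ring) (U h)"
    by (rule valuation_U[OF key False])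
  interpret U: pseudo_valuation "U h"
    by (rule pseudo_valuation_of_valuation[OF val])
  have e: "0 < e" "of_nat e \<noteq> (0::'a)"
    using g(1) degree_f_nonzero degree_f_pos by (auto simp: is_root_def intro: gr0I)
  obtain e' where e': "degree f = e' * degree h" "leads h f e'"
    by (rule degree_key_dvd_degree_f[OF key False])
  then have "e' = e"
    using g pos by (simp add: is_root_def)
  have df: "degree f = e * degree h"
    using e' \<open>e' = e\<close> by simp
  have "adic_coeff h f e = 1"
  proof -
    have m: "Polynomial.lead_coeff (h ^ e) = 1" "degree (h ^ e) = e * degree h"
      using degree_lead_coeff_power_monic[OF lead_coeff_keyD[OF key]] by auto
    have "h ^ e \<noteq> 0"
      using key_nonzero[OF key] by simp
    have "degree (f - h ^ e) < degree (h ^ e)"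
      using degree_diff_less_of_lead_coeff_eq[of f "h ^ e"] m df monic_f degree_f_pos by simp
    then have "(h ^ e + (f - h ^ e)) div h ^ e = 1"
      using \<open>h ^ e \<noteq> 0\<close> by (simp only: poly_div_add_left div_poly_less add_0_right div_self[OF \<open>h ^ e \<noteq> 0\<close>])
    then have "f div h ^ e = 1"
      by simp
    then show ?thesis
      using pos by (simp add: adic_coeff_def mod_poly_less)
  qed
  then have Uf: "U h f = e \<bullet> W h"
    using e'(2) \<open>e' = e\<close> by (simp add: leads_def adic_term_def power)
  \<comment> \<open>Division by h^(e-1) shifts the digits down by e - 1 places, which lowers the
    value of each term by (e - 1) W(h).\<close>
  have div: "1 \<bullet> W h \<le> U h (x div h ^ (e - 1))" if "e \<bullet> W h \<le> U h x" for x
    unfolding U_ge_iff[OF pos]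
  proof
    fix i
    have fin: "(e - 1) \<bullet> W h \<noteq> \<infinity>" "(e - 1) \<bullet> W h \<noteq> -\<infinity>"
      using False not_Minf[of h] by (cases "W h"; simp add: nsc_Fin)+
    have "e \<bullet> W h = 1 \<bullet> W h + (e - 1) \<bullet> W h"
      using e(1) nsc_add[of 1 "e - 1" "W h"] by simp
    then have "1 \<bullet> W h + (e - 1) \<bullet> W h \<le> W (adic_term h x (i + (e - 1)))"
      using that U_le_term[OF pos, of x "i + (e - 1)"] by (metis order_trans)
    also have "adic_term h x (i + (e - 1)) = adic_term h (x div h ^ (e - 1)) i * h ^ (e - 1)"
      by (simp add: adic_term_def adic_coeff_div_power power_add mult.assoc)
    finally show "1 \<bullet> W h \<le> W (adic_term h (x div h ^ (e - 1)) i)"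
      using fin by (simp add: mult power extended_add_cancel)
  qed
  have V0_inv: "V0 (1 / of_nat e) = 0"
    using V0_divide[of 1 0 "of_nat e" 0] V0_of_nat[OF e(2)] by (simp add: zero_extended_def)
  have smult: "U h (Polynomial.smult (1 / of_nat e) x) = U h x" for x
    using U.mult[of "[:1 / of_nat e:]" x] pos V0_inv by (simp add: U_small)
  have "\<exists>g. g \<in> {x. 1 \<bullet> W h \<le> U h x} \<and> Polynomial.lead_coeff g = 1 \<and> degree g = degree h \<and>
    (f = g ^ e \<or> degree (f - g ^ e) < (e - 1) * degree h)"
  proof (rule approximate_root_exists[where T = "\<lambda>l. {x. l \<bullet> W h \<le> U h x}"])
    show "x * y \<in> {x. (k + l) \<bullet> W h \<le> U h x}" if "x \<in> {x. k \<bullet> W h \<le> U h x}" "y \<in> {x. l \<bullet> W h \<le> U h x}" for x y k l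
      using that by (simp add: U.mult nsc_add add_mono)
    show "x div h ^ (e - 1) \<in> {x. 1 \<bullet> W h \<le> U h x}" if "x \<in> {x. e \<bullet> W h \<le> U h x}" for x
      using that div by blast
  qed (use e df pos lead_coeff_keyD[OF key] monic_f Uf smult U_key[OF key] in \<open>auto simp: U.add_geI U.diff_geI\<close>)
  then obtain g' where g': "W h \<le> U h g'" "is_root e g'"
    using df by (auto simp: is_root_def)
  then have "g' = g"
    using is_root_unique g(1) by blast
  then show ?thesis
    using g'(1) U_le_W[OF pos, of g] by auto
qed

end

section \<open>Existence of a complete chain of key polynomials\<close>

lemma (in pseudo_valuation) prod_finite:
  "(\<And>i. i \<in> S \<Longrightarrow> W (x i) \<noteq> \<infinity>) \<Longrightarrow> W (\<Prod>i\<in>S. x i) \<noteq> \<infinity>"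
  by (induction S rule: infinite_finite_induct) (simp_all add: mult extended_add_eq_inf)

context unique_extension_over
begin

text \<open>The equality of the values of the power and of the subtracted monomial yields the
  homogeneity of the new key polynomial, and later the relation between the initial forms.\<close>

definition key_step :: "(nat \<Rightarrow> 'a poly) \<Rightarrow> (nat \<Rightarrow> nat) \<Rightarrow> (nat \<Rightarrow> 'a) \<Rightarrow> (nat \<Rightarrow> nat \<Rightarrow> nat) \<Rightarrow> nat \<Rightarrow> bool" where
  "key_step \<phi> n c j i \<longleftrightarrow>
     W (\<phi> i) \<noteq> \<infinity> \<and> n i = ord (\<phi> i) \<and> c i \<in> A \<and> (\<forall>l\<in>{1..<i}. j l i < n l) \<and>
     \<phi> (Suc i) = \<phi> i ^ n i - Polynomial.smult (c i) (kmon \<phi> i (\<lambda>l. j l i)) \<and>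
     W (Polynomial.smult (c i) (kmon \<phi> i (\<lambda>l. j l i))) = n i \<bullet> W (\<phi> i) \<and>
     n i \<bullet> W (\<phi> i) < W (\<phi> (Suc i)) \<and>
     key_polynomial (U (\<phi> i)) (\<phi> i) (\<phi> (Suc i)) (W (\<phi> (Suc i)))"

text \<open>No step starts at the last member, so its value may be infinite; this is how a chain
  ends.\<close>

definition key_chain :: "nat \<Rightarrow> (nat \<Rightarrow> 'a poly) \<Rightarrow> (nat \<Rightarrow> nat) \<Rightarrow> (nat \<Rightarrow> 'a) \<Rightarrow> (nat \<Rightarrow> nat \<Rightarrow> nat) \<Rightarrow> bool" where
  "key_chain k \<phi> n c j \<longleftrightarrow> 1 \<le> k \<and> \<phi> 1 = [:0, 1:] \<and>
     (\<forall>i\<in>{1..k}. key (\<phi> i) \<and> \<phi> i \<in> polys_over A \<and> degree (\<phi> i) = (\<Prod>l\<in>{1..<i}. n l)) \<and>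
     (\<forall>i\<in>{1..<k}. key_step \<phi> n c j i)"

lemma key_z: "key [:0, 1:]"
  unfolding key_def
proof (intro conjI allI impI)
  show "W p \<noteq> \<infinity>" if "degree p < degree [:0, 1::'a:]" "p \<noteq> 0" for p
    using that degree_f_pos by (intro W_finite_small) auto
  fix a b :: "'a poly"
  assume "degree a < degree [:0, 1::'a:]" "a \<noteq> 0"
    "degree b < degree [:0, 1::'a:]" "b \<noteq> 0"
  then have *: "degree (a * b) < degree [:0, 1::'a:]" "W a \<noteq> \<infinity>" "W b \<noteq> \<infinity>"
    using degree_f_pos W_finite_small[of a] W_finite_small[of b] by (simp_all add: Polynomial.degree_mult_eq)
  then show "W (a * b mod [:0, 1:]) = W a + W b"
    by (simp only: mod_poly_less mult)
  have "W a + W b \<noteq> \<infinity>"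
    using * by (simp add: extended_add_eq_inf)
  then show "W a + W b < W (a * b div [:0, 1:]) + W [:0, 1:]"
    using * by (simp only: div_poly_less zero extended_add_inf less_inf_iff) simp
qed simp_all

lemma key_chain_1: "key_chain 1 (\<lambda>_. [:0, 1:]) n c j"
  unfolding key_chain_def using key_z A_0 A_1 by (auto simp: polys_over_def coeff_pCons split: nat.split)

section \<open>Chains of key polynomials and their monomials\<close>

context
  fixes k \<phi> n c j
  assumes chain: "key_chain k \<phi> n c j"
begin

lemma chain_ge_1: "1 \<le> k"
  and chain_key: "i \<in> {1..k} \<Longrightarrow> key (\<phi> i)"
  and chain_over: "i \<in> {1..k} \<Longrightarrow> \<phi> i \<in> polys_over A"
  and chain_degree: "i \<in> {1..k} \<Longrightarrow> degree (\<phi> i) = (\<Prod>l\<in>{1..<i}. n l)"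
  and chain_finite: "i \<in> {1..<k} \<Longrightarrow> W (\<phi> i) \<noteq> \<infinity>"
  and chain_ord: "i \<in> {1..<k} \<Longrightarrow> n i = ord (\<phi> i)"
  and chain_1: "\<phi> 1 = [:0, 1:]"
  and chain_key_step: "i \<in> {1..<k} \<Longrightarrow> key_step \<phi> n c j i"
  using chain unfolding key_chain_def by (blast, blast, blast, blast, auto simp only: key_step_def)

lemma chain_ord_pos: "i \<in> {1..<k} \<Longrightarrow> 0 < n i"
proof -
  assume i: "i \<in> {1..<k}"
  then obtain \<mu> where "W (\<phi> i) = Fin \<mu>"
    using chain_finite[OF i] not_Minf[of "\<phi> i"] by (cases "W (\<phi> i)") auto
  then show ?thesis
    using ord_pos[of "\<phi> i" \<mu>] chain_key[of i] chain_ord[OF i] i by simp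
qed

lemma chain_degree_f:
  assumes "i \<in> {1..k}"
  shows "degree (\<phi> i) \<le> degree f"
proof (cases "i = 1")
  case True
  then show ?thesis
    using chain_1 degree_f_pos by simp
next
  case False
  then obtain i' where i': "i = Suc i'" "i' \<in> {1..<k}"
    using assms by (cases i) auto
  obtain \<mu> where \<mu>: "W (\<phi> i') = Fin \<mu>"
    using chain_finite[OF i'(2)] not_Minf[of "\<phi> i'"] by (cases "W (\<phi> i')") auto
  have "degree (\<phi> i) = ord (\<phi> i') * degree (\<phi> i')"
    using chain_degree[OF assms] chain_degree[of i'] i' chain_ord by simp
  then show ?thesis
    using ord_degree_le[OF chain_key \<mu>] i'(2) by simp
qed

lemma chain_expansion:
  assumes "i \<in> {1..k}" "p \<in> polys_over A" "degree p < degree (\<phi> i)"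
  obtains b where "\<And>J. b J \<in> A" "p = (\<Sum>J\<in>expon n i. Polynomial.smult (b J) (kmon \<phi> i J))"
proof -
  have "\<exists>b. (\<forall>J. b J \<in> A) \<and> p = (\<Sum>J\<in>expon n i. Polynomial.smult (b J) (kmon \<phi> i J))"
  proof (rule kmon_expansion)
    fix l assume l: "l \<in> {1..<i}"
    then have l': "l \<in> {1..k}" "l \<in> {1..<k}"
      using assms(1) by auto
    show "degree (\<phi> l) = (\<Prod>i\<in>{1..<l}. n i)" "0 < n l"
      by (rule chain_degree[OF l'(1)], rule chain_ord_pos[OF l'(2)])
    show "Polynomial.lead_coeff (\<phi> l) = 1 \<and> \<phi> l \<in> polys_over A"
      using lead_coeff_keyD[OF chain_key[OF l'(1)]] chain_over[OF l'(1)] by blast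
  qed (use assms chain_degree in auto)
  then show thesis
    using that by blast
qed

lemma chain_degree_kmon:
  assumes "i \<in> {1..k}" "J \<in> expon n i"
  shows "degree (kmon \<phi> i J) < degree (\<phi> i)"
  using degree_kmon_less[of i \<phi> n J] chain_degree assms by auto

lemma kmon_finite:
  assumes "i \<in> {1..k}" "a \<noteq> 0"
  shows "W (Polynomial.smult a (kmon \<phi> i J)) \<noteq> \<infinity>"
proof -
  have "W (\<phi> l ^ J l) \<noteq> \<infinity>" if "l \<in> {1..<i}" for l
    using chain_finite[of l] assms(1) that not_Minf[of "\<phi> l"] by (cases "W (\<phi> l)") (auto simp: power nsc_Fin)
  then have "W (kmon \<phi> i J) \<noteq> \<infinity>"
    unfolding kmon_def by (rule prod_finite)
  then show ?thesis
    using assms(2) by (simp add: W_smult extended_add_eq_inf V0_inf_iff)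
qed

lemma kmon_value_in_Gam:
  assumes "i \<in> {1..k}" "J \<in> expon n i" "a \<noteq> 0"
  obtains \<alpha> where "W (Polynomial.smult a (kmon \<phi> i J)) = Fin \<alpha>" "\<alpha> \<in> Gam (degree (\<phi> i))"
proof -
  obtain \<alpha> where \<alpha>: "W (Polynomial.smult a (kmon \<phi> i J)) = Fin \<alpha>"
    using kmon_finite[OF assms(1,3), of J] not_Minf[of "Polynomial.smult a (kmon \<phi> i J)"]
    by (cases "W (Polynomial.smult a (kmon \<phi> i J))") auto
  moreover have "degree (Polynomial.smult a (kmon \<phi> i J)) < degree (\<phi> i)"
    using chain_degree_kmon[OF assms(1,2)] assms(3) by simp
  ultimately show thesis
    using that unfolding Gam_def by blast
qed

text \<open>Because the scalars are arbitrary, this separates the values of the monomials modulo the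
  value group of \<open>V0\<close>. The last exponent is determined modulo the values in smaller
  degree, since it is below \<open>ord\<close>; the other exponents follow by induction.\<close>

lemma kmon_values_distinct:
  assumes "i \<in> {1..k}" "J \<in> expon n i" "J' \<in> expon n i" "a \<noteq> 0" "a' \<noteq> 0"
    and "W (Polynomial.smult a (kmon \<phi> i J)) = W (Polynomial.smult a' (kmon \<phi> i J'))"
  shows "J = J'"
proof -
  have "1 \<le> i"
    using assms(1) by simp
  then show ?thesis
    using assms
  proof (induction i arbitrary: J J' rule: nat_induct_at_least)
    case base
    then show ?case
      by (simp add: expon_1)
  next
    case (Suc i)
    have i: "i \<in> {1..k}" "i \<in> {1..<k}"
      using Suc.prems Suc.hyps by auto
    obtain \<mu> where \<mu>: "W (\<phi> i) = Fin \<mu>"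
      using chain_finite[OF i(2)] not_Minf[of "\<phi> i"] by (cases "W (\<phi> i)") auto
    have val: "W (Polynomial.smult b (kmon \<phi> (Suc i) I)) = W (Polynomial.smult b (kmon \<phi> i (I(i := 0)))) + Fin (I i \<bullet> \<mu>)" for b I
    proof -
      have "kmon \<phi> i (I(i := 0)) = kmon \<phi> i I"
        by (rule kmon_cong) auto
      then show ?thesis
        using Suc.hyps by (simp add: kmon_Suc W_smult mult power \<mu> nsc_Fin add.assoc)
    qed
    have J: "J(i := 0) \<in> expon n i" "J'(i := 0) \<in> expon n i" "J i < n i" "J' i < n i"
      using Suc.prems Suc.hyps expon_upd[of i] by (auto simp: expon_def)
    obtain \<alpha> where \<alpha>: "W (Polynomial.smult a (kmon \<phi> i (J(i := 0)))) = Fin \<alpha>" "\<alpha> \<in> Gam (degree (\<phi> i))"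
      by (rule kmon_value_in_Gam[OF i(1) J(1) Suc.prems(4)])
    obtain \<beta> where \<beta>: "W (Polynomial.smult a' (kmon \<phi> i (J'(i := 0)))) = Fin \<beta>" "\<beta> \<in> Gam (degree (\<phi> i))"
      by (rule kmon_value_in_Gam[OF i(1) J(2) Suc.prems(5)])
    have eq: "\<alpha> + J i \<bullet> \<mu> = \<beta> + J' i \<bullet> \<mu>"
      using Suc.prems(6) by (simp add: val \<alpha>(1) \<beta>(1))
    have Ji: "J i = J' i"
      using distinct_residues_Gam[OF chain_key[OF i(1)] \<mu> \<alpha>(2) \<beta>(2) _ _ eq] J chain_ord[OF i(2)] by simp
    then have "W (Polynomial.smult a (kmon \<phi> i (J(i := 0)))) = W (Polynomial.smult a' (kmon \<phi> i (J'(i := 0))))"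
      using eq \<alpha>(1) \<beta>(1) by simp
    then have "J(i := 0) = J'(i := 0)"
      using Suc.IH[OF i(1) J(1,2) Suc.prems(4,5)] by blast
    then show ?case
      using Ji by (metis fun_upd_triv fun_upd_upd)
  qed
qed

lemma W_kmon_sum_le:
  assumes "i \<in> {1..k}" "J \<in> expon n i"
  shows "W (\<Sum>J\<in>expon n i. Polynomial.smult (b J) (kmon \<phi> i J)) \<le> W (Polynomial.smult (b J) (kmon \<phi> i J))"
proof (rule sum_ge_distinct)
  fix I J assume *: "I \<in> expon n i" "J \<in> expon n i" "I \<noteq> J" "W (Polynomial.smult (b I) (kmon \<phi> i I)) \<noteq> \<infinity>"
  show "W (Polynomial.smult (b I) (kmon \<phi> i I)) \<noteq> W (Polynomial.smult (b J) (kmon \<phi> i J))"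
  proof
    assume eq: "W (Polynomial.smult (b I) (kmon \<phi> i I)) = W (Polynomial.smult (b J) (kmon \<phi> i J))"
    then have "b I \<noteq> 0" "b J \<noteq> 0"
      using *(4) by auto
    then show False
      using kmon_values_distinct[OF assms(1) *(1,2)] eq *(3) by blast
  qed
qed (use assms in auto)

text \<open>The new key polynomial is the power of the old one minus the term of least value in its
  difference from the approximate root of the same degree.\<close>

lemma least_term:
  assumes \<mu>: "W (\<phi> k) = Fin \<mu>" and n': "n' = n(k := ord (\<phi> k))"
    and g: "is_root e g" "degree g = ord (\<phi> k) * degree (\<phi> k)"
    and b: "\<phi> k ^ ord (\<phi> k) - g = (\<Sum>J\<in>expon n' (Suc k). Polynomial.smult (b J) (kmon \<phi> (Suc k) J))"
  obtains J where "J \<in> expon n k" "b J \<noteq> 0"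
    "W (Polynomial.smult (b J) (kmon \<phi> k J)) = ord (\<phi> k) \<bullet> W (\<phi> k)"
    "ord (\<phi> k) \<bullet> W (\<phi> k) < W (\<phi> k ^ ord (\<phi> k) - Polynomial.smult (b J) (kmon \<phi> k J))"
    "kmon \<phi> (Suc k) J = kmon \<phi> k J" "J \<in> expon n' (Suc k)"
proof -
  have kk: "k \<in> {1..k}"
    using chain_ge_1 by simp
  note key = chain_key[OF kk]
  let ?N = "ord (\<phi> k)"
  let ?\<gamma> = "?N \<bullet> W (\<phi> k)"
  obtain b0 where b0: "degree b0 < degree (\<phi> k)" "?\<gamma> < W (\<phi> k ^ ?N - b0)"
    using next_key_exists[OF key \<mu>] by blast
  \<comment> \<open>The auxiliary key polynomial, with coefficients in K, shows that g has larger
    value than \<open>\<phi> k ^ ?N\<close>; so the difference u has the value of the power.\<close>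
  have "W (\<phi> k ^ ?N - b0) \<le> W g"
    using is_root_value[OF next_key[OF key \<mu> b0] g(1)] next_key_degree(2)[OF key \<mu> b0] g(2) by simp
  then have Wg: "?\<gamma> < W g"
    using b0(2) by simp
  define u where "u = \<phi> k ^ ?N - g"
  have Wu: "W u = ?\<gamma>"
    using diff_eq(1)[of "\<phi> k ^ ?N" g] Wg by (simp add: u_def power)
  define x where "x J = Polynomial.smult (b J) (kmon \<phi> (Suc k) J)" for J
  define S where "S = {J \<in> expon n' (Suc k). b J \<noteq> 0}"
  have finS: "finite S"
    using chain_ge_1 by (simp add: S_def)
  have u_sum: "u = (\<Sum>J\<in>S. x J)"
    unfolding u_def b x_def S_def using chain_ge_1
    by (intro sum.mono_neutral_right) auto
  have "u \<noteq> 0"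
    using Wu \<mu> by (auto simp: nsc_Fin)
  then have "S \<noteq> {}"
    using u_sum by auto
  have n'_eq: "expon n' k = expon n k"
    using n' by (intro expon_cong) auto
  have low: "kmon \<phi> k (I(k := 0)) = kmon \<phi> k I" for I
    by (rule kmon_cong) auto
  have split: "I(k := 0) \<in> expon n k" "I k < ?N" if "I \<in> S" for I
  proof -
    have I: "I \<in> expon n' (Suc k)"
      using that by (simp add: S_def)
    show "I(k := 0) \<in> expon n k"
      using expon_upd[OF chain_ge_1 I] n'_eq by simp
    have "I k < n' k"
      using I chain_ge_1 unfolding expon_def by simp
    then show "I k < ?N"
      by (simp add: n')
  qed
  have val: "W (x I) = W (Polynomial.smult (b I) (kmon \<phi> k (I(k := 0)))) + Fin (I k \<bullet> \<mu>)" for I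
    using chain_ge_1 by (simp add: x_def low kmon_Suc W_smult mult power \<mu> nsc_Fin add.assoc)
  have "inj_on (\<lambda>J. W (x J)) S"
  proof (rule inj_onI)
    fix I J assume IJ: "I \<in> S" "J \<in> S" "W (x I) = W (x J)"
    have nz: "b I \<noteq> 0" "b J \<noteq> 0"
      using IJ by (auto simp: S_def)
    obtain \<alpha> where \<alpha>: "W (Polynomial.smult (b I) (kmon \<phi> k (I(k := 0)))) = Fin \<alpha>" "\<alpha> \<in> Gam (degree (\<phi> k))"
      by (rule kmon_value_in_Gam[OF kk split(1)[OF IJ(1)] nz(1)])
    obtain \<beta> where \<beta>: "W (Polynomial.smult (b J) (kmon \<phi> k (J(k := 0)))) = Fin \<beta>" "\<beta> \<in> Gam (degree (\<phi> k))"
      by (rule kmon_value_in_Gam[OF kk split(1)[OF IJ(2)] nz(2)])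
    have eq: "\<alpha> + I k \<bullet> \<mu> = \<beta> + J k \<bullet> \<mu>"
      using IJ(3) by (simp add: val \<alpha>(1) \<beta>(1))
    then have "I k = J k"
      using distinct_residues_Gam[OF key \<mu> \<alpha>(2) \<beta>(2) split(2)[OF IJ(1)] split(2)[OF IJ(2)]] by blast
    moreover from this have "I(k := 0) = J(k := 0)"
      using kmon_values_distinct[OF kk split(1)[OF IJ(1)] split(1)[OF IJ(2)] nz] eq \<alpha>(1) \<beta>(1) by simp
    ultimately show "I = J"
      by (metis fun_upd_triv fun_upd_upd)
  qed
  then obtain J where J: "J \<in> S" "\<And>I. I \<in> S \<Longrightarrow> W (x J) \<le> W (x I)" "\<And>I. I \<in> S - {J} \<Longrightarrow> W (x J) < W (x I)"
      "W (\<Sum>I\<in>S. x I) = W (x J)"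
    using sum_distinct[OF finS \<open>S \<noteq> {}\<close>] by metis
  have WJ: "W (x J) = ?\<gamma>"
    using J(4) Wu u_sum by simp
  have nz: "b J \<noteq> 0"
    using J(1) by (simp add: S_def)
  obtain \<alpha> where \<alpha>: "W (Polynomial.smult (b J) (kmon \<phi> k (J(k := 0)))) = Fin \<alpha>" "\<alpha> \<in> Gam (degree (\<phi> k))"
    by (rule kmon_value_in_Gam[OF kk split(1)[OF J(1)] nz])
  \<comment> \<open>The value of the least term belongs to \<open>Gam (degree (\<phi> k))\<close>,
    so its exponent at place k is 0: only earlier key polynomials occur in it.\<close>
  have "\<alpha> + J k \<bullet> \<mu> = ?N \<bullet> \<mu> + 0 \<bullet> \<mu>"
    using WJ by (simp add: val \<alpha>(1) \<mu> nsc_Fin)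
  then have "J k = 0"
    using distinct_residues_Gam[OF key \<mu> \<alpha>(2) ord_in_Gam[OF key \<mu>] split(2)[OF J(1)] ord_pos[OF key \<mu>]] by blast
  then have "J(k := 0) = J"
    by auto
  then have Jn: "J \<in> expon n k"
    using split(1)[OF J(1)] by simp
  have eqJ: "kmon \<phi> (Suc k) J = kmon \<phi> k J"
    using chain_ge_1 \<open>J k = 0\<close> by (simp add: kmon_Suc)
  \<comment> \<open>The power minus the least term is g plus the remaining terms, all of which have
    larger value.\<close>
  have "?\<gamma> < W (\<Sum>I\<in>S - {J}. x I)"
    using J(3) \<mu> WJ by (intro sum_gtI) (auto simp: nsc_Fin)
  then have "?\<gamma> < W (g + (\<Sum>I\<in>S - {J}. x I))"
    using Wg by (intro add_gtI)
  also have "g + (\<Sum>I\<in>S - {J}. x I) = \<phi> k ^ ?N - x J"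
    using sum.remove[OF finS J(1), of x] u_sum by (simp add: u_def algebra_simps)
  finally have "?\<gamma> < W (\<phi> k ^ ?N - Polynomial.smult (b J) (kmon \<phi> k J))"
    by (simp add: x_def eqJ)
  then show thesis
    using that[of J] Jn nz WJ eqJ J(1) by (simp add: x_def S_def)
qed

lemma chain_extend:
  assumes \<mu>: "W (\<phi> k) = Fin \<mu>" and J: "J \<in> expon n k" and b: "b \<in> A"
    and val: "W (Polynomial.smult b (kmon \<phi> k J)) = ord (\<phi> k) \<bullet> W (\<phi> k)"
      "ord (\<phi> k) \<bullet> W (\<phi> k) < W (\<phi> k ^ ord (\<phi> k) - Polynomial.smult b (kmon \<phi> k J))"
  shows "key_chain (Suc k) (\<phi>(Suc k := \<phi> k ^ ord (\<phi> k) - Polynomial.smult b (kmon \<phi> k J)))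
    (n(k := ord (\<phi> k))) (c(k := b)) (\<lambda>l i. if i = k then J l else j l i)"
    (is "key_chain _ ?\<phi> ?n ?c ?j")
proof -
  have kk: "k \<in> {1..k}"
    using chain_ge_1 by simp
  note key = chain_key[OF kk]
  let ?t = "Polynomial.smult b (kmon \<phi> k J)"
  have tdeg: "degree ?t < degree (\<phi> k)"
    using chain_degree_kmon[OF kk J] degree_smult_le[of b "kmon \<phi> k J"] by simp
  note nk = next_key[OF key \<mu> tdeg val(2)] next_key_polynomial[OF key \<mu> tdeg val(2)]
    next_key_degree[OF key \<mu> tdeg val(2)]
  have over: "\<phi> k ^ ord (\<phi> k) - ?t \<in> polys_over A"
    using chain_over chain_ge_1 b
    by (intro polys_over_diff polys_over_power polys_over_smult polys_over_kmon) auto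
  have kmon_eq: "kmon ?\<phi> i J' = kmon \<phi> i J'" if "i \<le> Suc k" for i J'
    using that by (intro kmon_cong) auto
  have "key_step ?\<phi> ?n ?c ?j i" if "i \<in> {1..<k}" for i
  proof -
    have "kmon \<phi> i (\<lambda>l. ?j l i) = kmon \<phi> i (\<lambda>l. j l i)"
      using that by (intro kmon_cong) auto
    then show ?thesis
      using chain_key_step[OF that] that kmon_eq[of i] unfolding key_step_def by auto
  qed
  moreover have "key_step ?\<phi> ?n ?c ?j k"
    using \<mu> b J val nk(2) kmon_eq[of k] unfolding key_step_def by (auto simp: expon_def)
  moreover have "degree (?\<phi> i) = (\<Prod>l\<in>{1..<i}. ?n l)" if "i \<in> {1..Suc k}" for i
  proof (cases "i = Suc k")
    case True
    have "(\<Prod>l\<in>{1..<k}. ?n l) = (\<Prod>l\<in>{1..<k}. n l)"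
      by (intro prod.cong) auto
    then show ?thesis
      using True nk(4) chain_degree[OF kk] chain_ge_1 by (simp add: mult.commute)
  next
    case False
    have "(\<Prod>l\<in>{1..<i}. ?n l) = (\<Prod>l\<in>{1..<i}. n l)"
      using False that by (intro prod.cong) auto
    then show ?thesis
      using False chain_degree[of i] that by simp
  qed
  ultimately show ?thesis
    using chain_1 chain_key chain_over over nk(1) chain_ge_1
    unfolding key_chain_def by (auto simp: less_Suc_eq le_Suc_eq)
qed

end

text \<open>A termination measure for steps within one degree: the number of terms by which the last
  key polynomial still differs from the approximate root of its degree.\<close>

definition has_terms :: "(nat \<Rightarrow> 'a poly) \<Rightarrow> (nat \<Rightarrow> nat) \<Rightarrow> nat \<Rightarrow> nat \<Rightarrow> bool" where
  "has_terms \<phi> n k t \<longleftrightarrow> (\<exists>e g b. is_root e g \<and> degree g = degree (\<phi> k) \<and> (\<forall>J. b J \<in> A) \<and>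
     \<phi> k - g = (\<Sum>J\<in>expon n k. Polynomial.smult (b J) (kmon \<phi> k J)) \<and> card {J \<in> expon n k. b J \<noteq> 0} \<le> t)"

lemma has_terms_exists:
  assumes chain: "key_chain k \<phi> n c j" and dvd: "degree (\<phi> k) dvd degree f"
  obtains t where "has_terms \<phi> n k t"
proof -
  have kk: "k \<in> {1..k}"
    using chain_ge_1[OF chain] by simp
  obtain e where "degree f = e * degree (\<phi> k)"
    using dvd by (metis dvd_def mult.commute)
  then obtain g where g: "is_root e g" "degree g = degree (\<phi> k)" "g \<in> polys_over A"
    by (rule is_root_exists)
  note key = chain_key[OF chain kk]
  have "degree (\<phi> k - g) < degree (\<phi> k)"
    using g lead_coeff_keyD[OF key] degree_keyD[OF key]
    by (intro degree_diff_less_of_lead_coeff_eq) (auto simp: is_root_def)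
  then obtain b where "\<And>J. b J \<in> A" "\<phi> k - g = (\<Sum>J\<in>expon n k. Polynomial.smult (b J) (kmon \<phi> k J))"
    using chain_expansion[OF chain kk] polys_over_diff[OF chain_over[OF chain kk] g(3)] by metis
  then show thesis
    using that g(1,2) unfolding has_terms_def by blast
qed

text \<open>If \<open>ord\<close> is 1, the approximate root stays the same and its difference from
  the key polynomial loses exactly the term that was subtracted, so t drops. Otherwise the degree
  rises, which is left to the assumption \<open>IH\<close>, the hypothesis of an outer induction on
  the degree.\<close>

lemma chain_completes_same_degree:
  assumes IH: "\<And>k' \<phi>' n' c' j'. key_chain k' \<phi>' n' c' j' \<Longrightarrow> m < degree (\<phi>' k') \<Longrightarrow>
      \<exists>k \<phi> n c j. key_chain k \<phi> n c j \<and> W (\<phi> k) = \<infinity>"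
    and "key_chain k \<phi> n c j" "degree (\<phi> k) = m" "has_terms \<phi> n k t"
  shows "\<exists>k \<phi> n c j. key_chain k \<phi> n c j \<and> W (\<phi> k) = \<infinity>"
  using assms(2-)
proof (induction t arbitrary: k \<phi> n c j rule: less_induct)
  case (less t)
  note chain = less.prems(1)
  have kk: "k \<in> {1..k}"
    using chain_ge_1[OF chain] by simp
  note key = chain_key[OF chain kk]
  show ?case
  proof (cases "W (\<phi> k) = \<infinity>")
    case True
    then show ?thesis
      using chain by blast
  next
    case False
    then obtain \<mu> where \<mu>: "W (\<phi> k) = Fin \<mu>"
      using not_Minf[of "\<phi> k"] by (cases "W (\<phi> k)") auto
    define n' where "n' = n(k := ord (\<phi> k))"
    \<comment> \<open>Both cases produce the data for one application of \<open>least_term\<close>.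
      The bound t' matters when the degree stays the same, and then it is t.\<close>
    obtain t' e g b where g: "is_root e g" "degree g = ord (\<phi> k) * degree (\<phi> k)"
      and b: "\<And>J. b J \<in> A" "\<phi> k ^ ord (\<phi> k) - g = (\<Sum>J\<in>expon n' (Suc k). Polynomial.smult (b J) (kmon \<phi> (Suc k) J))"
        "card {J \<in> expon n' (Suc k). b J \<noteq> 0} \<le> t'" "ord (\<phi> k) = 1 \<Longrightarrow> t' = t"
    proof (cases "ord (\<phi> k) = 1")
      case True
      obtain e g b where *: "is_root e g" "degree g = degree (\<phi> k)" "\<And>J. b J \<in> A"
        "\<phi> k - g = (\<Sum>J\<in>expon n k. Polynomial.smult (b J) (kmon \<phi> k J))" "card {J \<in> expon n k. b J \<noteq> 0} \<le> t"
        using less.prems(3) unfolding has_terms_def by blast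
      \<comment> \<open>A digit with radix 1 is 0, so the additional place contributes no new
        exponents.\<close>
      have expon_eq: "expon n' (Suc k) = expon n k"
      proof -
        have eq: "expon n' k = expon n k"
          by (intro expon_cong) (simp add: n'_def)
        have "J \<in> expon n k" if "J \<in> expon n' (Suc k)" for J
        proof -
          have "J k < n' k"
            using that kk unfolding expon_def by simp
          then have "J(k := 0) = J"
            using True by (auto simp: n'_def)
          then show ?thesis
            using expon_upd[of k J n'] that kk eq by simp
        qed
        moreover have "J \<in> expon n' (Suc k)" if "J \<in> expon n k" for J
          using that kk True by (auto simp: expon_def n'_def)
        ultimately show ?thesis
          by blast
      qed
      have "kmon \<phi> (Suc k) J = kmon \<phi> k J" if "J \<in> expon n k" for J
        using that kk by (simp add: kmon_Suc expon_def)
      then have "(\<Sum>J\<in>expon n' (Suc k). Polynomial.smult (b J) (kmon \<phi> (Suc k) J)) = \<phi> k ^ ord (\<phi> k) - g"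
        unfolding expon_eq using * True by simp
      then show ?thesis
        using that[of e g b t] * True expon_eq by simp
    next
      case False
      obtain e where "degree f = e * (ord (\<phi> k) * degree (\<phi> k))"
        using ord_degree_dvd[OF key \<mu>] by (metis dvd_def mult.commute)
      then obtain g where g: "is_root e g" "degree g = ord (\<phi> k) * degree (\<phi> k)" "g \<in> polys_over A"
        by (rule is_root_exists)
      have m: "Polynomial.lead_coeff (\<phi> k ^ ord (\<phi> k)) = 1"
        "degree (\<phi> k ^ ord (\<phi> k)) = ord (\<phi> k) * degree (\<phi> k)"
        using degree_lead_coeff_power_monic[OF lead_coeff_keyD[OF key]] by auto
      have "degree (\<phi> k ^ ord (\<phi> k) - g) < ord (\<phi> k) * degree (\<phi> k)"
        using degree_diff_less_of_lead_coeff_eq[of "\<phi> k ^ ord (\<phi> k)" g] g m ord_pos[OF key \<mu>] degree_keyD[OF key]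
        by (simp add: is_root_def)
      also have "\<dots> = (\<Prod>i\<in>{1..<Suc k}. n' i)"
      proof -
        have "(\<Prod>i\<in>{1..<k}. n' i) = (\<Prod>i\<in>{1..<k}. n i)"
          by (intro prod.cong) (auto simp: n'_def)
        then show ?thesis
          using chain_degree[OF chain kk] kk by (simp add: n'_def mult.commute)
      qed
      finally have deg: "degree (\<phi> k ^ ord (\<phi> k) - g) < (\<Prod>i\<in>{1..<Suc k}. n' i)" .
      have "\<exists>b. (\<forall>J. b J \<in> A) \<and> \<phi> k ^ ord (\<phi> k) - g = (\<Sum>J\<in>expon n' (Suc k). Polynomial.smult (b J) (kmon \<phi> (Suc k) J))"
      proof (rule kmon_expansion[OF _ _ _ _ _ deg])
        fix l assume "l \<in> {1..<Suc k}"
        then have l: "l \<in> {1..k}"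
          by auto
        have "(\<Prod>i\<in>{1..<l}. n i) = (\<Prod>i\<in>{1..<l}. n' i)"
          using l by (intro prod.cong) (auto simp: n'_def)
        then show "degree (\<phi> l) = (\<Prod>i\<in>{1..<l}. n' i)"
          using chain_degree[OF chain l] by (rule trans[rotated])
        show "0 < n' l"
          using l chain_ord_pos[OF chain, of l] ord_pos[OF key \<mu>] by (auto simp: n'_def)
        show "Polynomial.lead_coeff (\<phi> l) = 1 \<and> \<phi> l \<in> polys_over A"
          using lead_coeff_keyD[OF chain_key[OF chain l]] chain_over[OF chain l] by blast
      next
        show "\<phi> k ^ ord (\<phi> k) - g \<in> polys_over A"
          by (intro polys_over_diff polys_over_power g(3) chain_over[OF chain kk])
      qed simp
      then show ?thesis
        using that[of e g _ "card {J \<in> expon n' (Suc k). _ J \<noteq> 0}"] g False by blast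
    qed
    obtain J where J: "J \<in> expon n k" "b J \<noteq> 0"
      "W (Polynomial.smult (b J) (kmon \<phi> k J)) = ord (\<phi> k) \<bullet> W (\<phi> k)"
      "ord (\<phi> k) \<bullet> W (\<phi> k) < W (\<phi> k ^ ord (\<phi> k) - Polynomial.smult (b J) (kmon \<phi> k J))"
      "kmon \<phi> (Suc k) J = kmon \<phi> k J" "J \<in> expon n' (Suc k)"
      using least_term[OF chain \<mu> n'_def g b(2)] by blast
    define \<phi>' where "\<phi>' = \<phi>(Suc k := \<phi> k ^ ord (\<phi> k) - Polynomial.smult (b J) (kmon \<phi> k J))"
    have chain': "key_chain (Suc k) \<phi>' n' (c(k := b J)) (\<lambda>l i. if i = k then J l else j l i)"
      unfolding \<phi>'_def n'_def by (rule chain_extend[OF chain \<mu> J(1) b(1) J(3,4)])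
    have deg': "degree (\<phi>' (Suc k)) = ord (\<phi> k) * m"
    proof -
      have "(\<Prod>i\<in>{1..<k}. n' i) = (\<Prod>i\<in>{1..<k}. n i)"
        by (intro prod.cong) (auto simp: n'_def)
      then show ?thesis
        using chain_degree[OF chain', of "Suc k"] chain_degree[OF chain kk] less.prems(2) kk
        by (simp add: n'_def)
    qed
    show ?thesis
    proof (cases "ord (\<phi> k) = 1")
      case False
      then have "m < ord (\<phi> k) * m"
        using ord_pos[OF key \<mu>] degree_keyD[OF key] less.prems(2) by simp
      then show ?thesis
        using IH[OF chain'] deg' by simp
    next
      case True
      let ?b = "b(J := 0)"
      let ?S = "{J \<in> expon n' (Suc k). b J \<noteq> 0}"
      have fin: "finite (expon n' (Suc k))"
        by simp
      have kmon_eq: "kmon \<phi>' (Suc k) I = kmon \<phi> (Suc k) I" for I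
        by (rule kmon_cong) (simp add: \<phi>'_def)
      have "\<phi>' (Suc k) - g = (\<phi> k ^ ord (\<phi> k) - g) - Polynomial.smult (b J) (kmon \<phi> (Suc k) J)"
        by (simp add: \<phi>'_def J(5))
      also have "\<dots> = (\<Sum>I\<in>expon n' (Suc k) - {J}. Polynomial.smult (b I) (kmon \<phi> (Suc k) I))"
        unfolding b(2) sum.remove[OF fin J(6), of "\<lambda>I. Polynomial.smult (b I) (kmon \<phi> (Suc k) I)"]
        by (rule add_diff_cancel_left')
      also have "\<dots> = (\<Sum>I\<in>expon n' (Suc k). Polynomial.smult (?b I) (kmon \<phi>' (Suc k) I))"
        using sum.remove[OF fin J(6), of "\<lambda>I. Polynomial.smult (?b I) (kmon \<phi>' (Suc k) I)"]
        by (simp add: kmon_eq)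
      finally have sum: "\<phi>' (Suc k) - g = (\<Sum>I\<in>expon n' (Suc k). Polynomial.smult (?b I) (kmon \<phi>' (Suc k) I))" .
      have "{I \<in> expon n' (Suc k). ?b I \<noteq> 0} = ?S - {J}"
        by auto
      moreover have "card (?S - {J}) < card ?S"
        using J(2,6) fin by (intro card_Diff1_less) auto
      ultimately have lt: "card {I \<in> expon n' (Suc k). ?b I \<noteq> 0} < t"
        using b(3) b(4)[OF True] by simp
      have "has_terms \<phi>' n' (Suc k) (card {I \<in> expon n' (Suc k). ?b I \<noteq> 0})"
        unfolding has_terms_def
        using g sum b(1) A_0 deg' less.prems(2) by (intro exI[of _ e] exI[of _ g] exI[of _ ?b]) auto
      then show ?thesis
        using less.IH[OF lt chain'] deg' True by simp
    qed
  qed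
qed

theorem complete_chain_exists: "\<exists>k \<phi> n c j. key_chain k \<phi> n c j \<and> W (\<phi> k) = \<infinity>"
proof -
  have "\<exists>k \<phi> n c j. key_chain k \<phi> n c j \<and> W (\<phi> k) = \<infinity>" if "key_chain k \<phi> n c j" for k \<phi> n c j
    using that
  \<comment> \<open>Degrees in a chain are bounded by deg f, so the degree can rise only finitely
    often.\<close>
  proof (induction "degree f - degree (\<phi> k)" arbitrary: k \<phi> n c j rule: less_induct)
    case less
    note chain = less.prems
    have kk: "k \<in> {1..k}"
      using chain_ge_1[OF chain] by simp
    show ?case
    proof (cases "W (\<phi> k) = \<infinity>")
      case True
      then show ?thesis
        using chain by blast
    next
      case False
      obtain e where "degree f = e * degree (\<phi> k)"
        by (rule degree_key_dvd_degree_f[OF chain_key[OF chain kk] False])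
      then obtain t where t: "has_terms \<phi> n k t"
        using has_terms_exists[OF chain] by (metis dvd_triv_right)
      show ?thesis
      proof (rule chain_completes_same_degree[OF _ chain refl t])
        fix k' \<phi>' n' c' j'
        assume chain': "key_chain k' \<phi>' n' c' j'" and lt: "degree (\<phi> k) < degree (\<phi>' k')"
        have "degree (\<phi>' k') \<le> degree f"
          using chain_degree_f[OF chain', of k'] chain_ge_1[OF chain'] by simp
        then show "\<exists>k \<phi> n c j. key_chain k \<phi> n c j \<and> W (\<phi> k) = \<infinity>"
          using lt by (intro less.hyps[OF _ chain']) simp
      qed
    qed
  qed
  then show ?thesis
    using key_chain_1 by blast
qed

end

section \<open>Approximants and value groups\<close>

lemma adic_coeff_z: "adic_coeff [:0, 1:] p i = [:Polynomial.coeff p i:]"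
proof -
  have "(\<Sum>j\<le>degree p. [:Polynomial.coeff p j:] * [:0, 1:] ^ j) = p"
    using poly_as_sum_of_monoms[of p] by (simp add: monom_altdef)
  from arg_cong[OF this, of "\<lambda>q. adic_coeff [:0, 1:] q i"]
  have "adic_coeff [:0, 1:] p i = (\<Sum>j\<le>degree p. adic_coeff [:0, 1:] ([:Polynomial.coeff p j:] * [:0, 1:] ^ j) i)"
    unfolding adic_coeff_sum by (rule sym)
  also have "\<dots> = (\<Sum>j\<le>degree p. if i = j then [:Polynomial.coeff p j:] else 0)"
  proof (intro sum.cong refl)
    fix j
    show "adic_coeff [:0, 1:] ([:Polynomial.coeff p j:] * [:0, 1:] ^ j) i = (if i = j then [:Polynomial.coeff p j:] else 0)"
      using adic_coeff_mult_power[of "[:0, 1:]" "[:Polynomial.coeff p j:]" j i]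
        adic_coeff_small[of "[:Polynomial.coeff p j:]" "[:0, 1:]" "i - j"] by auto
  qed
  also have "\<dots> = [:Polynomial.coeff p i:]"
    by (auto simp: coeff_eq_0)
  finally show ?thesis .
qed

lemma (in poly_pseudo_valuation) U_adic_term:
  assumes "0 < degree \<phi>"
  shows "U \<phi> (adic_term \<phi> p i) = W (adic_term \<phi> p i)"
proof (rule antisym)
  have "\<phi> \<noteq> 0"
    using assms by auto
  then have "adic_term \<phi> (adic_term \<phi> p i) s = (if s = i then adic_term \<phi> p i else 0)" for s
    using adic_coeff_mult_power[of \<phi> "adic_coeff \<phi> p i" i s]
      adic_coeff_small[OF degree_adic_coeff[OF assms], of p i "s - i"]
    by (auto simp: adic_term_def)
  then show "W (adic_term \<phi> p i) \<le> U \<phi> (adic_term \<phi> p i)"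
    by (simp add: U_ge_iff[OF assms])
qed (rule U_le_W[OF assms])

lemma augmentation_cong:
  assumes "0 < degree \<phi>" "\<And>p. degree p < degree \<phi> \<Longrightarrow> V p = V' p"
  shows "augmentation V \<phi> \<mu> = augmentation V' \<phi> \<mu>"
  unfolding augmentation_def using assms degree_adic_coeff[OF assms(1)] by simp

context unique_extension_over
begin

lemma first_stage_eq_U: "first_stage V0 (W [:0, 1:]) = U [:0, 1:]"
  unfolding first_stage_def U_def augmentation_def adic_coeff_z by simp

text \<open>Since W(f) = \<infinity>, every positive exponent has an infinite term, and only the
  remainder modulo f, which has the value of p, counts.\<close>

lemma U_f: "W = U f"
proof (rule ext, rule antisym)
  fix p
  show "U f p \<le> W p"
    by (rule U_le_W[OF degree_f_pos])
  have "W f = \<infinity>"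
    by (simp add: W_inf_iff)
  then have "W (adic_term f p i) = \<infinity>" if "i > 0" for i
    using that by (simp add: adic_term_def mult power nsc_inf)
  moreover have "W (adic_term f p 0) = W p"
  proof -
    have "W (p div f * f) = \<infinity>"
      using \<open>W f = \<infinity>\<close> by (simp add: mult)
    then have "W (p mod f) = W (p mod f + p div f * f)"
      using add_eq(1)[of "p mod f" "p div f * f"] add_eq(2)[of "p div f * f" "p mod f"]
      by (metis add_ge diff_ge add_diff_cancel_right' antisym le_Pinf min.absorb1)
    then show ?thesis
      by (simp add: adic_term_def adic_coeff_def)
  qed
  ultimately show "W p \<le> U f p"
    unfolding U_ge_iff[OF degree_f_pos] by (metis gr0I le_Pinf order_refl)
qed

text \<open>If the minimum were attained by a single term, W(f) = \<infinity> would be that minimum,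
  which forces W(\<phi>) = \<infinity>. Then all exponents attain it, also those with zero
  coefficient, and there is more than one because deg \<phi> > deg f would make W(f) finite.\<close>

lemma proj_pos:
  assumes "key \<phi>"
  shows "0 < proj (U \<phi>) \<phi> f"
proof -
  note pos = degree_keyD[OF assms]
  let ?N = "degree f div degree \<phi>"
  define J where "J = {i. i \<le> ?N \<and> W (adic_term \<phi> f i) = U \<phi> f}"
  have J_eq: "{i. i \<le> ?N \<and> U \<phi> f = U \<phi> (adic_coeff \<phi> f i * \<phi> ^ i)} = J"
    using U_adic_term[OF pos, of f] by (auto simp: J_def adic_term_def)
  have fin: "finite J"
    by (simp add: J_def)
  obtain i where "i \<le> ?N" "U \<phi> f = W (adic_term \<phi> f i)"
    by (rule U_attained)
  then have i: "i \<in> J"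
    by (simp add: J_def)
  have "\<exists>i'\<in>J. i' \<noteq> i"
  proof (rule ccontr)
    assume "\<not> ?thesis"
    then have only: "i' = i" if "i' \<in> J" for i'
      using that by blast
    have "U \<phi> f < W (adic_term \<phi> f i')" if "i' \<in> {..?N} - {i}" for i'
      using only[of i'] that U_le_term[OF pos, of f i'] by (force simp: J_def order_less_le)
    then have "W (\<Sum>i\<le>?N. adic_term \<phi> f i) = W (adic_term \<phi> f i)"
      using i by (intro sum_eq) (auto simp: J_def)
    then have "W f = W (adic_term \<phi> f i)"
      using adic_expansion[OF pos, of f] by (simp add: adic_term_def)
    then have "W (adic_term \<phi> f i) = \<infinity>"
      using W_inf_iff[of f] by simp
    then have inf: "U \<phi> f = \<infinity>"
      using i by (simp add: J_def)
    then have "W \<phi> = \<infinity>"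
      using U_finite[OF assms, of f] degree_f_pos by (metis degree_0 less_irrefl)
    then have "degree f \<le> degree \<phi>"
      using key_nonzero[OF assms] by (simp add: W_inf_iff dvd_imp_degree_le)
    have "{0, ?N} \<subseteq> J"
      using inf U_le_term[OF pos, of f] by (auto simp: J_def)
    then have "?N = 0"
      using only by blast
    then have "degree f < degree \<phi>"
      using pos by (simp add: div_eq_0_iff)
    then show False
      using key_finite[OF assms, of f] W_inf_iff[of f] degree_f_pos by (cases "f = 0") auto
  qed
  then obtain i' where i': "i' \<in> J" "i' \<noteq> i"
    by blast
  have "Min J \<le> i" "Min J \<le> i'" "i \<le> Max J" "i' \<le> Max J"
    using fin i i' by auto
  then have "Min J < Max J"
    using i'(2) by linarith
  then show ?thesis
    by (simp add: proj_def J_eq)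
qed

section \<open>Value groups of the stages\<close>

lemma value_group_V0: "value_group ring_of_type_algebra V0 = Gam 1"
proof -
  have "a - b \<in> Gam 1" if "V0 x = Fin a" "V0 y = Fin b" for a b x y
    using V0_divide[OF that] unfolding Gam_1 by blast
  moreover have "\<exists>x y. V0 x = Fin a \<and> V0 y = Fin 0" if "a \<in> Gam 1" for a
    using that V0.one unfolding Gam_1 zero_extended_def by blast
  ultimately show ?thesis
    unfolding value_group_def ring_of_type_algebra_def by auto (metis diff_zero)
qed

lemma value_group_W: "key f \<Longrightarrow> value_group ring_of_type_algebra W = Gam (degree f)"
proof -
  assume key: "key f"
  have val: "\<gamma> \<in> Gam (degree f)" if "W p = Fin \<gamma>" for p \<gamma>
  proof -
    have "W p = W (adic_term f p 0)"
    proof (rule antisym)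
      show "W p \<le> W (adic_term f p 0)"
        using U_le_term[OF degree_f_pos, of p 0] U_f by metis
      obtain i where i: "U f p = W (adic_term f p i)"
        by (rule U_attained)
      then have "i = 0"
        using that U_f W_inf_iff[of f] by (cases "i = 0") (auto simp: adic_term_def mult power nsc_inf)
      then show "W (adic_term f p 0) \<le> W p"
        using i U_f by simp
    qed
    then have "W (p mod f) = Fin \<gamma>"
      using that by (simp add: adic_term_def adic_coeff_def)
    moreover from this have "degree (p mod f) < degree f"
      using degree_mod_less[of f p] degree_f_pos by (cases "p mod f = 0"; cases "f = 0") auto
    ultimately show ?thesis
      by (auto simp: Gam_def)
  qed
  have "W 1 = Fin 0"
    by (simp flip: zero_extended_def)
  then have "\<exists>x y. W x = Fin a \<and> W y = Fin 0" if "a \<in> Gam (degree f)" for a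
    using that unfolding Gam_def by blast
  then show ?thesis
    unfolding value_group_def ring_of_type_algebra_def using Gam_diff[OF key] val
    by auto (metis diff_zero)
qed

context
  fixes \<phi> \<mu>
  assumes key: "key \<phi>" and \<mu>: "W \<phi> = Fin \<mu>"
begin

lemma value_group_U:
  "value_group ring_of_type_algebra (U \<phi>) = {\<alpha> + s \<bullet> \<mu> | \<alpha> s. \<alpha> \<in> Gam (degree \<phi>) \<and> s < ord \<phi>}"
    (is "?G = ?R")
proof
  note pos = degree_keyD[OF key]
  have red: "\<alpha> + s \<bullet> \<mu> \<in> ?R" if "\<alpha> \<in> Gam (degree \<phi>)" for \<alpha> s
  proof -
    have "s \<bullet> \<mu> = (s div ord \<phi> * ord \<phi> + s mod ord \<phi>) \<bullet> \<mu>"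
      by (simp only: div_mult_mod_eq)
    also have "\<dots> = (s div ord \<phi>) \<bullet> ord \<phi> \<bullet> \<mu> + (s mod ord \<phi>) \<bullet> \<mu>"
      by (simp only: nsc_add nsc_mult)
    finally have "\<alpha> + s \<bullet> \<mu> = (\<alpha> + (s div ord \<phi>) \<bullet> ord \<phi> \<bullet> \<mu>) + (s mod ord \<phi>) \<bullet> \<mu>"
      by (simp add: add.assoc)
    moreover have "\<alpha> + (s div ord \<phi>) \<bullet> ord \<phi> \<bullet> \<mu> \<in> Gam (degree \<phi>)"
      by (intro Gam_add[OF key] Gam_nsc[OF key] ord_in_Gam[OF key \<mu>] that)
    ultimately show ?thesis
      using ord_pos[OF key \<mu>] mod_less_divisor by blast
  qed
  have val: "\<exists>\<alpha> s. \<alpha> \<in> Gam (degree \<phi>) \<and> a = \<alpha> + s \<bullet> \<mu>" if "U \<phi> p = Fin a" for p a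
  proof -
    obtain i where i: "U \<phi> p = W (adic_term \<phi> p i)"
      by (rule U_attained)
    then show ?thesis
      using adic_term_value[OF key \<mu>, of p i] that by (metis extended.distinct(1) extended.inject)
  qed
  show "?G \<subseteq> ?R"
  proof
    fix x assume "x \<in> ?G"
    then obtain a b p q where x: "x = a - b" "U \<phi> p = Fin a" "U \<phi> q = Fin b"
      unfolding value_group_def by blast
    obtain \<alpha> \<beta> s t where st: "\<alpha> \<in> Gam (degree \<phi>)" "\<beta> \<in> Gam (degree \<phi>)"
        "a = \<alpha> + s \<bullet> \<mu>" "b = \<beta> + t \<bullet> \<mu>"
      using val[OF x(2)] val[OF x(3)] by blast
    \<comment> \<open>Negative multiples of \<mu> are traded for nonnegative ones: with n =
      \<open>ord \<phi>\<close>, -t \<mu> = t (n - 1) \<mu> - t n \<mu>, and n \<mu> lies in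
      \<open>Gam (degree \<phi>)\<close>.\<close>
    have "(ord \<phi>) \<bullet> \<mu> = (ord \<phi> - 1) \<bullet> \<mu> + \<mu>"
      using ord_pos[OF key \<mu>] nsc_add[of "ord \<phi> - 1" 1 \<mu>] by simp
    then have "t \<bullet> ord \<phi> \<bullet> \<mu> = (t * (ord \<phi> - 1)) \<bullet> \<mu> + t \<bullet> \<mu>"
      by (simp add: nsc_add_right nsc_mult)
    then have "x = (\<alpha> - \<beta> - t \<bullet> ord \<phi> \<bullet> \<mu>) + (s + t * (ord \<phi> - 1)) \<bullet> \<mu>"
      by (simp add: x(1) st nsc_add algebra_simps)
    also have "\<dots> \<in> ?R"
      by (intro red Gam_diff[OF key] Gam_nsc[OF key] ord_in_Gam[OF key \<mu>] st)
    finally show "x \<in> ?R" .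
  qed
  show "?R \<subseteq> ?G"
  proof
    fix x assume "x \<in> ?R"
    then obtain \<alpha> s p where x: "x = \<alpha> + s \<bullet> \<mu>" "degree p < degree \<phi>" "W p = Fin \<alpha>"
      by (auto simp: Gam_def)
    interpret U: pseudo_valuation "U \<phi>"
      by (rule pseudo_valuation_of_valuation) (use key \<mu> in \<open>intro valuation_U; simp\<close>)
    have "U \<phi> (p * \<phi> ^ s) = Fin x"
      using x by (simp add: U.mult U.power U_key[OF key] U_small \<mu> nsc_Fin)
    moreover have "U \<phi> 1 = Fin 0"
      using U.one by (simp add: zero_extended_def)
    ultimately show "x \<in> ?G"
      unfolding value_group_def ring_of_type_algebra_def by (metis (mono_tags, lifting) UNIV_I diff_zero mem_Collect_eq partial_object.select_convs(1))
  qed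
qed

lemma group_index_U: "group_index (value_group ring_of_type_algebra (U \<phi>)) (Gam (degree \<phi>)) = ord \<phi>"
proof -
  let ?H = "Gam (degree \<phi>)"
  let ?c = "\<lambda>a. (+) a ` ?H"
  have coset: "?c (\<alpha> + a) = ?c a" if "\<alpha> \<in> ?H" for \<alpha> a
  proof
    show "?c (\<alpha> + a) \<subseteq> ?c a"
    proof
      fix x assume "x \<in> ?c (\<alpha> + a)"
      then obtain h where "h \<in> ?H" "x = a + (\<alpha> + h)"
        by (auto simp: ac_simps)
      then show "x \<in> ?c a"
        using Gam_add[OF key that] by blast
    qed
    show "?c a \<subseteq> ?c (\<alpha> + a)"
    proof
      fix x assume "x \<in> ?c a"
      then obtain h where "h \<in> ?H" "x = (\<alpha> + a) + (h - \<alpha>)"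
        by auto
      then show "x \<in> ?c (\<alpha> + a)"
        using Gam_diff[OF key _ that] by blast
    qed
  qed
  have "?c ` value_group ring_of_type_algebra (U \<phi>) = (\<lambda>s. ?c (s \<bullet> \<mu>)) ` {..<ord \<phi>}"
  proof -
    have "?c ` value_group ring_of_type_algebra (U \<phi>) \<subseteq> (\<lambda>s. ?c (s \<bullet> \<mu>)) ` {..<ord \<phi>}"
      unfolding value_group_U using coset by auto
    moreover have "s \<bullet> \<mu> \<in> value_group ring_of_type_algebra (U \<phi>)" if "s < ord \<phi>" for s
      unfolding value_group_U using that Gam_0[OF degree_keyD[OF key]]
      by (auto intro!: exI[of _ "0::'g"] exI[of _ s])
    ultimately show ?thesis
      by auto
  qed
  moreover have "inj_on (\<lambda>s. ?c (s \<bullet> \<mu>)) {..<ord \<phi>}"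
  proof (rule inj_onI)
    fix s t assume st: "s \<in> {..<ord \<phi>}" "t \<in> {..<ord \<phi>}" "?c (s \<bullet> \<mu>) = ?c (t \<bullet> \<mu>)"
    have "s \<bullet> \<mu> + 0 \<in> ?c (s \<bullet> \<mu>)"
      using Gam_0[OF degree_keyD[OF key]] by blast
    then obtain h where "h \<in> ?H" "0 + s \<bullet> \<mu> = h + t \<bullet> \<mu>"
      using st(3) by (auto simp: add.commute)
    then show "s = t"
      using distinct_residues_Gam[OF key \<mu> Gam_0[OF degree_keyD[OF key]]] st by auto
  qed
  ultimately show ?thesis
    by (simp add: group_index_def card_image)
qed

text \<open>Connects consecutive stages: the value group of one stage is the group modulo which the
  next key value has its \<open>ord\<close>. Hence \<open>ord\<close> is the index of consecutive
  value groups.\<close>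

lemma value_group_U_eq_Gam: "value_group ring_of_type_algebra (U \<phi>) = Gam (ord \<phi> * degree \<phi>)"
proof
  note pos = degree_keyD[OF key]
  show "value_group ring_of_type_algebra (U \<phi>) \<subseteq> Gam (ord \<phi> * degree \<phi>)"
  proof
    fix x assume "x \<in> value_group ring_of_type_algebra (U \<phi>)"
    then obtain \<alpha> s p where x: "x = \<alpha> + s \<bullet> \<mu>" "s < ord \<phi>" "degree p < degree \<phi>" "W p = Fin \<alpha>"
      unfolding value_group_U by (auto simp: Gam_def)
    have "degree (p * \<phi> ^ s) < degree \<phi> + s * degree \<phi>"
      using degree_mult_le[of p "\<phi> ^ s"] degree_power_le[of \<phi> s] x(3) by (simp add: mult.commute)
    also have "\<dots> \<le> ord \<phi> * degree \<phi>"
      using mult_le_mono1[of "Suc s" "ord \<phi>" "degree \<phi>"] x(2) by simp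
    finally show "x \<in> Gam (ord \<phi> * degree \<phi>)"
      using x by (auto simp: Gam_def mult power \<mu> nsc_Fin)
  qed
  interpret U: pseudo_valuation "U \<phi>"
    by (rule pseudo_valuation_of_valuation) (use key \<mu> in \<open>intro valuation_U; simp\<close>)
  show "Gam (ord \<phi> * degree \<phi>) \<subseteq> value_group ring_of_type_algebra (U \<phi>)"
  proof
    fix x assume "x \<in> Gam (ord \<phi> * degree \<phi>)"
    then obtain p where "degree p < ord \<phi> * degree \<phi>" "W p = Fin x"
      by (auto simp: Gam_def)
    then have "U \<phi> p = Fin x"
      using U_eq_W[OF key \<mu>] by simp
    moreover have "U \<phi> 1 = Fin 0"
      using U.one by (simp add: zero_extended_def)
    ultimately show "x \<in> value_group ring_of_type_algebra (U \<phi>)"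
      unfolding value_group_def ring_of_type_algebra_def by (metis (mono_tags, lifting) UNIV_I diff_zero mem_Collect_eq partial_object.select_convs(1))
  qed
qed

end

section \<open>Chains as realizations of the algorithm\<close>

context
  fixes k \<phi> n c j
  assumes chain: "key_chain k \<phi> n c j"
begin

lemma chain_\<mu>:
  assumes "i \<in> {1..<k}"
  obtains \<mu> where "W (\<phi> i) = Fin \<mu>" "key (\<phi> i)" "n i = ord (\<phi> i)" "0 < n i"
proof -
  obtain \<mu> where "W (\<phi> i) = Fin \<mu>"
    using chain_finite[OF chain assms] not_Minf[of "\<phi> i"] by (cases "W (\<phi> i)") auto
  then show thesis
    using that chain_key[OF chain, of i] chain_ord[OF chain assms] chain_ord_pos[OF chain assms] assms by simp
qed

lemma chain_homogeneous:
  assumes i: "i \<in> {1..<k}"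
  shows "homogeneous_in (U (\<phi> i)) \<phi> i (\<phi> (Suc i))"
proof -
  obtain \<mu> where \<mu>: "W (\<phi> i) = Fin \<mu>" "key (\<phi> i)" "n i = ord (\<phi> i)" "0 < n i"
    by (rule chain_\<mu>[OF i])
  interpret U: pseudo_valuation "U (\<phi> i)"
    by (rule pseudo_valuation_of_valuation) (use \<mu> in \<open>intro valuation_U; simp\<close>)
  have st: "j l i < n l" "\<phi> (Suc i) = \<phi> i ^ n i - Polynomial.smult (c i) (kmon \<phi> i (\<lambda>l. j l i))"
      "W (Polynomial.smult (c i) (kmon \<phi> i (\<lambda>l. j l i))) = n i \<bullet> W (\<phi> i)" if "l \<in> {1..<i}" for l
    using chain_key_step[OF chain i] that by (auto simp: key_step_def)
  have st': "\<phi> (Suc i) = \<phi> i ^ n i - Polynomial.smult (c i) (kmon \<phi> i (\<lambda>l. j l i))"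
      "W (Polynomial.smult (c i) (kmon \<phi> i (\<lambda>l. j l i))) = n i \<bullet> W (\<phi> i)"
    using chain_key_step[OF chain i] by (auto simp: key_step_def)
  have c: "c i \<noteq> 0"
    using st'(2) \<mu>(1) by (auto simp: nsc_Fin)
  \<comment> \<open>The expansion consists of the power and the subtracted monomial. The exponent n
    i is admissible since only the places before i are bounded.\<close>
  define m1 where "m1 = (\<lambda>l. if l = i then n i else 0)"
  define m2 where "m2 = (\<lambda>l. if l \<in> {1..<i} then j l i else 0)"
  define a where "a m = (if m = m1 then 1 else - c i)" for m
  have ne: "m1 \<noteq> m2"
    using \<mu>(4) by (auto simp: m1_def m2_def fun_eq_iff)
  have set: "{1..i} = insert i {1..<i}"
    using i by auto
  have p1: "(\<Prod>l=1..i. \<phi> l ^ m1 l) = \<phi> i ^ n i"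
    unfolding set by (simp add: m1_def)
  have p2: "(\<Prod>l=1..i. \<phi> l ^ m2 l) = kmon \<phi> i (\<lambda>l. j l i)"
    unfolding set by (simp add: m2_def kmon_def)
  have div: "degree (\<phi> (l + 1)) div degree (\<phi> l) = n l" if "l \<in> {1..<i}" for l
  proof -
    have "degree (\<phi> l) = (\<Prod>x\<in>{1..<l}. n x)" "degree (\<phi> (Suc l)) = (\<Prod>x\<in>{1..<Suc l}. n x)"
      using chain_degree[OF chain] that i by auto
    moreover have "0 < degree (\<phi> l)"
      using chain_key[OF chain, of l] that i degree_keyD by auto
    ultimately show ?thesis
      using that by simp
  qed
  have exp2: "m2 \<in> expon n i"
    using st by (auto simp: m2_def expon_def)
  have "kmon \<phi> i m2 = kmon \<phi> i (\<lambda>l. j l i)"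
    by (intro kmon_cong) (auto simp: m2_def)
  then have deg2: "degree (Polynomial.smult (- c i) (kmon \<phi> i (\<lambda>l. j l i))) < degree (\<phi> i)"
    using chain_degree_kmon[OF chain _ exp2] i c by simp
  have v1: "U (\<phi> i) (Polynomial.smult (a m1) (\<Prod>l=1..i. \<phi> l ^ m1 l)) = n i \<bullet> W (\<phi> i)"
    using U_key[OF \<mu>(2)] unfolding p1 by (simp add: a_def U.power)
  have v2: "U (\<phi> i) (Polynomial.smult (a m2) (\<Prod>l=1..i. \<phi> l ^ m2 l)) = n i \<bullet> W (\<phi> i)"
    using U_small[OF deg2] st'(2) ne unfolding p2 by (simp add: a_def)
  show ?thesis
    unfolding homogeneous_in_def
  proof (intro exI conjI)
    show "finite {m1, m2}"
      by simp
    show "\<phi> (Suc i) = (\<Sum>m\<in>{m1, m2}. Polynomial.smult (a m) (\<Prod>l=1..i. \<phi> l ^ m l))"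
      using ne p1 p2 st' by (simp add: a_def)
    show "\<forall>m\<in>{m1, m2}. U (\<phi> i) (Polynomial.smult (a m) (\<Prod>l=1..i. \<phi> l ^ m l)) = n i \<bullet> W (\<phi> i)"
      using v1 v2 by simp
    show "\<forall>m\<in>{m1, m2}. (\<forall>l. l \<notin> {1..i} \<longrightarrow> m l = 0) \<and>
        (\<forall>l\<in>{1..<i}. m l < degree (\<phi> (l + 1)) div degree (\<phi> l)) \<and> a m \<noteq> 0"
    proof (intro ballI conjI allI impI)
      fix m l assume m: "m \<in> {m1, m2}"
      show "a m \<noteq> 0"
        using c by (simp add: a_def)
      show "m l = 0" if "l \<notin> {1..i}"
        using m that i by (auto simp: m1_def m2_def)
      show "m l < degree (\<phi> (l + 1)) div degree (\<phi> l)" if "l \<in> {1..<i}"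
      proof -
        have "0 < n l"
          using chain_ord_pos[OF chain, of l] that i by simp
        then show ?thesis
          unfolding div[OF that] using m st(1)[OF that] that by (auto simp: m1_def m2_def)
      qed
    qed
  qed
qed

lemma chain_augmentation:
  assumes i: "i \<in> {1..<k}"
  shows "U (\<phi> (Suc i)) = augmentation (U (\<phi> i)) (\<phi> (Suc i)) (W (\<phi> (Suc i)))"
proof -
  obtain \<mu> where \<mu>: "W (\<phi> i) = Fin \<mu>" "key (\<phi> i)" "n i = ord (\<phi> i)" "0 < n i"
    by (rule chain_\<mu>[OF i])
  have deg: "degree (\<phi> (Suc i)) = ord (\<phi> i) * degree (\<phi> i)"
    using chain_degree[OF chain, of i] chain_degree[OF chain, of "Suc i"] i \<mu>(3) by simp
  have "0 < degree (\<phi> (Suc i))"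
    using chain_key[OF chain, of "Suc i"] i degree_keyD by simp
  then show ?thesis
    unfolding U_def[of "\<phi> (Suc i)"]
    by (rule augmentation_cong) (simp add: U_eq_W[OF \<mu>(2,1)] deg)
qed

lemma chain_approximant:
  assumes "i \<in> {1..k}"
  shows "approximant V0 f \<phi> (\<lambda>l. W (\<phi> l)) (\<lambda>i. U (\<phi> i)) i"
  unfolding approximant_def
proof (intro conjI ballI)
  show "1 \<le> i" "\<phi> 1 = [:0, 1:]"
    using assms chain_1[OF chain] by auto
  show "U (\<phi> 1) = first_stage V0 (W (\<phi> 1))"
    using chain_1[OF chain] first_stage_eq_U by simp
  show "0 < proj (U (\<phi> i)) (\<phi> i) f"
    by (rule proj_pos[OF chain_key[OF chain assms]])
  show "W (\<phi> l) \<noteq> \<infinity>" if "l \<in> {1..<i}" for l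
    using chain_finite[OF chain, of l] that assms by simp
  fix l assume l: "l \<in> {2..i}"
  then obtain l' where l': "l = Suc l'" "l' \<in> {1..<k}"
    using assms by (cases l) auto
  show "key_polynomial (U (\<phi> (l - 1))) (\<phi> (l - 1)) (\<phi> l) (W (\<phi> l))"
    using chain_key_step[OF chain l'(2)] unfolding l'(1) key_step_def diff_Suc_1 by blast
  show "homogeneous_in (U (\<phi> (l - 1))) \<phi> (l - 1) (\<phi> l)"
    using chain_homogeneous[OF l'(2)] l'(1) by simp
  show "U (\<phi> l) = augmentation (U (\<phi> (l - 1))) (\<phi> l) (W (\<phi> l))"
    using chain_augmentation[OF l'(2)] l'(1) by simp
qed simp

lemma chain_stage_group:
  assumes "i \<in> {1..k}"
  shows "stage_group V0 (\<lambda>i. U (\<phi> i)) (i - 1) = Gam (degree (\<phi> i))"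
proof (cases "i = 1")
  case True
  then show ?thesis
    using chain_1[OF chain] by (simp add: stage_group_def value_group_V0)
next
  case False
  then obtain i' where i': "i = Suc i'" "i' \<in> {1..<k}"
    using assms by (cases i) auto
  obtain \<mu> where \<mu>: "W (\<phi> i') = Fin \<mu>" "key (\<phi> i')" "n i' = ord (\<phi> i')" "0 < n i'"
    by (rule chain_\<mu>[OF i'(2)])
  have deg: "degree (\<phi> (Suc i')) = ord (\<phi> i') * degree (\<phi> i')"
    using chain_degree[OF chain, of i'] chain_degree[OF chain, of "Suc i'"] i' \<mu>(3) by simp
  show ?thesis
    using value_group_U_eq_Gam[OF \<mu>(2,1)] i' by (simp add: stage_group_def deg)
qed

lemma chain_group_index:
  assumes "i \<in> {1..<k}"
  shows "n i = group_index (stage_group V0 (\<lambda>i. U (\<phi> i)) i) (stage_group V0 (\<lambda>i. U (\<phi> i)) (i - 1))"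
proof -
  obtain \<mu> where \<mu>: "W (\<phi> i) = Fin \<mu>" "key (\<phi> i)" "n i = ord (\<phi> i)" "0 < n i"
    by (rule chain_\<mu>[OF assms])
  show ?thesis
    using chain_stage_group[of i] group_index_U[OF \<mu>(2,1)] \<mu>(3) assms by (simp add: stage_group_def)
qed

lemma chain_expansion_K:
  assumes "i \<in> {1..k}" "degree p < degree (\<phi> i)"
  obtains b where "p = (\<Sum>J\<in>expon n i. Polynomial.smult (b J) (kmon \<phi> i J))"
proof -
  interpret K: subring_type "UNIV :: 'a set"
    by unfold_locales auto
  have "\<exists>b. (\<forall>J. b J \<in> UNIV) \<and> p = (\<Sum>J\<in>expon n i. Polynomial.smult (b J) (kmon \<phi> i J))"
  proof (rule K.kmon_expansion)
    fix l assume l: "l \<in> {1..<i}"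
    then have l': "l \<in> {1..k}" "l \<in> {1..<k}"
      using assms(1) by auto
    show "degree (\<phi> l) = (\<Prod>i\<in>{1..<l}. n i)" "0 < n l"
      by (rule chain_degree[OF chain l'(1)], rule chain_ord_pos[OF chain l'(2)])
    show "Polynomial.lead_coeff (\<phi> l) = 1 \<and> \<phi> l \<in> polys_over UNIV"
      using lead_coeff_keyD[OF chain_key[OF chain l'(1)]] by (simp add: polys_over_def)
  qed (use assms chain_degree[OF chain] in \<open>auto simp: polys_over_def\<close>)
  then show thesis
    using that by blast
qed

text \<open>This will give the linear independence of the initial forms of the monomials; the
  version with \<le> will show that the coefficients of a homogeneous element respect the
  grading.\<close>

lemma W_kmon_sum_gt_iff:
  assumes "i \<in> {1..k}" "\<gamma> \<noteq> \<infinity>"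
  shows "\<gamma> < W (\<Sum>J\<in>expon n i. Polynomial.smult (b J) (kmon \<phi> i J)) \<longleftrightarrow>
    (\<forall>J\<in>expon n i. \<gamma> < W (Polynomial.smult (b J) (kmon \<phi> i J)))"
  using W_kmon_sum_le[OF chain assms(1)] sum_gtI[OF assms(2), of "expon n i" "\<lambda>J. Polynomial.smult (b J) (kmon \<phi> i J)"]
  by (meson order_less_le_trans)

lemma W_kmon_sum_ge_iff:
  assumes "i \<in> {1..k}"
  shows "\<gamma> \<le> W (\<Sum>J\<in>expon n i. Polynomial.smult (b J) (kmon \<phi> i J)) \<longleftrightarrow>
    (\<forall>J\<in>expon n i. \<gamma> \<le> W (Polynomial.smult (b J) (kmon \<phi> i J)))"
  using W_kmon_sum_le[OF chain assms(1)] sum_geI[of "expon n i" \<gamma> "\<lambda>J. Polynomial.smult (b J) (kmon \<phi> i J)"]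
  by (meson order_trans)

section \<open>The complete chain\<close>

context
  assumes complete: "W (\<phi> k) = \<infinity>"
begin

lemma complete_eq_f: "\<phi> k = f"
proof -
  have kk: "k \<in> {1..k}"
    using chain_ge_1[OF chain] by simp
  have "f dvd \<phi> k"
    using complete by (simp add: W_inf_iff)
  then obtain q where q: "\<phi> k = f * q"
    by blast
  have nz: "\<phi> k \<noteq> 0"
    using key_nonzero[OF chain_key[OF chain kk]] .
  then have "degree (\<phi> k) = degree f + degree q"
    using q by (auto simp: Polynomial.degree_mult_eq)
  then have "degree q = 0"
    using chain_degree_f[OF chain kk] by simp
  moreover have "Polynomial.lead_coeff q = 1"
    using lead_coeff_keyD[OF chain_key[OF chain kk]] monic_f unfolding q lead_coeff_mult by simp
  ultimately have "q = 1"
    by (metis degree_eq_zeroE coeff_pCons_0 one_pCons)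
  then show ?thesis
    using q by simp
qed

text \<open>Each value of a polynomial of degree below deg f is the value of a term of its
  expansion, so the monomials represent all cosets of the value group of \<open>V0\<close>, and by
  \<open>kmon_values_distinct\<close> each coset once. Their number, the product of the n l, is deg
  f.\<close>

lemma complete_group_index: "group_index (value_group ring_of_type_algebra W) (value_group ring_of_type_algebra V0) = degree f"
proof -
  have kk: "k \<in> {1..k}"
    using chain_ge_1[OF chain] by simp
  have keyf: "key f"
    using chain_key[OF chain kk] complete_eq_f by simp
  have deg: "degree f = (\<Prod>l\<in>{1..<k}. n l)"
    using chain_degree[OF chain kk] complete_eq_f by simp
  let ?H = "Gam 1" and ?G = "Gam (degree f)"
  let ?c = "\<lambda>a. (+) a ` ?H"
  have H_eq: "?H = {\<gamma>. \<exists>a. V0 a = Fin \<gamma>}"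
    using Gam_1 by blast
  define v where "v J = (THE \<gamma>. W (kmon \<phi> k J) = Fin \<gamma>)" for J
  have v: "W (kmon \<phi> k J) = Fin (v J)" for J
  proof -
    obtain \<gamma> where "W (kmon \<phi> k J) = Fin \<gamma>"
      using kmon_finite[OF chain kk, of 1 J] not_Minf[of "kmon \<phi> k J"] by (cases "W (kmon \<phi> k J)") auto
    then show ?thesis
      by (simp add: v_def)
  qed
  have "?c ` ?G = (\<lambda>J. ?c (v J)) ` expon n k"
  proof
    show "?c ` ?G \<subseteq> (\<lambda>J. ?c (v J)) ` expon n k"
    proof
      fix C assume "C \<in> ?c ` ?G"
      then obtain \<gamma> p where C: "C = ?c \<gamma>" "degree p < degree f" "W p = Fin \<gamma>"
        by (auto simp: Gam_def)
      then obtain b where b: "p = (\<Sum>J\<in>expon n k. Polynomial.smult (b J) (kmon \<phi> k J))"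
        using chain_expansion_K[OF kk, of p] complete_eq_f by auto
      have "\<exists>J\<in>expon n k. W (Polynomial.smult (b J) (kmon \<phi> k J)) = Fin \<gamma>"
      proof (rule ccontr)
        assume "\<not> ?thesis"
        then have "Fin \<gamma> < W (Polynomial.smult (b J) (kmon \<phi> k J))" if "J \<in> expon n k" for J
          using W_kmon_sum_le[OF chain kk that, of b] C(3) that unfolding b[symmetric] by (force simp: order_less_le)
        then have "Fin \<gamma> < W p"
          using W_kmon_sum_gt_iff[OF kk, of "Fin \<gamma>" b] b by simp
        then show False
          using C(3) by simp
      qed
      then obtain J where J: "J \<in> expon n k" "V0 (b J) + Fin (v J) = Fin \<gamma>"
        by (auto simp: W_smult v)
      obtain \<beta> where \<beta>: "V0 (b J) = Fin \<beta>"
        using J(2) by (cases "V0 (b J)") auto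
      have \<gamma>: "\<gamma> = v J + \<beta>"
        using J(2) \<beta> by (simp add: add.commute)
      have "?c \<gamma> = ?c (v J)"
      proof
        show "?c \<gamma> \<subseteq> ?c (v J)"
        proof
          fix x assume "x \<in> ?c \<gamma>"
          then obtain h a where h: "x = \<gamma> + h" "V0 a = Fin h"
            unfolding H_eq by blast
          have "V0 (b J * a) = Fin (\<beta> + h)"
            using h(2) \<beta> by (simp add: V0.mult)
          then have "x = v J + (\<beta> + h)" "\<beta> + h \<in> ?H"
            using h(1) unfolding H_eq \<gamma> by (auto simp: add.assoc)
          then show "x \<in> ?c (v J)"
            by blast
        qed
        show "?c (v J) \<subseteq> ?c \<gamma>"
        proof
          fix x assume "x \<in> ?c (v J)"
          then obtain h a where h: "x = v J + h" "V0 a = Fin h"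
            unfolding H_eq by blast
          then have "x = \<gamma> + (h - \<beta>)" "h - \<beta> \<in> ?H"
            using V0_divide[OF h(2) \<beta>] unfolding \<gamma> H_eq by (simp, blast)
          then show "x \<in> ?c \<gamma>"
            by blast
        qed
      qed
      then show "C \<in> (\<lambda>J. ?c (v J)) ` expon n k"
        using C(1) J(1) by blast
    qed
    have "v J \<in> ?G" if "J \<in> expon n k" for J
      using chain_degree_kmon[OF chain kk that] v[of J] complete_eq_f by (auto simp: Gam_def)
    then show "(\<lambda>J. ?c (v J)) ` expon n k \<subseteq> ?c ` ?G"
      by blast
  qed
  moreover have "inj_on (\<lambda>J. ?c (v J)) (expon n k)"
  proof (rule inj_onI)
    fix I J assume IJ: "I \<in> expon n k" "J \<in> expon n k" "?c (v I) = ?c (v J)"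
    have "v I + 0 \<in> ?c (v I)"
      by (rule imageI) (simp add: Gam_0)
    then obtain h a where a: "v I = v J + h" "V0 a = Fin h"
      unfolding IJ(3) unfolding H_eq by auto
    then have "a \<noteq> 0" "W (Polynomial.smult 1 (kmon \<phi> k I)) = W (Polynomial.smult a (kmon \<phi> k J))"
      by (auto simp: W_smult v add.commute)
    then show "I = J"
      using kmon_values_distinct[OF chain kk IJ(1,2)] by (metis zero_neq_one)
  qed
  ultimately show ?thesis
    using chain_ge_1[OF chain] by (simp add: group_index_def value_group_W[OF keyf] value_group_V0 card_image card_expon deg)
qed

lemma complete_realization:
  assumes "\<And>a. a \<in> A \<Longrightarrow> 0 \<le> V0 a"
  shows "realization V0 W f k \<phi> (\<lambda>i. U (\<phi> i)) n c j"
  unfolding realization_def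
proof (intro conjI ballI)
  show "approximant V0 f \<phi> (\<lambda>l. W (\<phi> l)) (\<lambda>i. U (\<phi> i)) i" if "i \<in> {1..k}" for i
    by (rule chain_approximant[OF that])
  fix i assume i: "i \<in> {2..k}"
  then obtain i' where i': "i = Suc i'" "i' \<in> {1..<k}"
    by (cases i) auto
  have st: "c i' \<in> A" "\<And>l. l \<in> {1..<i'} \<Longrightarrow> j l i' < n l"
    "\<phi> (Suc i') = \<phi> i' ^ n i' - Polynomial.smult (c i') (kmon \<phi> i' (\<lambda>l. j l i'))"
    using chain_key_step[OF chain i'(2)] by (auto simp: key_step_def)
  have set: "{1..i - 2} = {1..<i'}"
    using i' by auto
  show "\<phi> i = \<phi> (i - 1) ^ n (i - 1) - Polynomial.smult (c (i - 1)) (\<Prod>l = 1..i - 2. \<phi> l ^ j l (i - 1))"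
    unfolding set using st(3) i'(1) by (simp add: kmon_def)
  show "c (i - 1) \<in> val_ring ring_of_type_algebra V0"
    using assms[OF st(1)] i'(1) by (simp add: val_ring_def ring_of_type_algebra_def)
  show "n (i - 1) = group_index (stage_group V0 (\<lambda>i. U (\<phi> i)) (i - 1)) (stage_group V0 (\<lambda>i. U (\<phi> i)) (i - 2))"
    using chain_group_index[OF i'(2)] i'(1) by (simp add: numeral_2_eq_2)
  show "j l (i - 1) < n l" if "l \<in> {1..i - 2}" for l
    using st(2)[of l] that i'(1) unfolding set by simp
qed

end

end

end

section \<open>Integrality over the valuation ring\<close>

definition coeffs_in :: "'b::comm_ring_1 set \<Rightarrow> 'b poly set" where
  "coeffs_in S = {P. \<forall>i. Polynomial.coeff P i \<in> S}"

text \<open>Stated for subsets of a ring type rather than for ring records, so that it applies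
  equally in K[z], in polynomial rings over it and in Rees algebras.\<close>

definition subring_set :: "'b::comm_ring_1 set \<Rightarrow> bool" where
  "subring_set S \<longleftrightarrow> 1 \<in> S \<and> (\<forall>a\<in>S. \<forall>b\<in>S. a - b \<in> S) \<and> (\<forall>a\<in>S. \<forall>b\<in>S. a * b \<in> S)"

lemma subring_setD:
  assumes "subring_set S"
  shows "1 \<in> S" "0 \<in> S" "a \<in> S \<Longrightarrow> b \<in> S \<Longrightarrow> a - b \<in> S" "a \<in> S \<Longrightarrow> b \<in> S \<Longrightarrow> a + b \<in> S"
    "a \<in> S \<Longrightarrow> b \<in> S \<Longrightarrow> a * b \<in> S" "a \<in> S \<Longrightarrow> - a \<in> S" "a \<in> S \<Longrightarrow> a ^ i \<in> S"
proof -
  show 1: "1 \<in> S" and diff: "\<And>a b. a \<in> S \<Longrightarrow> b \<in> S \<Longrightarrow> a - b \<in> S" and mult: "\<And>a b. a \<in> S \<Longrightarrow> b \<in> S \<Longrightarrow> a * b \<in> S"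
    using assms by (auto simp: subring_set_def)
  show 0: "0 \<in> S"
    using diff[OF 1 1] by simp
  show neg: "\<And>a. a \<in> S \<Longrightarrow> - a \<in> S"
    using diff[OF 0] by simp
  show "\<And>a b. a \<in> S \<Longrightarrow> b \<in> S \<Longrightarrow> a + b \<in> S"
    using diff neg by (metis diff_minus_eq_add)
  show "a \<in> S \<Longrightarrow> a ^ i \<in> S"
    using 1 mult by (induction i) auto
qed

lemma subring_set_sum: "subring_set S \<Longrightarrow> (\<And>i. i \<in> I \<Longrightarrow> a i \<in> S) \<Longrightarrow> (\<Sum>i\<in>I. a i) \<in> S"
  by (induction I rule: infinite_finite_induct) (auto intro: subring_setD)

lemma subring_set_coeffs_in: "subring_set S \<Longrightarrow> subring_set (coeffs_in S)"
  unfolding subring_set_def[of "coeffs_in S"]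
  by (auto simp: coeffs_in_def coeff_mult intro!: subring_set_sum intro: subring_setD)

text \<open>
  A subring of \<open>K[z]\<close> that is a union of classes modulo \<open>f\<close> stands for a subring of \<open>K[z]/(f)\<close>.
\<close>

definition saturated :: "'a::field poly \<Rightarrow> 'a poly set \<Rightarrow> bool" where
  "saturated f S \<longleftrightarrow> subring_set S \<and> (\<forall>p\<in>S. \<forall>q. [p = q] (mod f) \<longrightarrow> q \<in> S)"

definition adjoin :: "'a::field poly \<Rightarrow> 'a poly set \<Rightarrow> 'a poly \<Rightarrow> 'a poly set" where
  "adjoin f S x = {q. \<exists>P\<in>coeffs_in S. [q = poly P x] (mod f)}"

lemma saturated_adjoin:
  assumes "subring_set S"
  shows "saturated f (adjoin f S x)"
proof -
  note C = subring_setD[OF subring_set_coeffs_in[OF assms]]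
  have "1 \<in> adjoin f S x"
    unfolding adjoin_def using C(1) by (auto intro!: bexI[of _ 1])
  moreover have "a - b \<in> adjoin f S x" "a * b \<in> adjoin f S x" if "a \<in> adjoin f S x" "b \<in> adjoin f S x" for a b
  proof -
    from that obtain P Q where PQ: "P \<in> coeffs_in S" "[a = poly P x] (mod f)" "Q \<in> coeffs_in S" "[b = poly Q x] (mod f)"
      unfolding adjoin_def by blast
    have "[a - b = poly (P - Q) x] (mod f)" "[a * b = poly (P * Q) x] (mod f)"
      using cong_diff[OF PQ(2,4)] cong_mult[OF PQ(2,4)] by (simp_all only: poly_diff poly_mult)
    then show "a - b \<in> adjoin f S x" "a * b \<in> adjoin f S x"
      unfolding adjoin_def using C(3)[OF PQ(1,3)] C(5)[OF PQ(1,3)] by blast+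
  qed
  moreover have "q \<in> adjoin f S x" if "p \<in> adjoin f S x" "[p = q] (mod f)" for p q
    using that unfolding adjoin_def by (blast intro: cong_trans cong_sym)
  ultimately show ?thesis
    by (auto simp: saturated_def subring_set_def)
qed

lemma adjoin_superset:
  assumes "subring_set S"
  shows "S \<subseteq> adjoin f S x" "x \<in> adjoin f S x"
proof -
  note S = subring_setD[OF assms]
  have "[:a:] \<in> coeffs_in S" if "a \<in> S" for a
    using that S(2) by (auto simp: coeffs_in_def coeff_pCons split: nat.split)
  then show "S \<subseteq> adjoin f S x"
    unfolding adjoin_def by (auto intro!: bexI[of _ "[:_:]"])
  have "[:0, 1:] \<in> coeffs_in S"
    using S by (auto simp: coeffs_in_def coeff_pCons split: nat.split)
  then show "x \<in> adjoin f S x"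
    unfolding adjoin_def by (auto intro!: bexI[of _ "[:0, 1:]"])
qed

section \<open>Chevalley's extension argument\<close>

locale dominating_subring =
  fixes f :: "'a::field poly" and V0 :: "'a \<Rightarrow> 'g::linordered_ab_group_add extended" and y :: "'a poly"
  assumes V0: "valuation_on (ring_of_type_algebra :: 'a ring) V0"
begin

sublocale V0: pseudo_valuation V0
  using V0 by (rule pseudo_valuation_of_valuation)

lemma V0_inf: "V0 a = \<infinity> \<longleftrightarrow> a = 0"
  using V0 unfolding valuation_on_type_algebra by blast

lemma V0_le_dvd:
  assumes "V0 a \<le> V0 b" "a \<noteq> 0"
  shows "0 \<le> V0 (b / a)"
proof -
  have fin: "V0 a \<noteq> \<infinity>" "V0 a \<noteq> -\<infinity>"
    using assms(2) V0_inf by auto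
  have "0 + V0 a \<le> V0 (b / a) + V0 a"
    using assms V0.mult[of "b / a" a] by simp
  then show ?thesis
    using extended_add_cancel(2)[OF fin, of 0 "V0 (b / a)"] by blast
qed

text \<open>For a subring S containing the constants of nonnegative value, this is the ideal
  generated by y and the maximal ideal of \<open>V0\<close>. A single constant m per element
  suffices, because of two constants one divides the other in the valuation ring. In the application
  y is an inverse modulo f of an element that is supposed not to be integral.\<close>

definition I :: "'a poly set \<Rightarrow> 'a poly set" where
  "I S = {y * t + [:m:] * s | t s m. t \<in> S \<and> s \<in> S \<and> 0 < V0 m}"

definition proper :: "'a poly set \<Rightarrow> bool" where
  "proper S \<longleftrightarrow> saturated f S \<and> y \<in> S \<and> (\<forall>a. 0 \<le> V0 a \<longrightarrow> [:a:] \<in> S) \<and> (\<forall>b\<in>I S. \<not> [b = 1] (mod f))"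

context
  fixes S
  assumes S: "subring_set S" and R: "\<And>a. 0 \<le> V0 a \<Longrightarrow> [:a:] \<in> S"
begin

lemma I_add:
  assumes "b \<in> I S" "b' \<in> I S"
  shows "b + b' \<in> I S"
proof -
  note S' = subring_setD[OF S]
  \<comment> \<open>If \<open>V0 m \<le> V0 m'\<close>, then m' is a multiple of m by a constant in
    S, and the two constant parts merge. The case m = 0 has to be separated, as then no quotient
    exists.\<close>
  have main: "y * t + [:m:] * s + (y * t' + [:m':] * s') \<in> I S"
    if "t \<in> S" "s \<in> S" "0 < V0 m" "t' \<in> S" "s' \<in> S" "0 < V0 m'" "V0 m \<le> V0 m'" for t s m t' s' m'
  proof (cases "m = 0")
    case True
    then have "m' = 0"
      using that(7) V0_inf by auto
    then have "y * t + [:m:] * s + (y * t' + [:m':] * s') = y * (t + t') + [:0:] * s"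
      using True by (simp add: algebra_simps)
    moreover have "0 < V0 0"
      by (simp add: less_inf_iff)
    ultimately show ?thesis
      unfolding I_def using S'(4)[OF that(1,4)] that(2) by blast
  next
    case False
    have "[:m' / m:] \<in> S"
      using R V0_le_dvd[OF that(7) False] by blast
    then have "s + [:m' / m:] * s' \<in> S"
      using that S' by blast
    moreover have "y * t + [:m:] * s + (y * t' + [:m':] * s') = y * (t + t') + [:m:] * (s + [:m' / m:] * s')"
      using False by (simp add: algebra_simps)
    ultimately show ?thesis
      unfolding I_def using that S'(4) by blast
  qed
  obtain t s m where 1: "b = y * t + [:m:] * s" "t \<in> S" "s \<in> S" "0 < V0 m"
    using assms(1) by (auto simp: I_def)
  obtain t' s' m' where 2: "b' = y * t' + [:m':] * s'" "t' \<in> S" "s' \<in> S" "0 < V0 m'"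
    using assms(2) by (auto simp: I_def)
  show ?thesis
    using main[of t s m t' s' m'] main[of t' s' m' t s m] 1 2 by (cases "V0 m \<le> V0 m'") (auto simp: add.commute)
qed

lemma I_mult: "b \<in> I S \<Longrightarrow> x \<in> S \<Longrightarrow> x * b \<in> I S"
proof -
  assume "b \<in> I S" "x \<in> S"
  then obtain t s m where "b = y * t + [:m:] * s" "t \<in> S" "s \<in> S" "0 < V0 m"
    by (auto simp: I_def)
  then have "x * b = y * (x * t) + [:m:] * (x * s)" "x * t \<in> S" "x * s \<in> S" "0 < V0 m"
    using \<open>x \<in> S\<close> subring_setD[OF S] by (auto simp: algebra_simps)
  then show ?thesis
    unfolding I_def by blast
qed

lemma I_0: "0 \<in> I S"
proof -
  have "(0::'a poly) = y * 0 + [:0:] * 0" "0 < V0 0"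
    by (simp_all add: less_inf_iff)
  then show ?thesis
    unfolding I_def using subring_setD(2)[OF S] by blast
qed

lemma I_sum: "(\<And>i. i \<in> A \<Longrightarrow> b i \<in> I S) \<Longrightarrow> (\<Sum>i\<in>A. b i) \<in> I S"
  by (induction A rule: infinite_finite_induct) (auto intro: I_0 I_add)

lemma I_subset: "y \<in> S \<Longrightarrow> I S \<subseteq> S"
proof
  fix b assume "y \<in> S" "b \<in> I S"
  then obtain t s m where b: "b = y * t + [:m:] * s" "t \<in> S" "s \<in> S" "0 < V0 m"
    unfolding I_def by blast
  then have "[:m:] \<in> S"
    using R by (blast dest: order_less_imp_le)
  then show "b \<in> S"
    unfolding b(1) using \<open>y \<in> S\<close> b(2,3) subring_setD(4,5)[OF S] by blast
qed

end

context
  fixes S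
  assumes proper: "proper S" and maximal: "\<And>T. proper T \<Longrightarrow> S \<subseteq> T \<Longrightarrow> T = S"
begin

lemma S_facts: "subring_set S" "0 \<le> V0 a \<Longrightarrow> [:a:] \<in> S" "y \<in> S" "b \<in> I S \<Longrightarrow> \<not> [b = 1] (mod f)"
  "p \<in> S \<Longrightarrow> [p = q] (mod f) \<Longrightarrow> q \<in> S"
  using proper by (auto simp: proper_def saturated_def)

lemmas S_closed = subring_setD[OF S_facts(1)]
lemma I_closed:
  "b \<in> I S \<Longrightarrow> b' \<in> I S \<Longrightarrow> b + b' \<in> I S" "b \<in> I S \<Longrightarrow> x \<in> S \<Longrightarrow> x * b \<in> I S"
  "(\<And>i. i \<in> A \<Longrightarrow> c i \<in> I S) \<Longrightarrow> (\<Sum>i\<in>A. c i) \<in> I S" "b \<in> I S \<Longrightarrow> b \<in> S"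
  using I_add[OF S_facts(1)] I_mult[OF S_facts(1)] I_sum[OF S_facts(1)] I_subset[OF S_facts(1)] S_facts(2,3)
  by blast+

text \<open>The localization of S at the powers of 1 - b still has a proper ideal, so by maximality
  it is S itself. The point is that (1 - b)^N is 1 modulo the ideal: clearing denominators in an
  equation for 1 in the larger ideal gives one in the ideal of S.\<close>

lemma inverse_in_S:
  assumes b: "b \<in> I S" and q: "[(1 - b) * q = 1] (mod f)"
  shows "q \<in> S"
proof -
  define T where "T = {x. \<exists>N. (1 - b) ^ N * x \<in> S}"
  have b1: "(1 - b) ^ N \<in> S" for N
    by (intro S_closed(1,3,7) I_closed(4)[OF b])
  have ST: "S \<subseteq> T"
    unfolding T_def by (auto intro!: exI[of _ 0])
  have common: "\<exists>N. (1 - b) ^ N * x \<in> S \<and> (1 - b) ^ N * x' \<in> S" if "x \<in> T" "x' \<in> T" for x x'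
  proof -
    from that obtain N N' where "(1 - b) ^ N * x \<in> S" "(1 - b) ^ N' * x' \<in> S"
      unfolding T_def by blast
    then have "(1 - b) ^ (N + N') * x \<in> S" "(1 - b) ^ (N + N') * x' \<in> S"
      using S_closed(5)[OF b1[of N'], of "(1 - b) ^ N * x"] S_closed(5)[OF b1[of N], of "(1 - b) ^ N' * x'"]
      by (simp_all add: power_add ac_simps)
    then show ?thesis
      by blast
  qed
  have "saturated f T"
    unfolding saturated_def subring_set_def
  proof (intro conjI ballI allI impI)
    show "1 \<in> T"
      using ST S_closed(1) by blast
    fix x assume x: "x \<in> T"
    show "x - x' \<in> T" "x * x' \<in> T" if x': "x' \<in> T" for x'
    proof -
      obtain N where N: "(1 - b) ^ N * x \<in> S" "(1 - b) ^ N * x' \<in> S"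
        using common[OF x x'] by blast
      have "(1 - b) ^ N * (x - x') \<in> S" "(1 - b) ^ (N + N) * (x * x') \<in> S"
        using S_closed(3)[OF N] S_closed(5)[OF N] by (simp_all add: algebra_simps power_add)
      then show "x - x' \<in> T" "x * x' \<in> T"
        unfolding T_def by blast+
    qed
    show "x' \<in> T" if "[x = x'] (mod f)" for x'
    proof -
      obtain N where "(1 - b) ^ N * x \<in> S"
        using x by (auto simp: T_def)
      then have "(1 - b) ^ N * x' \<in> S"
        using S_facts(5) cong_scalar_left[OF that] by blast
      then show ?thesis
        unfolding T_def by blast
    qed
  qed
  moreover have "\<not> [c = 1] (mod f)" if c: "c \<in> I T" for c
  proof
    assume c1: "[c = 1] (mod f)"
    obtain t s m where c': "c = y * t + [:m:] * s" "t \<in> T" "s \<in> T" "0 < V0 m"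
      using c by (auto simp: I_def)
    obtain N where N: "(1 - b) ^ N * t \<in> S" "(1 - b) ^ N * s \<in> S"
      using common[OF c'(2,3)] by blast
    have "(1 - b) ^ N * c = y * ((1 - b) ^ N * t) + [:m:] * ((1 - b) ^ N * s)"
      unfolding c'(1) by (simp only: distrib_left ac_simps)
    then have cI: "(1 - b) ^ N * c \<in> I S"
      unfolding I_def using N c'(4) by blast
    have "\<exists>k\<in>S. (1 - b) ^ N = 1 - b * k"
    proof (induction N)
      case 0
      then show ?case
        using S_closed(2) by (intro bexI[of _ 0]) auto
    next
      case (Suc N)
      then obtain k where k: "k \<in> S" "(1 - b) ^ N = 1 - b * k"
        by blast
      have "(1 - b) ^ Suc N = 1 - b * (1 + k - b * k)"
        unfolding power_Suc k(2) by (simp add: algebra_simps)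
      moreover have "1 + k - b * k \<in> S"
        by (intro S_closed(1,3-5) I_closed(4)[OF b] \<open>k \<in> S\<close>)
      ultimately show ?case
        by blast
    qed
    then obtain k where k: "k \<in> S" "(1 - b) ^ N = 1 - b * k"
      by blast
    have "(1 - b) ^ N * c + k * b \<in> I S"
      using cI I_closed(1,2) b k(1) by blast
    moreover have "[(1 - b) ^ N * c + k * b = (1 - b) ^ N * 1 + k * b] (mod f)"
      using c1 by (intro cong_add cong_mult) auto
    then have "[(1 - b) ^ N * c + k * b = 1] (mod f)"
      by (simp add: k(2) algebra_simps)
    ultimately show False
      using S_facts(4) by blast
  qed
  ultimately have "proper T"
    using ST S_facts(2,3) unfolding proper_def by blast
  then have "T = S"
    using maximal ST by blast
  moreover have "(1 - b) * q \<in> S"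
    using S_facts(5)[OF S_closed(1) cong_sym[OF q]] .
  then have "q \<in> T"
    unfolding T_def by (auto intro!: exI[of _ 1])
  ultimately show ?thesis
    by simp
qed

definition relation :: "'a poly \<Rightarrow> nat \<Rightarrow> bool" where
  "relation x n \<longleftrightarrow> (\<exists>a. (\<forall>i. a i \<in> I S) \<and> [(\<Sum>i\<le>n. a i * x ^ i) = 1] (mod f))"

text \<open>By maximality, adjoining x puts 1 into the enlarged ideal modulo f; collecting the
  powers of x gives the relation.\<close>

lemma relation_exists:
  assumes "x \<notin> S"
  obtains n where "relation x n"
proof -
  let ?T = "adjoin f S x"
  note T = adjoin_superset[OF S_facts(1), where f = f and x = x]
  have "\<not> proper ?T"
  proof
    assume "proper ?T"
    then have "?T = S"
      using T(1) by (rule maximal)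
    then show False
      using T(2) assms by simp
  qed
  moreover have "saturated f ?T"
    by (rule saturated_adjoin[OF S_facts(1)])
  moreover have "y \<in> ?T" "\<forall>a. 0 \<le> V0 a \<longrightarrow> [:a:] \<in> ?T"
    using T(1) S_facts(2,3) by blast+
  ultimately obtain c where c: "c \<in> I ?T" "[c = 1] (mod f)"
    unfolding proper_def by blast
  then obtain t s m where tsm: "c = y * t + [:m:] * s" "t \<in> ?T" "s \<in> ?T" "0 < V0 m"
    unfolding I_def by blast
  then obtain P Q where PQ: "P \<in> coeffs_in S" "[t = poly P x] (mod f)" "Q \<in> coeffs_in S" "[s = poly Q x] (mod f)"
    unfolding adjoin_def by blast
  define F where "F = Polynomial.smult y P + Polynomial.smult [:m:] Q"
  have "Polynomial.coeff F i \<in> I S" for i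
    unfolding I_def F_def using PQ(1,3) tsm(4) unfolding coeffs_in_def by (simp del: mult_pCons_left) blast
  moreover have "[poly F x = c] (mod f)"
    unfolding F_def tsm(1) using PQ(2,4)
    by (simp del: mult_pCons_left) (intro cong_add cong_mult cong_refl, (erule cong_sym)+)
  then have "[poly F x = 1] (mod f)"
    using c(2) cong_trans by blast
  then have "[(\<Sum>i\<le>degree F. Polynomial.coeff F i * x ^ i) = 1] (mod f)"
    by (simp add: poly_altdef)
  ultimately show thesis
    using that unfolding relation_def by blast
qed

lemma not_relation_0: "\<not> relation x 0"
  using S_facts(4) by (auto simp: relation_def)

text \<open>The relation of lower degree solves for a power of \<open>x\<close>, since \<open>1 - b 0\<close> is invertible.\<close>

lemma relation_reduce:
  assumes xx': "[x * x' = 1] (mod f)" and "relation x n" "relation x' m" "m \<le> n" "0 < n"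
    and inv: "\<And>p. \<not> [p = 0] (mod f) \<Longrightarrow> \<exists>q. [p * q = 1] (mod f)"
  shows "relation x (n - 1)"
proof -
  obtain a where a: "\<And>i. a i \<in> I S" "[(\<Sum>i\<le>n. a i * x ^ i) = 1] (mod f)"
    using assms(2) by (auto simp: relation_def)
  obtain b where b: "\<And>i. b i \<in> I S" "[(\<Sum>i\<le>m. b i * x' ^ i) = 1] (mod f)"
    using assms(3) by (auto simp: relation_def)
  have "\<not> [1 - b 0 = 0] (mod f)"
  proof
    assume "[1 - b 0 = 0] (mod f)"
    then have "[b 0 = 1] (mod f)"
      by (simp add: cong_iff_dvd_diff dvd_diff_commute)
    then show False
      using S_facts(4) b(1) by blast
  qed
  then obtain q where q: "[(1 - b 0) * q = 1] (mod f)"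
    using inv by blast
  then have qS: "q \<in> S"
    by (rule inverse_in_S[OF b(1)])
  have pow: "[x ^ i * x' ^ i = 1] (mod f)" for i
    using cong_pow[OF xx', of i] by (simp add: power_mult_distrib)
  have set: "{..m} = insert 0 {1..m}" "{..n} = insert n {..n - 1}"
    using assms(5) by auto
  have "[(\<Sum>i\<in>{1..m}. b i * x' ^ i) = 1 - b 0] (mod f)"
    using cong_diff[OF b(2) cong_refl[of "b 0"]] unfolding set by simp
  then have "[(\<Sum>i\<in>{1..m}. b i * x' ^ i) * q = 1] (mod f)"
    using q cong_scalar_right cong_trans by blast
  then have eq1: "[x ^ n * ((\<Sum>i\<in>{1..m}. b i * x' ^ i) * q) = x ^ n * 1] (mod f)"
    by (rule cong_scalar_left)
  have eq2: "[x ^ n * ((\<Sum>i\<in>{1..m}. b i * x' ^ i) * q) = (\<Sum>i\<in>{1..m}. q * b i * x ^ (n - i))] (mod f)"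
  proof -
    have "x ^ n * ((\<Sum>i\<in>{1..m}. b i * x' ^ i) * q) = (\<Sum>i\<in>{1..m}. q * b i * x ^ (n - i) * (x ^ i * x' ^ i))"
      unfolding sum_distrib_left sum_distrib_right
    proof (intro sum.cong refl)
      fix i assume "i \<in> {1..m}"
      then have "x ^ n = x ^ (n - i) * x ^ i"
        using assms(4) by (simp flip: power_add)
      then show "x ^ n * (b i * x' ^ i * q) = q * b i * x ^ (n - i) * (x ^ i * x' ^ i)"
        by (simp only: ac_simps)
    qed
    moreover have "[(\<Sum>i\<in>{1..m}. q * b i * x ^ (n - i) * (x ^ i * x' ^ i)) = (\<Sum>i\<in>{1..m}. q * b i * x ^ (n - i) * 1)] (mod f)"
      by (intro cong_sum cong_mult cong_refl pow)
    ultimately show ?thesis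
      by simp
  qed
  have xn: "[x ^ n = (\<Sum>i\<in>{1..m}. q * b i * x ^ (n - i))] (mod f)"
    using cong_trans[OF cong_sym[OF eq1] eq2] by (simp only: mult_1_right)
  \<comment> \<open>Substitutes the expression for x^n; the exponents n - i with 1 \<le> i \<le> m
    lie between 0 and n - 1.\<close>
  define a' where "a' l = a l + (\<Sum>i\<in>{1..m}. if n - i = l then a n * (q * b i) else 0)" for l
  have a': "a' l \<in> I S" for l
    unfolding a'_def
  proof (intro I_closed(1,3) a(1))
    fix i
    have "a n * (q * b i) \<in> I S" "0 * a n \<in> I S"
      by (rule I_closed(2)[OF I_closed(2)[OF b(1) qS] I_closed(4)[OF a(1)]], rule I_closed(2)[OF a(1) S_closed(2)])
    then show "(if n - i = l then a n * (q * b i) else 0) \<in> I S"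
      by simp
  qed
  have sum_a': "(\<Sum>l\<le>n - 1. a' l * x ^ l) = (\<Sum>l\<le>n - 1. a l * x ^ l) + a n * (\<Sum>i\<in>{1..m}. q * b i * x ^ (n - i))"
  proof -
    have "(\<Sum>l\<le>n - 1. \<Sum>i\<in>{1..m}. (if n - i = l then a n * (q * b i) else 0) * x ^ l)
        = (\<Sum>i\<in>{1..m}. \<Sum>l\<le>n - 1. (if n - i = l then a n * (q * b i) else 0) * x ^ l)"
      by (rule sum.swap)
    also have "\<dots> = (\<Sum>i\<in>{1..m}. a n * (q * b i * x ^ (n - i)))"
    proof (intro sum.cong refl)
      fix i assume i: "i \<in> {1..m}"
      have "(\<Sum>l\<le>n - 1. (if n - i = l then a n * (q * b i) else 0) * x ^ l)
        = (\<Sum>l\<le>n - 1. if n - i = l then a n * (q * b i) * x ^ l else 0)"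
        by (intro sum.cong) auto
      also have "\<dots> = a n * (q * b i) * x ^ (n - i)"
      proof -
        have "n - i \<le> n - 1"
          using i by (intro diff_le_mono2) simp
        then show ?thesis
          by simp
      qed
      finally show "(\<Sum>l\<le>n - 1. (if n - i = l then a n * (q * b i) else 0) * x ^ l) = a n * (q * b i * x ^ (n - i))"
        by (simp add: mult.assoc)
    qed
    finally show ?thesis
      by (simp add: a'_def distrib_right sum.distrib sum_distrib_right sum_distrib_left)
  qed
  have "[(\<Sum>l\<le>n - 1. a l * x ^ l) + a n * (\<Sum>i\<in>{1..m}. q * b i * x ^ (n - i)) = (\<Sum>l\<le>n - 1. a l * x ^ l) + a n * x ^ n] (mod f)"
    by (intro cong_add cong_mult cong_refl cong_sym[OF xn])
  also have "(\<Sum>l\<le>n - 1. a l * x ^ l) + a n * x ^ n = (\<Sum>i\<le>n. a i * x ^ i)"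
    unfolding set(2) using assms(5) by (simp add: add.commute)
  also note a(2)
  finally have "[(\<Sum>l\<le>n - 1. a' l * x ^ l) = 1] (mod f)"
    unfolding sum_a' .
  then show ?thesis
    unfolding relation_def using a' by blast
qed

text \<open>If both x and its inverse were outside S, both would satisfy relations, and the longer
  could be shortened by means of the other again and again. But a relation of degree 0 would put 1
  into the ideal.\<close>

lemma maximal_is_valuation_ring:
  assumes inv: "\<And>p. \<not> [p = 0] (mod f) \<Longrightarrow> \<exists>q. [p * q = 1] (mod f)"
    and xx': "[x * x' = 1] (mod f)"
  shows "x \<in> S \<or> x' \<in> S"
proof (rule ccontr)
  assume "\<not> ?thesis"
  then obtain n m where "relation x n" "relation x' m"
    using relation_exists by metis
  then show False
  proof (induction "n + m" arbitrary: n m rule: less_induct)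
    case less
    have pos: "0 < n" "0 < m"
      using less.prems not_relation_0 by (auto intro: gr0I)
    show False
    proof (cases "m \<le> n")
      case True
      then show False
        using less.hyps[of "n - 1" m] relation_reduce[OF xx' less.prems True pos(1) inv] less.prems(2) pos by simp
    next
      case False
      have "[x' * x = 1] (mod f)"
        using xx' by (simp add: mult.commute)
      then show False
        using less.hyps[of n "m - 1"] relation_reduce[of x' x m n] inv False less.prems pos by simp
    qed
  qed
qed

text \<open>A constant of negative value in S would have its inverse in the maximal ideal of
  \<open>V0\<close>, and their product 1 would lie in the ideal.\<close>

lemma maximal_const: "[:a:] \<in> S \<longleftrightarrow> 0 \<le> V0 a"
proof
  assume a: "[:a:] \<in> S"
  show "0 \<le> V0 a"
  proof (rule ccontr)
    assume neg: "\<not> 0 \<le> V0 a"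
    then have "a \<noteq> 0"
      by auto
    then have "V0 (1 / a) + V0 a = 0"
      using V0.mult[of "1 / a" a] by simp
    then have "0 < V0 (1 / a)"
      using neg by (cases "V0 a"; cases "V0 (1 / a)") (auto simp: zero_extended_def add_eq_0_iff)
    moreover have "1 = y * 0 + [:1 / a:] * [:a:]"
      using \<open>a \<noteq> 0\<close> by (simp add: one_pCons)
    ultimately have "1 \<in> I S"
      unfolding I_def using a S_closed(2) by blast
    then show False
      using S_facts(4) cong_refl by blast
  qed
qed (rule S_facts(2))

end

end

text \<open>Multiplying E(1/p) by p^D with D = deg E reverses the coefficients. The nonzero constant
  coefficient ensures that reflection keeps the degree.\<close>

lemma cong_poly_reflect:
  fixes f p y :: "'a::field poly" and E :: "'a poly"
  assumes "[p * y = 1] (mod f)" "Polynomial.coeff E 0 \<noteq> 0" "[pcompose E y = 0] (mod f)"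
  shows "f dvd pcompose (reflect_poly E) p"
proof -
  let ?D = "degree E"
  have pow: "[p ^ i * y ^ i = 1] (mod f)" for i
    using cong_pow[OF assms(1), of i] by (simp add: power_mult_distrib)
  have D: "degree (reflect_poly E) = ?D"
    using assms(2) by simp
  have "pcompose (reflect_poly E) p = (\<Sum>i\<le>?D. Polynomial.smult (Polynomial.coeff E (?D - i)) (p ^ i))"
    unfolding pcompose_eq_sum D by (intro sum.cong) (auto simp: coeff_reflect_poly)
  also have "\<dots> = (\<Sum>i\<le>?D. Polynomial.smult (Polynomial.coeff E i) (p ^ (?D - i)))"
    by (rule sum.reindex_bij_witness[of _ "\<lambda>i. ?D - i" "\<lambda>i. ?D - i"]) auto
  finally have eq: "pcompose (reflect_poly E) p = (\<Sum>i\<le>?D. [:Polynomial.coeff E i:] * p ^ (?D - i) * 1)"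
    by simp
  have "[(\<Sum>i\<le>?D. [:Polynomial.coeff E i:] * p ^ (?D - i) * 1) = (\<Sum>i\<le>?D. [:Polynomial.coeff E i:] * p ^ (?D - i) * (p ^ i * y ^ i))] (mod f)"
    by (intro cong_sum cong_mult cong_refl cong_sym[OF pow])
  also have "(\<Sum>i\<le>?D. [:Polynomial.coeff E i:] * p ^ (?D - i) * (p ^ i * y ^ i)) = p ^ ?D * pcompose E y"
    unfolding pcompose_eq_sum sum_distrib_left
  proof (intro sum.cong refl)
    fix i assume "i \<in> {..?D}"
    then have "p ^ ?D = p ^ (?D - i) * p ^ i"
      by (simp flip: power_add)
    then show "[:Polynomial.coeff E i:] * p ^ (?D - i) * (p ^ i * y ^ i) = p ^ ?D * Polynomial.smult (Polynomial.coeff E i) (y ^ i)"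
      by (simp add: ac_simps)
  qed
  also have "[p ^ ?D * pcompose E y = p ^ ?D * 0] (mod f)"
    by (rule cong_scalar_left[OF assms(3)])
  finally show ?thesis
    unfolding eq by (simp add: cong_0_iff)
qed

text \<open>Suppose that p is not integral and let y be its inverse modulo f. Then y and the maximal
  ideal of \<open>V0\<close> generate a proper ideal in the ring obtained by adjoining y to the
  valuation ring of \<open>V0\<close>: an equation 1 = y t + m s would, read backwards, be a monic
  equation for p up to a unit. A maximal subring with this property is a valuation ring over that of
  \<open>V0\<close> whose ideal contains y; but by uniqueness it contains p.\<close>

theorem integral_of_unique_valuation_ring:
  fixes W :: "'a::field poly \<Rightarrow> 'g::linordered_ab_group_add extended"
  assumes V0: "valuation_on (ring_of_type_algebra :: 'a ring) V0"
    and irr: "Factorial_Ring.irreducible f"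
    and unique: "\<And>S. saturated f S \<Longrightarrow> (\<And>x x'. [x * x' = 1] (mod f) \<Longrightarrow> x \<in> S \<or> x' \<in> S) \<Longrightarrow>
      (\<And>a. [:a:] \<in> S \<longleftrightarrow> 0 \<le> V0 a) \<Longrightarrow> S = {p. 0 \<le> W p}"
    and p: "0 \<le> W p"
  shows "\<exists>\<chi>. Polynomial.lead_coeff \<chi> = 1 \<and> 0 < degree \<chi> \<and>
      (\<forall>i. 0 \<le> V0 (Polynomial.coeff \<chi> i)) \<and> f dvd pcompose \<chi> p"
proof (rule ccontr)
  assume contr: "\<not> ?thesis"
  interpret V0: pseudo_valuation V0
    using V0 by (rule pseudo_valuation_of_valuation)
  have inv: "\<exists>q. [p * q = 1] (mod f)" if "\<not> [p = 0] (mod f)" for p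
    using inverse_mod_irreducible[OF irr, of p] that by (metis cong_0_iff cong_iff_dvd_diff)
  have "\<not> [p = 0] (mod f)"
  proof
    assume "[p = 0] (mod f)"
    then have "f dvd pcompose [:0, 1:] p"
      by (simp add: cong_0_iff pcompose_pCons)
    moreover have "0 \<le> V0 (Polynomial.coeff [:0, 1:] i)" for i
      by (auto simp: coeff_pCons split: nat.split)
    moreover have "Polynomial.lead_coeff [:0, 1::'a:] = 1" "0 < degree [:0, 1::'a:]"
      by simp_all
    ultimately show False
      using contr by blast
  qed
  then obtain y where y: "[p * y = 1] (mod f)"
    using inv by blast
  interpret D: dominating_subring f V0 y
    using V0 by unfold_locales
  define R where "R = {[:a:] | a. 0 \<le> V0 a}"
  have R: "subring_set R"
    unfolding subring_set_def R_def
    by (auto simp: one_pCons V0.mult intro!: V0.diff_geI intro: add_nonneg_nonneg)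
      (metis add.right_neutral add_mono)+
  have RT: "\<exists>a. x = [:a:] \<and> 0 \<le> V0 a" if "x \<in> R" for x
    using that by (auto simp: R_def)
  define T0 where "T0 = adjoin f R y"
  have "D.proper T0"
    unfolding D.proper_def
  proof (intro conjI allI impI ballI notI)
    show "saturated f T0" "y \<in> T0" "\<And>a. 0 \<le> V0 a \<Longrightarrow> [:a:] \<in> T0"
      using saturated_adjoin[OF R] adjoin_superset[OF R, where f = f and x = y] by (auto simp: T0_def R_def)
    fix c assume c: "c \<in> D.I T0" "[c = 1] (mod f)"
    obtain t s m where tsm: "c = y * t + [:m:] * s" "t \<in> T0" "s \<in> T0" "0 < V0 m"
      using c(1) by (auto simp: D.I_def)
    have "\<exists>P. (\<forall>i. 0 \<le> V0 (Polynomial.coeff P i)) \<and> [q = pcompose P y] (mod f)" if q: "q \<in> T0" for q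
    proof -
      obtain P where P: "P \<in> coeffs_in R" "[q = poly P y] (mod f)"
        using q by (auto simp: T0_def adjoin_def)
      define P' where "P' = map_poly (\<lambda>x. Polynomial.coeff x 0) P"
      have "P = map_poly (\<lambda>x. [:x:]) P'"
      proof (rule poly_eqI)
        fix i
        show "Polynomial.coeff P i = Polynomial.coeff (map_poly (\<lambda>x. [:x:]) P') i"
          using RT[of "Polynomial.coeff P i"] P(1) by (auto simp: P'_def coeff_map_poly coeffs_in_def)
      qed
      moreover have "0 \<le> V0 (Polynomial.coeff P' i)" for i
        using RT[of "Polynomial.coeff P i"] P(1) by (auto simp: P'_def coeff_map_poly coeffs_in_def)
      ultimately show ?thesis
        using P(2) by (auto simp: pcompose_altdef)
    qed
    then obtain P Q where PQ: "\<And>i. 0 \<le> V0 (Polynomial.coeff P i)" "[t = pcompose P y] (mod f)"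
        "\<And>i. 0 \<le> V0 (Polynomial.coeff Q i)" "[s = pcompose Q y] (mod f)"
      using tsm(2,3) by metis
    \<comment> \<open>E vanishes at y modulo f, and its constant coefficient 1 - m Q(0) has value 0.
      Reflected and divided by this unit it becomes the monic equation for p.\<close>
    define E where "E = 1 - [:0, 1:] * P - Polynomial.smult m Q"
    have coeffE: "0 \<le> V0 (Polynomial.coeff E i)" for i
    proof -
      have "0 \<le> V0 (Polynomial.coeff (1::'a poly) i)"
        by (simp add: coeff_1)
      moreover have "0 \<le> V0 (Polynomial.coeff ([:0, 1:] * P) i)"
        using PQ(1) by (cases i) auto
      moreover have "0 \<le> V0 (Polynomial.coeff (Polynomial.smult m Q) i)"
        using add_mono[of 0 "V0 m" 0 "V0 (Polynomial.coeff Q i)"] PQ(3)[of i] tsm(4) by (simp add: V0.mult)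
      ultimately show ?thesis
        unfolding E_def coeff_diff by (intro V0.diff_geI)
    qed
    have "0 < V0 (m * Polynomial.coeff Q 0)"
      using add_mono[of 0 "V0 m" 0 "V0 (Polynomial.coeff Q 0)"] PQ(3)[of 0] tsm(4)
      by (cases "V0 m"; cases "V0 (Polynomial.coeff Q 0)") (auto simp: V0.mult zero_extended_def add_pos_nonneg)
    then have u: "V0 (Polynomial.coeff E 0) = 0"
      using V0.diff_eq(1)[of 1 "m * Polynomial.coeff Q 0"] by (simp add: E_def)
    define u where "u = Polynomial.coeff E 0"
    have unz: "u \<noteq> 0"
      using u by (auto simp: u_def)
    have "pcompose E y = 1 - y * pcompose P y - [:m:] * pcompose Q y"
      by (simp add: E_def pcompose_diff pcompose_mult pcompose_1 pcompose_smult pcompose_pCons)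
    moreover have "[1 - y * pcompose P y - [:m:] * pcompose Q y = 1 - y * t - [:m:] * s] (mod f)"
      by (intro cong_diff cong_mult cong_refl cong_sym[OF PQ(2)] cong_sym[OF PQ(4)])
    ultimately have "[pcompose E y = 1 - y * t - [:m:] * s] (mod f)"
      by (simp only:)
    also have "1 - y * t - [:m:] * s = 1 - c"
      by (simp add: tsm(1))
    also have "[1 - c = 1 - 1] (mod f)"
      using c(2) by (intro cong_diff) auto
    finally have Ey: "[pcompose E y = 0] (mod f)"
      by simp
    \<comment> \<open>Otherwise f would divide a nonzero constant.\<close>
    have "0 < degree E"
    proof (rule gr0I)
      assume "degree E = 0"
      then have "E = [:u:]"
        by (auto simp: u_def elim!: degree_eq_zeroE)
      then have "f dvd [:u:]"
        using Ey by (simp add: cong_0_iff)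
      then have "f dvd [:u:] * [:1 / u:]"
        by (rule dvd_mult2)
      then have "f dvd 1"
        using unz by (simp add: one_pCons)
      then show False
        using irr by (simp add: Factorial_Ring.irreducible_def)
    qed
    define \<chi> where "\<chi> = Polynomial.smult (1 / u) (reflect_poly E)"
    have "Polynomial.lead_coeff (reflect_poly E) = u"
      using unz by (simp add: u_def coeff_reflect_poly)
    then have "Polynomial.lead_coeff \<chi> = 1"
      using unz by (simp add: \<chi>_def)
    moreover have "0 < degree \<chi>"
      using unz \<open>0 < degree E\<close> by (simp add: \<chi>_def u_def)
    moreover have "0 \<le> V0 (Polynomial.coeff \<chi> i)" for i
    proof -
      have "V0 (1 / u) + V0 u = 0"
        using V0.mult[of "1 / u" u] unz by simp
      then have "V0 (1 / u) = 0"
        using u by (simp add: u_def)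
      then have "V0 (Polynomial.coeff \<chi> i) = V0 (Polynomial.coeff (reflect_poly E) i)"
        unfolding \<chi>_def coeff_smult V0.mult by simp
      then show ?thesis
        using coeffE by (simp add: coeff_reflect_poly)
    qed
    moreover have "f dvd pcompose \<chi> p"
      using cong_poly_reflect[OF y _ Ey] unz by (simp add: \<chi>_def u_def pcompose_smult dvd_smult)
    ultimately show False
      using contr by blast
  qed
  have "\<exists>M\<in>Collect D.proper. \<forall>N\<in>Collect D.proper. M \<subseteq> N \<longrightarrow> N = M"
  proof (rule subset_Zorn_nonempty)
    show "Collect D.proper \<noteq> {}"
      using \<open>D.proper T0\<close> by blast
    fix C assume C: "C \<noteq> {}" "subset.chain (Collect D.proper) C"
    have mem: "D.proper T" if "T \<in> C" for T
      using C(2) that by (auto simp: subset_chain_def)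
    have common: "\<exists>T\<in>C. a \<in> T \<and> b \<in> T" if "a \<in> \<Union>C" "b \<in> \<Union>C" for a b
    proof -
      from that obtain T T' where T: "T \<in> C" "a \<in> T" "T' \<in> C" "b \<in> T'"
        by blast
      then have "T \<subseteq> T' \<or> T' \<subseteq> T"
        using C(2) by (auto simp: subset_chain_def)
      then show ?thesis
        using T by blast
    qed
    have sat: "saturated f T" if "T \<in> C" for T
      using mem[OF that] by (simp add: D.proper_def)
    have "saturated f (\<Union>C)"
      unfolding saturated_def subring_set_def
    proof (intro conjI ballI allI impI)
      show "1 \<in> \<Union>C"
        using C(1) sat by (auto simp: saturated_def subring_set_def)
      show "a - b \<in> \<Union>C" "a * b \<in> \<Union>C" if "a \<in> \<Union>C" "b \<in> \<Union>C" for a b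
        using common[OF that] sat unfolding saturated_def subring_set_def by blast+
      show "q \<in> \<Union>C" if "p \<in> \<Union>C" "[p = q] (mod f)" for p q
        using that sat unfolding saturated_def by blast
    qed
    moreover have "\<not> [b = 1] (mod f)" if "b \<in> D.I (\<Union>C)" for b
    proof -
      obtain t s m where tsm: "b = y * t + [:m:] * s" "t \<in> \<Union>C" "s \<in> \<Union>C" "0 < V0 m"
        using \<open>b \<in> D.I (\<Union>C)\<close> unfolding D.I_def by blast
      then obtain T where "T \<in> C" "t \<in> T" "s \<in> T"
        using common by blast
      then have "b \<in> D.I T"
        unfolding D.I_def using tsm(1,4) by blast
      then show ?thesis
        using mem[OF \<open>T \<in> C\<close>] by (simp add: D.proper_def)
    qed
    ultimately show "\<Union>C \<in> Collect D.proper"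
      using C(1) mem unfolding D.proper_def by blast
  qed
  then obtain S where S: "D.proper S" "\<And>T. D.proper T \<Longrightarrow> S \<subseteq> T \<Longrightarrow> T = S"
    by blast
  have "S = {p. 0 \<le> W p}"
  proof (rule unique)
    show "saturated f S"
      using S(1) by (simp add: D.proper_def)
    show "x \<in> S \<or> x' \<in> S" if "[x * x' = 1] (mod f)" for x x'
      using D.maximal_is_valuation_ring[OF S inv that] by blast
    show "[:a:] \<in> S \<longleftrightarrow> 0 \<le> V0 a" for a
      using D.maximal_const[OF S] by blast
  qed
  \<comment> \<open>With p in S, the product y p, which is 1 modulo f, would lie in the
    ideal.\<close>
  then have "p \<in> S"
    using p by simp
  moreover have "0 < V0 0"
    by (simp add: less_inf_iff)
  ultimately have "y * p + [:0:] * p \<in> D.I S"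
    unfolding D.I_def by blast
  then show False
    using S(1) y by (auto simp: D.proper_def mult.commute)
qed

section \<open>Graded rings as images of Rees algebras\<close>

text \<open>All rings given by records below (residue rings, graded rings, polynomial rings over
  them) are images of subsets of ring types. Ring laws and computations are done with
  representatives and transported along \<rho>, instead of working with cosets.\<close>

locale surj_hom =
  fixes \<rho> :: "'x::comm_ring_1 \<Rightarrow> 'y" and D and G (structure)
  assumes D: "subring_set D" and image: "\<rho> ` D = carrier G"
    and hom_add: "a \<in> D \<Longrightarrow> b \<in> D \<Longrightarrow> \<rho> (a + b) = \<rho> a \<oplus> \<rho> b"
    and hom_mult: "a \<in> D \<Longrightarrow> b \<in> D \<Longrightarrow> \<rho> (a * b) = \<rho> a \<otimes> \<rho> b"
    and hom_one: "\<rho> 1 = \<one>" and hom_zero: "\<rho> 0 = \<zero>"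
begin

lemmas X_closed = subring_setD[OF D]

lemma hom_closed: "a \<in> D \<Longrightarrow> \<rho> a \<in> carrier G"
  using image by blast

lemma rep: "y \<in> carrier G \<Longrightarrow> \<exists>a\<in>D. y = \<rho> a"
  using image by blast

lemma cring_image: "cring G"
proof (rule cringI)
  show "abelian_group G"
  proof (rule abelian_groupI)
    show "\<exists>y\<in>carrier G. y \<oplus> x = \<zero>" if x: "x \<in> carrier G" for x
    proof -
      obtain a where a: "a \<in> D" "x = \<rho> a"
        using rep[OF x] by blast
      then have "\<rho> (- a) \<oplus> x = \<zero>"
        using hom_add[of "- a" a] X_closed(6) by (simp add: hom_zero)
      then show ?thesis
        using hom_closed X_closed(6) a(1) by blast
    qed
  qed (auto simp flip: image hom_add hom_zero simp: X_closed ac_simps)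
  show "comm_monoid G"
    by (rule comm_monoidI) (auto simp flip: image hom_mult hom_one simp: X_closed ac_simps)
qed (auto simp flip: image hom_mult hom_add simp: X_closed distrib_right)

sublocale cring G
  by (rule cring_image)

lemma hom_uminus: "a \<in> D \<Longrightarrow> \<rho> (- a) = \<ominus> \<rho> a"
  using hom_add[of "- a" a] X_closed(6)[of a] hom_closed
  by (intro minus_equality[symmetric]) (auto simp: hom_zero)

lemma hom_diff: "a \<in> D \<Longrightarrow> b \<in> D \<Longrightarrow> \<rho> (a - b) = \<rho> a \<ominus> \<rho> b"
  using hom_add[of a "- b"] X_closed(6)[of b] by (simp add: hom_uminus a_minus_def)

lemma hom_eq_iff: "a \<in> D \<Longrightarrow> b \<in> D \<Longrightarrow> \<rho> a = \<rho> b \<longleftrightarrow> \<rho> (a - b) = \<zero>"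
  using hom_diff[of a b] hom_closed by (auto simp: r_right_minus_eq)

lemma hom_power: "a \<in> D \<Longrightarrow> \<rho> (a ^ i) = \<rho> a [^] (i::nat)"
  by (induction i) (simp_all add: hom_one hom_mult X_closed m_comm hom_closed)

lemma hom_sum: "finite I \<Longrightarrow> (\<And>i. i \<in> I \<Longrightarrow> a i \<in> D) \<Longrightarrow> \<rho> (\<Sum>i\<in>I. a i) = (\<Oplus>i\<in>I. \<rho> (a i))"
proof (induction I rule: finite_induct)
  case (insert i I)
  then show ?case
    using subring_set_sum[OF D, of I a] hom_closed by (simp add: hom_add Pi_def)
qed (simp add: hom_zero)

lemma X_prod: "(\<And>i. i \<in> I \<Longrightarrow> a i \<in> D) \<Longrightarrow> (\<Prod>i\<in>I. a i) \<in> D"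
  by (induction I rule: infinite_finite_induct) (auto simp: X_closed)

lemma hom_prod: "finite I \<Longrightarrow> (\<And>i. i \<in> I \<Longrightarrow> a i \<in> D) \<Longrightarrow> \<rho> (\<Prod>i\<in>I. a i) = (\<Otimes>i\<in>I. \<rho> (a i))"
proof (induction I rule: finite_induct)
  case (insert i I)
  then show ?case
    using X_prod[of I a] hom_closed by (simp add: hom_mult Pi_def)
qed (simp add: hom_one)

end

section \<open>Products of finitely supported families\<close>

lemma lookup_mult_group:
  fixes p q :: "'g::ab_group_add \<Rightarrow>\<^sub>0 'r::comm_ring_1"
  shows "Poly_Mapping.lookup (p * q) \<gamma>
    = (\<Sum>\<alpha>\<in>Poly_Mapping.keys p. Poly_Mapping.lookup p \<alpha> * Poly_Mapping.lookup q (\<gamma> - \<alpha>))"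
proof -
  have "(\<Sum>\<beta>. Poly_Mapping.lookup q \<beta> when \<gamma> = \<alpha> + \<beta>) = Poly_Mapping.lookup q (\<gamma> - \<alpha>)" for \<alpha>
  proof -
    have "\<gamma> = \<alpha> + \<beta> \<longleftrightarrow> \<beta> = \<gamma> - \<alpha>" for \<beta>
      by (auto simp: algebra_simps)
    then show ?thesis
      by simp
  qed
  then have "Poly_Mapping.lookup (p * q) \<gamma> = (\<Sum>\<alpha>. Poly_Mapping.lookup p \<alpha> * Poly_Mapping.lookup q (\<gamma> - \<alpha>))"
    by (simp add: lookup_mult)
  also have "\<dots> = (\<Sum>\<alpha>\<in>Poly_Mapping.keys p. Poly_Mapping.lookup p \<alpha> * Poly_Mapping.lookup q (\<gamma> - \<alpha>))"
    by (rule Sum_any.expand_superset) (auto simp: in_keys_iff)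
  finally show ?thesis .
qed

lemma finite_submultisets: "finite {a. a \<subseteq># (m::'i multiset)}"
proof (induction m)
  case (add x m)
  have "{a. a \<subseteq># add_mset x m} \<subseteq> {a. a \<subseteq># m} \<union> add_mset x ` {a. a \<subseteq># m}"
  proof
    fix a assume a: "a \<in> {a. a \<subseteq># add_mset x m}"
    show "a \<in> {a. a \<subseteq># m} \<union> add_mset x ` {a. a \<subseteq># m}"
    proof (cases "x \<in># a")
      case True
      then obtain b where "a = add_mset x b"
        by (metis multi_member_split)
      then show ?thesis
        using a by auto
    next
      case False
      have "count a y \<le> count m y" for y
        using a mset_subset_eq_count[of a "add_mset x m" y] False by (cases "y = x") (auto simp: not_in_iff)
      then show ?thesis
        using mset_subset_eqI by blast
    qed
  qed
  then show ?case
    using add finite_subset by blast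
qed simp

lemma lookup_mult_multiset:
  fixes p q :: "'i multiset \<Rightarrow>\<^sub>0 'r::comm_ring_1"
  shows "Poly_Mapping.lookup (p * q) m
    = (\<Sum>a\<in>{a. a \<subseteq># m}. Poly_Mapping.lookup p a * Poly_Mapping.lookup q (m - a))"
proof -
  have "(\<Sum>b. Poly_Mapping.lookup q b when m = a + b) = (if a \<subseteq># m then Poly_Mapping.lookup q (m - a) else 0)" for a
  proof (cases "a \<subseteq># m")
    case True
    then have "m = a + b \<longleftrightarrow> b = m - a" for b
      by auto
    then show ?thesis
      using True by simp
  next
    case False
    then have "\<not> m = a + b" for b
      by auto
    then show ?thesis
      using False by simp
  qed
  then have "Poly_Mapping.lookup (p * q) m
      = (\<Sum>a. Poly_Mapping.lookup p a * (if a \<subseteq># m then Poly_Mapping.lookup q (m - a) else 0))"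
    by (simp add: lookup_mult)
  also have "\<dots> = (\<Sum>a\<in>{a. a \<subseteq># m}. Poly_Mapping.lookup p a * (if a \<subseteq># m then Poly_Mapping.lookup q (m - a) else 0))"
    by (rule Sum_any.expand_superset) (auto simp: finite_submultisets split: if_splits)
  finally show ?thesis
    by simp
qed

lemma poly_mapping_sum_single: "p = (\<Sum>k\<in>Poly_Mapping.keys p. Poly_Mapping.single k (Poly_Mapping.lookup p k))"
proof (rule poly_mapping_eqI)
  fix k
  have "Poly_Mapping.lookup (\<Sum>k\<in>Poly_Mapping.keys p. Poly_Mapping.single k (Poly_Mapping.lookup p k)) k
    = (\<Sum>l\<in>Poly_Mapping.keys p. if l = k then Poly_Mapping.lookup p l else 0)"
    unfolding lookup_sum by (intro sum.cong) (auto simp: lookup_single)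
  also have "\<dots> = Poly_Mapping.lookup p k"
    by (simp add: in_keys_iff)
  finally show "Poly_Mapping.lookup p k = Poly_Mapping.lookup (\<Sum>k\<in>Poly_Mapping.keys p. Poly_Mapping.single k (Poly_Mapping.lookup p k)) k"
    by (rule sym)
qed

text \<open>
  The associated graded ring of \<open>B\<close> is the image of the Rees algebra of the filtration, whose
  elements are finitely supported families of elements of \<open>S\<close>, a ring mapped onto \<open>B\<close>.
\<close>

locale valued_image = surj_hom \<pi> S B for \<pi> :: "'r::comm_ring_1 \<Rightarrow> 'b" and S and B (structure) +
  fixes v :: "'b \<Rightarrow> 'g::linordered_ab_group_add extended"
  assumes valuation: "valuation_on B v" and nontrivial: "\<one> \<noteq> \<zero>"
begin

definition w :: "'r \<Rightarrow> 'g extended" where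
  "w s = v (\<pi> s)"

lemma w_not_Minf: "s \<in> S \<Longrightarrow> w s \<noteq> -\<infinity>"
  and w_mult: "s \<in> S \<Longrightarrow> t \<in> S \<Longrightarrow> w (s * t) = w s + w t"
  and w_add: "s \<in> S \<Longrightarrow> t \<in> S \<Longrightarrow> min (w s) (w t) \<le> w (s + t)"
  and w_zero: "w 0 = \<infinity>"
  using valuation hom_closed by (auto simp: valuation_on_def w_def hom_mult hom_add hom_zero)

lemma w_one: "w 1 = 0"
proof -
  have "w 1 \<noteq> \<infinity>" "w 1 \<noteq> -\<infinity>" "w 1 + w 1 = w 1"
    using valuation nontrivial w_mult[of 1 1] X_closed(1) by (auto simp: valuation_on_def w_def hom_one)
  then show ?thesis
    by (cases "w 1") (auto simp: zero_extended_def)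
qed

lemma w_uminus: "s \<in> S \<Longrightarrow> w (- s) = w s"
proof -
  assume s: "s \<in> S"
  have m1: "- 1 \<in> S"
    by (rule X_closed(6)[OF X_closed(1)])
  have "w (- 1) + w (- 1) = 0"
    using w_mult[OF m1 m1] w_one by simp
  then have "w (- 1) = 0"
    by (cases "w (- 1)") (auto simp: zero_extended_def double_zero)
  then show ?thesis
    using w_mult[OF m1 s] by simp
qed

lemma w_add_geI: "s \<in> S \<Longrightarrow> t \<in> S \<Longrightarrow> \<gamma> \<le> w s \<Longrightarrow> \<gamma> \<le> w t \<Longrightarrow> \<gamma> \<le> w (s + t)"
  using w_add[of s t] by (meson min.boundedI order_trans)

lemma w_add_gtI: "s \<in> S \<Longrightarrow> t \<in> S \<Longrightarrow> \<gamma> < w s \<Longrightarrow> \<gamma> < w t \<Longrightarrow> \<gamma> < w (s + t)"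
  using w_add[of s t] by (meson min_less_iff_conj order_less_le_trans)

lemma w_sum_geI: "(\<And>i. i \<in> I \<Longrightarrow> s i \<in> S \<and> \<gamma> \<le> w (s i)) \<Longrightarrow> \<gamma> \<le> w (\<Sum>i\<in>I. s i)"
  by (induction I rule: infinite_finite_induct) (auto simp: w_zero intro!: w_add_geI subring_set_sum[OF D])

lemma w_sum_gtI: "\<gamma> \<noteq> \<infinity> \<Longrightarrow> (\<And>i. i \<in> I \<Longrightarrow> s i \<in> S \<and> \<gamma> < w (s i)) \<Longrightarrow> \<gamma> < w (\<Sum>i\<in>I. s i)"
  by (induction I rule: infinite_finite_induct)
    (auto simp: w_zero less_inf_iff intro!: w_add_gtI subring_set_sum[OF D])

text \<open>The coset of \<open>\<pi> s\<close> modulo the elements of value above \<gamma>, as the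
  image of a ball around s in S; equality of cosets thereby becomes an inequality between values of
  representatives.\<close>

definition cs :: "'g \<Rightarrow> 'r \<Rightarrow> 'b set" where
  "cs \<gamma> s = \<pi> ` {t \<in> S. Fin \<gamma> < w (t - s)}"

lemma mem_cs: "s \<in> S \<Longrightarrow> t \<in> S \<Longrightarrow> \<pi> t \<in> cs \<gamma> s \<longleftrightarrow> Fin \<gamma> < w (t - s)"
  by (auto simp: cs_def w_def hom_diff X_closed)

lemma coset_eq_cs: "s \<in> S \<Longrightarrow> val_gt B v \<gamma> +> \<pi> s = cs \<gamma> s"
proof
  assume s: "s \<in> S"
  show "val_gt B v \<gamma> +> \<pi> s \<subseteq> cs \<gamma> s"
  proof
    fix x assume "x \<in> val_gt B v \<gamma> +> \<pi> s"
    then obtain h where h: "h \<in> carrier B" "Fin \<gamma> < v h" "x = h \<oplus> \<pi> s"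
      by (auto simp: a_r_coset_def' val_gt_def)
    then obtain r where "r \<in> S" "h = \<pi> r"
      using rep by blast
    then show "x \<in> cs \<gamma> s"
      using h s hom_add[of r s] X_closed(4) unfolding cs_def w_def by (auto intro!: image_eqI[of _ _ "r + s"])
  qed
  show "cs \<gamma> s \<subseteq> val_gt B v \<gamma> +> \<pi> s"
  proof
    fix x assume "x \<in> cs \<gamma> s"
    then obtain t where t: "t \<in> S" "Fin \<gamma> < v (\<pi> (t - s))" "x = \<pi> t"
      by (auto simp: cs_def w_def)
    then have "x = \<pi> (t - s) \<oplus> \<pi> s" "\<pi> (t - s) \<in> carrier B"
      using s hom_add[of "t - s" s] X_closed(3)[of t s] hom_closed by simp_all
    then show "x \<in> val_gt B v \<gamma> +> \<pi> s"
      using t by (auto simp: a_r_coset_def' val_gt_def)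
  qed
qed

lemma val_gt_eq_cs: "val_gt B v \<gamma> = cs \<gamma> 0"
proof -
  have "val_gt B v \<gamma> = {x \<in> \<pi> ` S. Fin \<gamma> < v x}"
    by (simp add: val_gt_def image)
  then show ?thesis
    by (auto simp: cs_def w_def)
qed

lemma cs_eq_iff: "s \<in> S \<Longrightarrow> t \<in> S \<Longrightarrow> cs \<gamma> s = cs \<gamma> t \<longleftrightarrow> Fin \<gamma> < w (s - t)"
proof
  assume st: "s \<in> S" "t \<in> S" and eq: "cs \<gamma> s = cs \<gamma> t"
  have "\<pi> s \<in> cs \<gamma> s"
    using st mem_cs[of s s] by (simp add: w_zero)
  then show "Fin \<gamma> < w (s - t)"
    using st mem_cs[of t s] eq by simp
next
  assume st: "s \<in> S" "t \<in> S" and less: "Fin \<gamma> < w (s - t)"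
  have "cs \<gamma> s \<subseteq> cs \<gamma> t" if st: "s \<in> S" "t \<in> S" and less: "Fin \<gamma> < w (s - t)" for s t
  proof
    fix x assume "x \<in> cs \<gamma> s"
    then obtain u where u: "u \<in> S" "x = \<pi> u" "Fin \<gamma> < w (u - s)"
      by (auto simp: cs_def)
    then have "Fin \<gamma> < w ((u - s) + (s - t))"
      using st less X_closed(3) by (intro w_add_gtI) auto
    then show "x \<in> cs \<gamma> t"
      using u st mem_cs by simp
  qed
  moreover have "w (t - s) = w (s - t)"
    using w_uminus[of "s - t"] X_closed(3) st by simp
  ultimately show "cs \<gamma> s = cs \<gamma> t"
    using st less by (metis subset_antisym)
qed

lemma cs_add: "s \<in> S \<Longrightarrow> t \<in> S \<Longrightarrow> cs \<gamma> s <+>\<^bsub>B\<^esub> cs \<gamma> t = cs \<gamma> (s + t)"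
proof
  assume st: "s \<in> S" "t \<in> S"
  show "cs \<gamma> s <+>\<^bsub>B\<^esub> cs \<gamma> t \<subseteq> cs \<gamma> (s + t)"
  proof
    fix x assume "x \<in> cs \<gamma> s <+>\<^bsub>B\<^esub> cs \<gamma> t"
    then obtain a b where ab: "a \<in> S" "b \<in> S" "Fin \<gamma> < w (a - s)" "Fin \<gamma> < w (b - t)" "x = \<pi> a \<oplus> \<pi> b"
      by (auto simp: set_add_def' cs_def)
    then have "Fin \<gamma> < w ((a - s) + (b - t))"
      using st X_closed(3) by (intro w_add_gtI) auto
    then have "Fin \<gamma> < w ((a + b) - (s + t))"
      by (simp add: algebra_simps)
    then show "x \<in> cs \<gamma> (s + t)"
      using ab mem_cs[of "s + t" "a + b"] st X_closed(4) by (simp add: hom_add)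
  qed
  show "cs \<gamma> (s + t) \<subseteq> cs \<gamma> s <+>\<^bsub>B\<^esub> cs \<gamma> t"
  proof
    fix x assume "x \<in> cs \<gamma> (s + t)"
    then obtain u where u: "u \<in> S" "Fin \<gamma> < w (u - (s + t))" "x = \<pi> u"
      by (auto simp: cs_def)
    then have "x = \<pi> (u - t) \<oplus> \<pi> t"
      using hom_add[of "u - t" t] X_closed(3) st by simp
    moreover have "\<pi> (u - t) \<in> cs \<gamma> s"
      using u st X_closed(3) mem_cs[of s "u - t"] by (simp add: algebra_simps)
    moreover have "\<pi> t \<in> cs \<gamma> t"
      using st mem_cs[of t t] by (simp add: w_zero)
    ultimately show "x \<in> cs \<gamma> s <+>\<^bsub>B\<^esub> cs \<gamma> t"
      by (auto simp: set_add_def')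
  qed
qed

lemma cs_mult:
  assumes "s \<in> S" "t \<in> S" "Fin \<alpha> \<le> w s" "Fin \<beta> \<le> w t" "\<gamma> = \<alpha> + \<beta>"
  shows "(\<Union>a\<in>cs \<alpha> s. \<Union>b\<in>cs \<beta> t. val_gt B v \<gamma> +> (a \<otimes> b)) = cs \<gamma> (s * t)"
proof -
  have "val_gt B v \<gamma> +> (\<pi> a \<otimes> \<pi> b) = cs \<gamma> (s * t)"
    if ab: "a \<in> S" "b \<in> S" "Fin \<alpha> < w (a - s)" "Fin \<beta> < w (b - t)" for a b
  proof -
    have b: "Fin \<beta> \<le> w b"
      using w_add_geI[of "b - t" t "Fin \<beta>"] ab assms X_closed(3) by simp
    have "Fin \<gamma> < w (a - s) + w b"
      using ab(3) b assms(5) by (cases "w (a - s)"; cases "w b") (auto intro: add_less_le_mono)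
    moreover have "Fin \<gamma> < w s + w (b - t)"
      using ab(4) assms(3,5) by (cases "w (b - t)"; cases "w s") (auto intro: add_le_less_mono)
    \<comment> \<open>Well-definedness of the product rests on a b - s t = (a - s) b + s (b - t),
      where both summands have value above \<gamma>.\<close>
    ultimately have "Fin \<gamma> < w ((a - s) * b + s * (b - t))"
      using ab assms X_closed(3,5) by (intro w_add_gtI) (simp_all add: w_mult)
    then have "cs \<gamma> (a * b) = cs \<gamma> (s * t)"
      using cs_eq_iff[of "a * b" "s * t"] ab assms X_closed(5) by (simp add: algebra_simps)
    then show ?thesis
      using coset_eq_cs[of "a * b" \<gamma>] ab X_closed(5) by (simp add: hom_mult)
  qed
  moreover have "\<pi> s \<in> cs \<alpha> s" "\<pi> t \<in> cs \<beta> t"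
    using assms mem_cs[of s s] mem_cs[of t t] by (simp_all add: w_zero)
  ultimately show ?thesis
    unfolding cs_def by auto
qed

lemma carrier_gr_component: "carrier (gr_component B v \<gamma>) = {cs \<gamma> s | s. s \<in> S \<and> Fin \<gamma> \<le> w s}"
proof -
  have "carrier (gr_component B v \<gamma>) = {val_gt B v \<gamma> +> x | x. x \<in> val_ge B v \<gamma>}"
    by (auto simp: gr_component_def A_FactGroup_def FactGroup_def RCOSETS_def a_r_coset_def r_coset_def)
  also have "\<dots> = {val_gt B v \<gamma> +> \<pi> s | s. s \<in> S \<and> Fin \<gamma> \<le> w s}"
    using image by (auto simp: val_ge_def w_def) (metis imageE)
  also have "\<dots> = {cs \<gamma> s | s. s \<in> S \<and> Fin \<gamma> \<le> w s}"
    by (intro Collect_cong ex_cong1) (auto simp: coset_eq_cs)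
  finally show ?thesis .
qed

text \<open>The components are additive quotients turned into multiplicative records, so that their
  product is addition of cosets; this is why the multiplication of the graded ring is a
  \<open>finprod\<close>.\<close>

lemma mult_gr_component: "x \<otimes>\<^bsub>gr_component B v \<gamma>\<^esub> y = x <+>\<^bsub>B\<^esub> y"
  by (simp add: gr_component_def A_FactGroup_def FactGroup_def set_add_def set_mult_def)

lemma one_gr_component: "\<one>\<^bsub>gr_component B v \<gamma>\<^esub> = cs \<gamma> 0"
  by (simp add: gr_component_def A_FactGroup_def FactGroup_def val_gt_eq_cs)

lemma comm_monoid_gr_component: "comm_monoid (gr_component B v \<gamma>)"
proof (rule comm_monoidI, goal_cases)
  case (1 x y)
  then obtain s t where "s \<in> S" "t \<in> S" "Fin \<gamma> \<le> w s" "Fin \<gamma> \<le> w t" "x = cs \<gamma> s" "y = cs \<gamma> t"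
    by (auto simp: carrier_gr_component)
  then show ?case
    using w_add_geI X_closed(4) unfolding carrier_gr_component mult_gr_component by (auto simp: cs_add)
next
  case 2
  show ?case
    using X_closed(2) w_zero by (auto simp: carrier_gr_component one_gr_component)
qed (auto simp: carrier_gr_component mult_gr_component one_gr_component cs_add X_closed ac_simps)

lemma finprod_gr_component:
  assumes "finite I" "\<And>i. i \<in> I \<Longrightarrow> s i \<in> S \<and> Fin \<gamma> \<le> w (s i) \<and> h i = cs \<gamma> (s i)"
  shows "finprod (gr_component B v \<gamma>) h I = cs \<gamma> (\<Sum>i\<in>I. s i)"
proof -
  interpret C: comm_monoid "gr_component B v \<gamma>"
    by (rule comm_monoid_gr_component)
  show ?thesis
    using assms
  proof (induction I rule: finite_induct)
    case (insert i I)
    have "h \<in> I \<rightarrow> carrier (gr_component B v \<gamma>)" "h i \<in> carrier (gr_component B v \<gamma>)"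
      using insert.prems by (auto simp: carrier_gr_component Pi_def)
    then show ?case
      using insert subring_set_sum[OF D, of I s] by (simp add: mult_gr_component cs_add)
  qed (simp add: one_gr_component)
qed

definition rees :: "('g \<Rightarrow>\<^sub>0 'r) set" where
  "rees = {p. \<forall>\<gamma>. Poly_Mapping.lookup p \<gamma> \<in> S \<and> Fin \<gamma> \<le> w (Poly_Mapping.lookup p \<gamma>)}"

definition gr_of :: "('g \<Rightarrow>\<^sub>0 'r) \<Rightarrow> 'g \<Rightarrow> 'b set" where
  "gr_of p = (\<lambda>\<gamma>. cs \<gamma> (Poly_Mapping.lookup p \<gamma>))"

lemma reesD: "p \<in> rees \<Longrightarrow> Poly_Mapping.lookup p \<gamma> \<in> S" "p \<in> rees \<Longrightarrow> Fin \<gamma> \<le> w (Poly_Mapping.lookup p \<gamma>)"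
  by (auto simp: rees_def)

lemma single_in_rees: "s \<in> S \<Longrightarrow> Fin \<gamma> \<le> w s \<Longrightarrow> Poly_Mapping.single \<gamma> s \<in> rees"
  by (auto simp: rees_def lookup_single when_def X_closed w_zero)

lemma lookup_mult_terms:
  assumes "p \<in> rees" "q \<in> rees"
  shows "Poly_Mapping.lookup p \<alpha> * Poly_Mapping.lookup q (\<gamma> - \<alpha>) \<in> S"
    "Fin \<gamma> \<le> w (Poly_Mapping.lookup p \<alpha> * Poly_Mapping.lookup q (\<gamma> - \<alpha>))"
proof -
  have "Fin \<alpha> + Fin (\<gamma> - \<alpha>) \<le> w (Poly_Mapping.lookup p \<alpha>) + w (Poly_Mapping.lookup q (\<gamma> - \<alpha>))"
    using assms by (intro add_mono reesD)
  then show "Fin \<gamma> \<le> w (Poly_Mapping.lookup p \<alpha> * Poly_Mapping.lookup q (\<gamma> - \<alpha>))"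
    using assms reesD(1) by (simp add: w_mult)
  show "Poly_Mapping.lookup p \<alpha> * Poly_Mapping.lookup q (\<gamma> - \<alpha>) \<in> S"
    using assms reesD(1) X_closed(5) by blast
qed

lemma subring_set_rees: "subring_set rees"
  unfolding subring_set_def
proof (intro conjI ballI)
  show "1 \<in> rees"
    using single_in_rees[of 1 0] X_closed(1) by (simp add: w_one zero_extended_def)
  fix p q assume pq: "p \<in> rees" "q \<in> rees"
  have "Fin \<gamma> \<le> w (Poly_Mapping.lookup p \<gamma> - Poly_Mapping.lookup q \<gamma>)" for \<gamma>
    using w_add_geI[of "Poly_Mapping.lookup p \<gamma>" "- Poly_Mapping.lookup q \<gamma>" "Fin \<gamma>"]
      reesD[OF pq(1), of \<gamma>] reesD[OF pq(2), of \<gamma>] X_closed(6) by (simp add: w_uminus)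
  then show "p - q \<in> rees"
    unfolding rees_def mem_Collect_eq lookup_minus using reesD(1)[OF pq(1)] reesD(1)[OF pq(2)] X_closed(3) by blast
  show "p * q \<in> rees"
    unfolding rees_def mem_Collect_eq lookup_mult_group using lookup_mult_terms[OF pq]
    by (auto intro!: subring_set_sum[OF D] w_sum_geI)
qed

text \<open>The graded product sums over the degrees with nonzero coset, the product of
  representatives over the support of p, which may be larger. In the additional degrees p has value
  above its degree, so they contribute only terms of value above \<gamma>.\<close>

lemma gr_of_mult:
  assumes pq: "p \<in> rees" "q \<in> rees"
  shows "gr_of (p * q) = gr_of p \<otimes>\<^bsub>gr_ring B v\<^esub> gr_of q"
proof
  fix \<gamma>
  let ?N = "{\<alpha>. gr_of p \<alpha> \<noteq> val_gt B v \<alpha>}" and ?K = "Poly_Mapping.keys p"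
  let ?t = "\<lambda>\<alpha>. Poly_Mapping.lookup p \<alpha> * Poly_Mapping.lookup q (\<gamma> - \<alpha>)"
  have sub: "?N \<subseteq> ?K"
    by (auto simp: gr_of_def val_gt_eq_cs in_keys_iff)
  have fin: "finite ?N"
    by (rule finite_subset[OF sub]) simp
  have "(gr_of p \<otimes>\<^bsub>gr_ring B v\<^esub> gr_of q) \<gamma> = cs \<gamma> (\<Sum>\<alpha>\<in>?N. ?t \<alpha>)"
    unfolding gr_ring_def monoid.simps
  proof (rule finprod_gr_component[OF fin])
    fix \<alpha> assume "\<alpha> \<in> ?N"
    show "?t \<alpha> \<in> S \<and> Fin \<gamma> \<le> w (?t \<alpha>) \<and>
        (\<Union>a\<in>gr_of p \<alpha>. \<Union>b\<in>gr_of q (\<gamma> - \<alpha>). val_gt B v \<gamma> +> a \<otimes> b) = cs \<gamma> (?t \<alpha>)"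
      using lookup_mult_terms[OF pq] unfolding gr_of_def
      by (intro conjI cs_mult reesD pq) simp_all
  qed
  also have "\<dots> = cs \<gamma> (\<Sum>\<alpha>\<in>?K. ?t \<alpha>)"
  proof -
    have "Fin \<gamma> < w (\<Sum>\<alpha>\<in>?K - ?N. ?t \<alpha>)"
    proof (rule w_sum_gtI)
      fix \<alpha> assume "\<alpha> \<in> ?K - ?N"
      then have "Fin \<alpha> < w (Poly_Mapping.lookup p \<alpha>)"
        using cs_eq_iff[of "Poly_Mapping.lookup p \<alpha>" 0] reesD(1)[OF pq(1)] X_closed(2)
        by (simp add: gr_of_def val_gt_eq_cs)
      then have "Fin \<gamma> < w (Poly_Mapping.lookup p \<alpha>) + w (Poly_Mapping.lookup q (\<gamma> - \<alpha>))"
        using reesD(2)[OF pq(2), of "\<gamma> - \<alpha>"]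
        by (cases "w (Poly_Mapping.lookup p \<alpha>)"; cases "w (Poly_Mapping.lookup q (\<gamma> - \<alpha>))")
          (auto dest: add_less_le_mono)
      then show "?t \<alpha> \<in> S \<and> Fin \<gamma> < w (?t \<alpha>)"
        using lookup_mult_terms(1)[OF pq] reesD(1)[OF pq(1)] reesD(1)[OF pq(2)] by (simp add: w_mult)
    qed simp
    also have "(\<Sum>\<alpha>\<in>?K - ?N. ?t \<alpha>) = (\<Sum>\<alpha>\<in>?K. ?t \<alpha>) - (\<Sum>\<alpha>\<in>?N. ?t \<alpha>)"
      by (rule sum_diff[OF finite_keys sub])
    finally have less: "Fin \<gamma> < w ((\<Sum>\<alpha>\<in>?K. ?t \<alpha>) - (\<Sum>\<alpha>\<in>?N. ?t \<alpha>))" .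
    have mem: "(\<Sum>\<alpha>\<in>?K. ?t \<alpha>) \<in> S" "(\<Sum>\<alpha>\<in>?N. ?t \<alpha>) \<in> S"
      using lookup_mult_terms(1)[OF pq] by (auto intro!: subring_set_sum[OF D])
    show ?thesis
      by (rule cs_eq_iff[OF mem, THEN iffD2, OF less, symmetric])
  qed
  finally show "gr_of (p * q) \<gamma> = (gr_of p \<otimes>\<^bsub>gr_ring B v\<^esub> gr_of q) \<gamma>"
    by (simp add: gr_of_def lookup_mult_group)
qed

lemma surj_hom_gr: "surj_hom gr_of rees (gr_ring B v)"
proof
  show "subring_set rees"
    by (rule subring_set_rees)
  show "gr_of (p * q) = gr_of p \<otimes>\<^bsub>gr_ring B v\<^esub> gr_of q" if "p \<in> rees" "q \<in> rees" for p q
    by (rule gr_of_mult[OF that])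
  show "gr_of (p + q) = gr_of p \<oplus>\<^bsub>gr_ring B v\<^esub> gr_of q" if "p \<in> rees" "q \<in> rees" for p q
    using that by (auto simp: gr_of_def gr_ring_def lookup_add cs_add reesD)
  show "gr_of 1 = \<one>\<^bsub>gr_ring B v\<^esub>"
    using coset_eq_cs[of 1 0] X_closed(1)
    by (auto simp: gr_of_def gr_ring_def lookup_one when_def val_gt_eq_cs hom_one fun_eq_iff)
  show "gr_of 0 = \<zero>\<^bsub>gr_ring B v\<^esub>"
    by (auto simp: gr_of_def gr_ring_def val_gt_eq_cs)
  show "gr_of ` rees = carrier (gr_ring B v)"
  proof
    show "gr_of ` rees \<subseteq> carrier (gr_ring B v)"
    proof
      fix x assume "x \<in> gr_of ` rees"
      then obtain p where p: "p \<in> rees" "x = gr_of p"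
        by blast
      have "{\<gamma>. x \<gamma> \<noteq> val_gt B v \<gamma>} \<subseteq> Poly_Mapping.keys p"
        by (auto simp: p(2) gr_of_def val_gt_eq_cs in_keys_iff)
      then have "finite {\<gamma>. x \<gamma> \<noteq> val_gt B v \<gamma>}"
        by (rule finite_subset) simp
      then show "x \<in> carrier (gr_ring B v)"
        using p reesD by (auto simp: gr_ring_def carrier_gr_component gr_of_def)
    qed
    show "carrier (gr_ring B v) \<subseteq> gr_of ` rees"
    proof
      fix x assume x: "x \<in> carrier (gr_ring B v)"
      \<comment> \<open>Zero cosets are represented by 0, so that the family of representatives has
        finite support.\<close>
      have "\<exists>s. s \<in> S \<and> Fin \<gamma> \<le> w s \<and> x \<gamma> = cs \<gamma> s \<and> (x \<gamma> = cs \<gamma> 0 \<longrightarrow> s = 0)" for \<gamma>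
      proof (cases "x \<gamma> = cs \<gamma> 0")
        case True
        then show ?thesis
          using X_closed(2) by (intro exI[of _ 0]) (simp add: w_zero)
      next
        case False
        then show ?thesis
          using x by (auto simp: gr_ring_def carrier_gr_component)
      qed
      then obtain s where s: "\<And>\<gamma>. s \<gamma> \<in> S \<and> Fin \<gamma> \<le> w (s \<gamma>) \<and> x \<gamma> = cs \<gamma> (s \<gamma>) \<and> (x \<gamma> = cs \<gamma> 0 \<longrightarrow> s \<gamma> = 0)"
        by metis
      have "{\<gamma>. s \<gamma> \<noteq> 0} \<subseteq> {\<gamma>. x \<gamma> \<noteq> val_gt B v \<gamma>}"
      proof
        fix \<gamma> assume "\<gamma> \<in> {\<gamma>. s \<gamma> \<noteq> 0}"
        then show "\<gamma> \<in> {\<gamma>. x \<gamma> \<noteq> val_gt B v \<gamma>}"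
          using s[of \<gamma>] by (auto simp: val_gt_eq_cs)
      qed
      moreover have "finite {\<gamma>. x \<gamma> \<noteq> val_gt B v \<gamma>}"
        using x by (simp add: gr_ring_def)
      ultimately have "finite {\<gamma>. s \<gamma> \<noteq> 0}"
        by (rule finite_subset)
      then have lookup: "Poly_Mapping.lookup (Abs_poly_mapping s) = s"
        by simp
      have "x = gr_of (Abs_poly_mapping s)" "Abs_poly_mapping s \<in> rees"
        using s by (auto simp: gr_of_def rees_def lookup)
      then show "x \<in> gr_of ` rees"
        by blast
    qed
  qed
qed

lemma gr_of_eq_iff:
  assumes "p \<in> rees" "q \<in> rees"
  shows "gr_of p = gr_of q \<longleftrightarrow> (\<forall>\<gamma>. Fin \<gamma> < w (Poly_Mapping.lookup p \<gamma> - Poly_Mapping.lookup q \<gamma>))"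
  unfolding gr_of_def fun_eq_iff using cs_eq_iff reesD(1) assms by simp

lemma gr_of_single:
  assumes "s \<in> S" "w s = Fin \<gamma>"
  shows "gr_of (Poly_Mapping.single \<gamma> s) = initial_form B v (\<pi> s)"
  using assms coset_eq_cs[of s] by (auto simp: gr_of_def initial_form_def lookup_single when_def val_gt_eq_cs w_def fun_eq_iff)

end

section \<open>Polynomial rings\<close>

definition mpset :: "'x::comm_ring_1 set \<Rightarrow> 'i set \<Rightarrow> ('i multiset \<Rightarrow>\<^sub>0 'x) set" where
  "mpset D I = {q. \<forall>m. Poly_Mapping.lookup q m \<in> D \<and> (Poly_Mapping.lookup q m \<noteq> 0 \<longrightarrow> set_mset m \<subseteq> I)}"

lemma single_in_mpset: "subring_set D \<Longrightarrow> x \<in> D \<Longrightarrow> set_mset m \<subseteq> I \<Longrightarrow> Poly_Mapping.single m x \<in> mpset D I"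
  using subring_setD(2)[of D] by (auto simp: mpset_def lookup_single when_def)

lemma subring_set_mpset:
  assumes D: "subring_set D"
  shows "subring_set (mpset D I)"
  unfolding subring_set_def
proof (intro conjI ballI)
  show "1 \<in> mpset D I"
    using single_in_mpset[OF D subring_setD(1)[OF D], of "{#}" I] by simp
  fix p q assume pq: "p \<in> mpset D I" "q \<in> mpset D I"
  then have D': "Poly_Mapping.lookup p m \<in> D" "Poly_Mapping.lookup q m \<in> D" for m
    by (auto simp: mpset_def)
  have supp: "Poly_Mapping.lookup p m \<noteq> 0 \<Longrightarrow> set_mset m \<subseteq> I" "Poly_Mapping.lookup q m \<noteq> 0 \<Longrightarrow> set_mset m \<subseteq> I" for m
    using pq by (auto simp: mpset_def)
  show "p - q \<in> mpset D I"
    unfolding mpset_def mem_Collect_eq lookup_minus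
  proof (intro allI conjI impI)
    fix m
    show "Poly_Mapping.lookup p m - Poly_Mapping.lookup q m \<in> D"
      by (rule subring_setD(3)[OF D D'])
    assume "Poly_Mapping.lookup p m - Poly_Mapping.lookup q m \<noteq> 0"
    then have "Poly_Mapping.lookup p m \<noteq> 0 \<or> Poly_Mapping.lookup q m \<noteq> 0"
      by auto
    then show "set_mset m \<subseteq> I"
      using supp by blast
  qed
  show "p * q \<in> mpset D I"
    unfolding mpset_def mem_Collect_eq
  proof (intro allI conjI impI)
    fix m
    show "Poly_Mapping.lookup (p * q) m \<in> D"
      unfolding lookup_mult_multiset by (intro subring_set_sum[OF D] subring_setD(5)[OF D] D')
    assume "Poly_Mapping.lookup (p * q) m \<noteq> 0"
    then obtain a where a: "a \<subseteq># m" "Poly_Mapping.lookup p a * Poly_Mapping.lookup q (m - a) \<noteq> 0"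
      unfolding lookup_mult_multiset by (rule sum.not_neutral_contains_not_neutral) simp
    then have "Poly_Mapping.lookup p a \<noteq> 0" "Poly_Mapping.lookup q (m - a) \<noteq> 0"
      by auto
    then have "set_mset a \<subseteq> I" "set_mset (m - a) \<subseteq> I"
      using supp by blast+
    moreover have "m = a + (m - a)"
      using a(1) by simp
    ultimately show "set_mset m \<subseteq> I"
      by (metis Un_least set_mset_union)
  qed
qed

context surj_hom
begin

definition mp_of :: "('i multiset \<Rightarrow>\<^sub>0 'x) \<Rightarrow> 'i multiset \<Rightarrow> 'y" where
  "mp_of q = (\<lambda>m. \<rho> (Poly_Mapping.lookup q m))"

lemma mp_of_single_empty: "mp_of (Poly_Mapping.single {#} x) = indexed_const (\<rho> x)"
  by (auto simp: mp_of_def indexed_const_def lookup_single when_def hom_zero)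

lemma mp_of_zero: "mp_of 0 = indexed_const \<zero>"
  using mp_of_single_empty[of 0] by (simp add: hom_zero)

lemma mp_of_one: "mp_of 1 = indexed_const \<one>"
  using mp_of_single_empty[of 1] by (simp add: hom_one)

lemma mp_of_add: "q \<in> mpset D I \<Longrightarrow> q' \<in> mpset D I \<Longrightarrow> mp_of (q + q') = indexed_padd (mp_of q) (mp_of q')"
  by (auto simp: mp_of_def indexed_padd_def lookup_add mpset_def hom_add)

lemma lookup_mult_single_var:
  "Poly_Mapping.lookup (Poly_Mapping.single {#i#} 1 * q) m
    = (if i \<in># m then Poly_Mapping.lookup q (m - {#i#}) else (0 :: 'x))"
proof -
  have "Poly_Mapping.lookup (Poly_Mapping.single {#i#} 1 * q) m
    = (\<Sum>a\<in>{a. a \<subseteq># m}. if {#i#} = a then Poly_Mapping.lookup q (m - a) else 0)"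
    unfolding lookup_mult_multiset by (intro sum.cong) (auto simp: lookup_single when_def)
  then show ?thesis
    by (simp add: finite_submultisets)
qed

lemma mp_of_var: "mp_of (Poly_Mapping.single {#i#} 1 * q) = indexed_pmult (mp_of q) i"
  unfolding mp_of_def indexed_pmult_def lookup_mult_single_var by (auto simp: hom_zero)

text \<open>\<open>indexed_pset\<close> is generated inductively by constants, sums and
  multiplication by a variable. Accordingly a polynomial is split into monomials, and a monomial is
  built up by one variable at a time.\<close>

lemma mp_of_image: "mp_of ` mpset D I = indexed_pset I (carrier G)"
proof
  note P = subring_setD[OF subring_set_mpset[OF D, of I]]
  show "indexed_pset I (carrier G) \<subseteq> mp_of ` mpset D I"
  proof
    fix x assume "x \<in> indexed_pset I (carrier G)"
    then show "x \<in> mp_of ` mpset D I"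
    proof (induction rule: indexed_pset.induct)
      case (indexed_const k)
      then obtain a where "a \<in> D" "k = \<rho> a"
        using rep by blast
      then show ?case
        using single_in_mpset[OF D, of a "{#}" I] by (auto simp flip: mp_of_single_empty)
    next
      case (indexed_padd P Q)
      then show ?case
        using P(4) by (auto simp flip: mp_of_add)
    next
      case (indexed_pmult P i)
      then show ?case
        using P(5) single_in_mpset[OF D X_closed(1), of "{#i#}" I] by (auto simp flip: mp_of_var)
    qed
  qed
  have single: "mp_of (Poly_Mapping.single m a) \<in> indexed_pset I (carrier G)" if "set_mset m \<subseteq> I" "a \<in> D" for m a
    using that(1)
  proof (induction m)
    case empty
    then show ?case
      using that(2) hom_closed by (simp add: mp_of_single_empty indexed_pset.indexed_const)
  next
    case (add i m)
    have "Poly_Mapping.single (add_mset i m) a = Poly_Mapping.single {#i#} 1 * Poly_Mapping.single m a"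
      by (simp add: mult_single)
    then show ?case
      using add by (simp add: mp_of_var indexed_pset.indexed_pmult)
  qed
  show "mp_of ` mpset D I \<subseteq> indexed_pset I (carrier G)"
  proof
    fix x assume "x \<in> mp_of ` mpset D I"
    then obtain q where q: "q \<in> mpset D I" "x = mp_of q"
      by blast
    have mem: "Poly_Mapping.single k (Poly_Mapping.lookup q k) \<in> mpset D I \<and>
        mp_of (Poly_Mapping.single k (Poly_Mapping.lookup q k)) \<in> indexed_pset I (carrier G)" if "k \<in> Poly_Mapping.keys q" for k
    proof -
      have "Poly_Mapping.lookup q k \<in> D" "set_mset k \<subseteq> I"
        using that q(1) by (auto simp: mpset_def in_keys_iff)
      then show ?thesis
        using single[of k] single_in_mpset[OF D] by simp
    qed
    have "mp_of (\<Sum>k\<in>K. Poly_Mapping.single k (Poly_Mapping.lookup q k)) \<in> indexed_pset I (carrier G)"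
      if "finite K" "K \<subseteq> Poly_Mapping.keys q" for K
      using that
    proof (induction K rule: finite_induct)
      case empty
      show ?case
        by (simp add: mp_of_zero indexed_pset.indexed_const)
    next
      case (insert k K)
      have "(\<Sum>k\<in>K. Poly_Mapping.single k (Poly_Mapping.lookup q k)) \<in> mpset D I"
        using insert.prems mem by (intro subring_set_sum[OF subring_set_mpset[OF D]]) auto
      then show ?case
        using insert mem[of k] by (simp add: mp_of_add[of _ I] indexed_pset.indexed_padd)
    qed
    then show "x \<in> indexed_pset I (carrier G)"
      using q(2) poly_mapping_sum_single[of q] by (metis finite_keys order_refl)
  qed
qed

lemma surj_hom_mpoly: "surj_hom mp_of (mpset D I) (mpoly_ring G I)"
proof
  show "subring_set (mpset D I)"
    by (rule subring_set_mpset[OF D])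
  show "mp_of ` mpset D I = carrier (mpoly_ring G I)"
    by (simp add: mp_of_image mpoly_ring_def)
  show "mp_of (p + q) = mp_of p \<oplus>\<^bsub>mpoly_ring G I\<^esub> mp_of q" if "p \<in> mpset D I" "q \<in> mpset D I" for p q
    using mp_of_add[OF that] by (simp add: mpoly_ring_def)
  show "mp_of 1 = \<one>\<^bsub>mpoly_ring G I\<^esub>" "mp_of 0 = \<zero>\<^bsub>mpoly_ring G I\<^esub>"
    by (simp_all add: mpoly_ring_def mp_of_one mp_of_zero)
  show "mp_of (p * q) = mp_of p \<otimes>\<^bsub>mpoly_ring G I\<^esub> mp_of q" if pq: "p \<in> mpset D I" "q \<in> mpset D I" for p q
  proof
    fix m
    have D': "Poly_Mapping.lookup p a \<in> D" "Poly_Mapping.lookup q a \<in> D" for a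
      using pq by (auto simp: mpset_def)
    have "mp_of (p * q) m = (\<Oplus>a\<in>{a. a \<subseteq># m}. \<rho> (Poly_Mapping.lookup p a * Poly_Mapping.lookup q (m - a)))"
      unfolding mp_of_def lookup_mult_multiset
      using D' X_closed(5) by (intro hom_sum) (auto simp: finite_submultisets)
    then show "mp_of (p * q) m = (mp_of p \<otimes>\<^bsub>mpoly_ring G I\<^esub> mp_of q) m"
      using D' by (simp add: mpoly_ring_def mp_of_def hom_mult)
  qed
qed

end

section \<open>Evaluation of polynomials\<close>

definition mset_of :: "nat set \<Rightarrow> (nat \<Rightarrow> nat) \<Rightarrow> nat multiset" where
  "mset_of I J = (\<Sum>i\<in>I. replicate_mset (J i) i)"

lemma count_mset_of: "finite I \<Longrightarrow> count (mset_of I J) i = (if i \<in> I then J i else 0)"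
  by (simp add: mset_of_def count_sum)

lemma single_prod: "(\<Prod>i\<in>I. Poly_Mapping.single (m i) (1::'x::comm_ring_1)) = Poly_Mapping.single (\<Sum>i\<in>I. m i) 1"
  by (induction I rule: infinite_finite_induct) (simp_all add: mult_single)

lemma single_power: "Poly_Mapping.single m (a::'x::comm_ring_1) ^ n = Poly_Mapping.single ((\<Sum>_<n. m)) (a ^ n)"
  by (induction n) (simp_all add: mult_single add.commute mult.commute)

lemma sum_replicate_mset: "(\<Sum>_<n. {#i#}) = replicate_mset n i"
  by (induction n) simp_all

locale evaluation =
  fixes lift :: "'x::comm_ring_1 \<Rightarrow> 'z::comm_ring_1" and e :: "nat \<Rightarrow> 'z"
  assumes lift_add: "lift (a + b) = lift a + lift b" and lift_mult: "lift (a * b) = lift a * lift b"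
    and lift_one: "lift 1 = 1"
begin

lemma lift_zero: "lift 0 = 0"
  using lift_add[of 0 0] by simp

definition ev :: "(nat multiset \<Rightarrow>\<^sub>0 'x) \<Rightarrow> 'z" where
  "ev q = (\<Sum>m\<in>Poly_Mapping.keys q. lift (Poly_Mapping.lookup q m) * (\<Prod>i\<in>#m. e i))"

lemma ev_superset:
  assumes "finite K" "Poly_Mapping.keys q \<subseteq> K"
  shows "ev q = (\<Sum>m\<in>K. lift (Poly_Mapping.lookup q m) * (\<Prod>i\<in>#m. e i))"
  unfolding ev_def using assms by (intro sum.mono_neutral_left) (auto simp: in_keys_iff lift_zero)

lemma ev_add: "ev (p + q) = ev p + ev q"
proof -
  let ?K = "Poly_Mapping.keys p \<union> Poly_Mapping.keys q"
  have "Poly_Mapping.keys (p + q) \<subseteq> ?K"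
    by (rule Poly_Mapping.keys_add)
  then show ?thesis
    using ev_superset[of ?K "p + q"] ev_superset[of ?K p] ev_superset[of ?K q]
    by (simp add: lookup_add lift_add distrib_right sum.distrib)
qed

lemma ev_zero: "ev 0 = 0"
  by (simp add: ev_def)

lemma ev_sum: "ev (\<Sum>i\<in>I. p i) = (\<Sum>i\<in>I. ev (p i))"
  by (induction I rule: infinite_finite_induct) (simp_all add: ev_add ev_zero)

lemma ev_single: "ev (Poly_Mapping.single m a) = lift a * (\<Prod>i\<in>#m. e i)"
  using ev_superset[of "{m}" "Poly_Mapping.single m a"] by simp

lemma ev_mult: "ev (p * q) = ev p * ev q"
proof -
  let ?s = "\<lambda>p m. Poly_Mapping.single m (Poly_Mapping.lookup p m)"
  have "p * q = (\<Sum>m\<in>Poly_Mapping.keys p. ?s p m) * (\<Sum>n\<in>Poly_Mapping.keys q. ?s q n)"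
    using poly_mapping_sum_single[of p] poly_mapping_sum_single[of q] by (rule arg_cong2[where f = "(*)"])
  then have "ev (p * q) = ev (\<Sum>m\<in>Poly_Mapping.keys p. \<Sum>n\<in>Poly_Mapping.keys q. ?s p m * ?s q n)"
    by (simp only: sum_product)
  also have "\<dots> = (\<Sum>m\<in>Poly_Mapping.keys p. \<Sum>n\<in>Poly_Mapping.keys q. ev (?s p m * ?s q n))"
    by (simp only: ev_sum)
  also have "\<dots> = (\<Sum>m\<in>Poly_Mapping.keys p. \<Sum>n\<in>Poly_Mapping.keys q. ev (?s p m) * ev (?s q n))"
    by (intro sum.cong refl) (simp add: ev_single mult_single lift_mult ac_simps)
  also have "\<dots> = (\<Sum>m\<in>Poly_Mapping.keys p. ev (?s p m)) * (\<Sum>n\<in>Poly_Mapping.keys q. ev (?s q n))"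
    by (simp only: sum_product)
  also have "\<dots> = ev p * ev q"
    by (simp only: ev_single) (simp only: ev_def)
  finally show ?thesis .
qed

lemma ev_one: "ev 1 = 1"
  using ev_single[of "{#}" 1] by (simp add: lift_one)

lemma ev_uminus: "ev (- p) = - ev p"
  using ev_add[of p "- p"] by (simp add: ev_zero eq_neg_iff_add_eq_0 add.commute)

lemma ev_diff: "ev (p - q) = ev p - ev q"
  using ev_add[of p "- q"] by (simp add: ev_uminus)

lemma prod_mset_of: "finite I \<Longrightarrow> (\<Prod>i\<in>#mset_of I J. e i) = (\<Prod>i\<in>I. e i ^ J i)"
  unfolding mset_of_def by (induction I rule: finite_induct) simp_all

end

section \<open>Presentations of graded rings\<close>

declare One_nat_def [simp del]

lemma sum_mset_of: "finite S \<Longrightarrow> (\<Sum>l\<in>#mset_of S J. (w l :: nat)) = (\<Sum>l\<in>S. J l * w l)"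
  unfolding mset_of_def by (induction S rule: finite_induct) simp_all

text \<open>\<open>weight\<close> orients each relation as a rewriting rule that replaces a power of
  a variable by a lighter monomial in earlier variables. \<open>span\<close> and \<open>free\<close>
  say that the values of the monomials to which no rule applies form a basis. For the graded ring
  the weights will be the degrees of the key polynomials.\<close>

locale presentation = ga: surj_hom \<rho>A DA GA + gb: surj_hom \<rho>B DB GB + evaluation lift e
  for \<rho>A :: "'x::comm_ring_1 \<Rightarrow> 'y" and DA and GA
    and \<rho>B :: "'z::comm_ring_1 \<Rightarrow> 'w" and DB and GB and lift :: "'x \<Rightarrow> 'z" and e +
  fixes \<psi> :: "'y \<Rightarrow> 'w" and k :: nat and n :: "nat \<Rightarrow> nat" and c :: "nat \<Rightarrow> 'x" and cb :: "nat \<Rightarrow> 'y"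
    and j :: "nat \<Rightarrow> nat \<Rightarrow> nat" and wt :: "nat \<Rightarrow> nat"
  assumes lift_closed: "a \<in> DA \<Longrightarrow> lift a \<in> DB"
    and lift_hom: "a \<in> DA \<Longrightarrow> \<psi> (\<rho>A a) = \<rho>B (lift a)"
    and k_ge_1: "1 \<le> k"
    and e_closed: "i \<in> {1..<k} \<Longrightarrow> e i \<in> DB"
    and c_closed: "i \<in> {1..<k} \<Longrightarrow> c i \<in> DA"
    and cb_eq: "i \<in> {1..<k} \<Longrightarrow> cb i = \<rho>A (c i)"
    and weight: "i \<in> {1..<k} \<Longrightarrow> (\<Sum>l\<in>{1..<i}. j l i * wt l) < n i * wt i"
    and relation: "i \<in> {1..<k} \<Longrightarrow> \<rho>B (e i ^ n i - lift (c i) * (\<Prod>l\<in>{1..<i}. e l ^ j l i)) = \<zero>\<^bsub>GB\<^esub>"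
    and span: "y \<in> DB \<Longrightarrow> \<exists>a. (\<forall>J. a J \<in> DA) \<and> \<rho>B y = \<rho>B (\<Sum>J\<in>expon n k. lift (a J) * kmon e k J)"
    and free: "(\<And>J. b J \<in> DA) \<Longrightarrow> \<rho>B (\<Sum>J\<in>expon n k. lift (b J) * kmon e k J) = \<zero>\<^bsub>GB\<^esub>
      \<Longrightarrow> J \<in> expon n k \<Longrightarrow> \<rho>A (b J) = \<zero>\<^bsub>GA\<^esub>"
begin

definition M :: "(nat multiset \<Rightarrow>\<^sub>0 'x) set" where "M = mpset DA {1..<k}"

abbreviation P where "P \<equiv> mpoly_ring GA {1..<k}"

definition I :: "(nat multiset \<Rightarrow> 'y) set" where "I = presentation_ideal GA k n cb j"

lemma mp: "surj_hom ga.mp_of M P"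
  unfolding M_def by (rule ga.surj_hom_mpoly)

sublocale mp: surj_hom ga.mp_of M P
  by (rule mp)

definition r :: "nat \<Rightarrow> nat multiset \<Rightarrow>\<^sub>0 'x" where
  "r i = Poly_Mapping.single {#i#} 1 ^ n i
    - Poly_Mapping.single {#} (c i) * (\<Prod>l\<in>{1..<i}. Poly_Mapping.single {#l#} 1 ^ j l i)"

lemma var_in_M: "i \<in> {1..<k} \<Longrightarrow> Poly_Mapping.single {#i#} 1 \<in> M"
  and const_in_M: "a \<in> DA \<Longrightarrow> Poly_Mapping.single {#} a \<in> M"
  unfolding M_def using single_in_mpset[OF ga.D, of _ _ "{1..<k}"] ga.X_closed(1) by auto

lemma mon_in_M: "set_mset m \<subseteq> {1..<k} \<Longrightarrow> a \<in> DA \<Longrightarrow> Poly_Mapping.single m a \<in> M"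
  unfolding M_def by (rule single_in_mpset[OF ga.D])

lemma prod_var_in_M: "i \<in> {1..<k} \<Longrightarrow> (\<Prod>l\<in>{1..<i}. Poly_Mapping.single {#l#} 1 ^ j l i) \<in> M"
  by (intro mp.X_prod mp.X_closed(7) var_in_M) auto

lemma r_in_M: "i \<in> {1..<k} \<Longrightarrow> r i \<in> M"
  unfolding r_def
  by (intro mp.X_closed(3) mp.X_closed(5) mp.X_closed(7) var_in_M const_in_M prod_var_in_M c_closed)

lemma mp_of_single_var: "ga.mp_of (Poly_Mapping.single {#i#} 1) = ring.indexed_var GA i"
  using ga.mp_of_var[of i 1] by (simp add: ga.mp_of_one ga.indexed_var_def)

lemma mp_of_r:
  assumes i: "i \<in> {1..<k}"
  shows "ga.mp_of (r i) = ring.indexed_var GA i [^]\<^bsub>P\<^esub> n i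
    \<ominus>\<^bsub>P\<^esub> ring.indexed_const GA (cb i) \<otimes>\<^bsub>P\<^esub> (\<Otimes>\<^bsub>P\<^esub>l\<in>{1..<i}. ring.indexed_var GA l [^]\<^bsub>P\<^esub> j l i)"
proof -
  have l: "l \<in> {1..<k}" if "l \<in> {1..<i}" for l
    using that i by auto
  have "ga.mp_of (\<Prod>l\<in>{1..<i}. Poly_Mapping.single {#l#} 1 ^ j l i)
      = (\<Otimes>\<^bsub>P\<^esub>l\<in>{1..<i}. ga.mp_of (Poly_Mapping.single {#l#} 1 ^ j l i))"
    by (intro mp.hom_prod mp.X_closed(7) var_in_M l) auto
  also have "\<dots> = (\<Otimes>\<^bsub>P\<^esub>l\<in>{1..<i}. ring.indexed_var GA l [^]\<^bsub>P\<^esub> j l i)"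
    using mp.hom_closed[OF var_in_M[OF l]]
    by (intro mp.finprod_cong') (auto simp: mp.hom_power var_in_M[OF l] mp_of_single_var)
  finally show ?thesis
    unfolding r_def using i mp.X_closed
    by (simp add: mp.hom_diff mp.hom_mult mp.hom_power var_in_M const_in_M prod_var_in_M c_closed
        mp_of_single_var ga.mp_of_single_empty cb_eq)
qed

lemma I_eq: "I = Idl\<^bsub>P\<^esub> (ga.mp_of ` r ` {1..<k})"
proof -
  have "ga.mp_of ` r ` {1..<k} = {ring.indexed_var GA i [^]\<^bsub>P\<^esub> n i
    \<ominus>\<^bsub>P\<^esub> ring.indexed_const GA (cb i) \<otimes>\<^bsub>P\<^esub> (\<Otimes>\<^bsub>P\<^esub>l\<in>{1..<i}. ring.indexed_var GA l [^]\<^bsub>P\<^esub> j l i) | i. i \<in> {1..<k}}"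
    (is "_ = ?R")
  proof
    show "ga.mp_of ` r ` {1..<k} \<subseteq> ?R"
      using mp_of_r by blast
    show "?R \<subseteq> ga.mp_of ` r ` {1..<k}"
    proof
      fix x assume "x \<in> ?R"
      then obtain i where "i \<in> {1..<k}" "x = ga.mp_of (r i)"
        using mp_of_r by force
      then show "x \<in> ga.mp_of ` r ` {1..<k}"
        by blast
    qed
  qed
  then show ?thesis
    unfolding I_def presentation_ideal_def Let_def by (simp only:)
qed

lemma r_image: "ga.mp_of ` r ` {1..<k} \<subseteq> carrier P"
  using r_in_M mp.hom_closed by blast

lemma ideal_I: "ideal I P"
  unfolding I_eq by (rule mp.genideal_ideal[OF r_image])

definition N :: "(nat multiset \<Rightarrow>\<^sub>0 'x) set" where "N = {q \<in> M. ga.mp_of q \<in> I}"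

lemma N_add: "p \<in> N \<Longrightarrow> q \<in> N \<Longrightarrow> p + q \<in> N"
  using mp.X_closed(4) additive_subgroup.a_closed[OF ideal.axioms(1)[OF ideal_I]]
  by (auto simp: N_def mp.hom_add)

lemma N_mult: "p \<in> M \<Longrightarrow> q \<in> N \<Longrightarrow> p * q \<in> N"
  using mp.X_closed(5) ideal.I_l_closed[OF ideal_I] mp.hom_closed
  by (auto simp: N_def mp.hom_mult)

lemma r_in_N: "i \<in> {1..<k} \<Longrightarrow> r i \<in> N"
  using mp.genideal_self[OF r_image] r_in_M by (auto simp: N_def I_eq)

lemma zero_in_N: "0 \<in> N"
  using mp.X_closed(2) additive_subgroup.zero_closed[OF ideal.axioms(1)[OF ideal_I]]
  by (auto simp: N_def mp.hom_zero)

section \<open>Rewriting to normal form modulo the relations\<close>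

definition nf :: "((nat \<Rightarrow> nat) \<Rightarrow> 'x) \<Rightarrow> nat multiset \<Rightarrow>\<^sub>0 'x" where
  "nf a = (\<Sum>J\<in>expon n k. Poly_Mapping.single (mset_of {1..<k} J) (a J))"

lemma nf_add: "nf (\<lambda>J. a J + b J) = nf a + nf b"
  by (simp add: nf_def single_add sum.distrib)

lemma nf_scale: "nf (\<lambda>J. x * a J) = Poly_Mapping.single {#} x * nf a"
  by (simp add: nf_def sum_distrib_left mult_single)

lemma ev_nf: "ev (nf a) = (\<Sum>J\<in>expon n k. lift (a J) * kmon e k J)"
  by (simp add: nf_def ev_sum ev_single prod_mset_of kmon_def)

lemma set_mset_of: "finite S \<Longrightarrow> set_mset (mset_of S J) \<subseteq> S"
  by (auto simp: count_mset_of simp flip: count_greater_zero_iff split: if_splits)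

lemma nf_in_M: "(\<And>J. a J \<in> DA) \<Longrightarrow> nf a \<in> M"
  unfolding nf_def by (intro subring_set_sum[OF mp.D] mon_in_M set_mset_of) auto

definition reducible :: "(nat multiset \<Rightarrow>\<^sub>0 'x) \<Rightarrow> bool" where
  "reducible q \<longleftrightarrow> (\<exists>a. (\<forall>J. a J \<in> DA) \<and> q - nf a \<in> N)"

lemma reducible_add: "reducible p \<Longrightarrow> reducible q \<Longrightarrow> reducible (p + q)"
proof -
  assume "reducible p" "reducible q"
  then obtain a b where ab: "\<And>J. a J \<in> DA" "p - nf a \<in> N" "\<And>J. b J \<in> DA" "q - nf b \<in> N"
    unfolding reducible_def by blast
  have "(p - nf a) + (q - nf b) = p + q - nf (\<lambda>J. a J + b J)"
    unfolding nf_add by simp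
  then have "p + q - nf (\<lambda>J. a J + b J) \<in> N"
    using N_add[OF ab(2,4)] by (simp only:)
  then show ?thesis
    unfolding reducible_def using ab ga.X_closed(4) by (intro exI[of _ "\<lambda>J. a J + b J"]) blast
qed

lemma reducible_scale: "x \<in> DA \<Longrightarrow> reducible q \<Longrightarrow> reducible (Poly_Mapping.single {#} x * q)"
proof -
  assume x: "x \<in> DA" and "reducible q"
  then obtain a where a: "\<And>J. a J \<in> DA" "q - nf a \<in> N"
    unfolding reducible_def by blast
  have "Poly_Mapping.single {#} x * (q - nf a) = Poly_Mapping.single {#} x * q - nf (\<lambda>J. x * a J)"
    by (simp add: nf_scale right_diff_distrib)
  then have "Poly_Mapping.single {#} x * q - nf (\<lambda>J. x * a J) \<in> N"
    using N_mult[OF const_in_M[OF x] a(2)] by simp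
  then show ?thesis
    unfolding reducible_def using a x ga.X_closed(5) by (intro exI[of _ "\<lambda>J. x * a J"]) blast
qed

lemma reducible_N: "q \<in> N \<Longrightarrow> reducible q"
proof -
  assume "q \<in> N"
  moreover have "nf (\<lambda>_. 0) = 0"
    by (simp add: nf_def)
  ultimately show ?thesis
    unfolding reducible_def using ga.X_closed(2) by (intro exI[of _ "\<lambda>_. 0"]) simp
qed

lemma r_monomial_form:
  "r i = Poly_Mapping.single (replicate_mset (n i) i) 1 - Poly_Mapping.single (mset_of {1..<i} (\<lambda>l. j l i)) (c i)"
  unfolding r_def by (simp add: single_power sum_replicate_mset single_prod mult_single flip: mset_of_def)

text \<open>Replacing a factor x_i^(n i) by c_i times a monomial in earlier variables lowers the
  weight, so the rewriting ends, and it ends at exponents in \<open>expon n k\<close>.\<close>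

lemma reducible_monomial: "set_mset m \<subseteq> {1..<k} \<Longrightarrow> reducible (Poly_Mapping.single m 1)"
proof (induction "\<Sum>i\<in>#m. wt i" arbitrary: m rule: less_induct)
  case less
  show ?case
  proof (cases "\<forall>i\<in>{1..<k}. count m i < n i")
    case True
    have zero: "count m i = 0" if "i \<notin> {1..<k}" for i
      using less.prems that by (meson count_eq_zero_iff subsetD)
    have J: "count m \<in> expon n k"
      using True zero by (simp add: expon_def)
    have m: "mset_of {1..<k} (count m) = m"
      using zero by (intro multiset_eqI) (simp add: count_mset_of)
    have "nf (\<lambda>J. if J = count m then 1 else 0)
        = (\<Sum>J\<in>expon n k. if J = count m then Poly_Mapping.single m 1 else 0)"
      unfolding nf_def by (intro sum.cong) (auto simp: m)
    also have "\<dots> = Poly_Mapping.single m 1"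
      using J k_ge_1 by simp
    finally have "nf (\<lambda>J. if J = count m then 1 else 0) = Poly_Mapping.single m 1" .
    then show ?thesis
      unfolding reducible_def using ga.X_closed(1,2) zero_in_N
      by (intro exI[of _ "\<lambda>J. if J = count m then 1 else 0"]) simp
  next
    case False
    then obtain i where i: "i \<in> {1..<k}" "n i \<le> count m i"
      by force
    define m' where "m' = m - replicate_mset (n i) i"
    have m: "m = m' + replicate_mset (n i) i"
      using i(2) by (simp add: m'_def count_le_replicate_mset_subset_eq)
    let ?t = "mset_of {1..<i} (\<lambda>l. j l i)"
    have m': "set_mset m' \<subseteq> {1..<k}"
      using less.prems unfolding m by auto
    have t: "set_mset ?t \<subseteq> {1..<k}"
      using set_mset_of[of "{1..<i}"] i(1) by fastforce
    have "(\<Sum>l\<in>#?t. wt l) = (\<Sum>l\<in>{1..<i}. j l i * wt l)"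
      by (rule sum_mset_of) simp
    then have less': "(\<Sum>l\<in>#m' + ?t. wt l) < (\<Sum>l\<in>#m. wt l)"
      using weight[OF i(1)] unfolding m by simp
    have "reducible (Poly_Mapping.single {#} (c i) * Poly_Mapping.single (m' + ?t) 1)"
      using m' t less' by (intro reducible_scale c_closed i less.hyps) auto
    moreover have "reducible (Poly_Mapping.single m' 1 * r i)"
      by (intro reducible_N N_mult mon_in_M m' r_in_N i ga.X_closed)
    ultimately have "reducible (Poly_Mapping.single {#} (c i) * Poly_Mapping.single (m' + ?t) 1
        + Poly_Mapping.single m' 1 * r i)"
      by (rule reducible_add)
    moreover have "Poly_Mapping.single {#} (c i) * Poly_Mapping.single (m' + ?t) 1
        + Poly_Mapping.single m' 1 * r i = Poly_Mapping.single m 1"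
      unfolding r_monomial_form m right_diff_distrib mult_single by simp
    ultimately show ?thesis
      by simp
  qed
qed

lemma reducible_all:
  assumes q: "q \<in> M"
  shows "reducible q"
proof -
  have "reducible (\<Sum>m\<in>S. Poly_Mapping.single m (Poly_Mapping.lookup q m))"
    if "finite S" "S \<subseteq> Poly_Mapping.keys q" for S
    using that
  proof (induction S rule: finite_induct)
    case empty
    show ?case
      by (simp add: reducible_N zero_in_N)
  next
    case (insert m S)
    have m: "Poly_Mapping.lookup q m \<in> DA" "set_mset m \<subseteq> {1..<k}"
      using q insert.prems by (auto simp: M_def mpset_def in_keys_iff)
    have "reducible (Poly_Mapping.single {#} (Poly_Mapping.lookup q m) * Poly_Mapping.single m 1)"
      by (intro reducible_scale reducible_monomial m)
    then have "reducible (Poly_Mapping.single m (Poly_Mapping.lookup q m))"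
      by (simp add: mult_single)
    then show ?case
      using insert by (simp add: reducible_add)
  qed
  from this[of "Poly_Mapping.keys q"] show ?thesis
    using poly_mapping_sum_single[of q] by simp
qed

section \<open>The kernel of evaluation\<close>

lemma prod_e_closed: "set_mset m \<subseteq> {1..<k} \<Longrightarrow> (\<Prod>i\<in>#m. e i) \<in> DB"
  by (induction m) (auto simp: gb.X_closed e_closed)

lemma ev_closed: "q \<in> M \<Longrightarrow> ev q \<in> DB"
  unfolding ev_def
  by (intro subring_set_sum[OF gb.D] gb.X_closed(5) lift_closed prod_e_closed)
    (auto simp: M_def mpset_def in_keys_iff)

lemma \<psi>_zero: "\<psi> \<zero>\<^bsub>GA\<^esub> = \<zero>\<^bsub>GB\<^esub>"
  using lift_hom[OF ga.X_closed(2)] by (simp add: lift_zero ga.hom_zero gb.hom_zero)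

lemma \<rho>B_ev_zero:
  assumes q: "q \<in> M" "ga.mp_of q = \<zero>\<^bsub>P\<^esub>"
  shows "\<rho>B (ev q) = \<zero>\<^bsub>GB\<^esub>"
proof -
  have q': "Poly_Mapping.lookup q m \<in> DA" "m \<in> Poly_Mapping.keys q \<Longrightarrow> set_mset m \<subseteq> {1..<k}" for m
    using q(1) by (auto simp: M_def mpset_def in_keys_iff)
  have zero: "\<rho>A (Poly_Mapping.lookup q m) = \<zero>\<^bsub>GA\<^esub>" for m
    using fun_cong[OF q(2), of m] by (simp add: ga.mp_of_def mpoly_ring_def ga.indexed_const_def)
  have "\<rho>B (lift (Poly_Mapping.lookup q m)) = \<zero>\<^bsub>GB\<^esub>" for m
    using lift_hom[OF q'(1), of m] by (simp add: zero \<psi>_zero)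
  then have "\<rho>B (lift (Poly_Mapping.lookup q m) * (\<Prod>i\<in>#m. e i)) = \<zero>\<^bsub>GB\<^esub>" if "m \<in> Poly_Mapping.keys q" for m
    using gb.hom_closed[OF prod_e_closed[OF q'(2)[OF that]]]
    by (simp add: gb.hom_mult lift_closed q' prod_e_closed that)
  then have "(\<Oplus>\<^bsub>GB\<^esub>m\<in>Poly_Mapping.keys q. \<rho>B (lift (Poly_Mapping.lookup q m) * (\<Prod>i\<in>#m. e i))) = \<zero>\<^bsub>GB\<^esub>"
    by (intro gb.add.finprod_one_eqI) simp
  then show ?thesis
    unfolding ev_def by (subst gb.hom_sum) (simp_all add: gb.X_closed lift_closed q' prod_e_closed)
qed

text \<open>Evaluation is defined on representatives. Choosing one for each polynomial over the
  graded ring is harmless, because evaluation sends the representatives of 0 to 0.\<close>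

definition \<Theta> :: "(nat multiset \<Rightarrow> 'y) \<Rightarrow> 'w" where
  "\<Theta> x = \<rho>B (ev (SOME q. q \<in> M \<and> ga.mp_of q = x))"

lemma \<Theta>: "q \<in> M \<Longrightarrow> \<Theta> (ga.mp_of q) = \<rho>B (ev q)"
proof -
  assume q: "q \<in> M"
  define q' where "q' = (SOME q'. q' \<in> M \<and> ga.mp_of q' = ga.mp_of q)"
  have q': "q' \<in> M" "ga.mp_of q' = ga.mp_of q"
    unfolding q'_def using someI[of "\<lambda>q'. q' \<in> M \<and> ga.mp_of q' = ga.mp_of q" q] q by auto
  have "ga.mp_of (q' - q) = \<zero>\<^bsub>P\<^esub>"
    using q' q mp.hom_eq_iff by blast
  then have "\<rho>B (ev q' - ev q) = \<zero>\<^bsub>GB\<^esub>"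
    using \<rho>B_ev_zero[of "q' - q"] q q' mp.X_closed(3) by (simp add: ev_diff)
  then have "\<rho>B (ev q') = \<rho>B (ev q)"
    using gb.hom_eq_iff ev_closed q q' by blast
  then show ?thesis
    unfolding \<Theta>_def q'_def .
qed

lemma \<Theta>_hom: "\<Theta> \<in> ring_hom P GB"
proof (rule ring_hom_memI)
  show "\<Theta> x \<in> carrier GB" if x: "x \<in> carrier P" for x
  proof -
    obtain p where "p \<in> M" "x = ga.mp_of p"
      using mp.rep[OF x] by blast
    then show ?thesis
      by (simp add: \<Theta> gb.hom_closed ev_closed)
  qed
  show "\<Theta> \<one>\<^bsub>P\<^esub> = \<one>\<^bsub>GB\<^esub>"
    using \<Theta>[OF mp.X_closed(1)] by (simp add: mp.hom_one ev_one gb.hom_one)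
  fix x y assume "x \<in> carrier P" "y \<in> carrier P"
  then obtain p q where pq: "p \<in> M" "x = ga.mp_of p" "q \<in> M" "y = ga.mp_of q"
    using mp.rep by meson
  show "\<Theta> (x \<otimes>\<^bsub>P\<^esub> y) = \<Theta> x \<otimes>\<^bsub>GB\<^esub> \<Theta> y"
    using \<Theta>[OF mp.X_closed(5)[OF pq(1,3)]]
    by (simp add: pq \<Theta> mp.hom_mult ev_mult gb.hom_mult ev_closed)
  show "\<Theta> (x \<oplus>\<^bsub>P\<^esub> y) = \<Theta> x \<oplus>\<^bsub>GB\<^esub> \<Theta> y"
    using \<Theta>[OF mp.X_closed(4)[OF pq(1,3)]]
    by (simp add: pq \<Theta> mp.hom_add ev_add gb.hom_add ev_closed)
qed

sublocale th: ring_hom_ring P GB \<Theta>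
  by (rule ring_hom_ringI2[OF mp.ring_axioms gb.ring_axioms \<Theta>_hom])

lemma \<Theta>_surj: "\<Theta> ` carrier P = carrier GB"
proof
  show "carrier GB \<subseteq> \<Theta> ` carrier P"
  proof
    fix x assume "x \<in> carrier GB"
    then obtain y where y: "y \<in> DB" "x = \<rho>B y"
      using gb.rep by blast
    then obtain a where a: "\<And>J. a J \<in> DA" "\<rho>B y = \<rho>B (ev (nf a))"
      using span unfolding ev_nf by blast
    then have "x = \<Theta> (ga.mp_of (nf a))"
      by (simp add: y \<Theta> nf_in_M)
    then show "x \<in> \<Theta> ` carrier P"
      using mp.hom_closed nf_in_M a(1) by blast
  qed
qed auto

text \<open>A polynomial in the kernel differs from its normal form by an element of I, which also
  evaluates to 0. So the normal form evaluates to 0, its coefficients vanish by \<open>free\<close>,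
  and the polynomial itself lies in I.\<close>

lemma kernel: "a_kernel P GB \<Theta> = I"
proof
  have "ga.mp_of (r i) \<in> a_kernel P GB \<Theta>" if i: "i \<in> {1..<k}" for i
  proof -
    have l: "l \<in> {1..<k}" if "l \<in> {1..<i}" for l
      using that i by auto
    have "ev (r i) = e i ^ n i - lift (c i) * (\<Prod>l\<in>{1..<i}. e l ^ j l i)"
      unfolding r_monomial_form ev_diff ev_single prod_mset_of[OF finite_atLeastLessThan]
      by (simp only: lift_one mult_1 image_replicate_mset prod_mset_replicate_mset)
    then have "\<Theta> (ga.mp_of (r i)) = \<zero>\<^bsub>GB\<^esub>"
      using relation[OF i] \<Theta>[OF r_in_M[OF i]] by (simp only:)
    then show ?thesis
      using mp.hom_closed[OF r_in_M[OF i]] unfolding a_kernel_def' by blast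
  qed
  then have "ga.mp_of ` r ` {1..<k} \<subseteq> a_kernel P GB \<Theta>"
    by (intro image_subsetI) (elim imageE, simp only:)
  moreover have "ideal (a_kernel P GB \<Theta>) P"
    by (rule th.kernel_is_ideal)
  ultimately have "Idl\<^bsub>P\<^esub> (ga.mp_of ` r ` {1..<k}) \<subseteq> a_kernel P GB \<Theta>"
    using mp.genideal_minimal by blast
  then show sub: "I \<subseteq> a_kernel P GB \<Theta>"
    by (simp only: I_eq)
  show "a_kernel P GB \<Theta> \<subseteq> I"
  proof
    fix x assume "x \<in> a_kernel P GB \<Theta>"
    then have x: "x \<in> carrier P" "\<Theta> x = \<zero>\<^bsub>GB\<^esub>"
      unfolding a_kernel_def' by blast+
    then obtain q where q: "q \<in> M" "x = ga.mp_of q"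
      using mp.rep by blast
    obtain a where a: "\<And>J. a J \<in> DA" "q - nf a \<in> N"
      using reducible_all[OF q(1)] unfolding reducible_def by blast
    have nf: "nf a \<in> M"
      by (rule nf_in_M[OF a(1)])
    have "ga.mp_of (q - nf a) \<in> a_kernel P GB \<Theta>"
      using a(2) sub unfolding N_def by blast
    then have "\<Theta> (ga.mp_of (q - nf a)) = \<zero>\<^bsub>GB\<^esub>"
      unfolding a_kernel_def' by blast
    then have "\<rho>B (ev q - ev (nf a)) = \<zero>\<^bsub>GB\<^esub>"
      by (simp only: \<Theta>[OF mp.X_closed(3)[OF q(1) nf]] ev_diff)
    then have "\<rho>B (ev q) = \<rho>B (ev (nf a))"
      using gb.hom_eq_iff ev_closed q nf by blast
    then have "\<rho>B (\<Sum>J\<in>expon n k. lift (a J) * kmon e k J) = \<zero>\<^bsub>GB\<^esub>"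
      using x(2) unfolding q(2) \<Theta>[OF q(1)] ev_nf by (rule trans[OF sym])
    then have zero: "\<rho>A (a J) = \<zero>\<^bsub>GA\<^esub>" if "J \<in> expon n k" for J
      using free a(1) that by blast
    have "ga.mp_of (nf a) m = \<zero>\<^bsub>GA\<^esub>" for m
    proof -
      have "ga.mp_of (nf a) m = (\<Oplus>\<^bsub>GA\<^esub>J\<in>expon n k. \<rho>A (Poly_Mapping.lookup (Poly_Mapping.single (mset_of {1..<k} J) (a J)) m))"
        unfolding ga.mp_of_def nf_def lookup_sum
        using a(1) k_ge_1 ga.X_closed(2) by (intro ga.hom_sum) (auto simp: lookup_single when_def)
      also have "\<dots> = \<zero>\<^bsub>GA\<^esub>"
        by (intro ga.add.finprod_one_eqI) (auto simp: lookup_single when_def zero ga.hom_zero)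
      finally show ?thesis .
    qed
    then have "ga.mp_of (nf a) = \<zero>\<^bsub>P\<^esub>"
      by (auto simp: mpoly_ring_def ga.indexed_const_def)
    then have "nf a \<in> N"
      using nf additive_subgroup.zero_closed[OF ideal.axioms(1)[OF ideal_I]] by (simp add: N_def)
    then have "(q - nf a) + nf a \<in> N"
      using a(2) by (intro N_add)
    then show "x \<in> I"
      by (simp add: N_def q(2))
  qed
qed

theorem presentation_iso:
  "\<exists>h\<in>ring_iso GB (P Quot I). \<forall>a\<in>carrier GA. h (\<psi> a) = I +>\<^bsub>P\<^esub> ring.indexed_const GA a"
proof -
  interpret I: ideal I P
    by (rule ideal_I)
  define t where "t = (\<lambda>C. the_elem (\<Theta> ` C))"
  have iso: "t \<in> ring_iso (P Quot I) GB"
    using th.FactRing_iso_set[OF \<Theta>_surj] by (simp add: kernel t_def)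
  have inv: "inv_into (carrier (P Quot I)) t \<in> ring_iso GB (P Quot I)"
    by (rule ring_iso_set_sym[OF I.quotient_is_ring iso])
  have "inv_into (carrier (P Quot I)) t (\<psi> a) = I +>\<^bsub>P\<^esub> ring.indexed_const GA a"
    if a: "a \<in> carrier GA" for a
  proof -
    obtain b where b: "b \<in> DA" "a = \<rho>A b"
      using ga.rep[OF a] by blast
    have ca: "ring.indexed_const GA a = ga.mp_of (Poly_Mapping.single {#} b)"
      by (simp add: ga.mp_of_single_empty b)
    have mem: "ring.indexed_const GA a \<in> carrier P"
      unfolding ca by (intro mp.hom_closed const_in_M b)
    have "\<Theta> ` (I +>\<^bsub>P\<^esub> ring.indexed_const GA a) = {\<Theta> (ring.indexed_const GA a)}"
    proof -
      have "\<Theta> x = \<Theta> (ring.indexed_const GA a)" if x: "x \<in> I +>\<^bsub>P\<^esub> ring.indexed_const GA a" for x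
        using th.rcos_imp_homeq[OF mem] x by (simp add: kernel)
      moreover have "ring.indexed_const GA a \<in> I +>\<^bsub>P\<^esub> ring.indexed_const GA a"
        by (rule I.a_rcos_self[OF mem])
      ultimately show ?thesis
        by blast
    qed
    then have "t (I +>\<^bsub>P\<^esub> ring.indexed_const GA a) = \<Theta> (ring.indexed_const GA a)"
      by (simp add: t_def)
    also have "\<dots> = \<psi> a"
      unfolding ca using \<Theta>[OF const_in_M[OF b(1)]] lift_hom[OF b(1)] by (simp add: ev_single b(2))
    finally have "t (I +>\<^bsub>P\<^esub> ring.indexed_const GA a) = \<psi> a" .
    moreover have "I +>\<^bsub>P\<^esub> ring.indexed_const GA a \<in> carrier (P Quot I)"
      using mem by (auto simp: FactRing_def A_RCOSETS_def')
    moreover have "inj_on t (carrier (P Quot I))"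
      using iso by (simp add: ring_iso_def bij_betw_def)
    ultimately show ?thesis
      by (metis inv_into_f_f)
  qed
  then show ?thesis
    using inv by blast
qed

section \<open>The module structure\<close>

lemma \<psi>_closed: "a \<in> carrier GA \<Longrightarrow> \<psi> a \<in> carrier GB"
  using ga.rep[of a] lift_hom lift_closed gb.hom_closed by metis

abbreviation MB where "MB \<equiv> restrict_scalars \<psi> GB"

lemma MB_simps: "carrier MB = carrier GB" "\<zero>\<^bsub>MB\<^esub> = \<zero>\<^bsub>GB\<^esub>" "x \<oplus>\<^bsub>MB\<^esub> y = x \<oplus>\<^bsub>GB\<^esub> y"
  "a \<odot>\<^bsub>MB\<^esub> x = \<psi> a \<otimes>\<^bsub>GB\<^esub> x" "finsum MB g S = finsum GB g S"
  by (simp_all add: restrict_scalars_def finsum_def finprod_def)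

lemma module_MB: "module GA MB"
proof (rule moduleI)
  show "cring GA"
    by (rule ga.cring_axioms)
  show "abelian_group MB"
  proof (rule abelian_groupI)
    show "\<exists>y\<in>carrier MB. y \<oplus>\<^bsub>MB\<^esub> x = \<zero>\<^bsub>MB\<^esub>" if "x \<in> carrier MB" for x
      using that by (intro bexI[of _ "\<ominus>\<^bsub>GB\<^esub> x"]) (simp_all add: MB_simps gb.l_neg)
  qed (simp_all add: MB_simps gb.a_ac)
  note hom = \<psi>_closed
  have add: "\<psi> (a \<oplus>\<^bsub>GA\<^esub> b) = \<psi> a \<oplus>\<^bsub>GB\<^esub> \<psi> b" and mul: "\<psi> (a \<otimes>\<^bsub>GA\<^esub> b) = \<psi> a \<otimes>\<^bsub>GB\<^esub> \<psi> b"
    if "a \<in> carrier GA" "b \<in> carrier GA" for a b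
  proof -
    obtain a' b' where ab: "a' \<in> DA" "a = \<rho>A a'" "b' \<in> DA" "b = \<rho>A b'"
      using ga.rep \<open>a \<in> carrier GA\<close> \<open>b \<in> carrier GA\<close> by meson
    show "\<psi> (a \<oplus>\<^bsub>GA\<^esub> b) = \<psi> a \<oplus>\<^bsub>GB\<^esub> \<psi> b"
      using lift_hom[OF ga.X_closed(4)[OF ab(1,3)]]
      by (simp add: ab lift_hom ga.hom_add lift_add gb.hom_add lift_closed)
    show "\<psi> (a \<otimes>\<^bsub>GA\<^esub> b) = \<psi> a \<otimes>\<^bsub>GB\<^esub> \<psi> b"
      using lift_hom[OF ga.X_closed(5)[OF ab(1,3)]]
      by (simp add: ab lift_hom ga.hom_mult lift_mult gb.hom_mult lift_closed)
  qed
  have one: "\<psi> \<one>\<^bsub>GA\<^esub> = \<one>\<^bsub>GB\<^esub>"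
    using lift_hom[OF ga.X_closed(1)] by (simp add: ga.hom_one lift_one gb.hom_one)
  show "a \<odot>\<^bsub>MB\<^esub> x \<in> carrier MB" if "a \<in> carrier GA" "x \<in> carrier MB" for a x
    using that hom by (simp add: MB_simps)
  show "(a \<oplus>\<^bsub>GA\<^esub> b) \<odot>\<^bsub>MB\<^esub> x = a \<odot>\<^bsub>MB\<^esub> x \<oplus>\<^bsub>MB\<^esub> b \<odot>\<^bsub>MB\<^esub> x"
    if "a \<in> carrier GA" "b \<in> carrier GA" "x \<in> carrier MB" for a b x
    using that hom add by (simp add: MB_simps gb.l_distr)
  show "a \<odot>\<^bsub>MB\<^esub> (x \<oplus>\<^bsub>MB\<^esub> y) = a \<odot>\<^bsub>MB\<^esub> x \<oplus>\<^bsub>MB\<^esub> a \<odot>\<^bsub>MB\<^esub> y"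
    if "a \<in> carrier GA" "x \<in> carrier MB" "y \<in> carrier MB" for a x y
    using that hom by (simp add: MB_simps gb.r_distr)
  show "(a \<otimes>\<^bsub>GA\<^esub> b) \<odot>\<^bsub>MB\<^esub> x = a \<odot>\<^bsub>MB\<^esub> (b \<odot>\<^bsub>MB\<^esub> x)"
    if "a \<in> carrier GA" "b \<in> carrier GA" "x \<in> carrier MB" for a b x
    using that hom mul by (simp add: MB_simps gb.m_assoc)
  show "\<one>\<^bsub>GA\<^esub> \<odot>\<^bsub>MB\<^esub> x = x" if "x \<in> carrier MB" for x
    using that one by (simp add: MB_simps)
qed

lemma kmon_e_closed: "kmon e k J \<in> DB"
  unfolding kmon_def by (intro gb.X_prod gb.X_closed(7) e_closed)

text \<open>Enumerates the monomials with exponents in \<open>expon n k\<close>; their images are a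
  basis by \<open>span\<close> and \<open>free\<close>. Coefficients are lifted to representatives
  before these two can be applied.\<close>

lemma module_basis:
  obtains N g where "module_generators GA MB N g"
    "\<And>a t. a \<in> module_relations GA MB N g \<Longrightarrow> t < N \<Longrightarrow> a t = \<zero>\<^bsub>GA\<^esub>"
proof -
  obtain b where b: "bij_betw b {..<card (expon n k)} (expon n k)"
    using ex_bij_betw_nat_finite[OF finite_expon[OF k_ge_1]] by (auto simp: atLeast0LessThan)
  let ?N = "card (expon n k)"
  define g where "g t = \<rho>B (kmon e k (b t))" for t
  have sum: "\<rho>B (\<Sum>J\<in>expon n k. lift (a J) * kmon e k J) = (\<Oplus>\<^bsub>MB\<^esub>t\<in>{..<?N}. \<rho>A (a (b t)) \<odot>\<^bsub>MB\<^esub> g t)"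
    if a: "\<And>J. a J \<in> DA" for a
  proof -
    have "\<rho>B (\<Sum>J\<in>expon n k. lift (a J) * kmon e k J) = \<rho>B (\<Sum>t<?N. lift (a (b t)) * kmon e k (b t))"
      by (simp add: sum.reindex_bij_betw[OF b, where g = "\<lambda>J. lift (a J) * kmon e k J"])
    also have "\<dots> = (\<Oplus>\<^bsub>GB\<^esub>t\<in>{..<?N}. \<rho>B (lift (a (b t)) * kmon e k (b t)))"
      by (intro gb.hom_sum gb.X_closed(5) lift_closed kmon_e_closed a) simp
    also have "\<dots> = (\<Oplus>\<^bsub>MB\<^esub>t\<in>{..<?N}. \<rho>A (a (b t)) \<odot>\<^bsub>MB\<^esub> g t)"
      by (simp add: MB_simps g_def lift_hom a gb.hom_mult lift_closed kmon_e_closed)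
    finally show ?thesis .
  qed
  have "module_generators GA MB ?N g"
    unfolding module_generators_def
  proof (intro conjI ballI)
    show "g \<in> {..<?N} \<rightarrow> carrier MB"
      by (simp add: g_def MB_simps gb.hom_closed kmon_e_closed)
    fix x assume "x \<in> carrier MB"
    then obtain y where y: "y \<in> DB" "x = \<rho>B y"
      using gb.rep by (auto simp: MB_simps)
    then obtain a where a: "\<And>J. a J \<in> DA" "\<rho>B y = \<rho>B (\<Sum>J\<in>expon n k. lift (a J) * kmon e k J)"
      using span by blast
    then show "\<exists>a\<in>{..<?N} \<rightarrow> carrier GA. x = (\<Oplus>\<^bsub>MB\<^esub>t\<in>{..<?N}. a t \<odot>\<^bsub>MB\<^esub> g t)"
      using sum[OF a(1)] y ga.hom_closed by (intro bexI[of _ "\<lambda>t. \<rho>A (a (b t))"]) auto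
  qed
  moreover have "a t = \<zero>\<^bsub>GA\<^esub>" if a: "a \<in> module_relations GA MB ?N g" and t: "t < ?N" for a t
  proof -
    have aG: "a t \<in> carrier GA" if "t < ?N" for t
      using a that by (auto simp: module_relations_def)
    obtain a' where a': "a' t \<in> DA \<and> (t < ?N \<longrightarrow> a t = \<rho>A (a' t))" for t
    proof -
      have "\<forall>t. \<exists>x. x \<in> DA \<and> (t < ?N \<longrightarrow> a t = \<rho>A x)"
        using aG ga.rep ga.X_closed(1) by metis
      then show ?thesis
        using that by metis
    qed
    let ?a = "\<lambda>J. a' (inv_into {..<?N} b J)"
    have inv: "inv_into {..<?N} b (b t) = t" if "t < ?N" for t
      using b that by (simp add: bij_betw_def)
    have D: "?a J \<in> DA" for J
      using a' by blast
    have "(\<Oplus>\<^bsub>MB\<^esub>t\<in>{..<?N}. \<rho>A (?a (b t)) \<odot>\<^bsub>MB\<^esub> g t) = (\<Oplus>\<^bsub>MB\<^esub>t\<in>{..<?N}. a t \<odot>\<^bsub>MB\<^esub> g t)"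
    proof -
      interpret M: module GA MB
        by (rule module_MB)
      show ?thesis
        using aG a' inv
        by (intro M.finsum_cong') (auto simp: g_def intro!: M.smult_closed simp: MB_simps gb.hom_closed kmon_e_closed \<psi>_closed)
    qed
    also have "\<dots> = \<zero>\<^bsub>GB\<^esub>"
      using a by (simp add: module_relations_def MB_simps)
    finally have "\<rho>B (\<Sum>J\<in>expon n k. lift (?a J) * kmon e k J) = \<zero>\<^bsub>GB\<^esub>"
      using sum[OF D] by simp
    then have "\<rho>A (?a (b t)) = \<zero>\<^bsub>GA\<^esub>"
      using bij_betwE[OF b] t by (intro free[where b = ?a, OF D]) blast+
    then show ?thesis
      using a' inv t by metis
  qed
  ultimately show ?thesis
    by (rule that)
qed

theorem module_finitely_generated: "finitely_generated_module GA MB"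
proof -
  obtain N g where "module_generators GA MB N g"
    by (rule module_basis) blast
  then show ?thesis
    unfolding finitely_generated_module_def using module_MB by blast
qed

theorem module_finitely_presented: "finitely_presented_module GA MB"
proof -
  obtain N g where gen: "module_generators GA MB N g"
    and rel: "\<And>a t. a \<in> module_relations GA MB N g \<Longrightarrow> t < N \<Longrightarrow> a t = \<zero>\<^bsub>GA\<^esub>"
    by (rule module_basis) blast
  \<comment> \<open>All relations of a basis are zero, hence generated by the empty family.\<close>
  have "\<forall>a\<in>module_relations GA MB N g. \<exists>b\<in>{..<0::nat} \<rightarrow> carrier GA.
      \<forall>i<N. a i = (\<Oplus>\<^bsub>GA\<^esub>t\<in>{..<0}. b t \<otimes>\<^bsub>GA\<^esub> (\<lambda>_ _. \<zero>\<^bsub>GA\<^esub>) t i)"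
    using rel by simp
  then show ?thesis
    unfolding finitely_presented_module_def using module_MB gen
    by (intro conjI exI[of _ N] exI[of _ g] exI[of _ "0::nat"] exI[of _ "\<lambda>_ _. \<zero>\<^bsub>GA\<^esub>"]) simp_all
qed

end

declare One_nat_def [simp]

section \<open>The graded ring of the residue ring\<close>

lemma surj_hom_subring:
  assumes "subring_set S"
  shows "surj_hom (\<lambda>x. x) S (ring_of_type_algebra\<lparr>carrier := S\<rparr>)"
  using assms by unfold_locales (simp_all add: ring_of_type_algebra_def)

lemma subring_type_UNIV: "subring_type UNIV"
  by unfold_locales simp_all

lemma polys_over_UNIV [simp]: "polys_over UNIV = UNIV"
  by (simp add: polys_over_def)

context subring_type
begin

lemma subring_set_A: "subring_set A"
  using A_1 A_diff A_mult by (simp add: subring_set_def)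

lemma subring_set_polys_over: "subring_set (polys_over A)"
  using polys_over_1 polys_over_diff polys_over_mult by (simp add: subring_set_def)

lemma residue_class_eq:
  assumes "f \<in> polys_over A"
  shows "residue_class A f g = {q * f + g | q. q \<in> polys_over A}"
  using assms by (auto simp: residue_class_def a_r_coset_def' cgenideal_def ring_of_type_algebra_def)

lemma residue_class_eq_iff:
  assumes f: "f \<in> polys_over A" "Polynomial.lead_coeff f = 1" and g: "g \<in> polys_over A" "h \<in> polys_over A"
  shows "residue_class A f g = residue_class A f h \<longleftrightarrow> f dvd g - h"
proof
  assume "residue_class A f g = residue_class A f h"
  moreover have "g \<in> residue_class A f g"
    using polys_over_0 by (force simp: residue_class_eq[OF f(1)])
  ultimately obtain q where "g = q * f + h"
    by (auto simp: residue_class_eq[OF f(1)])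
  then show "f dvd g - h"
    by simp
next
  assume dvd: "f dvd g - h"
  define q where "q = (g - h) div f"
  have q: "q \<in> polys_over A" "g = q * f + h"
    using polys_over_div_mod[OF f(2,1)] polys_over_diff[OF g] dvd by (auto simp: q_def)
  have "p * f + g = (p + q) * f + h" "p * f + h = (p - q) * f + g" for p
    by (simp_all add: q(2) algebra_simps)
  then show "residue_class A f g = residue_class A f h"
    unfolding residue_class_eq[OF f(1)] using q(1) polys_over_add polys_over_diff by blast
qed

lemma surj_hom_residue_ring:
  assumes f: "f \<in> polys_over A"
  shows "surj_hom (residue_class A f) (polys_over A) (residue_ring A f)"
proof -
  let ?R = "ring_of_type_algebra\<lparr>carrier := polys_over A\<rparr>"
  interpret R: surj_hom "\<lambda>x. x" "polys_over A" ?R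
    by (rule surj_hom_subring[OF subring_set_polys_over])
  have carrier: "carrier ?R = polys_over A"
    by simp
  interpret J: ideal "PIdl\<^bsub>?R\<^esub> f" ?R
    by (rule R.cgenideal_ideal) (simp add: f)
  have hom: "residue_class A f \<in> ring_hom ?R (residue_ring A f)"
    using J.rcos_ring_hom by (simp add: residue_class_def[abs_def] residue_ring_def)
  show ?thesis
  proof
    show "subring_set (polys_over A)"
      by (rule subring_set_polys_over)
    show "residue_class A f ` polys_over A = carrier (residue_ring A f)"
      by (auto simp: residue_class_def residue_ring_def FactRing_def A_RCOSETS_def')
    show "residue_class A f (a + b) = residue_class A f a \<oplus>\<^bsub>residue_ring A f\<^esub> residue_class A f b"
      "residue_class A f (a * b) = residue_class A f a \<otimes>\<^bsub>residue_ring A f\<^esub> residue_class A f b"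
      if "a \<in> polys_over A" "b \<in> polys_over A" for a b
      using ring_hom_add[OF hom, of a b] ring_hom_mult[OF hom, of a b] that
      by (simp_all add: ring_of_type_algebra_def)
    show "residue_class A f 1 = \<one>\<^bsub>residue_ring A f\<^esub>"
      using ring_hom_one[OF hom] by (simp add: ring_of_type_algebra_def)
    show "residue_class A f 0 = \<zero>\<^bsub>residue_ring A f\<^esub>"
      unfolding residue_class_eq[OF f]
      by (auto simp: residue_ring_def FactRing_def cgenideal_def ring_of_type_algebra_def)
  qed
qed

end

lemma residue_ring_map_class:
  assumes "subring_type A" "f \<in> polys_over A"
  shows "residue_ring_map f (residue_class A f g) = residue_class UNIV f g"
proof -
  interpret subring_type A
    by fact
  interpret U: subring_type UNIV
    by (rule subring_type_UNIV)
  have carrier: "ring_of_type_algebra\<lparr>carrier := UNIV\<rparr> = (ring_of_type_algebra :: 'a poly ring)"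
    by (simp add: ring_of_type_algebra_def)
  have "residue_ring_map f (residue_class A f g) = {(q * f + g) + h * f | q h. q \<in> polys_over A}"
    unfolding residue_ring_map_def residue_class_eq[OF assms(2)]
    by (auto simp: set_add_def' cgenideal_def ring_of_type_algebra_def)
  also have "\<dots> = {q * f + g | q. True}"
  proof
    show "{(q * f + g) + h * f | q h. q \<in> polys_over A} \<subseteq> {q * f + g | q. True}"
    proof
      fix x assume "x \<in> {(q * f + g) + h * f | q h. q \<in> polys_over A}"
      then obtain q h where "x = (q * f + g) + h * f"
        by blast
      then have "x = (q + h) * f + g"
        by (simp add: algebra_simps)
      then show "x \<in> {q * f + g | q. True}"
        by blast
    qed
    show "{q * f + g | q. True} \<subseteq> {(q * f + g) + h * f | q h. q \<in> polys_over A}"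
    proof
      fix x assume "x \<in> {q * f + g | q. True}"
      then obtain q where "x = (0 * f + g) + q * f"
        by (auto simp: add.commute)
      then show "x \<in> {(q * f + g) + h * f | q h. q \<in> polys_over A}"
        using polys_over_0 by blast
    qed
  qed
  also have "\<dots> = residue_class UNIV f g"
    by (simp add: U.residue_class_eq)
  finally show ?thesis .
qed

lemma single_prod_coeff:
  "(\<Prod>i\<in>I. Poly_Mapping.single (m i) (a i :: 'x::comm_ring_1)) = Poly_Mapping.single (\<Sum>i\<in>I. m i) (\<Prod>i\<in>I. a i)"
  by (induction I rule: infinite_finite_induct) (simp_all add: mult_single)

lemma lookup_mult_single_right:
  fixes p :: "'g::ab_group_add \<Rightarrow>\<^sub>0 'x::comm_ring_1"
  shows "Poly_Mapping.lookup (p * Poly_Mapping.single d x) \<gamma> = Poly_Mapping.lookup p (\<gamma> - d) * x"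
proof -
  have "Poly_Mapping.lookup (p * Poly_Mapping.single d x) \<gamma>
      = (\<Sum>\<alpha>\<in>Poly_Mapping.keys p. if \<alpha> = \<gamma> - d then Poly_Mapping.lookup p \<alpha> * x else 0)"
    unfolding lookup_mult_group by (intro sum.cong) (auto simp: lookup_single when_def)
  then show ?thesis
    by (simp add: in_keys_iff)
qed

definition const_lift :: "('g \<Rightarrow>\<^sub>0 'a::field) \<Rightarrow> 'g::ab_group_add \<Rightarrow>\<^sub>0 'a poly" where
  "const_lift p = Poly_Mapping.map (\<lambda>a. [:a:]) p"

lemma lookup_const_lift: "Poly_Mapping.lookup (const_lift p) \<gamma> = [:Poly_Mapping.lookup p \<gamma>:]"
  by (simp add: const_lift_def map.rep_eq when_def)

lemma const_lift_single: "const_lift (Poly_Mapping.single \<gamma> a) = Poly_Mapping.single \<gamma> [:a:]"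
  by (rule poly_mapping_eqI) (simp add: lookup_const_lift lookup_single when_def)

lemma evaluation_const_lift: "evaluation (const_lift :: ('g::ab_group_add \<Rightarrow>\<^sub>0 'a::field) \<Rightarrow> _)"
proof
  fix p q :: "'g \<Rightarrow>\<^sub>0 'a"
  show "const_lift (p + q) = const_lift p + const_lift q"
    by (rule poly_mapping_eqI) (simp add: lookup_const_lift lookup_add)
  have keys: "Poly_Mapping.keys (const_lift p) = Poly_Mapping.keys p"
    by (auto simp: in_keys_iff lookup_const_lift)
  have const_sum: "[:\<Sum>i\<in>S. h i:] = (\<Sum>i\<in>S. [:h i :: 'a:])" for S and h :: "'g \<Rightarrow> 'a"
  proof (induction S rule: infinite_finite_induct)
    case (insert x S)
    show ?case
      unfolding sum.insert[OF insert(1,2)] insert(3)[symmetric] by simp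
  qed simp_all
  show "const_lift (p * q) = const_lift p * const_lift q"
    by (rule poly_mapping_eqI)
      (simp add: lookup_const_lift lookup_mult_group keys const_sum ac_simps)
  show "const_lift (1 :: 'g \<Rightarrow>\<^sub>0 'a) = 1"
    using const_lift_single[of "0::'g" "1::'a"] by (simp flip: one_pCons)
qed

section \<open>Representatives for the graded ring of A[z]/(f)\<close>

context unique_extension_over
begin

context
  fixes \<omega> :: "'a poly set \<Rightarrow> 'g extended"
  assumes \<omega>: "\<And>g. W g = \<omega> (residue_class UNIV f g)"
begin

abbreviation RA :: "'a ring" where "RA \<equiv> ring_of_type_algebra\<lparr>carrier := A\<rparr>"
abbreviation RB :: "'a poly set ring" where "RB \<equiv> residue_ring A f"
abbreviation vB :: "'a poly set \<Rightarrow> 'g extended" where "vB \<equiv> \<lambda>C. \<omega> (residue_ring_map f C)"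

lemma vB_class: "vB (residue_class A f g) = W g"
  by (simp add: residue_ring_map_class[OF subring_type_axioms f_over] \<omega>)

lemma valued_image_A: "valued_image (\<lambda>x. x) A RA V0"
proof -
  interpret sa: surj_hom "\<lambda>x. x" A RA
    by (rule surj_hom_subring[OF subring_set_A])
  show ?thesis
  proof
    show "valuation_on RA V0"
      using V0 unfolding valuation_on_type_algebra by (auto simp: valuation_on_def ring_of_type_algebra_def)
    show "\<one>\<^bsub>RA\<^esub> \<noteq> \<zero>\<^bsub>RA\<^esub>"
      by (simp add: ring_of_type_algebra_def)
  qed
qed

lemma valued_image_B: "valued_image (residue_class A f) (polys_over A) RB vB"
proof -
  interpret sb: surj_hom "residue_class A f" "polys_over A" RB
    by (rule surj_hom_residue_ring[OF f_over])
  have zero: "residue_class A f g = \<zero>\<^bsub>RB\<^esub> \<longleftrightarrow> f dvd g" if "g \<in> polys_over A" for g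
    using residue_class_eq_iff[OF f_over monic_f that polys_over_0] by (simp add: sb.hom_zero)
  show ?thesis
  proof
    show "valuation_on RB vB"
      unfolding valuation_on_def
    proof (intro conjI ballI)
      fix x assume "x \<in> carrier RB"
      then obtain g where g: "g \<in> polys_over A" "x = residue_class A f g"
        using sb.rep by blast
      show "vB x \<noteq> -\<infinity>" "vB x = \<infinity> \<longleftrightarrow> x = \<zero>\<^bsub>RB\<^esub>"
        unfolding g(2) vB_class using W_inf_iff zero[OF g(1)] by simp_all
      fix y assume "y \<in> carrier RB"
      then obtain h where h: "h \<in> polys_over A" "y = residue_class A f h"
        using sb.rep by blast
      show "vB (x \<otimes>\<^bsub>RB\<^esub> y) = vB x + vB y" "min (vB x) (vB y) \<le> vB (x \<oplus>\<^bsub>RB\<^esub> y)"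
        unfolding g(2) h(2) sb.hom_mult[OF g(1) h(1), symmetric] sb.hom_add[OF g(1) h(1), symmetric] vB_class
        by (rule mult, rule add_ge)
    qed
    show "\<one>\<^bsub>RB\<^esub> \<noteq> \<zero>\<^bsub>RB\<^esub>"
      using zero[OF polys_over_1] W_inf_iff[of 1] by (simp flip: sb.hom_one)
  qed
qed

interpretation va: valued_image "\<lambda>x. x" A RA V0
  by (rule valued_image_A)

interpretation vb: valued_image "residue_class A f" "polys_over A" RB vB
  by (rule valued_image_B)

lemma vb_w: "vb.w g = W g"
  unfolding vb.w_def by (rule vB_class)

lemma va_w: "va.w a = V0 a"
  by (simp add: va.w_def)

abbreviation \<psi> :: "('g \<Rightarrow> 'a set) \<Rightarrow> 'g \<Rightarrow> 'a poly set set" where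
  "\<psi> \<equiv> gr_map RB vB (\<lambda>a. residue_class A f [:a:])"

text \<open>The image of a coset of constants is only part of a coset in A[z]/(f); adding all
  elements of larger value, as \<open>gr_map\<close> does, fills it up.\<close>

lemma \<psi>_gr_of:
  assumes p: "p \<in> va.rees"
  shows "\<psi> (va.gr_of p) = vb.gr_of (const_lift p)"
proof
  fix \<gamma>
  let ?s = "Poly_Mapping.lookup p \<gamma>"
  have s: "?s \<in> A" "[:?s:] \<in> polys_over A"
    using va.reesD(1)[OF p] polys_over_const by auto
  have "vb.cs \<gamma> 0 <+>\<^bsub>RB\<^esub> (\<lambda>a. residue_class A f [:a:]) ` va.cs \<gamma> ?s = vb.cs \<gamma> [:?s:]"
  proof
    show "vb.cs \<gamma> 0 <+>\<^bsub>RB\<^esub> (\<lambda>a. residue_class A f [:a:]) ` va.cs \<gamma> ?s \<subseteq> vb.cs \<gamma> [:?s:]"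
    proof
      fix x assume "x \<in> vb.cs \<gamma> 0 <+>\<^bsub>RB\<^esub> (\<lambda>a. residue_class A f [:a:]) ` va.cs \<gamma> ?s"
      then obtain u t where u: "u \<in> polys_over A" "Fin \<gamma> < W u" and t: "t \<in> A" "Fin \<gamma> < V0 (t - ?s)"
        and x: "x = residue_class A f u \<oplus>\<^bsub>RB\<^esub> residue_class A f [:t:]"
        by (auto simp: set_add_def' vb.cs_def va.cs_def vb_w va_w)
      have "Fin \<gamma> < W (u + ([:t:] - [:?s:]))"
        using u t by (intro add_gtI) simp_all
      then have "Fin \<gamma> < W ((u + [:t:]) - [:?s:])"
        by (simp only: add_diff_eq)
      then show "x \<in> vb.cs \<gamma> [:?s:]"
        unfolding x vb.hom_add[OF u(1) polys_over_const[OF t(1)], symmetric]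
        using vb.mem_cs s(2) polys_over_add[OF u(1) polys_over_const[OF t(1)]] by (simp add: vb_w)
    qed
    show "vb.cs \<gamma> [:?s:] \<subseteq> vb.cs \<gamma> 0 <+>\<^bsub>RB\<^esub> (\<lambda>a. residue_class A f [:a:]) ` va.cs \<gamma> ?s"
    proof
      fix x assume "x \<in> vb.cs \<gamma> [:?s:]"
      then obtain u where u: "u \<in> polys_over A" "Fin \<gamma> < W (u - [:?s:])" "x = residue_class A f u"
        by (auto simp: vb.cs_def vb_w)
      have d: "u - [:?s:] \<in> polys_over A"
        by (intro polys_over_diff u s)
      have "x = residue_class A f (u - [:?s:]) \<oplus>\<^bsub>RB\<^esub> residue_class A f [:?s:]"
        unfolding u(3) vb.hom_add[OF d s(2), symmetric] by simp
      moreover have "residue_class A f (u - [:?s:]) \<in> vb.cs \<gamma> 0"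
        using vb.mem_cs[OF polys_over_0 d] u(2) by (simp add: vb_w)
      moreover have "?s \<in> va.cs \<gamma> ?s"
        using va.mem_cs[OF s(1) s(1)] by (simp add: va.w_zero)
      ultimately show "x \<in> vb.cs \<gamma> 0 <+>\<^bsub>RB\<^esub> (\<lambda>a. residue_class A f [:a:]) ` va.cs \<gamma> ?s"
        unfolding set_add_def' by blast
    qed
  qed
  then show "\<psi> (va.gr_of p) \<gamma> = vb.gr_of (const_lift p) \<gamma>"
    by (simp add: gr_map_def va.gr_of_def vb.gr_of_def lookup_const_lift vb.val_gt_eq_cs)
qed

context
  fixes k \<phi> n c j
  assumes chain: "key_chain k \<phi> n c j" and complete: "W (\<phi> k) = \<infinity>"
begin

definition \<mu> :: "nat \<Rightarrow> 'g" where "\<mu> i = (THE \<alpha>. W (\<phi> i) = Fin \<alpha>)"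

definition \<nu> :: "nat \<Rightarrow> 'g" where "\<nu> i = (THE \<alpha>. V0 (c i) = Fin \<alpha>)"

abbreviation ct :: "nat \<Rightarrow> 'g \<Rightarrow>\<^sub>0 'a" where "ct i \<equiv> Poly_Mapping.single (\<nu> i) (c i)"

text \<open>The polynomial \<phi> i, placed in the degree of its own value, represents its initial
  form in the Rees algebra.\<close>

abbreviation e :: "nat \<Rightarrow> 'g \<Rightarrow>\<^sub>0 'a poly" where "e i \<equiv> Poly_Mapping.single (\<mu> i) (\<phi> i)"

lemma W_\<phi>: "i \<in> {1..<k} \<Longrightarrow> W (\<phi> i) = Fin (\<mu> i)"
  unfolding \<mu>_def by (rule theI') (use chain_finite[OF chain, of i] not_Minf[of "\<phi> i"] in \<open>cases "W (\<phi> i)", auto\<close>)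

definition deg :: "nat \<Rightarrow> (nat \<Rightarrow> nat) \<Rightarrow> 'g" where "deg i J = (\<Sum>l\<in>{1..<i}. J l \<bullet> \<mu> l)"

lemma W_kmon: "i \<in> {1..k} \<Longrightarrow> W (kmon \<phi> i J) = Fin (deg i J)"
proof -
  assume i: "i \<in> {1..k}"
  have "W (\<Prod>l\<in>S. \<phi> l ^ J l) = Fin (\<Sum>l\<in>S. J l \<bullet> \<mu> l)" if "finite S" "S \<subseteq> {1..<k}" for S
    using that
  proof (induction S rule: finite_induct)
    case (insert l S)
    have "W (\<phi> l ^ J l) = Fin (J l \<bullet> \<mu> l)"
      using W_\<phi>[of l] insert.prems by (simp add: power nsc_Fin)
    then show ?case
      using insert by (simp add: mult)
  qed (simp add: zero_extended_def)
  then show ?thesis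
    using i unfolding kmon_def deg_def by auto
qed

lemma W_smult_kmon: "i \<in> {1..k} \<Longrightarrow> W (Polynomial.smult a (kmon \<phi> i J)) = V0 a + Fin (deg i J)"
  using mult[of "[:a:]" "kmon \<phi> i J"] by (simp add: W_kmon)

lemma kmon_e: "kmon e i J = Poly_Mapping.single (deg i J) (kmon \<phi> i J)"
  by (simp add: kmon_def single_power single_prod_coeff deg_def nsc_def)

lemma key_step_facts:
  assumes "i \<in> {1..<k}"
  shows "c i \<in> A" "\<phi> (Suc i) = \<phi> i ^ n i - Polynomial.smult (c i) (kmon \<phi> i (\<lambda>l. j l i))"
    "Fin (n i \<bullet> \<mu> i) < W (\<phi> (Suc i))" "V0 (c i) = Fin (\<nu> i)" "\<nu> i + deg i (\<lambda>l. j l i) = n i \<bullet> \<mu> i"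
    "\<forall>l\<in>{1..<i}. j l i < n l"
proof -
  have step: "key_step \<phi> n c j i"
    by (rule chain_key_step[OF chain assms])
  have i: "i \<in> {1..k}"
    using assms by auto
  show "c i \<in> A" "\<phi> (Suc i) = \<phi> i ^ n i - Polynomial.smult (c i) (kmon \<phi> i (\<lambda>l. j l i))"
    "Fin (n i \<bullet> \<mu> i) < W (\<phi> (Suc i))" "\<forall>l\<in>{1..<i}. j l i < n l"
    using step W_\<phi>[OF assms] by (auto simp: key_step_def nsc_Fin)
  have eq: "V0 (c i) + Fin (deg i (\<lambda>l. j l i)) = Fin (n i \<bullet> \<mu> i)"
    using step W_\<phi>[OF assms] W_smult_kmon[OF i] by (simp add: key_step_def nsc_Fin)
  then obtain \<alpha> where \<alpha>: "V0 (c i) = Fin \<alpha>"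
    by (cases "V0 (c i)") auto
  then show *: "V0 (c i) = Fin (\<nu> i)"
    by (simp add: \<nu>_def)
  show "\<nu> i + deg i (\<lambda>l. j l i) = n i \<bullet> \<mu> i"
    using eq * by simp
qed

lemma lookup_kmon_sum:
  "Poly_Mapping.lookup (\<Sum>J\<in>expon n k. const_lift (b J) * kmon e k J) \<gamma>
    = (\<Sum>J\<in>expon n k. Polynomial.smult (Poly_Mapping.lookup (b J) (\<gamma> - deg k J)) (kmon \<phi> k J))"
  by (simp add: lookup_sum kmon_e lookup_mult_single_right lookup_const_lift)

text \<open>The relation for i holds because the difference of the two monomials is \<phi> (i + 1)
  placed in degree n i \<bullet> \<mu> i, below its value, and so it vanishes in the graded ring.
  Generation comes from expanding remainders modulo f over \<open>A\<close>, and freeness from the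
  distinct values of the monomials.\<close>

lemma presentation_graded:
  "presentation va.gr_of va.rees (gr_ring RA V0) vb.gr_of vb.rees (gr_ring RB vB) const_lift e \<psi>
    k n ct (\<lambda>i. initial_form RA V0 (c i)) j (\<lambda>i. degree (\<phi> i))"
proof -
  interpret ga: surj_hom va.gr_of va.rees "gr_ring RA V0"
    by (rule va.surj_hom_gr)
  interpret gb: surj_hom vb.gr_of vb.rees "gr_ring RB vB"
    by (rule vb.surj_hom_gr)
  interpret evaluation const_lift e
    by (rule evaluation_const_lift)
  have kk: "k \<in> {1..k}"
    using chain_ge_1[OF chain] by simp
  have f: "\<phi> k = f"
    by (rule complete_eq_f[OF chain complete])
  have lift_closed: "const_lift a \<in> vb.rees" if "a \<in> va.rees" for a
    using that polys_over_const by (auto simp: va.rees_def vb.rees_def lookup_const_lift va_w vb_w)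
  have e_closed: "e i \<in> vb.rees" if i: "i \<in> {1..<k}" for i
    using chain_over[OF chain, of i] i W_\<phi>[OF i] by (intro vb.single_in_rees) (auto simp: vb_w)
  have ct_closed: "ct i \<in> va.rees" if i: "i \<in> {1..<k}" for i
    using key_step_facts(1,4)[OF i] by (intro va.single_in_rees) (simp_all add: va_w)
  show ?thesis
  proof
    show "const_lift a \<in> vb.rees" if "a \<in> va.rees" for a
      by (rule lift_closed[OF that])
    show "\<psi> (va.gr_of a) = vb.gr_of (const_lift a)" if "a \<in> va.rees" for a
      by (rule \<psi>_gr_of[OF that])
    show "1 \<le> k"
      by (rule chain_ge_1[OF chain])
    show "e i \<in> vb.rees" if "i \<in> {1..<k}" for i
      by (rule e_closed[OF that])
    show "ct i \<in> va.rees" if "i \<in> {1..<k}" for i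
      by (rule ct_closed[OF that])
    show "initial_form RA V0 (c i) = va.gr_of (ct i)" if "i \<in> {1..<k}" for i
      using va.gr_of_single[of "c i"] key_step_facts(1,4)[OF that] by (simp add: va_w)
  next
    fix i assume i: "i \<in> {1..<k}"
    define J where "J l = (if l \<in> {1..<i} then j l i else 0)" for l
    have i': "i \<in> {1..k}"
      using i by auto
    have J: "J \<in> expon n i"
      using key_step_facts(6)[OF i] by (auto simp: J_def expon_def)
    have nz: "\<phi> l \<noteq> 0" if "l \<in> {1..<i}" for l
      using W_\<phi>[of l] that i by auto
    \<comment> \<open>The weight of the subtracted monomial is its degree, which is below deg
      (\<phi> i) by the bounds on the exponents.\<close>
    have "(\<Sum>l\<in>{1..<i}. j l i * degree (\<phi> l)) = (\<Sum>l\<in>{1..<i}. degree (\<phi> l ^ J l))"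
      by (intro sum.cong refl) (simp only: J_def degree_power_eq[OF nz] if_True)
    also have "\<dots> = degree (kmon \<phi> i J)"
      unfolding kmon_def by (rule degree_prod_eq_sum_degree[symmetric]) (use nz in simp)
    also have "\<dots> < degree (\<phi> i)"
      by (rule chain_degree_kmon[OF chain i' J])
    also have "\<dots> \<le> n i * degree (\<phi> i)"
      using chain_ord_pos[OF chain i] by simp
    finally show "(\<Sum>l\<in>{1..<i}. j l i * degree (\<phi> l)) < n i * degree (\<phi> i)" .
    have "e i ^ n i - const_lift (ct i) * kmon e i (\<lambda>l. j l i)
        = Poly_Mapping.single (n i \<bullet> \<mu> i) (\<phi> i ^ n i - Polynomial.smult (c i) (kmon \<phi> i (\<lambda>l. j l i)))"
      unfolding const_lift_single kmon_e mult_single key_step_facts(5)[OF i]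
      by (simp add: single_power nsc_def single_diff)
    also have "\<dots> = Poly_Mapping.single (n i \<bullet> \<mu> i) (\<phi> (Suc i))"
      by (simp only: key_step_facts(2)[OF i])
    finally have eq: "e i ^ n i - const_lift (ct i) * kmon e i (\<lambda>l. j l i) = Poly_Mapping.single (n i \<bullet> \<mu> i) (\<phi> (Suc i))" .
    have mem: "Poly_Mapping.single (n i \<bullet> \<mu> i) (\<phi> (Suc i)) \<in> vb.rees"
      using chain_over[OF chain, of "Suc i"] i key_step_facts(3)[OF i]
      by (intro vb.single_in_rees) (auto simp: vb_w)
    have "vb.gr_of (Poly_Mapping.single (n i \<bullet> \<mu> i) (\<phi> (Suc i))) = vb.gr_of 0"
      using vb.gr_of_eq_iff[OF mem gb.X_closed(2)] key_step_facts(3)[OF i]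
      by (simp add: lookup_single when_def vb_w)
    then show "vb.gr_of (e i ^ n i - const_lift (ct i) * (\<Prod>l\<in>{1..<i}. e l ^ j l i)) = \<zero>\<^bsub>gr_ring RB vB\<^esub>"
      unfolding kmon_def[symmetric] eq by (simp add: gb.hom_zero)
  next
    fix y assume y: "y \<in> vb.rees"
    \<comment> \<open>Passing to remainders modulo f changes y by elements of infinite value, which
      the graded ring does not see.\<close>
    let ?y = "\<lambda>\<gamma>. Poly_Mapping.lookup y \<gamma> mod f"
    \<comment> \<open>The coefficients are chosen to be 0 wherever y is 0, so that the families
      \<open>a J\<close> below have finite support.\<close>
    have "\<exists>b. (\<forall>J. b J \<in> A) \<and> ?y \<gamma> = (\<Sum>J\<in>expon n k. Polynomial.smult (b J) (kmon \<phi> k J)) \<and>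
        (Poly_Mapping.lookup y \<gamma> = 0 \<longrightarrow> (\<forall>J. b J = 0))" for \<gamma>
    proof (cases "Poly_Mapping.lookup y \<gamma> = 0")
      case True
      then show ?thesis
        using A_0 by (intro exI[of _ "\<lambda>_. 0"]) simp
    next
      case False
      have "0 < degree f"
        using chain_key[OF chain kk] by (simp add: f key_def)
      then have "degree (?y \<gamma>) < degree (\<phi> k)"
        unfolding f by (metis degree_0 degree_mod_less less_nat_zero_code)
      moreover have "?y \<gamma> \<in> polys_over A"
        using polys_over_div_mod[OF monic_f f_over vb.reesD(1)[OF y]] by simp
      ultimately obtain b where "\<And>J. b J \<in> A" "?y \<gamma> = (\<Sum>J\<in>expon n k. Polynomial.smult (b J) (kmon \<phi> k J))"
        using chain_expansion[OF chain kk] by blast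
      then show ?thesis
        using False by blast
    qed
    then obtain b where bA: "\<And>\<gamma> J. b \<gamma> J \<in> A"
      and b: "\<And>\<gamma>. ?y \<gamma> = (\<Sum>J\<in>expon n k. Polynomial.smult (b \<gamma> J) (kmon \<phi> k J))"
      and b0: "\<And>\<gamma> J. Poly_Mapping.lookup y \<gamma> = 0 \<Longrightarrow> b \<gamma> J = 0"
      by metis
    have W_y: "Fin \<gamma> \<le> W (?y \<gamma>)" for \<gamma>
    proof -
      have "W (Poly_Mapping.lookup y \<gamma> - ?y \<gamma>) = \<infinity>"
        unfolding W_inf_iff by (simp add: dvd_minus_mod)
      moreover have "Fin \<gamma> \<le> W (Poly_Mapping.lookup y \<gamma>)"
        using vb.reesD(2)[OF y, of \<gamma>] by (simp only: vb_w)
      ultimately have "Fin \<gamma> \<le> W (Poly_Mapping.lookup y \<gamma> - (Poly_Mapping.lookup y \<gamma> - ?y \<gamma>))"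
        by (metis diff_geI less_eq_extended.simps(2) linorder_linear)
      then show ?thesis
        by simp
    qed
    \<comment> \<open>The monomial J has degree \<open>deg k J\<close>, so its coefficient in degree
      \<gamma> stems from the component of y in degree \<gamma> + deg k J.\<close>
    define a where "a J = (if J \<in> expon n k then Abs_poly_mapping (\<lambda>\<gamma>. b (\<gamma> + deg k J) J) else 0)" for J
    have lookup_a: "Poly_Mapping.lookup (a J) \<gamma> = b (\<gamma> + deg k J) J" if "J \<in> expon n k" for J \<gamma>
    proof -
      have "{\<gamma>. b (\<gamma> + deg k J) J \<noteq> 0} \<subseteq> (\<lambda>\<gamma>. \<gamma> - deg k J) ` Poly_Mapping.keys y"
      proof
        fix \<gamma> assume "\<gamma> \<in> {\<gamma>. b (\<gamma> + deg k J) J \<noteq> 0}"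
        then have "\<gamma> + deg k J \<in> Poly_Mapping.keys y"
          using b0 by (auto simp: in_keys_iff)
        then show "\<gamma> \<in> (\<lambda>\<gamma>. \<gamma> - deg k J) ` Poly_Mapping.keys y"
          by (rule rev_image_eqI) simp
      qed
      then have "finite {\<gamma>. b (\<gamma> + deg k J) J \<noteq> 0}"
        by (rule finite_subset) simp
      then show ?thesis
        using that by (simp add: a_def)
    qed
    have "a J \<in> va.rees" for J
    proof (cases "J \<in> expon n k")
      case True
      have "Fin \<gamma> \<le> V0 (b (\<gamma> + deg k J) J)" for \<gamma>
      proof -
        have "Fin (\<gamma> + deg k J) \<le> W (Polynomial.smult (b (\<gamma> + deg k J) J) (kmon \<phi> k J))"
          using W_y[of "\<gamma> + deg k J"] W_kmon_sum_ge_iff[OF chain kk] True unfolding b by blast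
        then have "Fin \<gamma> + Fin (deg k J) \<le> V0 (b (\<gamma> + deg k J) J) + Fin (deg k J)"
          by (simp add: W_smult_kmon[OF kk])
        then show ?thesis
          by (subst (asm) extended_add_cancel) auto
      qed
      then show ?thesis
        using bA by (simp add: va.rees_def lookup_a[OF True] va_w)
    next
      case False
      then show ?thesis
        using ga.X_closed(2) by (simp add: a_def)
    qed
    moreover have "vb.gr_of y = vb.gr_of (\<Sum>J\<in>expon n k. const_lift (a J) * kmon e k J)"
    proof -
      have lookup: "Poly_Mapping.lookup (\<Sum>J\<in>expon n k. const_lift (a J) * kmon e k J) \<gamma> = ?y \<gamma>" for \<gamma>
        unfolding lookup_kmon_sum b by (intro sum.cong) (simp_all add: lookup_a)
      then have mem: "(\<Sum>J\<in>expon n k. const_lift (a J) * kmon e k J) \<in> vb.rees"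
        using W_y polys_over_div_mod[OF monic_f f_over vb.reesD(1)[OF y]] by (simp add: vb.rees_def vb_w)
      have "W (Poly_Mapping.lookup y \<gamma> - ?y \<gamma>) = \<infinity>" for \<gamma>
        unfolding W_inf_iff by (simp add: dvd_minus_mod)
      then show ?thesis
        unfolding vb.gr_of_eq_iff[OF y mem] lookup vb_w by simp
    qed
    ultimately show "\<exists>a. (\<forall>J. a J \<in> va.rees) \<and> vb.gr_of y = vb.gr_of (\<Sum>J\<in>expon n k. const_lift (a J) * kmon e k J)"
      by blast
  next
    fix b J assume b: "\<And>J. b J \<in> va.rees" and J: "J \<in> expon n k"
      and zero: "vb.gr_of (\<Sum>J\<in>expon n k. const_lift (b J) * kmon e k J) = \<zero>\<^bsub>gr_ring RB vB\<^esub>"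
    have kmon_e_closed: "kmon e k J \<in> vb.rees" for J
      unfolding kmon_def by (intro gb.X_prod gb.X_closed(7) e_closed)
    have mem: "(\<Sum>J\<in>expon n k. const_lift (b J) * kmon e k J) \<in> vb.rees"
      by (intro subring_set_sum[OF gb.D] gb.X_closed(5) lift_closed b kmon_e_closed)
    have less: "Fin \<gamma> < W (\<Sum>J\<in>expon n k. Polynomial.smult (Poly_Mapping.lookup (b J) (\<gamma> - deg k J)) (kmon \<phi> k J))" for \<gamma>
      using zero vb.gr_of_eq_iff[OF mem gb.X_closed(2)] by (simp add: gb.hom_zero lookup_kmon_sum vb_w)
    have "Fin \<gamma> < V0 (Poly_Mapping.lookup (b J) \<gamma>)" for \<gamma>
    proof -
      have "Fin (\<gamma> + deg k J) < W (Polynomial.smult (Poly_Mapping.lookup (b J) (\<gamma> + deg k J - deg k J)) (kmon \<phi> k J))"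
        by (rule W_kmon_sum_gt_iff[OF chain kk, THEN iffD1, rule_format, OF _ less J]) simp
      then have "Fin \<gamma> + Fin (deg k J) < V0 (Poly_Mapping.lookup (b J) \<gamma>) + Fin (deg k J)"
        by (simp add: W_smult_kmon[OF kk])
      then show ?thesis
        by (subst (asm) extended_add_cancel) auto
    qed
    then have "va.gr_of (b J) = va.gr_of 0"
      using va.gr_of_eq_iff[OF b ga.X_closed(2)] by (simp add: va_w)
    then show "va.gr_of (b J) = \<zero>\<^bsub>gr_ring RA V0\<^esub>"
      by (simp add: ga.hom_zero)
  qed
qed

lemma graded_ring_presentation:
  "\<exists>h\<in>ring_iso (gr_ring RB vB) (mpoly_ring (gr_ring RA V0) {1..<k} Quot
      presentation_ideal (gr_ring RA V0) k n (\<lambda>i. initial_form RA V0 (c i)) j).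
     \<forall>a\<in>carrier (gr_ring RA V0). h (\<psi> a) =
       presentation_ideal (gr_ring RA V0) k n (\<lambda>i. initial_form RA V0 (c i)) j
         +>\<^bsub>mpoly_ring (gr_ring RA V0) {1..<k}\<^esub> ring.indexed_const (gr_ring RA V0) a"
  and graded_ring_finitely_generated:
    "finitely_generated_module (gr_ring RA V0) (restrict_scalars \<psi> (gr_ring RB vB))"
  and graded_ring_finitely_presented:
    "finitely_presented_module (gr_ring RA V0) (restrict_scalars \<psi> (gr_ring RB vB))"
proof -
  interpret P: presentation va.gr_of va.rees "gr_ring RA V0" vb.gr_of vb.rees "gr_ring RB vB" const_lift e \<psi>
    k n ct "\<lambda>i. initial_form RA V0 (c i)" j "\<lambda>i. degree (\<phi> i)"
    by (rule presentation_graded)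
  show "\<exists>h\<in>ring_iso (gr_ring RB vB) (mpoly_ring (gr_ring RA V0) {1..<k} Quot
      presentation_ideal (gr_ring RA V0) k n (\<lambda>i. initial_form RA V0 (c i)) j).
     \<forall>a\<in>carrier (gr_ring RA V0). h (\<psi> a) =
       presentation_ideal (gr_ring RA V0) k n (\<lambda>i. initial_form RA V0 (c i)) j
         +>\<^bsub>mpoly_ring (gr_ring RA V0) {1..<k}\<^esub> ring.indexed_const (gr_ring RA V0) a"
    using P.presentation_iso unfolding P.I_def .
  show "finitely_generated_module (gr_ring RA V0) (restrict_scalars \<psi> (gr_ring RB vB))"
    "finitely_presented_module (gr_ring RA V0) (restrict_scalars \<psi> (gr_ring RB vB))"
    by (rule P.module_finitely_generated, rule P.module_finitely_presented)
qed

end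

end

end

section \<open>Residue field and integrality for the unique extension\<close>

lemma ring_of_type_algebra_UNIV: "ring_of_type_algebra\<lparr>carrier := UNIV\<rparr> = (ring_of_type_algebra :: 'a::comm_ring_1 ring)"
  by (simp add: ring_of_type_algebra_def)

lemma uminus_ring_of_type_algebra: "\<ominus>\<^bsub>ring_of_type_algebra\<^esub> a = - (a :: 'a::comm_ring_1)"
proof -
  have "subring_set (UNIV :: 'a set)"
    by (simp add: subring_set_def)
  then interpret h: surj_hom "\<lambda>x. x" "UNIV :: 'a set" "ring_of_type_algebra :: 'a ring"
    using surj_hom_subring[of UNIV] by (simp add: ring_of_type_algebra_UNIV)
  show ?thesis
    using h.hom_uminus[of a] by simp
qed

lemma subring_ring_of_type_algebra:
  assumes "subring S (ring_of_type_algebra :: 'a::comm_ring_1 ring)"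
  shows "0 \<in> S" "1 \<in> S" "a \<in> S \<Longrightarrow> - a \<in> S" "a \<in> S \<Longrightarrow> b \<in> S \<Longrightarrow> a + b \<in> S"
    "a \<in> S \<Longrightarrow> b \<in> S \<Longrightarrow> a - b \<in> S" "a \<in> S \<Longrightarrow> b \<in> S \<Longrightarrow> a * b \<in> S" "of_nat i \<in> S"
proof -
  note S = subringE[OF assms]
  show "0 \<in> S" "1 \<in> S" and neg: "\<And>a. a \<in> S \<Longrightarrow> - a \<in> S" and add: "\<And>a b. a \<in> S \<Longrightarrow> b \<in> S \<Longrightarrow> a + b \<in> S"
    and "a \<in> S \<Longrightarrow> b \<in> S \<Longrightarrow> a * b \<in> S"
    using S(2,3) S(5)[unfolded uminus_ring_of_type_algebra] S(6,7) by (auto simp: ring_of_type_algebra_def)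
  then show "a \<in> S \<Longrightarrow> b \<in> S \<Longrightarrow> a - b \<in> S"
    using add[of a "- b"] by simp
  show "of_nat i \<in> S"
    using \<open>0 \<in> S\<close> \<open>1 \<in> S\<close> add by (induction i) auto
qed

lemma subfield_inverse_closed:
  assumes "subfield kk (ring_of_type_algebra :: 'a::field ring)" "a \<in> kk" "a \<noteq> 0"
  shows "inverse a \<in> kk"
proof -
  interpret F: field "ring_of_type_algebra :: 'a ring"
    by (rule field_from_type_algebra)
  have a: "a \<in> kk - {\<zero>\<^bsub>ring_of_type_algebra\<^esub>}"
    using assms by (simp add: ring_of_type_algebra_def)
  have "inv\<^bsub>ring_of_type_algebra\<^esub> a \<in> kk" "a * inv\<^bsub>ring_of_type_algebra\<^esub> a = 1"
    using F.subfield_m_inv(1,2)[OF assms(1) a] by (simp_all add: ring_of_type_algebra_def)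
  then show ?thesis
    by (metis inverse_unique)
qed

section \<open>Roots in the algebraically closed field\<close>

lemma algebraically_closed_root:
  fixes kk :: "'a::field set"
  assumes kk: "subring kk ring_of_type_algebra" "algebraically_closed (ring_of_type_algebra\<lparr>carrier := kk\<rparr>)"
    and p: "p \<in> polys_over kk" "0 < degree p"
  shows "\<exists>x\<in>kk. poly p x = 0"
proof -
  define L where "L = ring_of_type_algebra\<lparr>carrier := kk\<rparr>"
  interpret L: algebraically_closed L
    unfolding L_def by (rule kk(2))
  have L: "carrier L = kk" "\<zero>\<^bsub>L\<^esub> = 0" "\<one>\<^bsub>L\<^esub> = 1" "x \<oplus>\<^bsub>L\<^esub> y = x + y" "x \<otimes>\<^bsub>L\<^esub> y = x * y" for x y
    by (simp_all add: L_def ring_of_type_algebra_def)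
  have pow: "x [^]\<^bsub>L\<^esub> (i::nat) = x ^ i" for x i
    by (induction i) (simp_all add: L L.nat_pow_Suc mult.commute)
  \<comment> \<open>The list representation of polynomials begins with the leading coefficient,
    whereas \<open>coeffs\<close> ends with it.\<close>
  define P where "P = rev (coeffs p)"
  have deg: "Polynomials.degree P = degree p"
    by (simp add: P_def degree_eq_length_coeffs)
  have "set (coeffs p) \<subseteq> kk"
    using p(1) by (auto simp: coeffs_def polys_over_def)
  then have carrier_P: "P \<in> carrier (poly_ring L)"
    using p(2) by (auto simp: univ_poly_def polynomial_def P_def hd_rev last_coeffs_eq_coeff_degree L)
  then have "L.splitted P"
    by (rule L.roots_over_carrier)
  then have "L.roots P \<noteq> {#}"
    unfolding L.splitted_def using deg p(2) by auto
  then obtain x where "x \<in># L.roots P"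
    by blast
  then have x: "L.is_root P x"
    using L.roots_mem_iff_is_root[OF carrier_P] by auto
  have "L.eval xs x = poly (Poly (rev xs)) x" for xs
    by (induction xs) (simp_all add: L pow Poly_append poly_monom mult.commute add.commute)
  then have "L.eval P x = poly p x"
    by (simp add: P_def)
  then show ?thesis
    using x by (auto simp: L.is_root_def L)
qed

lemma extended_add_pos:
  fixes x y :: "'g::linordered_ab_group_add extended"
  shows "0 < x \<Longrightarrow> 0 \<le> y \<Longrightarrow> 0 < x + y"
  by (cases x; cases y) (auto simp: zero_extended_def add_pos_nonneg)

text \<open>Split off linear factors over kk one at a time: if the product of the values at p is
  positive in the ordered group, then so is the value of one factor.\<close>

lemma (in poly_pseudo_valuation) positive_linear_factor:
  fixes kk :: "'a set"
  assumes kk: "subring kk ring_of_type_algebra" "algebraically_closed (ring_of_type_algebra\<lparr>carrier := kk\<rparr>)"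
    and q: "q \<in> polys_over kk" "Polynomial.lead_coeff q = 1" "0 < W (pcompose q p)"
  shows "\<exists>a\<in>kk. 0 < W (p - [:a:])"
  using q
proof (induction "degree q" arbitrary: q rule: less_induct)
  case less
  interpret k: subring_type kk
    using subring_ring_of_type_algebra[OF kk(1)] by unfold_locales auto
  show ?case
  proof (cases "degree q = 0")
    case True
    then have "q = 1"
      using less.prems(2) by (metis degree_eq_zeroE one_pCons lead_coeff_pCons(2))
    then show ?thesis
      using less.prems(3) by (simp add: pcompose_1)
  next
    case False
    then obtain a where a: "a \<in> kk" "poly q a = 0"
      using algebraically_closed_root[OF kk less.prems(1)] by blast
    define h where "h = q div [:- a, 1:]"
    have h: "q = [:- a, 1:] * h"
      using a(2) unfolding h_def by (simp only: poly_eq_0_iff_dvd dvd_mult_div_cancel)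
    have hk: "h \<in> polys_over kk"
      unfolding h_def using a(1) less.prems(1) k.A_uminus k.A_1 k.A_0
      by (intro k.polys_over_div_mod(1)) (auto simp: polys_over_def coeff_pCons split: nat.split)
    have lead: "Polynomial.lead_coeff h = 1"
      using less.prems(2) unfolding h lead_coeff_mult by simp
    then have "h \<noteq> 0"
      by auto
    then have deg: "degree h < degree q"
      unfolding h by (subst degree_mult_eq) auto
    have "pcompose q p = (p - [:a:]) * pcompose h p"
      unfolding h pcompose_mult by (simp add: pcompose_pCons)
    then have "0 < W (p - [:a:]) + W (pcompose h p)"
      using less.prems(3) by (simp only: mult)
    then have "0 < W (p - [:a:]) \<or> 0 < W (pcompose h p)"
      using add_mono[of "W (p - [:a:])" 0 "W (pcompose h p)" 0] by force
    then show ?thesis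
      using less.hyps[OF deg hk lead] a(1) by blast
  qed
qed

section \<open>From valuations of K[z]/(f) to pseudo valuations of K[z]\<close>

context
  fixes V0 :: "'a::field \<Rightarrow> 'g::linordered_ab_group_add extended" and f and \<omega> and W :: "'a poly \<Rightarrow> 'g extended"
  assumes f: "Polynomial.lead_coeff f = 1" "Factorial_Ring.irreducible f"
    and unique: "unique_extension V0 f \<omega>" and W: "\<And>g. W g = \<omega> (residue_class UNIV f g)"
begin

lemma extension: "valuation_on (residue_ring UNIV f) \<omega>" "W [:a:] = V0 a"
  using unique by (auto simp: unique_extension_def extends_valuation_def W)

lemma surj_hom_L: "surj_hom (residue_class UNIV f) UNIV (residue_ring UNIV f)"
  using subring_type.surj_hom_residue_ring[OF subring_type_UNIV, of f] by simp

interpretation L: surj_hom "residue_class UNIV f" UNIV "residue_ring UNIV f"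
  by (rule surj_hom_L)

lemma class_eq_iff: "residue_class UNIV f g = residue_class UNIV f h \<longleftrightarrow> f dvd g - h"
  using subring_type.residue_class_eq_iff[OF subring_type_UNIV, of f g h] f(1) by simp

lemma W_eq_inf_iff: "W p = \<infinity> \<longleftrightarrow> f dvd p"
  using extension(1) L.hom_closed[of p] class_eq_iff[of p 0]
  by (simp add: W valuation_on_def L.hom_zero)

lemma pseudo_valuation_W: "pseudo_valuation W"
proof
  show "W x \<noteq> -\<infinity>" for x
    using extension(1) L.hom_closed[of x] by (simp add: W valuation_on_def)
  show "W (x * y) = W x + W y" "min (W x) (W y) \<le> W (x + y)" for x y
    using extension(1) L.hom_closed[of x] L.hom_closed[of y] L.hom_mult[of x y] L.hom_add[of x y]
    by (simp_all add: W valuation_on_def)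
  show "W 0 = \<infinity>" "W 1 \<noteq> \<infinity>"
    using irreducible_not_unit[OF f(2)] by (auto simp: W_eq_inf_iff)
qed

lemma value_group_residue_ring:
  "value_group (residue_ring UNIV f) \<omega> = value_group ring_of_type_algebra W"
  by (auto simp: value_group_def W ring_of_type_algebra_def simp flip: L.image)

text \<open>A saturated subring of K[z] is the preimage of its image in K[z]/(f). In this way the
  valuation rings found by Zorn's lemma become competitors in the uniqueness assumption on
  \<omega>.\<close>

lemma integral_of_unique_extension:
  assumes V0: "valuation_on (ring_of_type_algebra :: 'a ring) V0" and p: "0 \<le> W p"
  shows "\<exists>\<chi>. Polynomial.lead_coeff \<chi> = 1 \<and> 0 < degree \<chi> \<and>
      (\<forall>i. 0 \<le> V0 (Polynomial.coeff \<chi> i)) \<and> f dvd pcompose \<chi> p"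
proof (rule integral_of_unique_valuation_ring[OF V0 f(2), where W = W])
  let ?c = "residue_class UNIV f" and ?L = "residue_ring UNIV f"
  fix S assume S: "saturated f S" and inv: "\<And>x x'. [x * x' = 1] (mod f) \<Longrightarrow> x \<in> S \<or> x' \<in> S"
    and const: "\<And>a. [:a:] \<in> S \<longleftrightarrow> 0 \<le> V0 a"
  have sub: "subring_set S" and sat: "\<And>p q. p \<in> S \<Longrightarrow> f dvd p - q \<Longrightarrow> q \<in> S"
    using S by (auto simp: saturated_def cong_iff_dvd_diff)
  note S' = subring_setD[OF sub]
  have mem: "?c g \<in> ?c ` S \<longleftrightarrow> g \<in> S" for g
    using sat class_eq_iff by blast
  have "valuation_ring_of ?L (?c ` S)"
    unfolding valuation_ring_of_def
  proof (intro conjI ballI)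
    show "subring (?c ` S) ?L"
    proof (rule L.subringI)
      show "?c ` S \<subseteq> carrier ?L"
        using L.hom_closed by blast
      show "\<one>\<^bsub>?L\<^esub> \<in> ?c ` S"
        using S'(1) by (simp add: mem flip: L.hom_one)
      show "\<ominus>\<^bsub>?L\<^esub> h \<in> ?c ` S" if "h \<in> ?c ` S" for h
        using that S'(6) by (auto simp: mem simp flip: L.hom_uminus)
      show "h \<otimes>\<^bsub>?L\<^esub> h' \<in> ?c ` S" "h \<oplus>\<^bsub>?L\<^esub> h' \<in> ?c ` S" if "h \<in> ?c ` S" "h' \<in> ?c ` S" for h h'
        using that S'(4,5) by (auto simp: mem simp flip: L.hom_mult L.hom_add)
    qed
    fix x assume "x \<in> carrier ?L - {\<zero>\<^bsub>?L\<^esub>}"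
    then obtain g where g: "x = ?c g" "\<not> f dvd g"
      using L.rep[of x] class_eq_iff[of _ 0] by (auto simp: L.hom_zero)
    then obtain h where h: "[g * h = 1] (mod f)"
      using inverse_mod_irreducible[OF f(2), of g] by (auto simp: cong_iff_dvd_diff)
    then have "?c g \<otimes>\<^bsub>?L\<^esub> ?c h = \<one>\<^bsub>?L\<^esub>"
      using class_eq_iff[of "g * h" 1] by (simp add: cong_iff_dvd_diff L.hom_one flip: L.hom_mult)
    then have "inv\<^bsub>?L\<^esub> x = ?c h"
      unfolding g(1) by (intro L.comm_inv_char L.hom_closed) auto
    then show "x \<in> ?c ` S \<or> inv\<^bsub>?L\<^esub> x \<in> ?c ` S"
      using inv[OF h] by (simp add: g(1) mem)
  qed
  moreover have "{a. ?c [:a:] \<in> ?c ` S} = val_ring ring_of_type_algebra V0"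
    by (simp add: mem const val_ring_def ring_of_type_algebra_def)
  ultimately have eq: "?c ` S = val_ring ?L \<omega>"
    using unique unfolding unique_extension_def by blast
  have "g \<in> S \<longleftrightarrow> 0 \<le> W g" for g
    using L.hom_closed[of g] unfolding mem[symmetric] eq by (simp add: val_ring_def W)
  then show "S = {p. 0 \<le> W p}"
    by blast
qed (rule p)

end

text \<open>Surjectivity of the residue isomorphism puts a into the coset of an element of
  kk.\<close>

lemma residue_field_representative:
  fixes V0 :: "'a::field \<Rightarrow> 'g::linordered_ab_group_add extended"
  defines "R \<equiv> ring_of_type_algebra\<lparr>carrier := val_ring ring_of_type_algebra V0\<rparr>"
  assumes V0: "valuation_on ring_of_type_algebra V0"
    and iso: "(\<lambda>x. val_ideal ring_of_type_algebra V0 +>\<^bsub>R\<^esub> x)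
      \<in> ring_iso (ring_of_type_algebra\<lparr>carrier := kk\<rparr>) (R Quot val_ideal ring_of_type_algebra V0)"
    and a: "0 \<le> V0 a"
  shows "\<exists>b\<in>kk. 0 < V0 (a - b)"
proof -
  interpret V0: pseudo_valuation V0
    using V0 by (rule pseudo_valuation_of_valuation)
  let ?m = "val_ideal ring_of_type_algebra V0"
  have coset: "?m +>\<^bsub>R\<^esub> x = {h + x | h. 0 < V0 h}" for x
    by (auto simp: R_def a_r_coset_def' val_ideal_def ring_of_type_algebra_def)
  have "?m +>\<^bsub>R\<^esub> a \<in> carrier (R Quot ?m)"
    using a by (auto simp: FactRing_def A_RCOSETS_def' R_def val_ring_def ring_of_type_algebra_def)
  also have "carrier (R Quot ?m) = (\<lambda>x. ?m +>\<^bsub>R\<^esub> x) ` kk"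
    using iso by (simp add: ring_iso_def bij_betw_def)
  finally obtain b where b: "b \<in> kk" "?m +>\<^bsub>R\<^esub> a = ?m +>\<^bsub>R\<^esub> b"
    by blast
  have "0 + a \<in> ?m +>\<^bsub>R\<^esub> a"
    unfolding coset by (intro CollectI exI[of _ 0]) (simp add: less_inf_iff)
  then have "a \<in> ?m +>\<^bsub>R\<^esub> b"
    using b(2) by simp
  then show ?thesis
    unfolding coset using b(1) by (auto intro!: bexI[of _ b])
qed

text \<open>Replacing the coefficients of an integral equation by representatives in kk changes its
  value at p by something of positive value. The result is monic over kk and positive at p, so it
  has a linear factor that is positive at p.\<close>

lemma (in poly_pseudo_valuation) residue_of_integral:
  fixes kk :: "'a set" and V0 :: "'a \<Rightarrow> 'g extended"
  assumes kk: "subring kk ring_of_type_algebra" "algebraically_closed (ring_of_type_algebra\<lparr>carrier := kk\<rparr>)"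
    and rep: "\<And>a. 0 \<le> V0 a \<Longrightarrow> \<exists>b\<in>kk. 0 < V0 (a - b)"
    and const: "\<And>a. W [:a:] = V0 a"
    and \<chi>: "Polynomial.lead_coeff \<chi> = 1" "\<And>i. 0 \<le> V0 (Polynomial.coeff \<chi> i)" "W (pcompose \<chi> p) = \<infinity>"
    and p: "0 \<le> W p"
  shows "\<exists>a\<in>kk. 0 < W (p - [:a:])"
proof -
  note kk' = subring_ring_of_type_algebra[OF kk(1)]
  let ?d = "degree \<chi>"
  obtain b where b: "\<And>i. b i \<in> kk" "\<And>i. 0 < V0 (Polynomial.coeff \<chi> i - b i)"
    using rep[OF \<chi>(2)] by metis
  \<comment> \<open>The leading coefficient stays exactly 1, so that h is monic of the same
    degree.\<close>
  define h where "h = (\<Sum>i<?d. Polynomial.monom (b i) i) + Polynomial.monom 1 ?d"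
  have coeff_h: "Polynomial.coeff h i = (if i < ?d then b i else if i = ?d then 1 else 0)" for i
    by (auto simp: h_def coeff_sum)
  have "degree h = ?d"
  proof (rule antisym)
    show "degree h \<le> ?d"
      by (rule degree_le) (simp add: coeff_h)
    show "?d \<le> degree h"
      by (rule le_degree) (simp add: coeff_h)
  qed
  then have h: "h \<in> polys_over kk" "Polynomial.lead_coeff h = 1"
    using b(1) kk'(1,2) by (simp_all add: polys_over_def coeff_h)
  have V0_inf: "V0 0 = \<infinity>"
    using const[of 0] by simp
  have small: "0 < V0 (Polynomial.coeff (\<chi> - h) i)" for i
  proof -
    consider "i < ?d" | "i = ?d" | "?d < i"
      by linarith
    then show ?thesis
      using b(2)[of i] \<chi>(1) coeff_eq_0[of \<chi> i]
      by cases (simp_all add: coeff_h V0_inf less_inf_iff)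
  qed
  have "0 < W (pcompose (\<chi> - h) p)"
    unfolding pcompose_eq_sum
  proof (rule sum_gtI)
    fix i assume "i \<in> {..degree (\<chi> - h)}"
    have "0 \<le> W (p ^ i)"
      using p by (induction i) (use add_mono[of 0 "W p" 0] in \<open>simp_all add: mult\<close>)
    then have "0 < V0 (Polynomial.coeff (\<chi> - h) i) + W (p ^ i)"
      using small[of i] by (intro extended_add_pos)
    then show "0 < W (Polynomial.smult (Polynomial.coeff (\<chi> - h) i) (p ^ i))"
      using mult[of "[:Polynomial.coeff (\<chi> - h) i:]" "p ^ i"] const by simp
  qed simp
  then have "0 < W (pcompose \<chi> p - pcompose (\<chi> - h) p)"
    using \<chi>(3) by (intro diff_gtI) (simp_all add: less_inf_iff)
  also have "pcompose \<chi> p - pcompose (\<chi> - h) p = pcompose h p"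
    by (simp add: pcompose_diff)
  finally show ?thesis
    using positive_linear_factor[OF kk h] by blast
qed

theorem theorem5p1:
  fixes A kk :: "'a::field set"
    and V0 :: "'a \<Rightarrow> 'g::linordered_ab_group_add extended"
    and f :: "'a poly"
    and \<omega> :: "'a poly set \<Rightarrow> 'g extended"
    and W :: "'a poly \<Rightarrow> 'g extended"
  defines "K \<equiv> (ring_of_type_algebra :: 'a ring)"
  defines "RA \<equiv> K\<lparr>carrier := A\<rparr>"
  defines "RV0 \<equiv> K\<lparr>carrier := val_ring K V0\<rparr>"
  defines "L \<equiv> residue_ring UNIV f"
  defines "GA \<equiv> gr_ring RA V0"
  defines "GB \<equiv> gr_ring (residue_ring A f) (\<lambda>C. \<omega> (residue_ring_map f C))"
  defines "\<psi> \<equiv> gr_map (residue_ring A f) (\<lambda>C. \<omega> (residue_ring_map f C)) (\<lambda>a. residue_class A f [:a:])"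
  assumes A: "subring A K" "local_ring RA"
    and quotient_field: "\<forall>x. \<exists>a\<in>A. \<exists>b\<in>A. b \<noteq> 0 \<and> x = a / b"
    and kk: "subfield kk K" "algebraically_closed (K\<lparr>carrier := kk\<rparr>)" "kk \<subseteq> A"
    and residue_A: "(\<lambda>x. max_ideal RA +>\<^bsub>RA\<^esub> x) \<in> ring_iso (K\<lparr>carrier := kk\<rparr>) (RA Quot max_ideal RA)"
    and V0: "valuation_on K V0" "dominates V0 A"
    and residue_V0: "(\<lambda>x. val_ideal K V0 +>\<^bsub>RV0\<^esub> x) \<in> ring_iso (K\<lparr>carrier := kk\<rparr>) (RV0 Quot val_ideal K V0)"
    and f: "f \<in> polys_over A" "Polynomial.lead_coeff f = 1" "Factorial_Ring.irreducible f"
    and \<omega>: "unique_extension V0 f \<omega>"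
    and char: "\<not> CHAR('a) dvd Polynomial.degree f"
    and W: "\<forall>g. W g = \<omega> (residue_class UNIV f g)"
  shows "\<exists>k \<phi> V n c j. 1 \<le> k \<and> realization V0 W f k \<phi> V n c j \<and>
           W = V k \<and>
           Polynomial.degree f = group_index (value_group L \<omega>) (value_group K V0) \<and>
           Polynomial.degree f = group_index (value_group ring_of_type_algebra (V k)) (value_group K V0) \<and>
           (\<forall>i\<in>{1..k - 1}. c i \<in> A) \<and>
           (let P = mpoly_ring GA {1..<k};
                I = presentation_ideal GA k n (\<lambda>i. initial_form RA V0 (c i)) j
            in \<exists>h\<in>ring_iso GB (P Quot I).
                 \<forall>a\<in>carrier GA. h (\<psi> a) = I +>\<^bsub>P\<^esub> ring.indexed_const GA a) \<and>
           finitely_generated_module GA (restrict_scalars \<psi> GB) \<and>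
           finitely_presented_module GA (restrict_scalars \<psi> GB)"
proof -
  have W': "W g = \<omega> (residue_class UNIV f g)" for g
    using W by simp
  note V0' = V0(1)[unfolded K_def]
  note fact = f(2,3) \<omega> W'
  interpret V0: pseudo_valuation V0
    using V0' by (rule pseudo_valuation_of_valuation)
  have ppv: "poly_pseudo_valuation W"
    using pseudo_valuation_W[OF fact] by (simp add: poly_pseudo_valuation_def)
  note A' = subring_ring_of_type_algebra[OF A(1)[unfolded K_def]]
  have kk_sub: "subring kk (ring_of_type_algebra :: 'a ring)"
    using kk(1) unfolding K_def by (rule subfieldE(1))
  note kk' = subring_ring_of_type_algebra[OF kk_sub]
  have kk_inverse: "inverse a \<in> kk" if "a \<in> kk" "a \<noteq> 0" for a
    using subfield_inverse_closed[OF kk(1)[unfolded K_def] that] .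
  have A_nonneg: "0 \<le> V0 a" if "a \<in> A" for a
    using V0(2) that by (auto simp: dominates_def val_ring_def)
  \<comment> \<open>Nonzero elements of kk have their inverses in \<open>A\<close>, so both values
    are nonnegative and add up to 0.\<close>
  have V0_kk: "V0 a = 0" if "a \<in> kk" "a \<noteq> 0" for a
  proof -
    have "0 \<le> V0 a" "0 \<le> V0 (inverse a)"
      using that kk_inverse kk(3) A_nonneg by blast+
    moreover have "V0 a + V0 (inverse a) = 0"
      using V0.mult[of a "inverse a"] that(2) by simp
    ultimately show ?thesis
      by (cases "V0 a"; cases "V0 (inverse a)") (auto simp: zero_extended_def add_nonneg_eq_0_iff)
  qed
  have integral: "\<exists>\<chi>. Polynomial.lead_coeff \<chi> = 1 \<and> 0 < degree \<chi> \<and>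
      (\<forall>i. 0 \<le> V0 (Polynomial.coeff \<chi> i)) \<and> f dvd pcompose \<chi> p" if "0 \<le> W p" for p
    by (rule integral_of_unique_extension[OF fact V0' that])
  have rep: "\<exists>b\<in>kk. 0 < V0 (a - b)" if "0 \<le> V0 a" for a
    by (rule residue_field_representative[OF V0' residue_V0[unfolded RV0_def K_def] that])
  have loc: "unique_extension_over W V0 f A"
  proof
    show "valuation_on (ring_of_type_algebra :: 'a ring) V0"
      by (rule V0')
    show "W [:a:] = V0 a" for a
      by (rule extension(2)[OF fact])
    show "W p = \<infinity> \<longleftrightarrow> f dvd p" for p
      by (rule W_eq_inf_iff[OF fact])
    show "\<exists>a. a \<noteq> 0 \<and> V0 a = 0 \<and> 0 < W (p - [:a:])" if p: "W p = 0" for p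
    proof -
      obtain \<chi> where \<chi>: "Polynomial.lead_coeff \<chi> = 1" "\<And>i. 0 \<le> V0 (Polynomial.coeff \<chi> i)" "f dvd pcompose \<chi> p"
        using integral[of p] p by auto
      have "\<exists>a\<in>kk. 0 < W (p - [:a:])"
        using \<chi>(3) W_eq_inf_iff[OF fact] extension(2)[OF fact] p
        by (intro poly_pseudo_valuation.residue_of_integral[OF ppv kk_sub kk(2)[unfolded K_def] rep _ \<chi>(1,2)]) auto
      then obtain a where a: "a \<in> kk" "0 < W (p - [:a:])"
        by blast
      then have "a \<noteq> 0"
        using p by auto
      then show ?thesis
        using a V0_kk by blast
    qed
    show "1 / of_nat i \<in> A" "V0 (of_nat i) = 0" if "of_nat i \<noteq> (0::'a)" for i
      using kk_inverse[OF kk'(7) that] V0_kk[OF kk'(7) that] kk(3) by (auto simp: inverse_eq_divide)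
    show "of_nat (degree f) \<noteq> (0::'a)"
      using char by (simp add: of_nat_eq_0_iff_char_dvd)
  qed (use A' f integral ppv[unfolded poly_pseudo_valuation_def pseudo_valuation_def] in auto)
  interpret unique_extension_over W V0 f A
    by (rule loc)
  obtain k \<phi> n c j where chain: "key_chain k \<phi> n c j" and complete: "W (\<phi> k) = \<infinity>"
    using complete_chain_exists by blast
  have W_eq: "W = U (\<phi> k)"
    using U_f complete_eq_f[OF chain complete] by simp
  have index: "degree f = group_index (value_group ring_of_type_algebra W) (value_group ring_of_type_algebra V0)"
    by (rule complete_group_index[OF chain complete, symmetric])
  have c: "c i \<in> A" if "i \<in> {1..k - 1}" for i
    using chain_key_step[OF chain, of i] that by (auto simp: key_step_def)
  show ?thesis
    unfolding L_def K_def GA_def GB_def \<psi>_def RA_def Let_def value_group_residue_ring[OF fact]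
  proof (intro exI[of _ k] exI[of _ \<phi>] exI[of _ "\<lambda>i. U (\<phi> i)"] exI[of _ n] exI[of _ c] exI[of _ j] conjI)
    show "1 \<le> k"
      by (rule chain_ge_1[OF chain])
    show "realization V0 W f k \<phi> (\<lambda>i. U (\<phi> i)) n c j"
      by (rule complete_realization[OF chain complete A_nonneg])
    show "W = U (\<phi> k)"
      by (rule W_eq)
    show "degree f = group_index (value_group ring_of_type_algebra W) (value_group ring_of_type_algebra V0)"
      by (rule index)
    show "degree f = group_index (value_group ring_of_type_algebra (U (\<phi> k))) (value_group ring_of_type_algebra V0)"
      using index by (simp only: W_eq[symmetric])
    show "\<forall>i\<in>{1..k - 1}. c i \<in> A"
      using c by blast
  qed (rule graded_ring_presentation[OF W' chain complete]
      graded_ring_finitely_generated[OF W' chain complete]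
      graded_ring_finitely_presented[OF W' chain complete])+
qed

end
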